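(* Let $\mathcal G$ be a Voevodsky pro-$3$ group, let $\chi_1,\chi_2\in H^1(\mathcal G,\mathbb Z/3\mathbb Z)$ be independent characters, abbreviated $i=\chi_1$, $j=\chi_2$, and let $\mathcal H=\ker(\chi_1)\cap\ker(\chi_2)$. Let $n\ge1$ and let $\eta:H^{n-1}(\mathcal G,\mathcal M_4\otimes\mathbb Z/3\mathbb Z)\to H^n(\mathcal G,\mathbb Z/3\mathbb Z)$ be the Positselski map, whose image is $\ker(H^n(\mathcal G,\mathbb Z/3\mathbb Z)\to H^n(\mathcal H,\mathbb Z/3\mathbb Z))$. Let $c=(u,v,0,-\chi T_4)$ be such that $[c]\in H^{n-1}(\mathcal G,\mathcal M_4\otimes\mathbb Z/3\mathbb Z)$, so that $\pi_4^*([c])=\chi\in H^{n-1}(\mathcal G,\mathbb Z/3\mathbb Z)$. Then: (i) The image $\eta([c])$ modulo $\mathrm{Dec}^n(\mathcal G,\chi_1,\chi_2)$ can be expressed as $[z]$ where $$z=i\,w_{12}'+\lambda^2_i\,w_{02}'+j\,w_{21}'+\lambda^2_j\,w_{20}'+ij\,w_{11}'$$ for some $w_{20},w_{11},w_{02}\in Z^{n-1}(\mathcal G,\mathbb Z/3\mathbb Z)$ and $w_{12},w_{21}\in C^{n-1}(\mathcal G,\mathbb Z/3\mathbb Z)$ with $w_{11}=\chi$, $\delta(w_{12})=-i\,w_{02}'-j\,w_{11}'$ and $\delta(w_{21})=-i\,w_{11}'-j\,w_{20}'$. Moreover these conditions on the $w_{rs}$, independently of the previous hypotheses, guarantee that $z\in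 Z^n(\mathcal G,\mathbb Z/3\mathbb Z)$. (ii) The image $\eta(H^{n-1}(\mathcal G,\mathcal M_4\otimes\mathbb Z/3\mathbb Z))\subseteq H^n(\mathcal G,\mathbb Z/3\mathbb Z)$ consists of all $[z]$ where $z=i\,w_{12}'+\lambda^2_i\,w_{02}'+j\,w_{21}'+\lambda^2_j\,w_{20}'+ij\,w_{11}'$ with $w_{20},w_{11},w_{02}\in Z^{n-1}(\mathcal G,\mathbb Z/3\mathbb Z)$, $w_{21},w_{12}\in C^{n-1}(\mathcal G,\mathbb Z/3\mathbb Z)$, $\delta(w_{12})=-i\,w_{02}'-j\,w_{11}'$ and $\delta(w_{21})=-i\,w_{11}'-j\,w_{20}'$. (iii) For $z$ as in (i), if $[-(i+j)\chi']=0$ or $[(i-j)\chi']=0$ in $H^n(\mathcal G,\mathbb Z/3\mathbb Z)$, then $[z]\in\mathrm{Dec}^n(\mathcal G,\chi_1,\chi_2)$. In particular, if $\chi=0$ then $[z]\in\mathrm{Dec}^n(\mathcal G,\chi_1,\chi_2)$.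
   Context: A pro-$3$ group $\mathcal G$ is a Voevodsky group if (a) for $\mathcal G$ and each of its closed subgroups $\mathcal K$ the reduction maps $H^n(\mathcal K,\mathbb Z/9\mathbb Z)\to H^n(\mathcal K,\mathbb Z/3\mathbb Z)$ are surjective for all $n$, and (b) every normal subgroup $\mathcal N$ of $\mathcal G$ with $\mathcal G/\mathcal N\cong\mathbb Z/3\mathbb Z$ contains a normal subgroup $\widetilde{\mathcal N}$ of $\mathcal G$ with $\mathcal G/\widetilde{\mathcal N}\cong\mathbb Z/9\mathbb Z$. $C^m,Z^m,H^m$ denote (continuous, inhomogeneous) cochains, cocycles, cohomology, and $\delta$ the coboundary. For $x\in C^1(\mathcal G,\mathbb Z/3\mathbb Z)$ and $y\in C^{m}(\mathcal G,\mathbb Z/3\mathbb Z)$, $x\,y'\in C^{m+1}$ is $(xy')(\gamma,\gamma')=x(\gamma)y(\gamma')$ for $\gamma\in\mathcal G$, $\gamma'\in\mathcal G^{m}$; $ij$ denotes the pointwise product $\gamma\mapsto\chi_1(\gamma)\chi_2(\gamma)$. For $\theta:\mathcal G\to\mathbb Z/3\mathbb Z$, $\lambda^2_\theta$ is $\theta$ followed by the function $\mathbb Z/3\mathbb Z\to\mathbb Z/3\mathbb Z$, $0,1\mapsto0$, $2\mapsto1$ (i.e. $\binom{\cdot}{2}$). $\mathrm{Dec}^n(\mathcal G,\chi_1,\chi_2)=\chi_1\smile H^{n-1}(\mathcal G,\mathbb Z/3\mathbb Z)+\chi_2\smile H^{n-1}(\mathcal G,\mathbb Z/3\mathbb Z)$.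 Let $G=\langle\tau_1,\tau_2\rangle\cong\mathbb Z/3\mathbb Z\oplus\mathbb Z/3\mathbb Z$, with $\mathcal G$ acting on $\mathbb Z[G]$-modules through $\gamma\mapsto\tau_1^{\chi_1(\gamma)}\tau_2^{\chi_2(\gamma)}$. Put $t_k=\tau_k-1$ $(k=1,2)$, $\tau_3=\tau_1\tau_2$, $\tau_4=\tau_1\tau_2^2$, $T_k=1+\tau_k+\tau_k^2$, $T_G=\sum_{g\in G}g$. Let $\mathcal M_1=\mathbb Z[G]T_G$, $\mathcal M_2=\mathbb Z[G]\oplus\mathbb Z[G]T_G$, $\mathcal M_3=\mathbb Z[G]\oplus\mathbb Z[G]\oplus\mathbb Z[G]T_3\oplus\mathbb Z[G]T_4$, $d_2(\xi,mT_G)=(-\xi t_1,-\xi t_2,\xi T_3+mT_G,\xi T_4+mT_G)$, $\mathcal M_4=\mathrm{cok}(d_2:\mathcal M_2\to\mathcal M_3)$, $h_1:\mathcal M_2\to\mathcal M_1$, $h_1(\xi,mT_G)=\xi T_G+2mT_G$. Writing $c\in C^{n-1}(\mathcal G,\mathcal M_3\otimes\mathbb Z/3\mathbb Z)$ with $[c]\in H^{n-1}(\mathcal G,\mathcal M_4\otimes\mathbb Z/3\mathbb Z)$ means that the image of $c$ in $\mathcal M_4\otimes\mathbb Z/3\mathbb Z$ is a cocycle representing $[c]$; then $\delta(c)=d_2(\omega)$ for some $\omega\in C^n(\mathcal G,\mathcal M_2\otimes\mathbb Z/3\mathbb Z)$ and $\eta([c])=[h_1(\omega)]$, where $\mathcal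 M_1\otimes\mathbb Z/3\mathbb Z$ is identified with $\mathbb Z/3\mathbb Z$ by $mT_G\leftrightarrow m$. Here $u,v\in C^{n-1}(\mathcal G,\mathbb Z/3\mathbb Z[G])$ and $\chi\in Z^{n-1}(\mathcal G,\mathbb Z/3\mathbb Z)$. The map $\pi_4:\mathcal M_4\to\mathbb Z[G]T_G$ is $[(\eta_1,\eta_2,\eta_3T_3,\eta_4T_4)]\mapsto(\eta_3-\eta_4)T_G$, and $\pi_4^*$ is the induced map $H^{n-1}(\mathcal G,\mathcal M_4\otimes\mathbb Z/3\mathbb Z)\to H^{n-1}(\mathcal G,\mathbb Z/3\mathbb Z[G]T_G)\cong H^{n-1}(\mathcal G,\mathbb Z/3\mathbb Z)$. *)

theory Defs
  imports
    "HOL-Analysis.Analysis"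
    "HOL-Algebra.Elementary_Groups"
    "HOL-Algebra.FiniteProduct"
    "HOL-Library.Poly_Mapping"
begin

section \<open>Pro-\<open>p\<close> groups\<close>

definition topological_group :: "('g, 'b) monoid_scheme \<Rightarrow> 'g topology \<Rightarrow> bool" where
  "topological_group G T \<longleftrightarrow>
     group G \<and> topspace T = carrier G \<and>
     continuous_map (prod_topology T T) T (\<lambda>(x, y). x \<otimes>\<^bsub>G\<^esub> y) \<and>
     continuous_map T T (\<lambda>x. inv\<^bsub>G\<^esub> x)"

definition pro_p_group :: "nat \<Rightarrow> ('g, 'b) monoid_scheme \<Rightarrow> 'g topology \<Rightarrow> bool" where
  "pro_p_group p G T \<longleftrightarrow>
     topological_group G T \<and> compact_space T \<and> Hausdorff_space T \<and>
     (\<forall>x \<in> topspace T. connected_component_of_set T x = {x}) \<and>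
     (\<forall>N. N \<lhd> G \<and> openin T N \<longrightarrow> (\<exists>k. order (G Mod N) = p ^ k))"

section \<open>Continuous cochain cohomology\<close>

text \<open>Coefficient groups are written multiplicatively, as in HOL-Algebra, so that quotient
  modules can be formed with \<open>Mod\<close>. They carry the discrete topology.\<close>

record ('g, 'a) gmodule = "'a monoid" +
  act :: "'g \<Rightarrow> 'a \<Rightarrow> 'a"

definition additive_module :: "'a::ab_group_add set \<Rightarrow> ('g \<Rightarrow> 'a \<Rightarrow> 'a) \<Rightarrow> ('g, 'a) gmodule" where
  "additive_module S \<rho> = \<lparr>carrier = S, mult = (+), one = 0, act = \<rho>\<rparr>"

definition trivial_module :: "('g, 'a::ab_group_add) gmodule" where
  "trivial_module = additive_module UNIV (\<lambda>\<gamma> x. x)"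

abbreviation Z3_module :: "('g, 3) gmodule" where
  "Z3_module \<equiv> trivial_module"

abbreviation Z9_module :: "('g, 9) gmodule" where
  "Z9_module \<equiv> trivial_module"

definition quotient_module :: "('g, 'a) gmodule \<Rightarrow> 'a set \<Rightarrow> ('g, 'a set) gmodule" where
  "quotient_module M N =
     \<lparr>carrier = carrier (M Mod N), mult = mult (M Mod N), one = one (M Mod N),
      act = (\<lambda>\<gamma> X. act M \<gamma> ` X)\<rparr>"

definition tuples :: "('g, 'b) monoid_scheme \<Rightarrow> nat \<Rightarrow> (nat \<Rightarrow> 'g) set" where
  "tuples G m = (\<Pi>\<^sub>E k \<in> {..<m}. carrier G)"

definition cochains ::
    "('g, 'b) monoid_scheme \<Rightarrow> 'g topology \<Rightarrow> ('g, 'a) gmodule \<Rightarrow> nat \<Rightarrow> ((nat \<Rightarrow> 'g) \<Rightarrow> 'a) set" where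
  "cochains G T M m =
     {f \<in> extensional (tuples G m).
        continuous_map (product_topology (\<lambda>_. T) {..<m}) (discrete_topology (carrier M)) f}"

definition cochain_group ::
    "('g, 'b) monoid_scheme \<Rightarrow> 'g topology \<Rightarrow> ('g, 'a) gmodule \<Rightarrow> nat \<Rightarrow> ((nat \<Rightarrow> 'g) \<Rightarrow> 'a) monoid" where
  "cochain_group G T M m =
     \<lparr>carrier = cochains G T M m,
      mult = (\<lambda>f h. \<lambda>g \<in> tuples G m. f g \<otimes>\<^bsub>M\<^esub> h g),
      one = (\<lambda>g \<in> tuples G m. \<one>\<^bsub>M\<^esub>)\<rparr>"

text \<open>The inhomogeneous coboundary: additively, \<open>(\<delta> f)(g\<^sub>0, \<dots>, g\<^sub>m)\<close> is
  \<open>g\<^sub>0 f(g\<^sub>1, \<dots>, g\<^sub>m) + \<Sum>\<^bsub>k < m\<^esub> (-1)^(k + 1) f(\<dots>, g\<^sub>k g\<^sub>k\<^sub>+\<^sub>1, \<dots>)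
    + (-1)^(m + 1) f(g\<^sub>0, \<dots>, g\<^sub>m\<^sub>-\<^sub>1)\<close>.\<close>

definition coboundary ::
    "('g, 'b) monoid_scheme \<Rightarrow> ('g, 'a) gmodule \<Rightarrow> nat \<Rightarrow> ((nat \<Rightarrow> 'g) \<Rightarrow> 'a) \<Rightarrow> (nat \<Rightarrow> 'g) \<Rightarrow> 'a" where
  "coboundary G M m f =
     (\<lambda>g \<in> tuples G (Suc m).
        act M (g 0) (f (\<lambda>l \<in> {..<m}. g (Suc l)))
        \<otimes>\<^bsub>M\<^esub> finprod M
              (\<lambda>k. f (\<lambda>l \<in> {..<m}. if l < k then g l
                                     else if l = k then g k \<otimes>\<^bsub>G\<^esub> g (Suc k)
                                     else g (Suc l))
                   [^]\<^bsub>M\<^esub> ((- 1) ^ Suc k :: int)) {..<m}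
        \<otimes>\<^bsub>M\<^esub> f (restrict g {..<m}) [^]\<^bsub>M\<^esub> ((- 1) ^ Suc m :: int))"

definition cocycles ::
    "('g, 'b) monoid_scheme \<Rightarrow> 'g topology \<Rightarrow> ('g, 'a) gmodule \<Rightarrow> nat \<Rightarrow> ((nat \<Rightarrow> 'g) \<Rightarrow> 'a) set" where
  "cocycles G T M m =
     {f \<in> cochains G T M m. coboundary G M m f = one (cochain_group G T M (Suc m))}"

definition coboundaries ::
    "('g, 'b) monoid_scheme \<Rightarrow> 'g topology \<Rightarrow> ('g, 'a) gmodule \<Rightarrow> nat \<Rightarrow> ((nat \<Rightarrow> 'g) \<Rightarrow> 'a) set" where
  "coboundaries G T M m =
     (case m of 0 \<Rightarrow> {one (cochain_group G T M 0)}
      | Suc k \<Rightarrow> coboundary G M k ` cochains G T M k)"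

definition cohomology ::
    "('g, 'b) monoid_scheme \<Rightarrow> 'g topology \<Rightarrow> ('g, 'a) gmodule \<Rightarrow> nat \<Rightarrow> ((nat \<Rightarrow> 'g) \<Rightarrow> 'a) set monoid" where
  "cohomology G T M m =
     (cochain_group G T M m)\<lparr>carrier := cocycles G T M m\<rparr> Mod coboundaries G T M m"

definition cohomology_class ::
    "('g, 'b) monoid_scheme \<Rightarrow> 'g topology \<Rightarrow> ('g, 'a) gmodule \<Rightarrow> nat \<Rightarrow> ((nat \<Rightarrow> 'g) \<Rightarrow> 'a)
      \<Rightarrow> ((nat \<Rightarrow> 'g) \<Rightarrow> 'a) set" where
  "cohomology_class G T M m z = coboundaries G T M m #>\<^bsub>cochain_group G T M m\<^esub> z"

definition cochain_map ::
    "('g, 'b) monoid_scheme \<Rightarrow> nat \<Rightarrow> ('a \<Rightarrow> 'c) \<Rightarrow> ((nat \<Rightarrow> 'g) \<Rightarrow> 'a) \<Rightarrow> (nat \<Rightarrow> 'g) \<Rightarrow> 'c" where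
  "cochain_map G m \<phi> f = (\<lambda>g \<in> tuples G m. \<phi> (f g))"

text \<open>The map on \<open>H\<^sup>m(G, -)\<close> induced by an equivariant homomorphism \<open>\<phi>\<close> of coefficients with
  target \<open>M\<close>; a cohomology class is literally the set of its representing cocycles.\<close>

definition cohomology_map ::
    "('g, 'b) monoid_scheme \<Rightarrow> 'g topology \<Rightarrow> ('g, 'c) gmodule \<Rightarrow> nat \<Rightarrow> ('a \<Rightarrow> 'c)
      \<Rightarrow> ((nat \<Rightarrow> 'g) \<Rightarrow> 'a) set \<Rightarrow> ((nat \<Rightarrow> 'g) \<Rightarrow> 'c) set" where
  "cohomology_map G T M m \<phi> X =
     (THE Y. \<exists>z \<in> X. Y = cohomology_class G T M m (cochain_map G m \<phi> z))"

text \<open>Restriction \<open>H\<^sup>m(G, M) \<rightarrow> H\<^sup>m(K, M)\<close> to a subgroup \<open>K\<close>.\<close>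

definition restriction_map ::
    "('g, 'b) monoid_scheme \<Rightarrow> 'g topology \<Rightarrow> ('g, 'a) gmodule \<Rightarrow> nat \<Rightarrow> 'g set
      \<Rightarrow> ((nat \<Rightarrow> 'g) \<Rightarrow> 'a) set \<Rightarrow> ((nat \<Rightarrow> 'g) \<Rightarrow> 'a) set" where
  "restriction_map G T M m K X =
     (THE Y. \<exists>z \<in> X. Y = cohomology_class (G\<lparr>carrier := K\<rparr>) (subtopology T K) M m
                            (restrict z (tuples (G\<lparr>carrier := K\<rparr>) m)))"

section \<open>Voevodsky pro-3 groups\<close>

text \<open>\<open>\<int>/3\<int>\<close> and \<open>\<int>/9\<int>\<close> are the numeral types \<open>3\<close> and \<open>9\<close>; \<open>Rep_bit1\<close> is the representative
  in \<open>{0..<9}\<close>.\<close>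

definition reduction_9_3 :: "9 \<Rightarrow> 3" where
  "reduction_9_3 x = of_int (Rep_bit1 x)"

text \<open>As usual for profinite groups, the normal subgroups with a finite quotient
  are understood to be closed.\<close>

definition voevodsky_pro_3_group :: "('g, 'b) monoid_scheme \<Rightarrow> 'g topology \<Rightarrow> bool" where
  "voevodsky_pro_3_group G T \<longleftrightarrow>
     pro_p_group 3 G T \<and>
     (\<forall>K m. subgroup K G \<and> closedin T K \<longrightarrow>
        (let K' = G\<lparr>carrier := K\<rparr>; T' = subtopology T K in
          cohomology_map K' T' Z3_module m reduction_9_3
            ` carrier (cohomology K' T' Z9_module m)
          = carrier (cohomology K' T' Z3_module m))) \<and>
     (\<forall>N. N \<lhd> G \<and> closedin T N \<and> (G Mod N) \<cong> integer_mod_group 3 \<longrightarrow>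
        (\<exists>N'. N' \<lhd> G \<and> closedin T N' \<and> N' \<subseteq> N \<and> (G Mod N') \<cong> integer_mod_group 9))"

section \<open>Characters and decomposable classes\<close>

text \<open>For the trivial action \<open>H\<^sup>1(G, \<int>/3\<int>)\<close> is the group of continuous homomorphisms; a
  \<open>1\<close>-cochain is written as a function on \<open>G\<close> itself.\<close>

definition characters :: "('g, 'b) monoid_scheme \<Rightarrow> 'g topology \<Rightarrow> ('g \<Rightarrow> 3) set" where
  "characters G T =
     {\<theta>. continuous_map T (discrete_topology UNIV) \<theta> \<and>
         (\<forall>\<gamma> \<in> carrier G. \<forall>\<gamma>' \<in> carrier G. \<theta> (\<gamma> \<otimes>\<^bsub>G\<^esub> \<gamma>') = \<theta> \<gamma> + \<theta> \<gamma>')}"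

definition independent_characters :: "('g, 'b) monoid_scheme \<Rightarrow> ('g \<Rightarrow> 3) \<Rightarrow> ('g \<Rightarrow> 3) \<Rightarrow> bool" where
  "independent_characters G \<chi>\<^sub>1 \<chi>\<^sub>2 \<longleftrightarrow>
     (\<forall>a b. (\<forall>\<gamma> \<in> carrier G. a * \<chi>\<^sub>1 \<gamma> + b * \<chi>\<^sub>2 \<gamma> = 0) \<longrightarrow> a = 0 \<and> b = 0)"

definition common_kernel :: "('g, 'b) monoid_scheme \<Rightarrow> ('g \<Rightarrow> 3) \<Rightarrow> ('g \<Rightarrow> 3) \<Rightarrow> 'g set" where
  "common_kernel G \<chi>\<^sub>1 \<chi>\<^sub>2 = {\<gamma> \<in> carrier G. \<chi>\<^sub>1 \<gamma> = 0 \<and> \<chi>\<^sub>2 \<gamma> = 0}"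

text \<open>\<open>cup1 G n x y\<close> is the \<open>n\<close>-cochain \<open>x y'\<close> for \<open>x \<in> C\<^sup>1\<close> and \<open>y \<in> C\<^sup>n\<^sup>-\<^sup>1\<close>, where \<open>n \<ge> 1\<close>.\<close>

definition cup1 ::
    "('g, 'b) monoid_scheme \<Rightarrow> nat \<Rightarrow> ('g \<Rightarrow> 3) \<Rightarrow> ((nat \<Rightarrow> 'g) \<Rightarrow> 3) \<Rightarrow> (nat \<Rightarrow> 'g) \<Rightarrow> 3" where
  "cup1 G n x y = (\<lambda>g \<in> tuples G n. x (g 0) * y (\<lambda>l \<in> {..<n - 1}. g (Suc l)))"

definition Dec ::
    "('g, 'b) monoid_scheme \<Rightarrow> 'g topology \<Rightarrow> ('g \<Rightarrow> 3) \<Rightarrow> ('g \<Rightarrow> 3) \<Rightarrow> nat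
      \<Rightarrow> ((nat \<Rightarrow> 'g) \<Rightarrow> 3) set set" where
  "Dec G T \<chi>\<^sub>1 \<chi>\<^sub>2 n =
     {cohomology_class G T Z3_module n (cup1 G n \<chi>\<^sub>1 a)
        \<otimes>\<^bsub>cohomology G T Z3_module n\<^esub>
      cohomology_class G T Z3_module n (cup1 G n \<chi>\<^sub>2 b) | a b.
        a \<in> cocycles G T Z3_module (n - 1) \<and> b \<in> cocycles G T Z3_module (n - 1)}"

definition lambda2 :: "3 \<Rightarrow> 3" where
  "lambda2 t = (if t = 2 then 1 else 0)"

definition w_conditions ::
    "('g, 'b) monoid_scheme \<Rightarrow> 'g topology \<Rightarrow> ('g \<Rightarrow> 3) \<Rightarrow> ('g \<Rightarrow> 3) \<Rightarrow> nat
      \<Rightarrow> ((nat \<Rightarrow> 'g) \<Rightarrow> 3) \<Rightarrow> ((nat \<Rightarrow> 'g) \<Rightarrow> 3) \<Rightarrow> ((nat \<Rightarrow> 'g) \<Rightarrow> 3)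
      \<Rightarrow> ((nat \<Rightarrow> 'g) \<Rightarrow> 3) \<Rightarrow> ((nat \<Rightarrow> 'g) \<Rightarrow> 3) \<Rightarrow> bool" where
  "w_conditions G T i j n w20 w11 w02 w12 w21 \<longleftrightarrow>
     w20 \<in> cocycles G T Z3_module (n - 1) \<and>
     w11 \<in> cocycles G T Z3_module (n - 1) \<and>
     w02 \<in> cocycles G T Z3_module (n - 1) \<and>
     w12 \<in> cochains G T Z3_module (n - 1) \<and>
     w21 \<in> cochains G T Z3_module (n - 1) \<and>
     coboundary G Z3_module (n - 1) w12
       = (\<lambda>g \<in> tuples G n. - cup1 G n i w02 g - cup1 G n j w11 g) \<and>
     coboundary G Z3_module (n - 1) w21
       = (\<lambda>g \<in> tuples G n. - cup1 G n i w11 g - cup1 G n j w20 g)"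

definition z_cochain ::
    "('g, 'b) monoid_scheme \<Rightarrow> ('g \<Rightarrow> 3) \<Rightarrow> ('g \<Rightarrow> 3) \<Rightarrow> nat
      \<Rightarrow> ((nat \<Rightarrow> 'g) \<Rightarrow> 3) \<Rightarrow> ((nat \<Rightarrow> 'g) \<Rightarrow> 3) \<Rightarrow> ((nat \<Rightarrow> 'g) \<Rightarrow> 3)
      \<Rightarrow> ((nat \<Rightarrow> 'g) \<Rightarrow> 3) \<Rightarrow> ((nat \<Rightarrow> 'g) \<Rightarrow> 3) \<Rightarrow> (nat \<Rightarrow> 'g) \<Rightarrow> 3" where
  "z_cochain G i j n w20 w11 w02 w12 w21 =
     (\<lambda>g \<in> tuples G n.
        cup1 G n i w12 g + cup1 G n (lambda2 \<circ> i) w02 g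
        + cup1 G n j w21 g + cup1 G n (lambda2 \<circ> j) w20 g
        + cup1 G n (\<lambda>\<gamma>. i \<gamma> * j \<gamma>) w11 g)"

section \<open>The modules \<open>\<M>\<^sub>1, \<dots>, \<M>\<^sub>4\<close>\<close>

text \<open>\<open>\<int>/3\<int> \<oplus> \<int>/3\<int>\<close> is the additive group \<open>3 \<times> 3\<close>, and \<open>'r group_ring\<close>, with
  the convolution product of finitely supported functions, is its group ring over \<open>'r\<close>.
  All modules are defined over an arbitrary coefficient ring: at \<open>'r = int\<close> they are the
  \<open>\<int>[G]\<close>-modules \<open>\<M>\<^sub>k\<close>, at \<open>'r = 3\<close> they are \<open>\<M>\<^sub>k \<otimes> \<int>/3\<int>\<close>, i.e. \<open>\<M>\<^sub>k / 3\<M>\<^sub>k\<close>. The lemmas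
  \<open>reduction_module1\<close>, \<open>reduction_module2\<close>, \<open>reduction_module3\<close> and \<open>reduction_module4\<close>
  below prove the latter identification.\<close>

type_synonym 'r group_ring = "(3 \<times> 3) \<Rightarrow>\<^sub>0 'r"

definition tau1 :: "'r::comm_ring_1 group_ring" where "tau1 = Poly_Mapping.single (1, 0) 1"
definition tau2 :: "'r::comm_ring_1 group_ring" where "tau2 = Poly_Mapping.single (0, 1) 1"
definition tau3 :: "'r::comm_ring_1 group_ring" where "tau3 = tau1 * tau2"
definition tau4 :: "'r::comm_ring_1 group_ring" where "tau4 = tau1 * tau2\<^sup>2"

definition T3 :: "'r::comm_ring_1 group_ring" where "T3 = 1 + tau3 + tau3\<^sup>2"
definition T4 :: "'r::comm_ring_1 group_ring" where "T4 = 1 + tau4 + tau4\<^sup>2"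
definition TG :: "'r::comm_ring_1 group_ring" where "TG = (\<Sum>a \<in> UNIV. Poly_Mapping.single a 1)"

definition carrier1 :: "'r::comm_ring_1 group_ring set" where
  "carrier1 = {x * TG | x. True}"
definition carrier2 :: "('r::comm_ring_1 group_ring \<times> 'r group_ring) set" where
  "carrier2 = UNIV \<times> {x * TG | x. True}"
definition carrier3 ::
    "('r::comm_ring_1 group_ring \<times> 'r group_ring \<times> 'r group_ring \<times> 'r group_ring) set" where
  "carrier3 = UNIV \<times> UNIV \<times> {x * T3 | x. True} \<times> {x * T4 | x. True}"

fun d2 :: "'r::comm_ring_1 group_ring \<times> 'r group_ring
      \<Rightarrow> 'r group_ring \<times> 'r group_ring \<times> 'r group_ring \<times> 'r group_ring" where
  "d2 (\<xi>, y) = (- \<xi> * (tau1 - 1), - \<xi> * (tau2 - 1), \<xi> * T3 + y, \<xi> * T4 + y)"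

fun h1 :: "'r::comm_ring_1 group_ring \<times> 'r group_ring \<Rightarrow> 'r group_ring" where
  "h1 (\<xi>, y) = \<xi> * TG + 2 * y"

text \<open>\<open>\<gamma>\<close> acts as multiplication by \<open>\<tau>\<^sub>1^\<chi>\<^sub>1(\<gamma>) \<tau>\<^sub>2^\<chi>\<^sub>2(\<gamma>)\<close>.\<close>

definition group_elt :: "('g \<Rightarrow> 3) \<Rightarrow> ('g \<Rightarrow> 3) \<Rightarrow> 'g \<Rightarrow> 'r::comm_ring_1 group_ring" where
  "group_elt \<chi>\<^sub>1 \<chi>\<^sub>2 \<gamma> = Poly_Mapping.single (\<chi>\<^sub>1 \<gamma>, \<chi>\<^sub>2 \<gamma>) 1"

definition regular_module ::
    "('g \<Rightarrow> 3) \<Rightarrow> ('g \<Rightarrow> 3) \<Rightarrow> ('g, 'r::comm_ring_1 group_ring) gmodule" where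
  "regular_module \<chi>\<^sub>1 \<chi>\<^sub>2 = additive_module UNIV (\<lambda>\<gamma> x. group_elt \<chi>\<^sub>1 \<chi>\<^sub>2 \<gamma> * x)"

definition module1 ::
    "('g \<Rightarrow> 3) \<Rightarrow> ('g \<Rightarrow> 3) \<Rightarrow> ('g, 'r::comm_ring_1 group_ring) gmodule" where
  "module1 \<chi>\<^sub>1 \<chi>\<^sub>2 = additive_module carrier1 (\<lambda>\<gamma> x. group_elt \<chi>\<^sub>1 \<chi>\<^sub>2 \<gamma> * x)"

definition module2 ::
    "('g \<Rightarrow> 3) \<Rightarrow> ('g \<Rightarrow> 3) \<Rightarrow> ('g, 'r::comm_ring_1 group_ring \<times> 'r group_ring) gmodule" where
  "module2 \<chi>\<^sub>1 \<chi>\<^sub>2 =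
     additive_module carrier2
       (\<lambda>\<gamma> (x, y). (group_elt \<chi>\<^sub>1 \<chi>\<^sub>2 \<gamma> * x, group_elt \<chi>\<^sub>1 \<chi>\<^sub>2 \<gamma> * y))"

definition module3 ::
    "('g \<Rightarrow> 3) \<Rightarrow> ('g \<Rightarrow> 3) \<Rightarrow>
      ('g, 'r::comm_ring_1 group_ring \<times> 'r group_ring \<times> 'r group_ring \<times> 'r group_ring) gmodule" where
  "module3 \<chi>\<^sub>1 \<chi>\<^sub>2 =
     additive_module carrier3
       (\<lambda>\<gamma> (a, b, x, y). (group_elt \<chi>\<^sub>1 \<chi>\<^sub>2 \<gamma> * a, group_elt \<chi>\<^sub>1 \<chi>\<^sub>2 \<gamma> * b,
                         group_elt \<chi>\<^sub>1 \<chi>\<^sub>2 \<gamma> * x, group_elt \<chi>\<^sub>1 \<chi>\<^sub>2 \<gamma> * y))"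

definition module4 ::
    "('g \<Rightarrow> 3) \<Rightarrow> ('g \<Rightarrow> 3) \<Rightarrow>
      ('g, ('r::comm_ring_1 group_ring \<times> 'r group_ring \<times> 'r group_ring \<times> 'r group_ring) set) gmodule" where
  "module4 \<chi>\<^sub>1 \<chi>\<^sub>2 = quotient_module (module3 \<chi>\<^sub>1 \<chi>\<^sub>2) (d2 ` carrier2)"

definition to_module4 ::
    "'r::comm_ring_1 group_ring \<times> 'r group_ring \<times> 'r group_ring \<times> 'r group_ring
      \<Rightarrow> ('r group_ring \<times> 'r group_ring \<times> 'r group_ring \<times> 'r group_ring) set" where
  "to_module4 x = (+) x ` d2 ` carrier2"

text \<open>The identification of \<open>\<int>/3\<int>[G]T\<^sub>G\<close> with \<open>\<int>/3\<int>\<close>, \<open>m T\<^sub>G \<mapsto> m\<close>.\<close>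

definition TG_coeff :: "3 group_ring \<Rightarrow> 3" where
  "TG_coeff y = Poly_Mapping.lookup y 0"

definition pi4 ::
    "('r::comm_ring_1 group_ring \<times> 'r group_ring \<times> 'r group_ring \<times> 'r group_ring) set
      \<Rightarrow> 'r group_ring" where
  "pi4 X = (THE y. \<exists>\<eta>1 \<eta>2 \<eta>3 \<eta>4. (\<eta>1, \<eta>2, \<eta>3 * T3, \<eta>4 * T4) \<in> X \<and> y = (\<eta>3 - \<eta>4) * TG)"

definition pi4_star ::
    "('g, 'b) monoid_scheme \<Rightarrow> 'g topology \<Rightarrow> ('g \<Rightarrow> 3) \<Rightarrow> ('g \<Rightarrow> 3) \<Rightarrow> nat
      \<Rightarrow> ((nat \<Rightarrow> 'g) \<Rightarrow> (3 group_ring \<times> 3 group_ring \<times> 3 group_ring \<times> 3 group_ring) set) set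
      \<Rightarrow> ((nat \<Rightarrow> 'g) \<Rightarrow> 3) set" where
  "pi4_star G T \<chi>\<^sub>1 \<chi>\<^sub>2 m X =
     cohomology_map G T Z3_module m TG_coeff
       (cohomology_map G T (module1 \<chi>\<^sub>1 \<chi>\<^sub>2) m pi4 X)"

text \<open>The Positselski map \<open>H\<^sup>n\<^sup>-\<^sup>1(G, \<M>\<^sub>4 \<otimes> \<int>/3\<int>) \<rightarrow> H\<^sup>n(G, \<int>/3\<int>)\<close>. The value does not depend
  on the choice of \<open>c\<close> and \<open>\<omega>\<close>, because \<open>h1\<close> vanishes on the kernel of \<open>d2\<close> modulo 3.\<close>

definition positselski_map ::
    "('g, 'b) monoid_scheme \<Rightarrow> 'g topology \<Rightarrow> ('g \<Rightarrow> 3) \<Rightarrow> ('g \<Rightarrow> 3) \<Rightarrow> nat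
      \<Rightarrow> ((nat \<Rightarrow> 'g) \<Rightarrow> (3 group_ring \<times> 3 group_ring \<times> 3 group_ring \<times> 3 group_ring) set) set
      \<Rightarrow> ((nat \<Rightarrow> 'g) \<Rightarrow> 3) set" where
  "positselski_map G T \<chi>\<^sub>1 \<chi>\<^sub>2 n X =
     (THE Y. \<exists>c \<in> cochains G T (module3 \<chi>\<^sub>1 \<chi>\<^sub>2) (n - 1). \<exists>\<omega> \<in> cochains G T (module2 \<chi>\<^sub>1 \<chi>\<^sub>2) n.
        cochain_map G (n - 1) to_module4 c \<in> X \<and>
        coboundary G (module3 \<chi>\<^sub>1 \<chi>\<^sub>2) (n - 1) c = cochain_map G n d2 \<omega> \<and>
        Y = cohomology_class G T Z3_module n (cochain_map G n (TG_coeff \<circ> h1) \<omega>))"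

section \<open>Reduction modulo 3\<close>

definition reduce :: "int group_ring \<Rightarrow> 3 group_ring" where
  "reduce = Poly_Mapping.map of_int"

lemma of_int_3_eq_0: "(of_int k :: 3) = 0 \<longleftrightarrow> 3 dvd k"
proof -
  have "(of_int k :: 3) = Abs_bit1' k" by (simp add: bit1.of_int_eq Abs_bit1'_def)
  then show ?thesis
    by (metis bit1.Rep_Abs_mod bit1.Rep_0 bit1.Rep_inject_sym bit1.of_int_eq card_bit1 card_num1
        dvd_eq_mod_eq_0 mult_2 of_nat_1 of_nat_add of_nat_Suc one_add_one
        numeral_eq_Suc of_nat_numeral Suc_1 numeral_Bit1 numeral_One add.commute)
qed

lemma lookup_reduce: "Poly_Mapping.lookup (reduce x) k = of_int (Poly_Mapping.lookup x k)"
  by (simp add: reduce_def Poly_Mapping.map.rep_eq when_def)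

lemma reduce_add: "reduce (x + y) = reduce x + reduce y"
  by (rule poly_mapping_eqI) (simp add: lookup_reduce lookup_add)

lemma reduce_0: "reduce 0 = 0"
  by (rule poly_mapping_eqI) (simp add: lookup_reduce)

lemma reduce_single: "reduce (Poly_Mapping.single a k) = Poly_Mapping.single a (of_int k)"
  by (rule poly_mapping_eqI) (simp add: lookup_reduce lookup_single when_def)

lemma reduce_uminus: "reduce (- x) = - reduce x"
  by (rule poly_mapping_eqI) (simp add: lookup_reduce)

lemma reduce_sum: "reduce (sum f A) = (\<Sum>a\<in>A. reduce (f a))"
  by (induction A rule: infinite_finite_induct) (auto simp: reduce_0 reduce_add)

lemma single_decomp: "(x :: 'r::comm_ring_1 group_ring) = (\<Sum>a\<in>UNIV. Poly_Mapping.single a (Poly_Mapping.lookup x a))"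
proof (rule poly_mapping_eqI)
  fix k
  show "Poly_Mapping.lookup x k = Poly_Mapping.lookup (\<Sum>a\<in>UNIV. Poly_Mapping.single a (Poly_Mapping.lookup x a)) k"
    by (simp add: lookup_sum lookup_single when_def)
qed

lemma reduce_mult: "reduce (x * y) = reduce x * reduce y"
proof -
  let ?s = "\<lambda>z. \<Sum>a\<in>UNIV. Poly_Mapping.single a (Poly_Mapping.lookup z a)"
  have "reduce (?s x * ?s y) = reduce (?s x) * reduce (?s y)"
    by (simp add: sum_product reduce_sum reduce_single mult_single)
  then show ?thesis by (simp flip: single_decomp)
qed

lemma reduce_1: "reduce 1 = 1"
  by (simp add: reduce_single flip: single_one)


lemma of_int_Rep_3: "of_int (Rep_bit1 (t :: 3)) = t"
proof -
  have "(of_int (Rep_bit1 t) :: 3) = Abs_bit1 (Rep_bit1 t mod int CARD(3))"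
    by (simp add: bit1.of_int_eq)
  also have "Rep_bit1 t mod int CARD(3) = Rep_bit1 t"
    using bit1.Rep_mod[of t] by simp
  finally show ?thesis by (simp add: Rep_bit1_inverse)
qed

lemma reduce_surj: "\<exists>x. reduce x = y"
proof
  show "reduce (Poly_Mapping.map Rep_bit1 y) = y"
    by (rule poly_mapping_eqI)
      (auto simp: lookup_reduce Poly_Mapping.map.rep_eq when_def of_int_Rep_3)
qed

lemma lookup_3_times: "Poly_Mapping.lookup (3 * y) k = 3 * Poly_Mapping.lookup y k"
  for y :: "'r::comm_ring_1 group_ring"
proof -
  have "3 * y = y + y + y"
    by (metis distrib_right mult_1 numeral_Bit1 numeral_One one_add_one)
  then have "Poly_Mapping.lookup (3 * y) k
      = Poly_Mapping.lookup y k + Poly_Mapping.lookup y k + Poly_Mapping.lookup y k"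
    by (simp only: lookup_add)
  then show ?thesis by simp
qed

lemma reduce_eq_0: "reduce x = 0 \<longleftrightarrow> (\<exists>y. x = 3 * y)"
proof
  assume "reduce x = 0"
  then have *: "3 dvd Poly_Mapping.lookup x k" for k
    by (metis lookup_reduce lookup_zero of_int_3_eq_0)
  have "x = 3 * Poly_Mapping.map (\<lambda>k. k div 3) x"
    by (rule poly_mapping_eqI)
      (use * in \<open>simp add: lookup_3_times Poly_Mapping.map.rep_eq when_def\<close>)
  then show "\<exists>y. x = 3 * y" by blast
next
  assume "\<exists>y. x = 3 * y"
  then obtain y where "x = 3 * y" by blast
  then show "reduce x = 0"
    by (intro poly_mapping_eqI) (simp only: lookup_reduce lookup_3_times of_int_3_eq_0 lookup_zero dvd_triv_left)
qed

lemma z3_cases: "(a::3) = 0 \<or> a = 1 \<or> a = 2"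
proof -
  have d: "(0::3) \<noteq> 1" "(1::3) \<noteq> 2" "(2::3) \<noteq> 0" by simp_all
  have "card {0::3, 1, 2} = CARD(3)" using d by (simp add: d(3)[symmetric])
  then have "{0::3, 1, 2} = UNIV" by (intro card_subset_eq) auto
  then show ?thesis by auto
qed

lemma z3_arith: "(3::3) = 0" "(4::3) = 1" by simp_all

lemma UNIV_3: "(UNIV :: 3 set) = {0, 1, 2}" using z3_cases by auto

lemma reduce_T: "reduce T3 = T3" "reduce T4 = T4" "reduce TG = TG"
  by (simp_all add: T3_def T4_def TG_def tau3_def tau4_def tau1_def tau2_def reduce_add reduce_mult
      reduce_1 reduce_single reduce_sum power2_eq_square)

lemma T_expand:
  "T3 = Poly_Mapping.single (0, 0) 1 + Poly_Mapping.single (1, 1) 1 + Poly_Mapping.single (2, 2) 1"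
  "T4 = Poly_Mapping.single (0, 0) 1 + Poly_Mapping.single (1, 2) 1 + Poly_Mapping.single (2, 1) 1"
  by (simp_all add: T3_def T4_def tau3_def tau4_def tau1_def tau2_def power2_eq_square mult_single z3_arith
      flip: zero_prod_def)

definition first_row :: "'r::comm_ring_1 group_ring \<Rightarrow> 'r group_ring" where
  "first_row x = (\<Sum>b\<in>UNIV. Poly_Mapping.single (0, b) (Poly_Mapping.lookup x (0, b)))"

lemma first_row_add: "first_row (x + y) = first_row x + first_row y"
  by (simp add: first_row_def lookup_add single_add sum.distrib)
lemma first_row_sum: "first_row (sum f A) = (\<Sum>a\<in>A. first_row (f a))"
  by (induction A rule: infinite_finite_induct) (auto simp: first_row_add, auto simp: first_row_def)

lemma first_row_single: "first_row (Poly_Mapping.single (a, b) r) = (if a = 0 then Poly_Mapping.single (0, b) r else 0)"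
proof (cases "a = 0")
  case True
  have "first_row (Poly_Mapping.single (a, b) r) = (\<Sum>c\<in>UNIV. if b = c then Poly_Mapping.single (0, c) r else 0)"
    unfolding first_row_def using True by (intro sum.cong) (auto simp: lookup_single when_def)
  then show ?thesis using True by simp
qed (simp add: first_row_def lookup_single when_def)

lemma first_row_T_single:
  "first_row (Poly_Mapping.single a r * T3) * T3 = Poly_Mapping.single a r * T3"
  "first_row (Poly_Mapping.single a r * T4) * T4 = Poly_Mapping.single a r * T4"
  using z3_cases[of "fst a"] z3_cases[of "snd a"]
  by (cases a; auto simp: T_expand distrib_left distrib_right mult_single first_row_add first_row_single z3_arith)+

lemma first_row_T: "first_row (x * T3) * T3 = x * T3" "first_row (x * T4) * T4 = x * T4"
  by (subst (1 2) single_decomp[of x], simp add: sum_distrib_right first_row_sum first_row_T_single)+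

lemma TG_mult: "x * TG = Poly_Mapping.single 0 (Poly_Mapping.lookup (x * TG) 0) * TG"
  for x :: "'r::comm_ring_1 group_ring"
proof -
  have "Poly_Mapping.single a r * TG = Poly_Mapping.single 0 r * TG" for a and r :: 'r
  proof -
    have "Poly_Mapping.single a r * TG = (\<Sum>b\<in>UNIV. Poly_Mapping.single (a + b) r)"
      by (simp add: TG_def sum_distrib_left mult_single)
    also have "\<dots> = (\<Sum>b\<in>UNIV. Poly_Mapping.single b r)"
      by (rule sum.reindex_bij_witness[of _ "\<lambda>b. b - a" "\<lambda>b. a + b"]) auto
    finally show ?thesis by (simp add: TG_def sum_distrib_left mult_single)
  qed
  note single_TG = this
  have "x * TG = (\<Sum>a\<in>UNIV. Poly_Mapping.single a (Poly_Mapping.lookup x a) * TG)"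
    by (subst single_decomp[of x]) (simp only: sum_distrib_right)
  also have "\<dots> = (\<Sum>a\<in>UNIV. Poly_Mapping.single 0 (Poly_Mapping.lookup x a) * TG)"
    by (intro sum.cong refl single_TG)
  finally have *: "x * TG = (\<Sum>a\<in>UNIV. Poly_Mapping.single 0 (Poly_Mapping.lookup x a)) * TG"
    by (simp only: sum_distrib_right)
  have **: "Poly_Mapping.lookup (Poly_Mapping.single 0 m * TG) 0 = m" for m :: 'r
    by (simp add: TG_def sum_distrib_left mult_single lookup_sum lookup_single when_def)
  have "(\<Sum>a\<in>A. Poly_Mapping.single 0 (f a)) = Poly_Mapping.single 0 (\<Sum>a\<in>A. f a)"
    for A and f :: "3 \<times> 3 \<Rightarrow> 'r"
    by (induction A rule: infinite_finite_induct) (auto simp: single_add)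
  then have "x * TG = Poly_Mapping.single 0 (\<Sum>a\<in>UNIV. Poly_Mapping.lookup x a) * TG"
    unfolding * by (rule arg_cong)
  then show ?thesis by (simp only: **)
qed

lemma first_row_3_times: "first_row (3 * x) = 3 * first_row x"
  by (simp add: first_row_def lookup_3_times sum_distrib_left)
    (intro sum.cong refl poly_mapping_eqI, simp add: lookup_3_times lookup_single when_def)

lemma reduce_eq_0_T:
  "reduce (x * T3) = 0 \<Longrightarrow> \<exists>y. x * T3 = 3 * (y * T3)"
  "reduce (x * T4) = 0 \<Longrightarrow> \<exists>y. x * T4 = 3 * (y * T4)"
  "reduce (x * TG) = 0 \<Longrightarrow> \<exists>y. x * TG = 3 * (y * TG)"
proof -
  assume "reduce (x * T3) = 0"
  then obtain w where "x * T3 = 3 * w" unfolding reduce_eq_0 by blast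
  then have "x * T3 = 3 * (first_row w * T3)"
    using first_row_T(1)[of x] by (simp only: first_row_3_times mult.assoc)
  then show "\<exists>y. x * T3 = 3 * (y * T3)" ..
next
  assume "reduce (x * T4) = 0"
  then obtain w where "x * T4 = 3 * w" unfolding reduce_eq_0 by blast
  then have "x * T4 = 3 * (first_row w * T4)"
    using first_row_T(2)[of x] by (simp only: first_row_3_times mult.assoc)
  then show "\<exists>y. x * T4 = 3 * (y * T4)" ..
next
  assume "reduce (x * TG) = 0"
  then obtain w where w: "x * TG = 3 * w" unfolding reduce_eq_0 by blast
  have "Poly_Mapping.single (0 :: 3 \<times> 3) (Poly_Mapping.lookup (3 * w) 0) = 3 * Poly_Mapping.single 0 (Poly_Mapping.lookup w 0)"
    by (rule poly_mapping_eqI) (simp add: lookup_3_times lookup_single when_def)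
  then have "x * TG = 3 * (Poly_Mapping.single 0 (Poly_Mapping.lookup w 0) * TG)"
    using TG_mult[of x] by (simp only: w mult.assoc)
  then show "\<exists>y. x * TG = 3 * (y * TG)" ..
qed

lemma reduce_3_times: "reduce (3 * x) = 0" by (auto simp: reduce_eq_0)

lemma triple_plus: "(x :: 'r::comm_ring_1 group_ring) + x + x = 3 * x"
  by (metis distrib_right mult_1 numeral_Bit1 numeral_One one_add_one)

fun reduce2 :: "int group_ring \<times> int group_ring \<Rightarrow> 3 group_ring \<times> 3 group_ring" where
  "reduce2 (x, y) = (reduce x, reduce y)"

fun reduce3 :: "int group_ring \<times> int group_ring \<times> int group_ring \<times> int group_ring
     \<Rightarrow> 3 group_ring \<times> 3 group_ring \<times> 3 group_ring \<times> 3 group_ring" where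
  "reduce3 (a, b, x, y) = (reduce a, reduce b, reduce x, reduce y)"


lemma reduce_surj_T: "\<exists>y. (\<exists>x. y = x * T3) \<and> z * T3 = reduce y"
    "\<exists>y. (\<exists>x. y = x * T4) \<and> z * T4 = reduce y"
    "\<exists>y. (\<exists>x. y = x * TG) \<and> z * TG = reduce y"
  by (metis reduce_surj reduce_mult reduce_T)+

lemma reduction_module1:
  "reduce ` carrier1 = carrier1"
  "x \<in> carrier1 \<Longrightarrow> reduce x = 0 \<longleftrightarrow> (\<exists>y \<in> carrier1. x = y + y + y)"
  unfolding carrier1_def triple_plus
  subgoal
    using reduce_surj_T by (auto simp: reduce_mult reduce_T image_iff)
  subgoal
    by (auto simp: reduce_3_times dest: reduce_eq_0_T(3))
  done

lemma reduction_module2: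
  "reduce2 ` carrier2 = carrier2"
  "x \<in> carrier2 \<Longrightarrow> reduce2 x = 0 \<longleftrightarrow> (\<exists>y \<in> carrier2. x = y + y + y)"
  unfolding carrier2_def
  subgoal
    using reduce_surj_T reduce_surj
    by (auto simp: reduce_mult reduce_T image_iff) metis
  subgoal
    using reduce_eq_0[of "fst x"]
    by (cases x) (auto simp: zero_prod_def triple_plus reduce_3_times dest!: reduce_eq_0_T(3))
  done

lemma reduction_module3:
  "reduce3 ` carrier3 = carrier3"
  "x \<in> carrier3 \<Longrightarrow> reduce3 x = 0 \<longleftrightarrow> (\<exists>y \<in> carrier3. x = y + y + y)"
  unfolding carrier3_def
  subgoal
    using reduce_surj_T reduce_surj
    by (auto simp: reduce_mult reduce_T image_iff) metis+
  subgoal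
    using reduce_eq_0[of "fst x"] reduce_eq_0[of "fst (snd x)"]
    by (cases x) (auto simp: zero_prod_def triple_plus reduce_3_times dest!: reduce_eq_0_T(1,2))
  done

lemma reduce_d2: "reduce3 (d2 x) = d2 (reduce2 x)"
  by (cases x) (simp add: reduce_mult reduce_add reduce_uminus reduce_T tau1_def tau2_def
      reduce_single reduce_1 diff_conv_add_uminus del: add_uminus_conv_diff)

lemma TG_expand: "TG = (\<Sum>a\<in>UNIV. \<Sum>b\<in>UNIV. Poly_Mapping.single (a, b) 1)"
  by (simp only: TG_def UNIV_Times_UNIV[symmetric] sum.cartesian_product) simp

lemma sum_UNIV_3: "(\<Sum>a\<in>UNIV. f (a :: 3)) = f 0 + (f 1 + f 2)"
proof -
  have "(0::3) \<noteq> 1" "(1::3) \<noteq> 2" "(0::3) \<noteq> 2" by simp_all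
  then show ?thesis unfolding UNIV_3 by simp
qed

lemma TG_factor: "TG = (1 + tau1 + tau1\<^sup>2) * T3" "TG = (1 + tau1 + tau1\<^sup>2) * T4"
  unfolding TG_expand sum_UNIV_3
  by (simp_all add: T_expand tau1_def power2_eq_square mult_single z3_arith
      distrib_left distrib_right add_ac flip: zero_prod_def single_one)

lemma d2_carrier: "x \<in> carrier2 \<Longrightarrow> d2 x \<in> carrier3"
proof -
  assume "x \<in> carrier2"
  then obtain a b where x: "x = (a, b * TG)" by (auto simp: carrier2_def)
  have "a * T3 + b * TG = (a + b * (1 + tau1 + tau1\<^sup>2)) * T3"
    "a * T4 + b * TG = (a + b * (1 + tau1 + tau1\<^sup>2)) * T4"
    by (simp_all only: distrib_right[of a] mult.assoc TG_factor[symmetric])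
  then show "d2 x \<in> carrier3" unfolding x carrier3_def by auto
qed

lemma carrier3_diff: "x \<in> carrier3 \<Longrightarrow> y \<in> carrier3 \<Longrightarrow> x - y \<in> carrier3"
  unfolding carrier3_def by (auto simp flip: left_diff_distrib)

lemma reduce3_add: "reduce3 (x + y) = reduce3 x + reduce3 y"
  by (cases x; cases y) (simp add: reduce_add)

lemma reduction_module4:
  assumes "x \<in> carrier3"
  shows "reduce3 x \<in> d2 ` carrier2 \<longleftrightarrow>
    (\<exists>a \<in> carrier2. \<exists>b \<in> carrier3. x = d2 a + (b + b + b))"
proof
  assume "reduce3 x \<in> d2 ` carrier2"
  then obtain a where a: "a \<in> carrier2" "reduce3 x = d2 (reduce2 a)"
    unfolding reduction_module2(1)[symmetric] by blast
  have "reduce3 x = reduce3 (x - d2 a) + reduce3 (d2 a)"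
    by (simp flip: reduce3_add)
  then have "reduce3 (x - d2 a) = 0" using a by (simp add: reduce_d2)
  then obtain b where "b \<in> carrier3" "x - d2 a = b + b + b"
    using reduction_module3(2) carrier3_diff[OF assms d2_carrier[OF a(1)]] by blast
  then show "\<exists>a \<in> carrier2. \<exists>b \<in> carrier3. x = d2 a + (b + b + b)"
    using a(1) by (metis add.commute diff_add_cancel)
next
  assume "\<exists>a \<in> carrier2. \<exists>b \<in> carrier3. x = d2 a + (b + b + b)"
  then obtain a b where ab: "a \<in> carrier2" "b \<in> carrier3" "x = d2 a + (b + b + b)" by blast
  have "b + b + b \<in> carrier3"
    using ab carrier3_diff[OF assms d2_carrier[OF ab(1)]] by simp
  then have "reduce3 (b + b + b) = 0"
    using reduction_module3(2) ab(2) by blast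
  then have "reduce3 x = d2 (reduce2 a)"
    unfolding ab(3) by (simp only: reduce3_add[of "d2 a"] reduce_d2 add_0_right)
  then show "reduce3 x \<in> d2 ` carrier2"
    using reduction_module2(1) ab(1) by auto
qed

end

theory Submission
  imports Defs
begin

text \<open>
  Write \<open>i, j\<close> for the two characters, \<open>\<delta>\<close> for the coboundary, \<open>H\<close> for the common kernel, and
  \<open>\<lambda>\<^sub>\<theta>\<close> for \<open>\<lambda>\<^sup>2\<^sub>\<theta>\<close>. The Voevodsky property enters through the lifting of cocycles: every cocycle of a closed
  subgroup with values in \<open>\<int>/3\<close> lifts to a cocycle with values in \<open>\<int>/9\<close> (\<open>liftable_voevodsky\<close>).

  \<^bold>\<open>Shapiro.\<close> Let \<open>\<theta>\<close> be a surjective character with values in a finite abelian group \<open>Q\<close>. Then also every cocycle with values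
  in \<open>\<int>/3[Q]\<close> lifts to \<open>\<int>/9[Q]\<close> (\<open>shapiro_lift\<close>), and a cocycle with trivial coefficients which is a
  coboundary on \<open>ker \<theta>\<close> is the coboundary of a cochain with values in the induced module
  (\<open>induced_coboundary\<close>). Both are explicit: in homogeneous cochains, written as functions of lists, a
  retraction \<open>r\<close> of the group to the kernel is connected with the identity by the prism homotopy
  (\<open>prism_homotopy\<close>).

  \<^bold>\<open>One character.\<close> Let \<open>\<theta>\<close> be a surjective character to \<open>\<int>/3\<close>, and \<open>t = \<tau> - 1\<close>, where \<open>\<tau>\<close> generates
  \<open>\<int>/3\<close>. In \<open>\<int>/9[\<tau>]\<close> one has \<open>t\<^sup>3 = -3t - 3t\<^sup>2\<close>, so that after lifting a cocycle \<open>p + A\<^sub>1 t + A\<^sub>2 t\<^sup>2\<close> the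
  cocycle equation in degree \<open>t\<close> acquires the extra term \<open>3 (\<theta> A\<^sub>2' + \<lambda>\<^sub>\<theta> A\<^sub>1')\<close> (\<open>lift_cyclic\<close>). For
  \<open>p = 0\<close> it follows that \<open>\<theta> A\<^sub>2' + \<lambda>\<^sub>\<theta> A\<^sub>1'\<close> is cohomologous to \<open>\<theta> k'\<close> for a cocycle \<open>k\<close>
  (\<open>cyclic_decomposable\<close>); in general it is determined, modulo such products, by the product in \<open>\<int>/9\<close> of
  \<open>\<theta>\<close> with a lift of \<open>p\<close> (\<open>cubic_class\<close>).

  \<^bold>\<open>The cochain \<open>z\<close>.\<close> That \<open>z\<close> is a cocycle is a computation with \<open>\<lambda>\<^sub>\<theta>\<close> (\<open>coc_zz\<close>). If \<open>w\<^sub>1\<^sub>1 = 0\<close> then \<open>z\<close> is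
  a sum of two expressions of the form just treated, so that \<open>[z]\<close> is
  decomposable, that is, in \<open>Dec\<close>. Hence \<open>[z]\<close> modulo
  decomposable classes depends only on \<open>w\<^sub>1\<^sub>1\<close>. If \<open>(i + j) w\<^sub>1\<^sub>1' = -\<delta>\<mu>\<close>, then a system with the same \<open>w\<^sub>1\<^sub>1\<close>
  is given by \<open>w\<^sub>2\<^sub>0 = w\<^sub>0\<^sub>2 = w\<^sub>1\<^sub>1\<close>, \<open>w\<^sub>1\<^sub>2 = w\<^sub>2\<^sub>1 = \<mu>\<close>, and its \<open>z\<close> is \<open>(i + j) \<mu>' + \<lambda>\<^sub>i\<^sub>+\<^sub>j w\<^sub>1\<^sub>1'\<close>, which is
  again decomposable; \<open>i - j\<close> is similar. This is part (iii).

  \<^bold>\<open>Part (i).\<close> Let \<open>c = (u, v, 0, -\<chi> T\<^sub>4)\<close> and \<open>\<delta>c = d\<^sub>2(\<xi>, y)\<close>. In the coordinates of \<open>\<int>/3[G]\<close> with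
  respect to \<open>t\<^sub>1\<^sup>a t\<^sub>2\<^sup>b\<close> the last two components express the coordinates of \<open>\<xi>\<close> of low degree and \<open>h\<^sub>1(\<xi>, y)\<close>
  by \<open>\<chi>\<close> and the coordinates \<open>\<xi>\<^sub>2\<^sub>0, \<xi>\<^sub>0\<^sub>2\<close> (\<open>omega_coordinates\<close>). The first two components give the
  coboundaries of the coordinates of \<open>u\<close> and \<open>v\<close>. From \<open>u\<^sub>0\<^sub>0, u\<^sub>1\<^sub>0\<close> one obtains by \<open>cyclic_decomposable\<close> a
  cocycle \<open>a\<close> and a cochain \<open>b\<close>, and one puts \<open>w\<^sub>0\<^sub>2 = a + \<chi>\<close>, \<open>w\<^sub>1\<^sub>2 = u\<^sub>2\<^sub>0 + b\<close>; symmetrically for \<open>v\<close>. The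
  difference of \<open>h\<^sub>1(\<xi>, y)\<close> and \<open>z\<close> then splits into one part for \<open>u\<close> and one for \<open>v\<close>, and each part is
  decomposable because the cubic expressions for \<open>i\<close>, \<open>j\<close> and \<open>i + j\<close> are additive up to the carry
  \<open>\<lambda>\<^sub>i j + i \<lambda>\<^sub>j\<close> of the addition modulo 3 (\<open>half_decomposable\<close>, \<open>eta_core\<close>).

  \<^bold>\<open>Part (ii).\<close> Every element of \<open>\<M>\<^sub>4 \<otimes> \<int>/3\<close> has a representative \<open>(u, v, 0, -\<chi> T\<^sub>4)\<close>
  (\<open>module4_normal_form\<close>), and a decomposable error term \<open>i a' + j b'\<close> is absorbed in \<open>w\<^sub>1\<^sub>2\<close> and \<open>w\<^sub>2\<^sub>1\<close>, so
  the image of \<open>\<eta>\<close> is contained in the set of all \<open>[z]\<close>. Each \<open>z\<close> vanishes if its first argument lies in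
  \<open>H\<close>, so \<open>[z]\<close> is in the kernel of the restriction. Finally let \<open>[a]\<close> be in this kernel. Then
  \<open>a = \<delta>\<xi>\<close> in \<open>\<int>/3[G]\<close>; for lifts \<open>A\<close>, \<open>X\<close> of \<open>a\<close>, \<open>\<xi>\<close> to \<open>\<int>/9\<close>, \<open>A\<close> a cocycle, the cochain
  \<open>\<omega> = ((A - \<delta>X)/3, -a T\<^sub>G)\<close> satisfies \<open>[h\<^sub>1(\<omega>)] = [a]\<close> and is the \<open>\<omega>\<close> of some \<open>c\<close>, whose
  components come from lifting the four cocycles obtained from \<open>\<xi>\<close> by the operators \<open>t\<^sub>1, t\<^sub>2\<close> and by
  summation over \<open>\<langle>\<tau>\<^sub>3\<rangle>\<close> and \<open>\<langle>\<tau>\<^sub>4\<rangle>\<close> (\<open>eta_exact\<close>). This closes the circle of inclusions.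
\<close>

section \<open>Cochains with trivial action\<close>

text \<open>The sign \<open>(-1)\<^sup>k\<close> as an operation on an abelian group.\<close>

definition alt :: "nat \<Rightarrow> 'r::ab_group_add \<Rightarrow> 'r" where
  "alt k x = (if even k then x else - x)"

lemma alt_simps [simp]:
  "alt (Suc k) x = - alt k x" "alt 0 x = x" "alt k 0 = 0"
  by (auto simp: alt_def)

lemma alt_add: "alt k (x + y) = alt k x + alt k y" by (simp add: alt_def)

text \<open>The faces of an \<open>(m + 1)\<close>-tuple: omitting the first entry, and multiplying the entries \<open>k\<close> and
  \<open>k + 1\<close>. The last face is a restriction.\<close>

definition shift :: "nat \<Rightarrow> (nat \<Rightarrow> 'g) \<Rightarrow> nat \<Rightarrow> 'g" where
  "shift m g = (\<lambda>l \<in> {..<m}. g (Suc l))"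

definition fuse :: "('g, 'b) monoid_scheme \<Rightarrow> nat \<Rightarrow> nat \<Rightarrow> (nat \<Rightarrow> 'g) \<Rightarrow> nat \<Rightarrow> 'g" where
  "fuse G m k g = (\<lambda>l \<in> {..<m}. if l < k then g l else if l = k then g k \<otimes>\<^bsub>G\<^esub> g (Suc k) else g (Suc l))"

text \<open>The inhomogeneous coboundary of an \<open>m\<close>-cochain for the trivial action, written additively and
  without restriction to tuples.\<close>

definition dlt :: "('g, 'b) monoid_scheme \<Rightarrow> nat \<Rightarrow> ((nat \<Rightarrow> 'g) \<Rightarrow> 'r::ab_group_add) \<Rightarrow> (nat \<Rightarrow> 'g) \<Rightarrow> 'r" where
  "dlt G m f g = f (shift m g) + (\<Sum>k<m. alt (Suc k) (f (fuse G m k g))) + alt (Suc m) (f (restrict g {..<m}))"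

lemma tuplesD: "g \<in> tuples G m \<Longrightarrow> l < m \<Longrightarrow> g l \<in> carrier G"
  by (auto simp: tuples_def)

lemma shift_tuples [simp]: "g \<in> tuples G (Suc m) \<Longrightarrow> shift m g \<in> tuples G m"
  unfolding tuples_def shift_def by (simp add: PiE_iff)

lemma restrict_tuples [simp]: "g \<in> tuples G (Suc m) \<Longrightarrow> restrict g {..<m} \<in> tuples G m"
  unfolding tuples_def by (simp add: PiE_iff)

lemma fuse_tuples [simp]:
  assumes "group G" "g \<in> tuples G (Suc m)"
  shows "fuse G m k g \<in> tuples G m"
proof -
  interpret group G by fact
  show ?thesis using tuplesD[OF assms(2)] by (simp add: tuples_def fuse_def PiE_iff)
qed

lemma dlt_cong:
  assumes "group G" "g \<in> tuples G (Suc m)" "\<And>h. h \<in> tuples G m \<Longrightarrow> f h = f' h"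
  shows "dlt G m f g = dlt G m f' g"
  unfolding dlt_def using assms by simp

lemma dlt_add: "dlt G m (\<lambda>h. f h + f' h) g = dlt G m f g + dlt G m f' g"
  by (simp add: dlt_def alt_add sum.distrib algebra_simps sum_negf sum_subtractf)

lemma dlt_hom:
  assumes "\<And>x y. \<phi> (x + y) = \<phi> x + \<phi> y"
  shows "\<phi> (dlt G m f g) = dlt G m (\<lambda>h. \<phi> (f h)) g"
proof -
  have 0: "\<phi> 0 = 0" using assms[of 0 0] by simp
  have m: "\<phi> (- x) = - \<phi> x" for x using assms[of x "- x"] 0 by (simp add: eq_neg_iff_add_eq_0 add.commute)
  have a: "\<phi> (alt k x) = alt k (\<phi> x)" for k x by (simp add: alt_def m)
  have s: "\<phi> (sum F {..<k}) = (\<Sum>i<k. \<phi> (F i))" for F and k :: nat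
    by (induction k) (simp_all add: 0 assms)
  show ?thesis unfolding dlt_def by (simp only: assms a s)
qed

lemma dlt_minus: "dlt G m (\<lambda>h. - f h) g = - dlt G m f g"
  by (rule dlt_hom[symmetric]) simp

lemma dlt_diff: "dlt G m (\<lambda>h. f h - f' h) g = dlt G m f g - dlt G m f' g"
  using dlt_add[of G m f "\<lambda>h. - f' h" g] by (simp add: dlt_minus)

lemma dlt_0 [simp]: "dlt G m (\<lambda>h. 0) g = 0"
  by (simp add: dlt_def)

lemma dlt_sum: "dlt G m (\<lambda>h. \<Sum>q\<in>A. f q h) g = (\<Sum>q\<in>A. dlt G m (f q) g)"
  by (induction A rule: infinite_finite_induct) (simp_all add: dlt_add)

section \<open>Homogeneous cochains as functions of lists\<close>

text \<open>The homogeneous coboundary: the alternating sum of \<open>\<phi>\<close> over the lists with one entry omitted. The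
  value at the empty list is irrelevant.\<close>

fun dh :: "('g list \<Rightarrow> 'r::ab_group_add) \<Rightarrow> 'g list \<Rightarrow> 'r" where
  "dh \<phi> [] = 0"
| "dh \<phi> (x # xs) = \<phi> xs - dh (\<lambda>ys. \<phi> (x # ys)) xs"

text \<open>The prism operator of the homotopy from the identity to a map \<open>r\<close>: the alternating sum of the
  values \<open>\<phi>(x\<^sub>0, \<dots>, x\<^sub>k, r x\<^sub>k, \<dots>, r x\<^sub>n)\<close>.\<close>

fun prism :: "('g \<Rightarrow> 'g) \<Rightarrow> ('g list \<Rightarrow> 'r::ab_group_add) \<Rightarrow> 'g list \<Rightarrow> 'r" where
  "prism r \<phi> [] = 0"
| "prism r \<phi> (x # xs) = \<phi> (x # r x # map r xs) - prism r (\<lambda>ys. \<phi> (x # ys)) xs"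

lemma dh_diff: "dh (\<lambda>ys. \<phi> ys - \<psi> ys) xs = dh \<phi> xs - dh \<psi> xs"
  by (induction xs arbitrary: \<phi> \<psi>) simp_all

lemma prism_diff: "prism r (\<lambda>ys. \<phi> ys - \<psi> ys) xs = prism r \<phi> xs - prism r \<psi> xs"
  by (induction xs arbitrary: \<phi> \<psi>) simp_all

lemma dh_dh: "dh (dh \<phi>) xs = 0"
  by (induction xs arbitrary: \<phi>) (simp_all add: dh_diff)

lemma dh_map: "dh (\<lambda>ys. \<phi> (map r ys)) xs = dh \<phi> (map r xs)"
  by (induction xs arbitrary: \<phi>) simp_all

lemma prism_homotopy: "dh (prism r \<phi>) xs + prism r (dh \<phi>) xs = \<phi> (map r xs) - \<phi> xs"
proof (induction xs arbitrary: \<phi>)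
  case (Cons x xs)
  have "dh (prism r \<phi>) (x # xs) = prism r \<phi> xs - dh (\<lambda>ys. \<phi> (x # r x # map r ys)) xs
      + dh (prism r (\<lambda>ys. \<phi> (x # ys))) xs"
    by (simp add: dh_diff)
  moreover have "dh (\<lambda>ys. \<phi> (x # r x # map r ys)) xs = dh (\<lambda>ys. \<phi> (x # r x # ys)) (map r xs)"
    by (rule dh_map)
  ultimately show ?case
    using Cons.IH[of "\<lambda>ys. \<phi> (x # ys)"] by (simp add: prism_diff algebra_simps)
qed simp

text \<open>Locality: the values on lists of a given length with entries in a set \<open>A\<close> only involve lists
  of the same kind.\<close>

lemma dh_cong:
  assumes "set xs \<subseteq> A" "\<And>ys. set ys \<subseteq> A \<Longrightarrow> Suc (length ys) = length xs \<Longrightarrow> \<phi> ys = \<psi> ys"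
  shows "dh \<phi> xs = dh \<psi> xs"
  using assms
proof (induction xs arbitrary: \<phi> \<psi>)
  case (Cons x xs)
  have "dh (\<lambda>ys. \<phi> (x # ys)) xs = dh (\<lambda>ys. \<psi> (x # ys)) xs"
    by (rule Cons.IH) (use Cons.prems in auto)
  then show ?case using Cons.prems by simp
qed simp

lemma prism_cong:
  assumes "set xs \<subseteq> A" "r ` A \<subseteq> A" "\<And>ys. set ys \<subseteq> A \<Longrightarrow> length ys = Suc (length xs) \<Longrightarrow> \<phi> ys = \<psi> ys"
  shows "prism r \<phi> xs = prism r \<psi> xs"
  using assms
proof (induction xs arbitrary: \<phi> \<psi>)
  case (Cons x xs)
  have "prism r (\<lambda>ys. \<phi> (x # ys)) xs = prism r (\<lambda>ys. \<psi> (x # ys)) xs"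
    by (rule Cons.IH) (use Cons.prems in auto)
  moreover have "\<phi> (x # r x # map r xs) = \<psi> (x # r x # map r xs)"
    using Cons.prems(1,2) by (intro Cons.prems(3)) auto
  ultimately show ?case by simp
qed simp

lemma prism_zero: "prism r (\<lambda>_. 0) xs = 0"
  by (induction xs) simp_all

text \<open>Invariance under a translation \<open>t\<close> commuting with \<open>r\<close>.\<close>

lemma prism_map:
  assumes "set xs \<subseteq> A" "\<And>x. x \<in> A \<Longrightarrow> r (t x) = t (r x)"
  shows "prism r \<phi> (map t xs) = prism r (\<lambda>ys. \<phi> (map t ys)) xs"
  using assms
proof (induction xs arbitrary: \<phi>)
  case (Cons x xs)
  have "map r (map t xs) = map t (map r xs)" using Cons.prems by auto
  moreover have "prism r (\<lambda>ys. \<phi> (t x # ys)) (map t xs) = prism r (\<lambda>ys. \<phi> (t x # map t ys)) xs"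
    using Cons.IH[of "\<lambda>ys. \<phi> (t x # ys)"] Cons.prems by simp
  ultimately show ?case using Cons.prems by (simp del: map_map)
qed simp

text \<open>The list \<open>s, s g\<^sub>0, s g\<^sub>0 g\<^sub>1, \<dots>\<close> of length \<open>m + 1\<close>; it relates homogeneous and inhomogeneous
  cochains.\<close>

fun walk :: "('g, 'b) monoid_scheme \<Rightarrow> 'g \<Rightarrow> nat \<Rightarrow> (nat \<Rightarrow> 'g) \<Rightarrow> 'g list" where
  "walk G s 0 g = [s]"
| "walk G s (Suc m) g = s # walk G (s \<otimes>\<^bsub>G\<^esub> g 0) m (\<lambda>l. g (Suc l))"

lemma length_walk [simp]: "length (walk G s m g) = Suc m"
  by (induction m arbitrary: s g) simp_all

lemma walk_cong: "(\<And>l. l < m \<Longrightarrow> g l = h l) \<Longrightarrow> walk G s m g = walk G s m h"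
proof (induction m arbitrary: s g h)
  case (Suc m)
  have "g 0 = h 0" using Suc.prems[of 0] by simp
  moreover have "walk G t m (\<lambda>l. g (Suc l)) = walk G t m (\<lambda>l. h (Suc l))" for t
    by (rule Suc.IH) (use Suc.prems in simp)
  ultimately show ?case by simp
qed simp

lemma walk_carrier:
  assumes "group G" "s \<in> carrier G" "\<And>l. l < m \<Longrightarrow> g l \<in> carrier G"
  shows "set (walk G s m g) \<subseteq> carrier G"
  using assms(2,3)
proof (induction m arbitrary: s g)
  case (Suc m)
  have "s \<otimes>\<^bsub>G\<^esub> g 0 \<in> carrier G" using Suc.prems assms(1) by (simp add: group.is_monoid monoid.m_closed)
  then show ?case using Suc by auto
qed simp

lemma walk_translate:
  assumes "group G" "k \<in> carrier G" "s \<in> carrier G" "\<And>l. l < m \<Longrightarrow> g l \<in> carrier G"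
  shows "walk G (k \<otimes>\<^bsub>G\<^esub> s) m g = map (\<lambda>x. k \<otimes>\<^bsub>G\<^esub> x) (walk G s m g)"
  using assms(3,4)
proof (induction m arbitrary: s g)
  case (Suc m)
  have "s \<otimes>\<^bsub>G\<^esub> g 0 \<in> carrier G" using Suc.prems assms(1) by (simp add: group.is_monoid monoid.m_closed)
  then show ?case using Suc assms(1,2) by (simp add: monoid.m_assoc group.is_monoid)
qed simp

text \<open>The homogeneous coboundary along a walk. The correction term is the change of the starting point
  in the face that omits the first entry; this is where a nontrivial action shows up.\<close>

lemma dh_walk:
  assumes "group G" "s \<in> carrier G" "\<And>l. l < Suc m \<Longrightarrow> g l \<in> carrier G"
  shows "dh \<phi> (walk G s (Suc m) g) =
    dlt G m (\<lambda>h. \<phi> (walk G s m h)) g + \<phi> (walk G (s \<otimes>\<^bsub>G\<^esub> g 0) m (shift m g)) - \<phi> (walk G s m (shift m g))"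
  using assms(2,3)
proof (induction m arbitrary: s g \<phi>)
  case 0
  show ?case by (simp add: dlt_def)
next
  case (Suc m)
  let ?g = "\<lambda>l. g (Suc l)" and ?s = "s \<otimes>\<^bsub>G\<^esub> g 0" and ?\<phi> = "\<lambda>ys. \<phi> (s # ys)"
  have s: "?s \<in> carrier G" using Suc.prems assms(1) by (simp add: group.is_monoid monoid.m_closed)
  have IH: "dh ?\<phi> (walk G ?s (Suc m) ?g) =
    (\<Sum>k<m. alt (Suc k) (?\<phi> (walk G ?s m (fuse G m k ?g)))) + alt (Suc m) (?\<phi> (walk G ?s m (restrict ?g {..<m})))
     + ?\<phi> (walk G (?s \<otimes>\<^bsub>G\<^esub> g 1) m (shift m ?g))"
    using Suc.IH[OF s, of ?g ?\<phi>] Suc.prems(2) by (simp add: dlt_def)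
  have e0: "walk G s (Suc m) (fuse G (Suc m) 0 g) = s # walk G (?s \<otimes>\<^bsub>G\<^esub> g 1) m (shift m ?g)"
    using Suc.prems assms(1)
    by (simp add: fuse_def monoid.m_assoc group.is_monoid, intro walk_cong, simp add: shift_def)
  have ek: "walk G s (Suc m) (fuse G (Suc m) (Suc k) g) = s # walk G ?s m (fuse G m k ?g)" for k
    by (simp add: fuse_def, intro walk_cong, simp)
  have el: "walk G s (Suc m) (restrict g {..<Suc m}) = s # walk G ?s m (restrict ?g {..<m})"
    by (simp, intro walk_cong, simp)
  have eh: "walk G ?s (Suc m) (shift (Suc m) g) = walk G ?s (Suc m) ?g"
    by (intro walk_cong) (simp add: shift_def)
  have "dh \<phi> (walk G s (Suc (Suc m)) g) = \<phi> (walk G ?s (Suc m) ?g) - dh ?\<phi> (walk G ?s (Suc m) ?g)"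
    by (subst walk.simps(2)) (simp only: dh.simps)
  also have "\<dots> = \<phi> (walk G ?s (Suc m) (shift (Suc m) g)) 
      + ((\<Sum>k<Suc m. alt (Suc k) (\<phi> (walk G s (Suc m) (fuse G (Suc m) k g))))
      + alt (Suc (Suc m)) (\<phi> (walk G s (Suc m) (restrict g {..<Suc m}))))"
    unfolding IH eh sum.lessThan_Suc_shift e0 ek el by (simp add: sum_negf)
  finally show ?case unfolding dlt_def by (simp add: algebra_simps)
qed

text \<open>The differences of a list: the inverse of \<open>walk\<close>.\<close>

definition quot :: "('g, 'b) monoid_scheme \<Rightarrow> 'g list \<Rightarrow> nat \<Rightarrow> 'g" where
  "quot G xs = (\<lambda>l \<in> {..<length xs - 1}. inv\<^bsub>G\<^esub> (xs ! l) \<otimes>\<^bsub>G\<^esub> (xs ! Suc l))"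

lemma quot_tuples:
  assumes "group G" "set xs \<subseteq> carrier G" "length xs = Suc m"
  shows "quot G xs \<in> tuples G m"
proof -
  interpret group G by fact
  have "xs ! l \<in> carrier G" if "l < Suc m" for l using assms that by auto
  then show ?thesis using assms(3) by (simp add: tuples_def quot_def PiE_iff)
qed

lemma walk_nth_Suc:
  "l < m \<Longrightarrow> walk G s m g ! Suc l = walk G s m g ! l \<otimes>\<^bsub>G\<^esub> g l"
proof (induction m arbitrary: s g l)
  case (Suc m)
  show ?case
  proof (cases l)
    case 0
    then show ?thesis by (cases m) simp_all
  next
    case (Suc l')
    then show ?thesis using Suc.IH[of l' "s \<otimes>\<^bsub>G\<^esub> g 0" "\<lambda>l. g (Suc l)"] Suc.prems by simp
  qed
qed simp

lemma hd_walk [simp]: "hd (walk G s m g) = s" by (cases m) simp_all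

lemma quot_walk:
  assumes "group G" "s \<in> carrier G" "g \<in> tuples G m"
  shows "quot G (walk G s m g) = g"
proof
  fix l
  have c: "set (walk G s m g) \<subseteq> carrier G" using assms by (intro walk_carrier) (auto dest: tuplesD)
  show "quot G (walk G s m g) l = g l"
  proof (cases "l < m")
    case True
    have "walk G s m g ! l \<in> carrier G" using c True by (simp add: subset_iff)
    moreover have "g l \<in> carrier G" using True assms(3) by (rule tuplesD[rotated])
    ultimately show ?thesis using True group.inv_solve_left'[OF assms(1)] assms(1)
      by (simp add: quot_def walk_nth_Suc group.is_monoid monoid.m_closed)
  next
    case False
    then show ?thesis using assms(3) by (auto simp: quot_def tuples_def PiE_def extensional_def)
  qed
qed

lemma walk_quot:
  assumes "group G" "set xs \<subseteq> carrier G" "length xs = Suc m"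
  shows "walk G (hd xs) m (quot G xs) = xs"
proof -
  have "walk G (hd xs) m (quot G xs) ! l = xs ! l" if "l < Suc m" for l
    using that
  proof (induction l)
    case 0
    have "xs \<noteq> []" "walk G (hd xs) m (quot G xs) \<noteq> []"
      using assms(3) length_walk[of G "hd xs" m "quot G xs"] by (auto simp del: length_walk)
    then show ?case by (simp add: hd_conv_nth[symmetric])
  next
    case (Suc l)
    have "xs ! l \<in> carrier G" "xs ! Suc l \<in> carrier G" using Suc.prems assms by (auto simp: subset_iff)
    then have "xs ! l \<otimes>\<^bsub>G\<^esub> (inv\<^bsub>G\<^esub> (xs ! l) \<otimes>\<^bsub>G\<^esub> (xs ! Suc l)) = xs ! Suc l"
      using assms(1) by (metis group.inv_closed group.is_monoid group.r_inv monoid.l_one monoid.m_assoc)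
    then show ?case using Suc assms(3) by (simp add: walk_nth_Suc quot_def)
  qed
  then show ?thesis using assms(3) by (intro nth_equalityI) simp_all
qed

lemma quot_translate:
  assumes "group G" "set xs \<subseteq> carrier G" "k \<in> carrier G"
  shows "quot G (map (\<lambda>x. k \<otimes>\<^bsub>G\<^esub> x) xs) = quot G xs"
proof
  interpret group G by fact
  fix l
  show "quot G (map (\<lambda>x. k \<otimes>\<^bsub>G\<^esub> x) xs) l = quot G xs l"
  proof (cases "Suc l < length xs")
    case True
    then have "xs ! l \<in> carrier G" "xs ! Suc l \<in> carrier G" using assms(2) by (auto simp: subset_iff)
    moreover have "inv\<^bsub>G\<^esub> k \<otimes>\<^bsub>G\<^esub> (k \<otimes>\<^bsub>G\<^esub> y) = y" if "y \<in> carrier G" for y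
      using that assms(3) by (simp flip: m_assoc)
    ultimately have "inv\<^bsub>G\<^esub> (k \<otimes>\<^bsub>G\<^esub> xs ! l) \<otimes>\<^bsub>G\<^esub> (k \<otimes>\<^bsub>G\<^esub> xs ! Suc l) = inv\<^bsub>G\<^esub> (xs ! l) \<otimes>\<^bsub>G\<^esub> xs ! Suc l"
      using assms(3) by (simp add: inv_mult_group m_assoc)
    then show ?thesis using True by (simp add: quot_def)
  next
    case False
    then have "\<not> l < length xs - 1" by simp
    then show ?thesis by (simp add: quot_def)
  qed
qed

lemma dh_trivial:
  assumes "group G" "s \<in> carrier G" "g \<in> tuples G (Suc m)"
    and "\<And>s g. s \<in> carrier G \<Longrightarrow> g \<in> tuples G m \<Longrightarrow> \<phi> (walk G s m g) = f g"
  shows "dh \<phi> (walk G s (Suc m) g) = dlt G m f g"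
proof -
  interpret group G by fact
  have "s \<otimes>\<^bsub>G\<^esub> g 0 \<in> carrier G" using assms by (auto dest: tuplesD)
  moreover have "dlt G m (\<lambda>h. \<phi> (walk G s m h)) g = dlt G m f g"
    by (rule dlt_cong) (use assms in auto)
  ultimately show ?thesis
    by (subst dh_walk) (use assms in \<open>auto dest: tuplesD\<close>)
qed

text \<open>By \<open>dh_trivial\<close> this is inherited from \<open>dh_dh\<close>.\<close>

lemma dlt_dlt:
  assumes "group G" "g \<in> tuples G (Suc (Suc m))"
  shows "dlt G (Suc m) (dlt G m f) g = 0"
proof -
  let ?\<phi> = "\<lambda>xs. f (quot G xs)"
  interpret group G by fact
  have "dlt G (Suc m) (dlt G m f) g = dh (dh ?\<phi>) (walk G \<one>\<^bsub>G\<^esub> (Suc (Suc m)) g)"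
    using assms by (intro dh_trivial[symmetric] dh_trivial) (simp_all add: quot_walk)
  then show ?thesis by (simp only: dh_dh)
qed

text \<open>The Leibniz rule for the product of a function on \<open>G\<close> with a cochain.\<close>

lemma shift_apply: "l < m \<Longrightarrow> shift m g l = g (Suc l)" by (simp add: shift_def)

lemma dlt_cup:
  fixes x :: "'g \<Rightarrow> 'r::comm_ring_1"
  assumes "group G" "g \<in> tuples G (Suc (Suc m))"
  shows "dlt G (Suc m) (\<lambda>h. x (h 0) * y (shift m h)) g =
     (x (g 1) - x (g 0 \<otimes>\<^bsub>G\<^esub> g 1) + x (g 0)) * y (shift m (shift (Suc m) g))
     - x (g 0) * dlt G m y (shift (Suc m) g)"
proof -
  let ?g = "shift (Suc m) g"
  have e0: "shift m (fuse G (Suc m) 0 g) = shift m ?g" "fuse G (Suc m) 0 g 0 = g 0 \<otimes>\<^bsub>G\<^esub> g 1"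
    by (auto simp: shift_def fuse_def fun_eq_iff)
  have ek: "shift m (fuse G (Suc m) (Suc k) g) = fuse G m k ?g"  "fuse G (Suc m) (Suc k) g 0 = g 0" if "k < m" for k
    using that by (auto simp: shift_def fuse_def fun_eq_iff)
  have el: "shift m (restrict g {..<Suc m}) = restrict ?g {..<m}"
    by (auto simp: shift_def fun_eq_iff)
  have alt_mult: "alt k (a * b) = a * alt k b" for k and a b :: 'r by (simp add: alt_def)
  have es: "(\<Sum>k<m. alt (Suc (Suc k)) (x (fuse G (Suc m) (Suc k) g 0) * y (shift m (fuse G (Suc m) (Suc k) g))))
     = x (g 0) * - (\<Sum>k<m. alt (Suc k) (y (fuse G m k ?g)))"
    unfolding sum_negf[symmetric] sum_distrib_left by (intro sum.cong) (simp_all add: ek alt_mult)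
  show ?thesis
    unfolding dlt_def sum.lessThan_Suc_shift es e0 el
    by (simp add: shift_def alt_mult) (simp add: algebra_simps)
qed

section \<open>Locally constant functions\<close>

text \<open>Continuity of a map to a discrete space, that is, local constancy.\<close>

abbreviation dc :: "'x topology \<Rightarrow> ('x \<Rightarrow> 'a) \<Rightarrow> bool" where
  "dc X f \<equiv> continuous_map X (discrete_topology UNIV) f"

text \<open>Continuous \<open>m\<close>-cochains; the values outside of the tuples of group elements are arbitrary.\<close>

abbreviation cts :: "'g topology \<Rightarrow> nat \<Rightarrow> ((nat \<Rightarrow> 'g) \<Rightarrow> 'a) \<Rightarrow> bool" where
  "cts T m f \<equiv> dc (product_topology (\<lambda>_. T) {..<m}) f"

lemma dc_iff: "dc X f \<longleftrightarrow> (\<forall>v. openin X {x \<in> topspace X. f x = v})"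
proof
  assume "dc X f"
  then have "openin X {x \<in> topspace X. f x \<in> {v}}" for v
    by (intro openin_continuous_map_preimage[of X "discrete_topology UNIV"]) simp_all
  then show "\<forall>v. openin X {x \<in> topspace X. f x = v}" by simp
next
  assume *: "\<forall>v. openin X {x \<in> topspace X. f x = v}"
  show "dc X f"
    unfolding continuous_map_def
  proof (intro conjI allI impI)
    fix U
    have "{x \<in> topspace X. f x \<in> U} = (\<Union>v\<in>U. {x \<in> topspace X. f x = v})" by auto
    then show "openin X {x \<in> topspace X. f x \<in> U}" using * by auto
  qed simp
qed

lemma dc_const [simp, intro]: "dc X (\<lambda>_. c)" by simp

lemma dc_comp: "dc X f \<Longrightarrow> dc X (\<lambda>x. F (f x))"
  using continuous_map_compose[of X "discrete_topology UNIV" f "discrete_topology UNIV" F] by (simp add: o_def)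

text \<open>A finite family of locally constant functions is locally constant as a function to the family of
  values.\<close>

lemma dc_family:
  fixes f :: "'q::finite \<Rightarrow> 'x \<Rightarrow> 'a"
  assumes "\<And>q. dc X (f q)"
  shows "dc X (\<lambda>x. F (\<lambda>q. f q x))"
proof -
  have "dc X (\<lambda>x q. f q x)"
    unfolding dc_iff
  proof
    fix v
    have "{x \<in> topspace X. (\<lambda>q. f q x) = v} = topspace X \<inter> (\<Inter>q. {x \<in> topspace X. f q x = v q})"
      by (auto simp: fun_eq_iff)
    also have "openin X \<dots>"
      using assms by (intro openin_Int openin_INT2) (auto simp: dc_iff)
    finally show "openin X {x \<in> topspace X. (\<lambda>q. f q x) = v}" .
  qed
  then show ?thesis by (rule dc_comp)
qed

lemma dc_comp2:
  assumes "dc X f" "dc X g"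
  shows "dc X (\<lambda>x. F (f x) (g x))"
proof -
  have "dc X (\<lambda>x. (f x, g x))"
    unfolding dc_iff
  proof
    fix v
    have "{x \<in> topspace X. (f x, g x) = v} = {x \<in> topspace X. f x = fst v} \<inter> {x \<in> topspace X. g x = snd v}"
      by auto
    then show "openin X {x \<in> topspace X. (f x, g x) = v}" using assms by (auto simp: dc_iff)
  qed
  then show ?thesis using dc_comp[of X _ "\<lambda>(a, b). F a b"] by force
qed

lemma dc_sum:
  fixes f :: "'i \<Rightarrow> 'x \<Rightarrow> 'a::comm_monoid_add"
  assumes "\<And>i. i \<in> A \<Longrightarrow> dc X (f i)"
  shows "dc X (\<lambda>x. \<Sum>i\<in>A. f i x)"
  using assms by (induction A rule: infinite_finite_induct) (auto intro: dc_comp2[of _ _ _ "(+)"])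

lemma dc_cong: "(\<And>x. x \<in> topspace X \<Longrightarrow> f x = g x) \<Longrightarrow> dc X f \<longleftrightarrow> dc X g"
  using continuous_map_eq[of X "discrete_topology UNIV" f g] continuous_map_eq[of X "discrete_topology UNIV" g f] by auto

lemma dc_pull: "continuous_map X Y e \<Longrightarrow> dc Y f \<Longrightarrow> dc X (\<lambda>x. f (e x))"
  using continuous_map_compose[of X Y e "discrete_topology UNIV" f] by (simp add: o_def)

lemma continuous_tuple:
  assumes "\<And>k. k < m \<Longrightarrow> continuous_map X T (e k)"
  shows "continuous_map X (product_topology (\<lambda>_. T) {..<m}) (\<lambda>x. \<lambda>k\<in>{..<m}. e k x)"
  unfolding continuous_map_componentwise using assms by (auto simp: PiE_def)

lemma cts_tuple:
  assumes "cts T m f" "\<And>k. k < m \<Longrightarrow> continuous_map X T (e k)"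
  shows "dc X (\<lambda>x. f (\<lambda>k\<in>{..<m}. e k x))"
  using dc_pull[OF continuous_tuple assms(1)] assms(2) by blast

text \<open>Continuity of a homogeneous cochain on lists of length \<open>m\<close>, formulated by substitution of
  continuous functions for the entries. It suffices to let the functions be defined on spaces of tuples.\<close>

definition hcts :: "'g topology \<Rightarrow> nat \<Rightarrow> ('g list \<Rightarrow> 'a) \<Rightarrow> bool" where
  "hcts T m \<phi> \<longleftrightarrow> (\<forall>(X :: (nat \<Rightarrow> 'g) topology) es. length es = m \<longrightarrow> (\<forall>e\<in>set es. continuous_map X T e) \<longrightarrow>
     dc X (\<lambda>x. \<phi> (map (\<lambda>e. e x) es)))"

lemma hctsI:
  fixes T :: "'g topology"
  assumes "\<And>(X :: (nat \<Rightarrow> 'g) topology) es. length es = m \<Longrightarrow> \<forall>e\<in>set es. continuous_map X T e \<Longrightarrow>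
     dc X (\<lambda>x. \<phi> (map (\<lambda>e. e x) es))"
  shows "hcts T m \<phi>"
  unfolding hcts_def by (intro allI impI assms)

lemma hctsD:
  fixes T :: "'g topology" and X :: "(nat \<Rightarrow> 'g) topology"
  assumes "hcts T m \<phi>" "length es = m" "\<forall>e\<in>set es. continuous_map X T e"
  shows "dc X (\<lambda>x. \<phi> (map (\<lambda>e. e x) es))"
  using assms unfolding hcts_def by blast

lemma hcts_comp2: "hcts T m \<phi> \<Longrightarrow> hcts T m \<psi> \<Longrightarrow> hcts T m (\<lambda>xs. F (\<phi> xs) (\<psi> xs))"
  by (rule hctsI, rule dc_comp2) (rule hctsD; assumption)+

lemma hcts_comp: "hcts T m \<phi> \<Longrightarrow> hcts T m (\<lambda>xs. F (\<phi> xs))"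
  by (rule hctsI, rule dc_comp) (rule hctsD; assumption)

text \<open>For the induction, \<open>\<phi>\<close> is allowed to depend on the point \<open>x\<close>; the same applies to the prism operator.\<close>

lemma dc_dh:
  fixes X :: "'x topology"
  assumes "\<And>es. Suc (length es) = m \<Longrightarrow> (\<forall>e\<in>set es. continuous_map X T e) \<Longrightarrow> dc X (\<lambda>x. \<phi> x (map (\<lambda>e. e x) es))"
    and "length es = m" "\<forall>e\<in>set es. continuous_map X T e"
  shows "dc X (\<lambda>x. dh (\<phi> x) (map (\<lambda>e. e x) es))"
  using assms
proof (induction es arbitrary: m \<phi>)
  case (Cons e es)
  have "dc X (\<lambda>x. dh (\<lambda>ys. \<phi> x (e x # ys)) (map (\<lambda>e. e x) es))"
  proof (rule Cons.IH[of "length es" "\<lambda>x ys. \<phi> x (e x # ys)"])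
    fix fs assume "Suc (length fs) = length es" "\<forall>e\<in>set fs. continuous_map X T e"
    then show "dc X (\<lambda>x. \<phi> x (e x # map (\<lambda>e. e x) fs))"
      using Cons.prems(1)[of "e # fs"] Cons.prems(2,3) by simp
  qed (use Cons.prems in auto)
  moreover have "dc X (\<lambda>x. \<phi> x (map (\<lambda>e. e x) es))"
    using Cons.prems by simp
  ultimately show ?case by (simp add: dc_comp2[of _ _ _ "(-)"])
qed simp

lemma hcts_dh: "hcts T m \<phi> \<Longrightarrow> hcts T (Suc m) (dh \<phi>)"
  by (rule hctsI, rule dc_dh[where m = "Suc m"]) (auto dest: hctsD)

lemma dc_prism:
  fixes X :: "'x topology"
  assumes "\<And>es. length es = Suc m \<Longrightarrow> (\<forall>e\<in>set es. continuous_map X T e) \<Longrightarrow> dc X (\<lambda>x. \<phi> x (map (\<lambda>e. e x) es))"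
    and "length es = m" "\<forall>e\<in>set es. continuous_map X T e" "continuous_map T T r"
  shows "dc X (\<lambda>x. prism r (\<phi> x) (map (\<lambda>e. e x) es))"
  using assms
proof (induction es arbitrary: m \<phi>)
  case (Cons e es)
  have "dc X (\<lambda>x. prism r (\<lambda>ys. \<phi> x (e x # ys)) (map (\<lambda>e. e x) es))"
  proof (rule Cons.IH[of "length es" "\<lambda>x ys. \<phi> x (e x # ys)"])
    fix fs assume "length fs = Suc (length es)" "\<forall>e\<in>set fs. continuous_map X T e"
    then show "dc X (\<lambda>x. \<phi> x (e x # map (\<lambda>e. e x) fs))"
      using Cons.prems(1)[of "e # fs"] Cons.prems(2,3) by simp
  qed (use Cons.prems in auto)
  moreover have "continuous_map X T (\<lambda>x. r (e' x))" if "continuous_map X T e'" for e'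
    using continuous_map_compose[OF that Cons.prems(4)] by (simp add: o_def)
  then have "dc X (\<lambda>x. \<phi> x (map (\<lambda>e. e x) (e # (\<lambda>x. r (e x)) # map (\<lambda>e' x. r (e' x)) es)))"
    using Cons.prems(2,3) by (intro Cons.prems(1)) auto
  then have "dc X (\<lambda>x. \<phi> x (e x # r (e x) # map r (map (\<lambda>e. e x) es)))"
    by (simp add: o_def)
  ultimately show ?case by (simp add: dc_comp2[of _ _ _ "(-)"])
qed simp

lemma hcts_prism: "hcts T (Suc m) \<phi> \<Longrightarrow> continuous_map T T r \<Longrightarrow> hcts T m (prism r \<phi>)"
  by (rule hctsI, rule dc_prism[where m = m]) (auto dest: hctsD)

lemma hcts_map:
  fixes T T' :: "'g topology"
  assumes "hcts T' m \<phi>" "continuous_map T T' r"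
  shows "hcts T m (\<lambda>xs. \<phi> (map r xs))"
proof (rule hctsI)
  fix X :: "(nat \<Rightarrow> 'g) topology" and es assume es: "length es = m" "\<forall>e\<in>set es. continuous_map X T e"
  have "\<forall>e\<in>set (map (\<lambda>e. r \<circ> e) es). continuous_map X T' e"
    using es assms(2) by (auto intro: continuous_map_compose)
  then have "dc X (\<lambda>x. \<phi> (map (\<lambda>e. e x) (map (\<lambda>e. r \<circ> e) es)))"
    by (intro hctsD[OF assms(1)]) (simp_all add: es(1))
  then show "dc X (\<lambda>x. \<phi> (map r (map (\<lambda>e. e x) es)))" by (simp add: o_def)
qed

locale top_grp =
  fixes G :: "('g, 'b) monoid_scheme" (structure) and T :: "'g topology"
  assumes top_grp: "topological_group G T"
begin

lemma grp: "group G" and topspace_T: "topspace T = carrier G"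
  and cont_mult: "continuous_map (prod_topology T T) T (\<lambda>(x, y). x \<otimes> y)"
  and cont_inv: "continuous_map T T (\<lambda>x. inv x)"
  using top_grp by (auto simp: topological_group_def)

sublocale group G by (rule grp)

lemma topspace_tuples: "topspace (product_topology (\<lambda>_. T) {..<m}) = tuples G m"
  by (simp add: tuples_def topspace_T)

lemma cont_prod:
  assumes "continuous_map X T e" "continuous_map X T f"
  shows "continuous_map X T (\<lambda>x. e x \<otimes> f x)"
  using continuous_map_compose[OF continuous_map_pairedI[OF assms] cont_mult] by (simp add: o_def)

lemma cont_inverse: "continuous_map X T e \<Longrightarrow> continuous_map X T (\<lambda>x. inv (e x))"
  using continuous_map_compose[OF _ cont_inv] by (simp add: o_def)

lemma cont_proj: "l < m \<Longrightarrow> continuous_map (product_topology (\<lambda>_. T) {..<m}) T (\<lambda>g. g l)"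
  by (rule continuous_map_product_projection) simp

lemma cts_cong: "(\<And>g. g \<in> tuples G m \<Longrightarrow> f g = f' g) \<Longrightarrow> cts T m f \<longleftrightarrow> cts T m f'"
  by (rule dc_cong) (simp only: topspace_tuples)

lemma cts_shift: "cts T m f \<Longrightarrow> cts T (Suc m) (\<lambda>g. f (shift m g))"
  unfolding shift_def by (rule cts_tuple) (auto intro: cont_proj)

lemma cts_dlt:
  assumes "cts T m f"
  shows "cts T (Suc m) (dlt G m f)"
proof -
  have "cts T (Suc m) (\<lambda>g. f (fuse G m k g))" if "k < m" for k
  proof -
    have "continuous_map (product_topology (\<lambda>_. T) {..<Suc m}) T
        (\<lambda>g. if l < k then g l else if l = k then g k \<otimes> g (Suc k) else g (Suc l))" if "l < m" for l
      by (cases "l < k"; cases "l = k") (use that \<open>k < m\<close> in \<open>auto intro!: cont_prod cont_proj\<close>)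
    then show ?thesis unfolding fuse_def by (rule cts_tuple[OF assms])
  qed
  moreover have "cts T (Suc m) (\<lambda>g. f (restrict g {..<m}))"
    by (rule cts_tuple[OF assms]) (auto intro: cont_proj)
  ultimately have "cts T (Suc m) (\<lambda>g. (f (shift m g) + (\<Sum>k<m. alt (Suc k) (f (fuse G m k g)))) + alt (Suc m) (f (restrict g {..<m})))"
    by (intro dc_comp2[of _ _ _ "(+)"] dc_sum dc_comp[of _ _ "alt _"] cts_shift assms) auto
  then show ?thesis by (simp only: dlt_def[abs_def])
qed

lemma hcts_quot:
  assumes "cts T m f"
  shows "hcts T (Suc m) (\<lambda>xs. f (quot G xs))"
proof (rule hctsI)
  fix X :: "(nat \<Rightarrow> 'g) topology" and es assume es: "length es = Suc m" "\<forall>e\<in>set es. continuous_map X T e"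
  have "continuous_map X T (\<lambda>x. inv ((es ! l) x) \<otimes> (es ! Suc l) x)" if "l < m" for l
    using es that by (intro cont_prod cont_inverse) auto
  then have "dc X (\<lambda>x. f (\<lambda>l\<in>{..<m}. inv ((es ! l) x) \<otimes> (es ! Suc l) x))"
    by (rule cts_tuple[OF assms])
  moreover have "quot G (map (\<lambda>e. e x) es) = (\<lambda>l\<in>{..<m}. inv ((es ! l) x) \<otimes> (es ! Suc l) x)" for x
    using es(1) by (auto simp: quot_def fun_eq_iff)
  ultimately show "dc X (\<lambda>x. f (quot G (map (\<lambda>e. e x) es)))" by simp
qed

lemma hcts_hd:
  assumes "dc T \<theta>"
  shows "hcts T (Suc m) (\<lambda>xs. \<theta> (hd xs))"
proof (rule hctsI)
  fix X :: "(nat \<Rightarrow> 'g) topology" and es assume es: "length es = Suc m" "\<forall>e\<in>set es. continuous_map X T e"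
  then obtain e es' where [simp]: "es = e # es'" by (cases es) auto
  show "dc X (\<lambda>x. \<theta> (hd (map (\<lambda>e. e x) es)))" using dc_pull[OF _ assms, of X e] es by simp
qed

lemma cts_walk:
  assumes "hcts T (Suc m) \<phi>" "s \<in> carrier G"
  shows "cts T m (\<lambda>g. \<phi> (walk G s m g))"
proof -
  let ?X = "product_topology (\<lambda>_. T) {..<m}"
  have "continuous_map ?X T (\<lambda>g. walk G s m g ! l)" if "l < Suc m" for l
    using that
  proof (induction l)
    case 0
    have "walk G s m g ! 0 = s" for g
      by (cases m) simp_all
    then show ?case using assms(2) by (simp add: topspace_T)
  next
    case (Suc l)
    then show ?case by (simp add: walk_nth_Suc cont_prod cont_proj)
  qed
  then have "dc ?X (\<lambda>g. \<phi> (map (\<lambda>e. e g) (map (\<lambda>l g. walk G s m g ! l) [0..<Suc m])))"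
    by (intro hctsD[OF assms(1)]) (auto simp del: upt_Suc)
  moreover have "map (\<lambda>e. e g) (map (\<lambda>l g. walk G s m g ! l) [0..<Suc m]) = walk G s m g" for g
    by (intro nth_equalityI) (simp_all del: upt_Suc)
  ultimately show ?thesis by simp
qed

end

section \<open>Continuous cochains with values in a presented module\<close>

text \<open>The inhomogeneous coboundary for the action \<open>\<rho>\<close>. It differs from the one for the trivial action in the
  first face only.\<close>

definition tdlt :: "('g, 'b) monoid_scheme \<Rightarrow> ('g \<Rightarrow> 'a \<Rightarrow> 'a) \<Rightarrow> nat \<Rightarrow> ((nat \<Rightarrow> 'g) \<Rightarrow> 'a::ab_group_add) \<Rightarrow> (nat \<Rightarrow> 'g) \<Rightarrow> 'a" where
  "tdlt G \<rho> m f g = dlt G m f g + (\<rho> (g 0) (f (shift m g)) - f (shift m g))"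

text \<open>A discrete module \<open>N\<close>, written multiplicatively, that is presented by a surjection \<open>\<phi>\<close> from a set \<open>S\<close>
  of elements of an additive group, closed under the operations and under an action \<open>\<rho>\<close>. Cochains with
  values in \<open>N\<close> can then be computed with additively. The kernel of \<open>\<phi>\<close> need not be trivial, so this covers
  quotient modules.\<close>

locale pmod = top_grp G T for G :: "('g, 'b) monoid_scheme" (structure) and T +
  fixes N :: "('g, 'c) gmodule" and S :: "'a::ab_group_add set" and \<rho> :: "'g \<Rightarrow> 'a \<Rightarrow> 'a" and \<phi> :: "'a \<Rightarrow> 'c"
  assumes N_comm: "comm_group N"
    and S_0: "0 \<in> S" and S_add: "x \<in> S \<Longrightarrow> y \<in> S \<Longrightarrow> x + y \<in> S" and S_minus: "x \<in> S \<Longrightarrow> - x \<in> S"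
    and phi_onto: "\<phi> ` S = carrier N"
    and phi_add: "x \<in> S \<Longrightarrow> y \<in> S \<Longrightarrow> \<phi> (x + y) = \<phi> x \<otimes>\<^bsub>N\<^esub> \<phi> y"
    and act_phi: "\<gamma> \<in> carrier G \<Longrightarrow> x \<in> S \<Longrightarrow> act N \<gamma> (\<phi> x) = \<phi> (\<rho> \<gamma> x)"
    and rho_in: "\<gamma> \<in> carrier G \<Longrightarrow> x \<in> S \<Longrightarrow> \<rho> \<gamma> x \<in> S"
    and rho_add: "\<gamma> \<in> carrier G \<Longrightarrow> x \<in> S \<Longrightarrow> y \<in> S \<Longrightarrow> \<rho> \<gamma> (x + y) = \<rho> \<gamma> x + \<rho> \<gamma> y"
    and rho_dc: "dc T \<rho>"
begin

sublocale N: comm_group N by (rule N_comm)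

lemma S_diff: "x \<in> S \<Longrightarrow> y \<in> S \<Longrightarrow> x - y \<in> S"
  using S_add[of x "- y"] S_minus[of y] by simp

lemma S_alt: "x \<in> S \<Longrightarrow> alt k x \<in> S" by (simp add: alt_def S_minus)

lemma S_sum: "(\<And>i. i \<in> A \<Longrightarrow> f i \<in> S) \<Longrightarrow> sum f A \<in> S"
  by (induction A rule: infinite_finite_induct) (auto simp: S_0 S_add)

lemma phi_in: "x \<in> S \<Longrightarrow> \<phi> x \<in> carrier N" using phi_onto by auto

lemma phi_0: "\<phi> 0 = \<one>\<^bsub>N\<^esub>"
  using phi_add[OF S_0 S_0] phi_in[OF S_0] by (simp add: N.l_cancel_one')

lemma phi_minus: "x \<in> S \<Longrightarrow> \<phi> (- x) = inv\<^bsub>N\<^esub> \<phi> x"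
  using phi_add[of "- x" x] by (simp add: phi_0 N.inv_equality phi_in S_minus)

lemma phi_alt: "x \<in> S \<Longrightarrow> \<phi> (alt k x) = \<phi> x [^]\<^bsub>N\<^esub> ((- 1) ^ k :: int)"
  using N.int_pow_neg[OF phi_in, of x 1] by (simp add: alt_def phi_minus phi_in)

lemma phi_sum: "finite A \<Longrightarrow> (\<And>i. i \<in> A \<Longrightarrow> f i \<in> S) \<Longrightarrow> \<phi> (sum f A) = finprod N (\<lambda>i. \<phi> (f i)) A"
proof (induction A rule: finite_induct)
  case (insert x A)
  then show ?case by (simp add: phi_add S_sum N.finprod_insert phi_in Pi_def)
qed (simp add: phi_0)

text \<open>Cochains with values in \<open>S\<close>, and the cochains with values in \<open>N\<close> presented by them.\<close>

definition pc :: "nat \<Rightarrow> ((nat \<Rightarrow> 'g) \<Rightarrow> 'a) set" where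
  "pc m = {f. cts T m f \<and> (\<forall>h \<in> tuples G m. f h \<in> S)}"

abbreviation cm :: "nat \<Rightarrow> ((nat \<Rightarrow> 'g) \<Rightarrow> 'a) \<Rightarrow> (nat \<Rightarrow> 'g) \<Rightarrow> 'c" where
  "cm m f \<equiv> cochain_map G m \<phi> f"

lemma dlt_in: "f \<in> pc m \<Longrightarrow> g \<in> tuples G (Suc m) \<Longrightarrow> dlt G m f g \<in> S"
  unfolding dlt_def pc_def by (intro S_add S_sum S_alt) (auto simp: grp)

lemma tdlt_in: "f \<in> pc m \<Longrightarrow> g \<in> tuples G (Suc m) \<Longrightarrow> tdlt G \<rho> m f g \<in> S"
  unfolding tdlt_def by (intro S_add S_diff rho_in dlt_in) (auto simp: pc_def dest: tuplesD)

lemma cts_tdlt: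
  assumes "cts T m f"
  shows "cts T (Suc m) (tdlt G \<rho> m f)"
proof -
  have "cts T (Suc m) (\<lambda>g. \<rho> (g 0))"
    by (rule dc_pull[OF cont_proj rho_dc]) simp
  then have "cts T (Suc m) (\<lambda>g. \<rho> (g 0) (f (shift m g)) - f (shift m g))"
    by (rule dc_comp2[of _ _ _ "\<lambda>r x. r x - x"]) (rule cts_shift[OF assms])
  from dc_comp2[OF cts_dlt[OF assms] this, of "(+)"] show ?thesis
    unfolding tdlt_def[abs_def] .
qed

lemma tdlt_pc: "f \<in> pc m \<Longrightarrow> tdlt G \<rho> m f \<in> pc (Suc m)"
  using cts_tdlt tdlt_in by (auto simp: pc_def)

lemma tdlt_add:
  assumes "f \<in> pc m" "f' \<in> pc m" "g \<in> tuples G (Suc m)"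
  shows "tdlt G \<rho> m (\<lambda>h. f h + f' h) g = tdlt G \<rho> m f g + tdlt G \<rho> m f' g"
proof -
  have "\<rho> (g 0) (f (shift m g) + f' (shift m g)) = \<rho> (g 0) (f (shift m g)) + \<rho> (g 0) (f' (shift m g))"
    using assms by (intro rho_add) (auto simp: pc_def dest: tuplesD)
  then show ?thesis by (simp add: tdlt_def dlt_add)
qed

lemma pc_add: "f \<in> pc m \<Longrightarrow> f' \<in> pc m \<Longrightarrow> (\<lambda>h. f h + f' h) \<in> pc m"
  unfolding pc_def using dc_comp2[of "product_topology (\<lambda>_. T) {..<m}" f f' "(+)"] by (auto intro: S_add)

lemma pc_minus: "f \<in> pc m \<Longrightarrow> (\<lambda>h. - f h) \<in> pc m"
  unfolding pc_def using dc_comp[of "product_topology (\<lambda>_. T) {..<m}" f "uminus"] by (auto intro: S_minus)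

lemma pc_0: "(\<lambda>h. 0) \<in> pc m"
  unfolding pc_def by (simp add: S_0)

lemma rho_0: "\<gamma> \<in> carrier G \<Longrightarrow> \<rho> \<gamma> 0 = 0"
  using rho_add[of \<gamma> 0 0] S_0 by simp

lemma rho_minus: "\<gamma> \<in> carrier G \<Longrightarrow> x \<in> S \<Longrightarrow> \<rho> \<gamma> (- x) = - \<rho> \<gamma> x"
  using rho_add[of \<gamma> x "- x"] S_minus[of x] by (simp add: rho_0 eq_neg_iff_add_eq_0 add.commute)

lemma tdlt_minus:
  assumes "f \<in> pc m" "g \<in> tuples G (Suc m)"
  shows "tdlt G \<rho> m (\<lambda>h. - f h) g = - tdlt G \<rho> m f g"
proof -
  have "\<rho> (g 0) (- f (shift m g)) = - \<rho> (g 0) (f (shift m g))"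
    using assms by (intro rho_minus) (auto simp: pc_def dest: tuplesD)
  then show ?thesis by (simp add: tdlt_def dlt_minus)
qed

lemma tdlt_0: "g \<in> tuples G (Suc m) \<Longrightarrow> tdlt G \<rho> m (\<lambda>h. 0) g = 0"
  by (simp add: tdlt_def rho_0 tuplesD)

lemma cm_cong: "(\<And>g. g \<in> tuples G m \<Longrightarrow> \<phi> (f g) = \<phi> (f' g)) \<Longrightarrow> cm m f = cm m f'"
  by (auto simp: cochain_map_def fun_eq_iff)

text \<open>Representatives in \<open>S\<close> can be chosen as a function of the value, which preserves continuity.\<close>

lemma cochains_eq: "cochains G T N m = cm m ` pc m"
proof (intro equalityI subsetI)
  fix F assume F: "F \<in> cochains G T N m"
  let ?f = "\<lambda>g. inv_into S \<phi> (F g)"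
  have Fc: "continuous_map (product_topology (\<lambda>_. T) {..<m}) (discrete_topology (carrier N)) F"
    using F by (simp add: cochains_def)
  have Fin: "F g \<in> carrier N" if "g \<in> tuples G m" for g
    using continuous_map_image_subset_topspace[OF Fc] that by (auto simp: topspace_tuples simp del: topspace_product_topology)
  have "continuous_map (discrete_topology (carrier N)) (discrete_topology UNIV) (\<lambda>x. x)" by simp
  from continuous_map_compose[OF Fc this] have "cts T m F" by (simp add: o_def)
  then have "cts T m ?f" by (rule dc_comp)
  then have "?f \<in> pc m" using Fin by (auto simp: pc_def inv_into_into phi_onto)
  moreover have "F = cm m ?f"
  proof
    fix g
    show "F g = cm m ?f g"
    proof (cases "g \<in> tuples G m")
      case True
      then show ?thesis using Fin by (simp add: cochain_map_def f_inv_into_f phi_onto)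
    next
      case False
      then show ?thesis using F by (simp add: cochains_def cochain_map_def extensional_def)
    qed
  qed
  ultimately show "F \<in> cm m ` pc m" by blast
next
  fix F assume "F \<in> cm m ` pc m"
  then obtain f where f: "f \<in> pc m" "F = cm m f" by blast
  have "cts T m F"
    using dc_comp[of "product_topology (\<lambda>_. T) {..<m}" f \<phi>] f cts_cong[of m F "\<lambda>g. \<phi> (f g)"]
    by (simp add: pc_def cochain_map_def)
  moreover have "F g \<in> carrier N" if "g \<in> tuples G m" for g
    using f that by (simp add: pc_def cochain_map_def phi_in)
  ultimately have "continuous_map (product_topology (\<lambda>_. T) {..<m}) (discrete_topology (carrier N)) F"
    unfolding continuous_map_def by (auto simp: topspace_tuples Pi_def simp del: topspace_product_topology)
  then show "F \<in> cochains G T N m"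
    unfolding cochains_def f(2) by (auto simp: cochain_map_def)
qed

lemma cm_cochain: "f \<in> pc m \<Longrightarrow> cm m f \<in> cochains G T N m" by (auto simp: cochains_eq)

lemma coboundary_eq:
  assumes "f \<in> pc m"
  shows "coboundary G N m (cm m f) = cm (Suc m) (tdlt G \<rho> m f)"
proof
  fix g
  show "coboundary G N m (cm m f) g = cm (Suc m) (tdlt G \<rho> m f) g"
  proof (cases "g \<in> tuples G (Suc m)")
    case True
    have f: "f h \<in> S" if "h \<in> tuples G m" for h using assms that by (simp add: pc_def)
    have sh: "(\<lambda>l\<in>{..<m}. g (Suc l)) = shift m g" by (simp add: shift_def)
    have fu: "(\<lambda>l\<in>{..<m}. if l < k then g l else if l = k then g k \<otimes> g (Suc k) else g (Suc l)) = fuse G m k g" for k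
      by (simp add: fuse_def)
    have "coboundary G N m (cm m f) g =
      act N (g 0) (\<phi> (f (shift m g))) \<otimes>\<^bsub>N\<^esub> finprod N (\<lambda>k. \<phi> (f (fuse G m k g)) [^]\<^bsub>N\<^esub> ((- 1) ^ Suc k :: int)) {..<m}
        \<otimes>\<^bsub>N\<^esub> \<phi> (f (restrict g {..<m})) [^]\<^bsub>N\<^esub> ((- 1) ^ Suc m :: int)"
      unfolding coboundary_def using True by (simp only: sh fu restrict_apply' cochain_map_def fuse_tuples[OF grp] shift_tuples restrict_tuples)
    also have "\<dots> = \<phi> (\<rho> (g 0) (f (shift m g))) \<otimes>\<^bsub>N\<^esub> \<phi> (\<Sum>k<m. alt (Suc k) (f (fuse G m k g)))
        \<otimes>\<^bsub>N\<^esub> \<phi> (alt (Suc m) (f (restrict g {..<m})))"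
      using True by (simp only: act_phi f phi_alt[symmetric] phi_sum[symmetric] S_alt fuse_tuples[OF grp] shift_tuples
          restrict_tuples tuplesD[OF _ zero_less_Suc] finite_lessThan)
    also have "\<dots> = \<phi> (\<rho> (g 0) (f (shift m g)) + (\<Sum>k<m. alt (Suc k) (f (fuse G m k g))) + alt (Suc m) (f (restrict g {..<m})))"
    proof -
      have "\<rho> (g 0) (f (shift m g)) \<in> S" "(\<Sum>k<m. alt (Suc k) (f (fuse G m k g))) \<in> S" "alt (Suc m) (f (restrict g {..<m})) \<in> S"
        using True by (auto intro!: rho_in f S_sum S_alt fuse_tuples grp simp: tuplesD simp del: alt_simps)
      then show ?thesis by (simp only: phi_add S_add)
    qed
    also have "\<dots> = \<phi> (tdlt G \<rho> m f g)" by (simp add: tdlt_def dlt_def algebra_simps)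
    finally show ?thesis using True by (simp add: cochain_map_def)
  qed (simp add: coboundary_def cochain_map_def)
qed

text \<open>The presented coboundaries. In degree 0 there is only the zero cochain.\<close>

definition bd :: "nat \<Rightarrow> ((nat \<Rightarrow> 'g) \<Rightarrow> 'a) set" where
  "bd m = (case m of 0 \<Rightarrow> {\<lambda>_. 0} | Suc k \<Rightarrow> {b. \<exists>e \<in> pc k. b \<in> pc m \<and> (\<forall>g \<in> tuples G m. b g = tdlt G \<rho> k e g)})"

lemma bd_pc: "b \<in> bd m \<Longrightarrow> b \<in> pc m"
  by (cases m) (auto simp: bd_def pc_0)

lemma bd_0: "(\<lambda>_. 0) \<in> bd m"
  by (cases m) (auto simp: bd_def pc_0 tdlt_0 intro!: bexI[of _ "\<lambda>_. 0"])

lemma bd_add: "b \<in> bd m \<Longrightarrow> b' \<in> bd m \<Longrightarrow> (\<lambda>g. b g + b' g) \<in> bd m"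
proof (cases m)
  case (Suc k)
  assume "b \<in> bd m" "b' \<in> bd m"
  then obtain e e' where "e \<in> pc k" "e' \<in> pc k" "b \<in> pc m" "b' \<in> pc m" 
    "\<forall>g \<in> tuples G m. b g = tdlt G \<rho> k e g" "\<forall>g \<in> tuples G m. b' g = tdlt G \<rho> k e' g"
    unfolding bd_def Suc by auto
  then show ?thesis unfolding bd_def Suc
    by (auto simp: pc_add tdlt_add intro!: bexI[of _ "\<lambda>h. e h + e' h"])
qed (simp add: bd_def)

lemma bd_minus: "b \<in> bd m \<Longrightarrow> (\<lambda>g. - b g) \<in> bd m"
proof (cases m)
  case (Suc k)
  assume "b \<in> bd m"
  then obtain e where "e \<in> pc k" "b \<in> pc m" "\<forall>g \<in> tuples G m. b g = tdlt G \<rho> k e g"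
    unfolding bd_def Suc by auto
  then show ?thesis unfolding bd_def Suc
    by (auto simp: pc_minus tdlt_minus intro!: bexI[of _ "\<lambda>h. - e h"])
qed (simp add: bd_def)

lemma coboundaries_eq: "coboundaries G T N m = cm m ` bd m"
proof (cases m)
  case 0
  then show ?thesis
    by (auto simp: coboundaries_def cochain_group_def bd_def cochain_map_def phi_0)
next
  case (Suc k)
  show ?thesis
  proof (intro equalityI subsetI)
    fix F assume "F \<in> coboundaries G T N m"
    then obtain e where e: "e \<in> pc k" "F = coboundary G N k (cm k e)"
      by (auto simp: coboundaries_def Suc cochains_eq)
    then have "F = cm m (tdlt G \<rho> k e)" by (simp add: coboundary_eq Suc)
    moreover have "tdlt G \<rho> k e \<in> bd m" using e(1) tdlt_pc[OF e(1)] by (auto simp: bd_def Suc)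
    ultimately show "F \<in> cm m ` bd m" by blast
  next
    fix F assume "F \<in> cm m ` bd m"
    then obtain b e where e: "F = cm m b" "e \<in> pc k" "\<forall>g \<in> tuples G m. b g = tdlt G \<rho> k e g"
      by (auto simp: bd_def Suc)
    have "F = coboundary G N k (cm k e)"
      unfolding e(1) coboundary_eq[OF e(2)] Suc by (rule cm_cong) (use e(3) Suc in simp)
    then show "F \<in> coboundaries G T N m" using e(2) by (auto simp: coboundaries_def Suc cochains_eq)
  qed
qed

lemma cochain_mult:
  assumes "f \<in> pc m" "f' \<in> pc m"
  shows "cm m f \<otimes>\<^bsub>cochain_group G T N m\<^esub> cm m f' = cm m (\<lambda>g. f g + f' g)"
  using assms by (auto simp: cochain_group_def cochain_map_def fun_eq_iff phi_add pc_def)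

text \<open>A cohomology class is literally the coset of its representing cocycles.\<close>

lemma class_eq:
  assumes "z \<in> pc m"
  shows "cohomology_class G T N m (cm m z) = {cm m (\<lambda>g. b g + z g) | b. b \<in> bd m}"
  unfolding cohomology_class_def r_coset_def coboundaries_eq
  by (auto simp: cochain_mult[OF bd_pc assms])

lemma class_self: "z \<in> pc m \<Longrightarrow> cm m z \<in> cohomology_class G T N m (cm m z)"
  by (subst class_eq, assumption, intro CollectI exI[of _ "\<lambda>_. 0"] conjI) (simp_all add: bd_0)

lemma class_cong:
  assumes "z \<in> pc m" "z' \<in> pc m" "b \<in> bd m" "\<And>g. g \<in> tuples G m \<Longrightarrow> \<phi> (z g) = \<phi> (b g + z' g)"
  shows "cohomology_class G T N m (cm m z) = cohomology_class G T N m (cm m z')"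
proof -
  have z: "cm m z = cm m (\<lambda>g. b g + z' g)" using assms(4) by (rule cm_cong)
  have bz: "(\<lambda>g. b g + z' g) \<in> pc m" using assms bd_pc pc_add by blast
  show ?thesis
    unfolding z class_eq[OF bz] class_eq[OF assms(2)]
  proof (intro equalityI subsetI)
    fix F assume "F \<in> {cm m (\<lambda>g. ba g + (b g + z' g)) |ba. ba \<in> bd m}"
    then obtain ba where "F = cm m (\<lambda>g. (ba g + b g) + z' g)" "ba \<in> bd m" by (auto simp: add.assoc)
    then show "F \<in> {cm m (\<lambda>g. b g + z' g) |b. b \<in> bd m}"
      using bd_add[OF _ assms(3)] by (intro CollectI exI[of _ "\<lambda>g. ba g + b g"] conjI)
  next
    fix F assume "F \<in> {cm m (\<lambda>g. b g + z' g) |b. b \<in> bd m}"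
    then obtain ba where ba: "F = cm m (\<lambda>g. ba g + z' g)" "ba \<in> bd m" by auto
    have "F = cm m (\<lambda>g. (ba g + - b g) + (b g + z' g))" unfolding ba(1) by (simp add: algebra_simps)
    then show "F \<in> {cm m (\<lambda>g. ba g + (b g + z' g)) |ba. ba \<in> bd m}"
      using bd_add[OF ba(2) bd_minus[OF assms(3)]] by (intro CollectI exI[of _ "\<lambda>g. ba g + - b g"] conjI)
  qed
qed

lemma class_eqD:
  assumes "z \<in> pc m" "z' \<in> pc m" "cohomology_class G T N m (cm m z) = cohomology_class G T N m (cm m z')"
  obtains b where "b \<in> bd m" "\<And>g. g \<in> tuples G m \<Longrightarrow> \<phi> (z g) = \<phi> (b g + z' g)"
proof -
  have "cm m z \<in> cohomology_class G T N m (cm m z')" using class_self[OF assms(1)] assms(3) by simp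
  then obtain b where b: "b \<in> bd m" "cm m z = cm m (\<lambda>g. b g + z' g)" unfolding class_eq[OF assms(2)] by auto
  have "\<phi> (z g) = \<phi> (b g + z' g)" if "g \<in> tuples G m" for g
    using that fun_cong[OF b(2), of g] by (simp add: cochain_map_def)
  with b(1) show thesis by (rule that)
qed

lemma cocycle_iff:
  assumes "f \<in> pc m"
  shows "cm m f \<in> cocycles G T N m \<longleftrightarrow> (\<forall>g \<in> tuples G (Suc m). \<phi> (tdlt G \<rho> m f g) = \<one>\<^bsub>N\<^esub>)"
proof -
  have "cm m f \<in> cocycles G T N m \<longleftrightarrow>
      cm (Suc m) (tdlt G \<rho> m f) = (\<lambda>g \<in> tuples G (Suc m). \<one>\<^bsub>N\<^esub>)"
    unfolding cocycles_def mem_Collect_eq coboundary_eq[OF assms]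
    by (simp add: cm_cochain[OF assms] cochain_group_def)
  then show ?thesis by (auto simp: cochain_map_def fun_eq_iff)
qed

lemma carrier_cohomology:
  "carrier (cohomology G T N m) = {cohomology_class G T N m z | z. z \<in> cocycles G T N m}"
  unfolding cohomology_def FactGroup_def RCOSETS_def cohomology_class_def r_coset_def by (auto simp: cochain_group_def)

end

text \<open>Functoriality in the coefficients.\<close>

lemma cohomology_map_class:
  assumes M: "pmod G T N S \<rho> \<phi>" and M': "pmod G T N' S' \<rho>' \<phi>'"
    and psi: "\<And>x. x \<in> S \<Longrightarrow> \<psi> (\<phi> x) = \<phi>' (\<psi>0 x)" "\<And>x. x \<in> S \<Longrightarrow> \<psi>0 x \<in> S'"
      "\<And>x y. x \<in> S \<Longrightarrow> y \<in> S \<Longrightarrow> \<psi>0 (x + y) = \<psi>0 x + \<psi>0 y"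
      "\<And>\<gamma> x. \<gamma> \<in> carrier G \<Longrightarrow> x \<in> S \<Longrightarrow> \<psi>0 (\<rho> \<gamma> x) = \<rho>' \<gamma> (\<psi>0 x)"
    and z: "z \<in> pmod.pc G T S m"
  shows "cohomology_map G T N' m \<psi> (cohomology_class G T N m (cochain_map G m \<phi> z)) =
    cohomology_class G T N' m (cochain_map G m \<phi>' (\<lambda>g. \<psi>0 (z g)))"
proof -
  interpret M: pmod G T N S \<rho> \<phi> by fact
  interpret M': pmod G T N' S' \<rho>' \<phi>' by fact
  have psi_0: "\<psi>0 0 = 0" using psi(3)[OF M.S_0 M.S_0] by simp
  have psi_minus: "\<psi>0 (- x) = - \<psi>0 x" if "x \<in> S" for x
    using psi(3)[OF that M.S_minus[OF that]] psi_0 by (simp add: eq_neg_iff_add_eq_0 add.commute)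
  have psi_alt: "\<psi>0 (alt k x) = alt k (\<psi>0 x)" if "x \<in> S" for k x
    using that by (simp add: alt_def psi_minus)
  have psi_sum: "\<psi>0 (\<Sum>k<n. f k) = (\<Sum>k<n. \<psi>0 (f k))" if "\<And>k. k < n \<Longrightarrow> f k \<in> S" for f and n :: nat
    using that
  proof (induction n)
    case (Suc n)
    have "sum f {..<n} \<in> S" "f n \<in> S" using Suc.prems by (auto intro: M.S_sum)
    then show ?case using Suc by (simp add: psi(3))
  qed (simp add: psi_0)
  have pcp: "(\<lambda>g. \<psi>0 (f g)) \<in> M'.pc n" if "f \<in> M.pc n" for f n
    using that psi(2) dc_comp[of _ f \<psi>0] by (auto simp: M.pc_def M'.pc_def)
  have tdlt_psi: "\<psi>0 (tdlt G \<rho> n f g) = tdlt G \<rho>' n (\<lambda>h. \<psi>0 (f h)) g"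
    if f: "f \<in> M.pc n" and g: "g \<in> tuples G (Suc n)" for f n g
  proof -
    have fS: "f h \<in> S" if "h \<in> tuples G n" for h using f that by (simp add: M.pc_def)
    note S = fS[OF shift_tuples[OF g]] fS[OF restrict_tuples[OF g]] fS[OF fuse_tuples[OF M.grp g]]
    have "tdlt G \<rho> n f g = \<rho> (g 0) (f (shift n g)) + ((\<Sum>k<n. alt (Suc k) (f (fuse G n k g))) + alt (Suc n) (f (restrict g {..<n})))"
      by (simp add: tdlt_def dlt_def)
    moreover have "\<psi>0 \<dots> = \<psi>0 (\<rho> (g 0) (f (shift n g))) + (\<psi>0 (\<Sum>k<n. alt (Suc k) (f (fuse G n k g))) + \<psi>0 (alt (Suc n) (f (restrict g {..<n}))))"
      by (subst psi(3) psi(3), (intro M.S_add M.rho_in M.S_sum M.S_alt S tuplesD[OF g zero_less_Suc])+)+ simp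
    moreover have "\<psi>0 (\<rho> (g 0) (f (shift n g))) = \<rho>' (g 0) (\<psi>0 (f (shift n g)))"
      using psi(4) tuplesD[OF g] S by simp
    ultimately show ?thesis
      using S by (simp add: psi_sum psi_alt M.S_alt del: alt_simps) (simp add: tdlt_def dlt_def)
  qed
  have bdp: "(\<lambda>g. \<psi>0 (b g)) \<in> M'.bd m" if bb: "b \<in> M.bd m" for b
  proof (cases m)
    case (Suc k)
    obtain e where e: "e \<in> M.pc k" "b \<in> M.pc m" "\<forall>g \<in> tuples G m. b g = tdlt G \<rho> k e g"
      using bb unfolding M.bd_def Suc by auto
    then show ?thesis unfolding M'.bd_def Suc
      using pcp[OF e(1)] pcp[OF e(2)] by (auto simp: tdlt_psi Suc intro!: bexI[of _ "\<lambda>h. \<psi>0 (e h)"])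
  qed (use bb in \<open>simp add: M.bd_def M'.bd_def psi_0\<close>)
  have *: "cohomology_class G T N' m (cochain_map G m \<psi> (cochain_map G m \<phi> (\<lambda>g. b g + z g)))
      = cohomology_class G T N' m (cochain_map G m \<phi>' (\<lambda>g. \<psi>0 (z g)))" if "b \<in> M.bd m" for b
  proof -
    have bz: "(\<lambda>g. b g + z g) \<in> M.pc m" using M.bd_pc[OF that] z M.pc_add by blast
    have "cochain_map G m \<psi> (cochain_map G m \<phi> (\<lambda>g. b g + z g)) = cochain_map G m \<phi>' (\<lambda>g. \<psi>0 (b g + z g))"
      using bz by (auto simp: cochain_map_def fun_eq_iff M.pc_def psi(1))
    moreover have "cohomology_class G T N' m (cochain_map G m \<phi>' (\<lambda>g. \<psi>0 (b g + z g))) = cohomology_class G T N' m (cochain_map G m \<phi>' (\<lambda>g. \<psi>0 (z g)))"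
      using M.bd_pc[OF that] z by (intro M'.class_cong[OF pcp[OF bz] pcp[OF z] bdp[OF that]]) (simp add: M.pc_def psi(3))
    ultimately show ?thesis by simp
  qed
  show ?thesis
    unfolding cohomology_map_def
  proof (rule the_equality)
    show "\<exists>y\<in>cohomology_class G T N m (cochain_map G m \<phi> z).
        cohomology_class G T N' m (cochain_map G m \<phi>' (\<lambda>g. \<psi>0 (z g))) = cohomology_class G T N' m (cochain_map G m \<psi> y)"
      using *[OF M.bd_0] M.class_self[OF z] by (intro bexI[of _ "cochain_map G m \<phi> z"]) simp_all
  next
    fix Y assume "\<exists>y\<in>cohomology_class G T N m (cochain_map G m \<phi> z). Y = cohomology_class G T N' m (cochain_map G m \<psi> y)"
    then obtain b where "b \<in> M.bd m" "Y = cohomology_class G T N' m (cochain_map G m \<psi> (cochain_map G m \<phi> (\<lambda>g. b g + z g)))"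
      unfolding M.class_eq[OF z] by auto
    then show "Y = cohomology_class G T N' m (cochain_map G m \<phi>' (\<lambda>g. \<psi>0 (z g)))" using * by simp
  qed
qed

section \<open>Reduction from \<open>\<int>/9\<int>\<close> to \<open>\<int>/3\<int>\<close>\<close>

text \<open>The reduction \<open>\<int>/9 \<rightarrow> \<int>/3\<close>, its section \<open>lft\<close> with values \<open>0, 1, 2\<close>, and the embedding
  \<open>emb : \<int>/3 \<rightarrow> \<int>/9\<close>, \<open>x \<mapsto> 3x\<close>, whose image is the kernel of the reduction.\<close>

abbreviation red :: "9 \<Rightarrow> 3" where "red \<equiv> reduction_9_3"

definition lft :: "3 \<Rightarrow> 9" where "lft x = of_int (Rep_bit1 x)"

definition emb :: "3 \<Rightarrow> 9" where "emb x = 3 * lft x"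

lemma of_int_Rep_9: "of_int (Rep_bit1 (t :: 9)) = t"
proof -
  have "(of_int (Rep_bit1 t) :: 9) = Abs_bit1 (Rep_bit1 t mod int CARD(9))"
    by (simp add: bit1.of_int_eq)
  also have "Rep_bit1 t mod int CARD(9) = Rep_bit1 t"
    using bit1.Rep_mod[of t] by simp
  finally show ?thesis by (simp add: Rep_bit1_inverse)
qed

lemma ex_int_9: "\<exists>k. (t :: 9) = of_int k" by (metis of_int_Rep_9)
lemma ex_int_3: "\<exists>k. (t :: 3) = of_int k" by (metis of_int_Rep_3)

lemma of_int_9_eq_0: "(of_int k :: 9) = 0 \<longleftrightarrow> 9 dvd k"
proof -
  have "(of_int k :: 9) = Abs_bit1' k" by (simp add: bit1.of_int_eq Abs_bit1'_def)
  moreover have "Rep_bit1 (Abs_bit1' k :: 9) = k mod 9" using bit1.Rep_Abs_mod[where 'a = "4", of k] by (simp add: Abs_bit1'_def)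
  moreover have "Rep_bit1 (0 :: 9) = 0" by (rule bit1.Rep_0)
  ultimately show ?thesis by (metis bit1.Rep_inject_sym dvd_eq_mod_eq_0)
qed

lemma of_int_9_eq: "(of_int k :: 9) = of_int l \<longleftrightarrow> 9 dvd k - l"
  using of_int_9_eq_0[of "k - l"] by simp

lemma of_int_3_eq: "(of_int k :: 3) = of_int l \<longleftrightarrow> 3 dvd k - l"
  using of_int_3_eq_0[of "k - l"] by simp

lemma red_of_int: "red (of_int k) = of_int k"
proof -
  have "9 dvd Rep_bit1 (of_int k :: 9) - k" using of_int_Rep_9[of "of_int k"] by (simp only: of_int_9_eq)
  then have "3 dvd Rep_bit1 (of_int k :: 9) - k" using dvd_trans[of "3 :: int" 9] by simp
  then show ?thesis by (simp only: reduction_9_3_def of_int_3_eq)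
qed

lemma red_add: "red (x + y) = red x + red y"
  using ex_int_9[of x] ex_int_9[of y] by (metis of_int_add red_of_int)
lemma red_mult: "red (x * y) = red x * red y"
  using ex_int_9[of x] ex_int_9[of y] by (metis of_int_mult red_of_int)
lemma red_minus: "red (- x) = - red x"
  using ex_int_9[of x] by (metis of_int_minus red_of_int)
lemma red_diff: "red (x - y) = red x - red y"
  using red_add[of x "- y"] by (simp add: red_minus)
lemma red_0 [simp]: "red 0 = 0" using red_of_int[of 0] by simp
lemma red_sum: "red (sum f A) = (\<Sum>i\<in>A. red (f i))"
  by (induction A rule: infinite_finite_induct) (simp_all add: red_add)

lemma red_lft [simp]: "red (lft x) = x" by (simp add: lft_def red_of_int of_int_Rep_3)

lemma emb_of_int: "emb (of_int k) = 3 * of_int k"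
proof -
  have "3 dvd Rep_bit1 (of_int k :: 3) - k" using of_int_Rep_3[of "of_int k"] by (simp only: of_int_3_eq)
  then have "(of_int (3 * Rep_bit1 (of_int k :: 3)) :: 9) = of_int (3 * k)" unfolding of_int_9_eq by presburger
  then show ?thesis by (simp add: emb_def lft_def)
qed

lemma emb_add: "emb (x + y) = emb x + emb y"
  using ex_int_3[of x] ex_int_3[of y] by (metis of_int_add emb_of_int distrib_left)
lemma emb_0 [simp]: "emb 0 = 0" using emb_of_int[of 0] by simp
lemma emb_minus: "emb (- x) = - emb x"
  using emb_add[of x "- x"] by (simp add: eq_neg_iff_add_eq_0 add.commute)
lemma emb_diff: "emb (x - y) = emb x - emb y"
  using emb_add[of x "- y"] by (simp add: emb_minus)
lemma emb_sum: "emb (sum f A) = (\<Sum>i\<in>A. emb (f i))"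
  by (induction A rule: infinite_finite_induct) (simp_all add: emb_add)

lemma emb_red: "emb (red y) = 3 * y"
  using ex_int_9[of y] by (metis red_of_int emb_of_int)

lemma mult_emb: "y * emb x = emb (red y * x)"
  using ex_int_9[of y] ex_int_3[of x] by (metis red_of_int emb_of_int of_int_mult mult.left_commute)

lemma emb_inject: "emb x = emb y \<longleftrightarrow> x = y"
proof
  assume *: "emb x = emb y"
  obtain k l where kl: "x = of_int k" "y = of_int l" using ex_int_3 by metis
  then have "(of_int (3 * k) :: 9) = of_int (3 * l)" using * by (simp add: emb_of_int)
  then have "3 dvd k - l" unfolding of_int_9_eq by presburger
  then show "x = y" by (simp add: kl of_int_3_eq)
qed simp

lemma red_eq_0: "red y = 0 \<Longrightarrow> \<exists>x. y = emb x"
proof -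
  assume *: "red y = 0"
  obtain k where k: "y = of_int k" using ex_int_9 by blast
  then have "3 dvd k" using * by (simp add: red_of_int of_int_3_eq_0)
  then obtain l where "k = 3 * l" ..
  then have "y = emb (of_int l)" using k by (simp add: emb_of_int)
  then show ?thesis ..
qed

text \<open>Division by 3 of a multiple of 3 in \<open>\<int>/9\<close>.\<close>

definition unemb :: "9 \<Rightarrow> 3" where "unemb y = (SOME x. y = emb x)"

lemma emb_unemb: "red y = 0 \<Longrightarrow> emb (unemb y) = y"
  unfolding unemb_def by (rule sym, rule someI_ex, rule red_eq_0)

section \<open>Trivial coefficients and liftable cocycles\<close>

lemma group_hom_dh: assumes "\<And>x y. F (x + y) = F x + F y" shows "F (dh \<phi> xs) = dh (\<lambda>ys. F (\<phi> ys)) xs"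
proof -
  have 0: "F 0 = 0" using assms[of 0 0] by simp
  have "F (x - y) = F x - F y" for x y using assms[of "x - y" y] by (simp add: algebra_simps)
  then show ?thesis by (induction xs arbitrary: \<phi>) (simp_all add: 0)
qed

text \<open>Continuous cocycles with trivial coefficients, without the condition to be extensional.\<close>

definition coc :: "('g, 'b) monoid_scheme \<Rightarrow> 'g topology \<Rightarrow> nat \<Rightarrow> ((nat \<Rightarrow> 'g) \<Rightarrow> 'r::ab_group_add) \<Rightarrow> bool" where
  "coc G T m f \<longleftrightarrow> cts T m f \<and> (\<forall>g \<in> tuples G (Suc m). dlt G m f g = 0)"

lemma coc_cts: "coc G T m f \<Longrightarrow> cts T m f"
  and cocD: "coc G T m f \<Longrightarrow> g \<in> tuples G (Suc m) \<Longrightarrow> dlt G m f g = 0"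
  by (simp_all add: coc_def)

lemma coc_add: "coc G T m f \<Longrightarrow> coc G T m f' \<Longrightarrow> coc G T m (\<lambda>h. f h + f' h)"
  unfolding coc_def by (auto simp: dlt_add intro: dc_comp2[of _ _ _ "(+)"])
lemma coc_minus: "coc G T m f \<Longrightarrow> coc G T m (\<lambda>h. - f h)"
  unfolding coc_def by (auto simp: dlt_minus intro: dc_comp)
lemma coc_diff: "coc G T m f \<Longrightarrow> coc G T m f' \<Longrightarrow> coc G T m (\<lambda>h. f h - f' h)"
  unfolding coc_def by (auto simp: dlt_diff intro: dc_comp2[of _ _ _ "(-)"])
lemma coc_0: "coc G T m (\<lambda>h. 0)"
  unfolding coc_def by simp

context top_grp
begin

lemma pmod_additive:
  fixes S :: "'a::ab_group_add set" and \<rho> :: "'g \<Rightarrow> 'a \<Rightarrow> 'a"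
  assumes "0 \<in> S" "\<And>x y. x \<in> S \<Longrightarrow> y \<in> S \<Longrightarrow> x + y \<in> S" "\<And>x. x \<in> S \<Longrightarrow> - x \<in> S"
    and "\<And>\<gamma> x. x \<in> S \<Longrightarrow> \<rho> \<gamma> x \<in> S" "\<And>\<gamma> x y. \<rho> \<gamma> (x + y) = \<rho> \<gamma> x + \<rho> \<gamma> y" "dc T \<rho>"
  shows "pmod G T (additive_module S \<rho>) S \<rho> (\<lambda>x. x)"
proof unfold_locales
  show "\<And>x y. x \<in> carrier (additive_module S \<rho>) \<Longrightarrow> y \<in> carrier (additive_module S \<rho>) \<Longrightarrow>
      x \<otimes>\<^bsub>additive_module S \<rho>\<^esub> y = y \<otimes>\<^bsub>additive_module S \<rho>\<^esub> x"
    by (simp add: additive_module_def add.commute)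
  show "carrier (additive_module S \<rho>) \<subseteq> Units (additive_module S \<rho>)"
    using assms(1,3) by (auto simp: additive_module_def Units_def intro!: bexI[of _ "- _"])
qed (use assms in \<open>auto simp: additive_module_def add.assoc\<close>)

lemma pmod_trivial: "pmod G T (trivial_module :: ('g, 'r::ab_group_add) gmodule) UNIV (\<lambda>\<gamma> x. x) (\<lambda>x. x)"
  unfolding trivial_module_def by (rule pmod_additive) auto

lemma tdlt_trivial [simp]: "tdlt G (\<lambda>\<gamma> x. x) m f = dlt G m f"
  by (simp add: tdlt_def fun_eq_iff)

lemma pc_trivial [simp]: "f \<in> pmod.pc G T UNIV m \<longleftrightarrow> cts T m f"
  by (simp add: pmod.pc_def[OF pmod_trivial])

lemma cochain_map_id: "cochain_map G m (\<lambda>x. x) f = restrict f (tuples G m)"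
  by (simp add: cochain_map_def)

lemma one_trivial: "\<one>\<^bsub>trivial_module\<^esub> = 0"
  by (simp add: trivial_module_def additive_module_def)

lemma cochains_trivial:
  "f \<in> cochains G T trivial_module m \<longleftrightarrow> f \<in> extensional (tuples G m) \<and> cts T m f"
  by (auto simp: cochains_def trivial_module_def additive_module_def)

lemma coc_cong: "(\<And>g. g \<in> tuples G m \<Longrightarrow> f g = f' g) \<Longrightarrow> coc G T m f \<longleftrightarrow> coc G T m f'"
  unfolding coc_def using cts_cong[of m f f'] dlt_cong[OF grp, of _ m f f'] by simp

lemma coc_restrict: "coc G T m (restrict f (tuples G m)) \<longleftrightarrow> coc G T m f"
  by (rule coc_cong) simp

lemma coboundary_trivial:
  assumes "cts T m f"
  shows "coboundary G trivial_module m (restrict f (tuples G m)) = restrict (dlt G m f) (tuples G (Suc m))"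
  using pmod.coboundary_eq[OF pmod_trivial, of f m] assms by (simp add: cochain_map_id)

lemma cocycles_trivial:
  "f \<in> cocycles G T trivial_module m \<longleftrightarrow> f \<in> extensional (tuples G m) \<and> coc G T m f"
proof (cases "f \<in> extensional (tuples G m) \<and> cts T m f")
  case True
  then have "restrict f (tuples G m) = f" by (simp add: extensional_restrict)
  moreover have "cochain_map G m (\<lambda>x. x) f \<in> cocycles G T trivial_module m \<longleftrightarrow> coc G T m f"
    using pmod.cocycle_iff[OF pmod_trivial, of f m] True by (simp add: one_trivial coc_def)
  ultimately show ?thesis using True by (simp add: cochain_map_id)
next
  case False
  then show ?thesis by (auto simp: cocycles_def cochains_trivial coc_def)
qed

lemma cocycles_trivialI: "coc G T m f \<Longrightarrow> restrict f (tuples G m) \<in> cocycles G T trivial_module m"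
  by (simp add: cocycles_trivial coc_restrict)

lemma coc_dlt: "cts T m f \<Longrightarrow> coc G T (Suc m) (dlt G m f)"
  by (simp add: coc_def cts_dlt dlt_dlt grp)

text \<open>The class of a cochain with trivial coefficients, as used for cocycles.\<close>

abbreviation cls :: "nat \<Rightarrow> ((nat \<Rightarrow> 'g) \<Rightarrow> 'r::ab_group_add) \<Rightarrow> ((nat \<Rightarrow> 'g) \<Rightarrow> 'r) set" where
  "cls m f \<equiv> cohomology_class G T trivial_module m (restrict f (tuples G m))"

lemma cls_eqI:
  assumes "cts T (Suc m) f" "cts T m e" "\<And>g. g \<in> tuples G (Suc m) \<Longrightarrow> f g = f' g + dlt G m e g"
  shows "cls (Suc m) f = cls (Suc m) f'"
proof -
  have f': "cts T (Suc m) f'"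
    using dc_comp2[OF assms(1) cts_dlt[OF assms(2)], of "(-)"] cts_cong[of "Suc m" f' "\<lambda>g. f g - dlt G m e g"] assms(3) by simp
  have "dlt G m e \<in> pmod.bd G T UNIV (\<lambda>\<gamma> x. x) (Suc m)"
    using assms(2) by (auto simp: pmod.bd_def[OF pmod_trivial] cts_dlt)
  with pmod.class_cong[OF pmod_trivial _ _ this, of f f'] show ?thesis
    using assms f' by (simp add: cochain_map_id add.commute)
qed

lemma cls_eqD:
  assumes "cts T (Suc m) f" "cts T (Suc m) f'" "cls (Suc m) f = cls (Suc m) f'"
  obtains e where "cts T m e" "\<And>g. g \<in> tuples G (Suc m) \<Longrightarrow> f g = f' g + dlt G m e g"
proof -
  obtain b where "b \<in> pmod.bd G T UNIV (\<lambda>\<gamma> x. x) (Suc m)" "\<And>g. g \<in> tuples G (Suc m) \<Longrightarrow> f g = b g + f' g"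
    using pmod.class_eqD[OF pmod_trivial, of f "Suc m" f'] assms by (auto simp: cochain_map_id)
  then show thesis using that by (auto simp: pmod.bd_def[OF pmod_trivial] add.commute)
qed

lemma top_grp_subgroup:
  assumes "subgroup K G"
  shows "top_grp (G\<lparr>carrier := K\<rparr>) (subtopology T K)"
proof
  have K: "K \<subseteq> carrier G" using assms by (rule subgroup.subset)
  have inv: "inv\<^bsub>G\<lparr>carrier := K\<rparr>\<^esub> x = inv x" if "x \<in> K" for x
    using m_inv_consistent[OF assms that] .
  have "continuous_map (prod_topology (subtopology T K) (subtopology T K)) T (\<lambda>(x, y). x \<otimes> y)"
    using continuous_map_from_subtopology[OF cont_mult, of "K \<times> K"] by (simp add: subtopology_Times)
  then have "continuous_map (prod_topology (subtopology T K) (subtopology T K)) (subtopology T K) (\<lambda>(x, y). x \<otimes> y)"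
    by (auto simp: continuous_map_in_subtopology subgroup.m_closed[OF assms])
  moreover have "continuous_map (subtopology T K) (subtopology T K) (\<lambda>x. inv x)"
    using continuous_map_from_subtopology[OF cont_inv, of K]
    by (auto simp: continuous_map_in_subtopology subgroup.m_inv_closed[OF assms])
  then have "continuous_map (subtopology T K) (subtopology T K) (\<lambda>x. inv\<^bsub>G\<lparr>carrier := K\<rparr>\<^esub> x)"
    by (rule continuous_map_eq) (simp add: inv)
  ultimately show "topological_group (G\<lparr>carrier := K\<rparr>) (subtopology T K)"
    using K by (auto simp: topological_group_def subgroup_imp_group[OF assms] topspace_T)
qed

end

lemma walk_subgroup [simp]: "walk (G\<lparr>carrier := K\<rparr>) s m g = walk G s m g"
  by (induction m arbitrary: s g) simp_all

lemma dlt_subgroup [simp]: "dlt (G\<lparr>carrier := K\<rparr>) m f g = dlt G m f g"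
  by (simp add: dlt_def fuse_def cong: if_cong)

text \<open>Cocycles of closed subgroups can be lifted from \<open>\<int>/3\<close> to \<open>\<int>/9\<close>.\<close>

locale liftable = top_grp G T for G :: "('g, 'b) monoid_scheme" (structure) and T +
  assumes lift_cocycle: "subgroup K G \<Longrightarrow> closedin T K \<Longrightarrow> coc (G\<lparr>carrier := K\<rparr>) (subtopology T K) m f \<Longrightarrow>
    \<exists>F. coc (G\<lparr>carrier := K\<rparr>) (subtopology T K) m F \<and> (\<forall>g \<in> tuples (G\<lparr>carrier := K\<rparr>) m. red (F g) = f g)"
begin

lemma lift_cocycle_G:
  assumes "coc G T m f"
  obtains F where "coc G T m F" "\<And>g. g \<in> tuples G m \<Longrightarrow> red (F g) = f g"
proof -
  have "subgroup (carrier G) G" "closedin T (carrier G)"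
    using subgroup_self closedin_topspace[of T] by (simp_all add: topspace_T)
  moreover have "subtopology T (carrier G) = T" by (simp flip: topspace_T)
  ultimately show thesis using lift_cocycle[of "carrier G" m f] assms that by auto
qed

end

text \<open>Surjectivity on cohomology gives lifts of the cocycles themselves: a coboundary by which the
  reduction of a representative differs from the given cocycle is lifted as well.\<close>

lemma (in top_grp) lift_from_surjective:
  assumes surj: "cohomology_map G T Z3_module m reduction_9_3 ` carrier (cohomology G T Z9_module m)
          = carrier (cohomology G T Z3_module m)"
    and f: "coc G T m f"
  shows "\<exists>F. coc G T m F \<and> (\<forall>g \<in> tuples G m. red (F g) = f g)"
proof -
  have "cls m f \<in> carrier (cohomology G T Z3_module m)"
    unfolding pmod.carrier_cohomology[OF pmod_trivial] using cocycles_trivialI[OF f] by blast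
  then obtain X where X: "X \<in> carrier (cohomology G T Z9_module m)" "cls m f = cohomology_map G T Z3_module m reduction_9_3 X"
    unfolding surj[symmetric] by (elim imageE) simp
  from X(1) obtain Z where Z: "Z \<in> cocycles G T Z9_module m" "X = cohomology_class G T Z9_module m Z"
    unfolding pmod.carrier_cohomology[OF pmod_trivial] by blast
  have Zc: "coc G T m Z" "restrict Z (tuples G m) = Z" using Z(1) by (simp_all add: cocycles_trivial extensional_restrict)
  have "cohomology_map G T Z3_module m red (cohomology_class G T Z9_module m (cochain_map G m (\<lambda>x. x) Z))
     = cohomology_class G T Z3_module m (cochain_map G m (\<lambda>x. x) (\<lambda>g. red (Z g)))"
    by (rule cohomology_map_class[OF pmod_trivial pmod_trivial]) (use Zc in \<open>simp_all add: red_add coc_def\<close>)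
  then have eq: "cls m f = cls m (\<lambda>g. red (Z g))"
    using X(2) Z(2) Zc(2) by (simp add: cochain_map_id)
  show ?thesis
  proof (cases m)
    case 0
    have "restrict f (tuples G m) \<in> cls m f"
      using pmod.class_self[OF pmod_trivial, of f m] f by (simp add: cochain_map_id coc_def)
    then have "restrict f (tuples G m) \<in> cls m (\<lambda>g. red (Z g))" using eq by simp
    then have req: "restrict f (tuples G m) = restrict (\<lambda>g. red (Z g)) (tuples G m)"
      using pmod.class_eq[OF pmod_trivial, of "\<lambda>g. red (Z g)" m] dc_comp[OF coc_cts[OF Zc(1)], of red]
      by (simp add: cochain_map_id pmod.bd_def[OF pmod_trivial] 0)
    have "red (Z g) = f g" if "g \<in> tuples G m" for g
      using that fun_cong[OF req, of g] by simp
    then show ?thesis using Zc(1) by blast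
  next
    case (Suc k)
    obtain e where e: "cts T k e" "\<And>g. g \<in> tuples G (Suc k) \<Longrightarrow> f g = red (Z g) + dlt G k e g"
      using cls_eqD[of k f "\<lambda>g. red (Z g)"] eq coc_cts[OF f] dc_comp[OF coc_cts[OF Zc(1)], of red] unfolding Suc by metis
    let ?F = "\<lambda>g. Z g + dlt G k (\<lambda>h. lft (e h)) g"
    have "coc G T m ?F" unfolding Suc
      by (intro coc_add coc_dlt dc_comp[OF e(1)]) (use Zc Suc in simp)
    moreover have "red (dlt G k (\<lambda>h. lft (e h)) g) = dlt G k e g" for g
      by (subst dlt_hom[of red]) (simp_all add: red_add)
    ultimately show ?thesis using e(2) Suc by (intro exI[of _ ?F]) (simp add: red_add)
  qed
qed

lemma liftable_voevodsky:
  assumes "voevodsky_pro_3_group G T"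
  shows "liftable G T"
proof -
  have "top_grp G T" using assms by (simp add: voevodsky_pro_3_group_def pro_p_group_def top_grp_def)
  then interpret top_grp G T .
  show ?thesis
  proof
    fix K m and f :: "(nat \<Rightarrow> 'a) \<Rightarrow> 3"
    assume K: "subgroup K G" "closedin T K" and f: "coc (G\<lparr>carrier := K\<rparr>) (subtopology T K) m f"
    interpret K: top_grp "G\<lparr>carrier := K\<rparr>" "subtopology T K" by (rule top_grp_subgroup) fact
    show "\<exists>F. coc (G\<lparr>carrier := K\<rparr>) (subtopology T K) m F \<and> (\<forall>g \<in> tuples (G\<lparr>carrier := K\<rparr>) m. red (F g) = f g)"
      by (rule K.lift_from_surjective[OF _ f]) (use assms K in \<open>auto simp: voevodsky_pro_3_group_def Let_def\<close>)
  qed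
qed

section \<open>Induced coefficients\<close>

text \<open>The coboundary for coefficients in the induced module of functions on \<open>Q\<close>, on which \<open>\<gamma>\<close> acts as
  translation by \<open>\<theta> \<gamma>\<close>. Identifying a function with the element \<open>\<Sum> f(q) q\<close>, this is the group ring of \<open>Q\<close>.\<close>

definition dltQ :: "('g, 'b) monoid_scheme \<Rightarrow> ('g \<Rightarrow> 'q::ab_group_add) \<Rightarrow> nat \<Rightarrow> ((nat \<Rightarrow> 'g) \<Rightarrow> 'q \<Rightarrow> 'r::ab_group_add) \<Rightarrow> (nat \<Rightarrow> 'g) \<Rightarrow> 'q \<Rightarrow> 'r" where
  "dltQ G \<theta> m f g q = dlt G m (\<lambda>h. f h q) g + (f (shift m g) (q - \<theta> (g 0)) - f (shift m g) q)"

text \<open>A continuous surjective homomorphism to a finite abelian group. The development around Shapiro's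
  lemma for its kernel takes place here.\<close>

locale quotient_char = top_grp G T for G :: "('g, 'b) monoid_scheme" (structure) and T +
  fixes \<theta> :: "'g \<Rightarrow> 'q::{finite, ab_group_add}"
  assumes theta_dc: "dc T \<theta>"
    and theta_hom: "x \<in> carrier G \<Longrightarrow> y \<in> carrier G \<Longrightarrow> \<theta> (x \<otimes> y) = \<theta> x + \<theta> y"
    and theta_surj: "\<exists>s \<in> carrier G. \<theta> s = q"
begin

text \<open>Representatives of the cosets of the kernel, and the resulting retraction to the kernel, which commutes
  with left translations by elements of the kernel.\<close>

definition sec :: "'q \<Rightarrow> 'g" where "sec q = (SOME s. s \<in> carrier G \<and> \<theta> s = q)"

lemma sec: "sec q \<in> carrier G" "\<theta> (sec q) = q"
  unfolding sec_def using someI_ex[of "\<lambda>s. s \<in> carrier G \<and> \<theta> s = q"] theta_surj[of q] by blast+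

lemma theta_one: "\<theta> \<one> = 0" using theta_hom[of \<one> \<one>] by simp
lemma theta_inv: "x \<in> carrier G \<Longrightarrow> \<theta> (inv x) = - \<theta> x"
  using theta_hom[of "inv x" x] by (simp add: theta_one eq_neg_iff_add_eq_0)

definition Ker :: "'g set" where "Ker = {x \<in> carrier G. \<theta> x = 0}"

lemma Ker_subgroup: "subgroup Ker G"
  by unfold_locales (auto simp: Ker_def theta_hom theta_one theta_inv)

lemma Ker_closed: "closedin T Ker"
proof -
  have "closedin T {x \<in> topspace T. \<theta> x \<in> {0}}"
    by (rule closedin_continuous_map_preimage[OF theta_dc]) simp
  then show ?thesis by (simp add: Ker_def topspace_T)
qed

abbreviation GK where "GK \<equiv> G\<lparr>carrier := Ker\<rparr>"
abbreviation TK where "TK \<equiv> subtopology T Ker"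

sublocale K: top_grp GK TK by (rule top_grp_subgroup[OF Ker_subgroup])

definition ret :: "'g \<Rightarrow> 'g" where "ret x = x \<otimes> inv (sec (\<theta> x))"

lemma ret_Ker: "x \<in> carrier G \<Longrightarrow> ret x \<in> Ker"
  by (simp add: Ker_def ret_def theta_hom sec theta_inv)

lemma ret_translate: "k \<in> Ker \<Longrightarrow> x \<in> carrier G \<Longrightarrow> ret (k \<otimes> x) = k \<otimes> ret x"
  by (simp add: ret_def Ker_def theta_hom sec m_assoc)

lemma ret_cont: "continuous_map T T ret"
proof -
  have "continuous_map (discrete_topology UNIV) T (\<lambda>q. inv (sec q))"
    by (auto simp: continuous_map_def topspace_T sec)
  from continuous_map_compose[OF theta_dc this] have "continuous_map T T (\<lambda>x. inv (sec (\<theta> x)))"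
    by (simp add: o_def)
  then show ?thesis unfolding ret_def[abs_def] by (intro cont_prod) simp_all
qed

lemma ret_cont_Ker: "continuous_map T TK ret"
  unfolding continuous_map_in_subtopology using ret_cont ret_Ker by (auto simp: topspace_T)

lemma Ker_carrier: "x \<in> Ker \<Longrightarrow> x \<in> carrier G" by (simp add: Ker_def)

lemma Ker_tuples: "g \<in> tuples GK m \<Longrightarrow> g \<in> tuples G m"
  using Ker_carrier by (auto simp: tuples_def PiE_iff)

text \<open>Invariance of a homogeneous cochain on lists of length \<open>n\<close> under left translation by the kernel. The
  homogeneous cochains with trivial coefficients and this invariance compute the cohomology of the kernel;
  \<open>corresponds\<close> below identifies them with inhomogeneous cochains for the induced module.\<close>

definition kinv :: "nat \<Rightarrow> ('g list \<Rightarrow> 'r) \<Rightarrow> bool" where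
  "kinv n \<phi> \<longleftrightarrow> (\<forall>k \<in> Ker. \<forall>xs. set xs \<subseteq> carrier G \<longrightarrow> length xs = n \<longrightarrow> \<phi> (map (\<lambda>x. k \<otimes> x) xs) = \<phi> xs)"

lemma kinvD: "kinv n \<phi> \<Longrightarrow> k \<in> Ker \<Longrightarrow> set xs \<subseteq> carrier G \<Longrightarrow> length xs = n \<Longrightarrow> \<phi> (map (\<lambda>x. k \<otimes> x) xs) = \<phi> xs"
  by (simp add: kinv_def)

lemma kinv_diff: "kinv n \<phi> \<Longrightarrow> kinv n \<psi> \<Longrightarrow> kinv n (\<lambda>xs. \<phi> xs - \<psi> xs)"
  by (simp add: kinv_def)

lemma kinv_comp: "kinv n \<phi> \<Longrightarrow> kinv n (\<lambda>xs. F (\<phi> xs))"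
  by (simp add: kinv_def)

lemma kinv_dh:
  assumes "kinv n \<phi>"
  shows "kinv (Suc n) (dh \<phi>)"
  unfolding kinv_def
proof (intro ballI allI impI)
  fix k xs assume a: "k \<in> Ker" "set xs \<subseteq> carrier G" "length xs = Suc n"
  have "dh \<phi> (map (\<lambda>x. k \<otimes> x) xs) = dh (\<lambda>ys. \<phi> (map (\<lambda>x. k \<otimes> x) ys)) xs" by (rule dh_map[symmetric])
  also have "\<dots> = dh \<phi> xs"
    using a by (intro dh_cong[OF a(2)] kinvD[OF assms a(1)]) simp_all
  finally show "dh \<phi> (map (\<lambda>x. k \<otimes> x) xs) = dh \<phi> xs" .
qed

lemma kinv_prism:
  assumes "kinv (Suc n) \<phi>"
  shows "kinv n (prism ret \<phi>)"
  unfolding kinv_def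
proof (intro ballI allI impI)
  fix k xs assume a: "k \<in> Ker" "set xs \<subseteq> carrier G" "length xs = n"
  have "prism ret \<phi> (map (\<lambda>x. k \<otimes> x) xs) = prism ret (\<lambda>ys. \<phi> (map (\<lambda>x. k \<otimes> x) ys)) xs"
    by (rule prism_map[where A = "carrier G"]) (use a ret_translate in auto)
  also have "\<dots> = prism ret \<phi> xs"
    using a ret_Ker Ker_carrier by (intro prism_cong[OF a(2)] kinvD[OF assms a(1)]) auto
  finally show "prism ret \<phi> (map (\<lambda>x. k \<otimes> x) xs) = prism ret \<phi> xs" .
qed

text \<open>\<open>corresponds m \<phi> f\<close>: the homogeneous cochain \<open>\<phi>\<close> and the inhomogeneous cochain \<open>f\<close> with values in
  the induced module correspond. The component of \<open>f\<close> at \<open>q\<close> is \<open>\<phi>\<close> along walks that start in a point \<open>s\<close>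
  with \<open>\<theta> s = -q\<close>.\<close>

definition corresponds :: "nat \<Rightarrow> ('g list \<Rightarrow> 'r) \<Rightarrow> ((nat \<Rightarrow> 'g) \<Rightarrow> 'q \<Rightarrow> 'r) \<Rightarrow> bool" where
  "corresponds m \<phi> f \<longleftrightarrow> (\<forall>s \<in> carrier G. \<forall>g \<in> tuples G m. \<phi> (walk G s m g) = f g (- \<theta> s))"

lemma corresponds_dh:
  assumes "corresponds m \<phi> f"
  shows "corresponds (Suc m) (dh \<phi>) (dltQ G \<theta> m f)"
  unfolding corresponds_def
proof (intro ballI)
  fix s g assume s: "s \<in> carrier G" and g: "g \<in> tuples G (Suc m)"
  have g0: "g 0 \<in> carrier G" using g by (rule tuplesD) simp
  have "dlt G m (\<lambda>h. \<phi> (walk G s m h)) g = dlt G m (\<lambda>h. f h (- \<theta> s)) g"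
    by (rule dlt_cong[OF grp g]) (use assms s in \<open>simp add: corresponds_def\<close>)
  moreover have "\<phi> (walk G (s \<otimes> g 0) m (shift m g)) = f (shift m g) (- \<theta> s - \<theta> (g 0))"
    using assms s g0 g by (simp add: corresponds_def theta_hom)
  moreover have "\<phi> (walk G s m (shift m g)) = f (shift m g) (- \<theta> s)"
    using assms s g by (simp add: corresponds_def)
  ultimately show "dh \<phi> (walk G s (Suc m) g) = dltQ G \<theta> m f g (- \<theta> s)"
    using dh_walk[OF grp s, of m g \<phi>] tuplesD[OF g] by (simp add: dltQ_def)
qed

lemma corresponds_exists:
  assumes "cts T m f"
  shows "corresponds m (\<lambda>xs. f (quot G xs) (- \<theta> (hd xs))) f" "hcts T (Suc m) (\<lambda>xs. f (quot G xs) (- \<theta> (hd xs)))"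
    "kinv (Suc m) (\<lambda>xs. f (quot G xs) (- \<theta> (hd xs)))"
proof -
  show "corresponds m (\<lambda>xs. f (quot G xs) (- \<theta> (hd xs))) f"
    by (simp add: corresponds_def quot_walk grp)
  show "hcts T (Suc m) (\<lambda>xs. f (quot G xs) (- \<theta> (hd xs)))"
    using hcts_comp2[OF hcts_quot[OF assms] hcts_hd[OF theta_dc], of "\<lambda>F t. F (- t)"] .
  show "kinv (Suc m) (\<lambda>xs. f (quot G xs) (- \<theta> (hd xs)))"
    unfolding kinv_def
  proof (intro ballI allI impI)
    fix k xs assume a: "k \<in> Ker" "set xs \<subseteq> carrier G" "length xs = Suc m"
    then obtain x ys where xs: "xs = x # ys" by (cases xs) auto
    have "\<theta> (k \<otimes> x) = \<theta> x" using a xs by (simp add: Ker_def theta_hom)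
    then show "f (quot G (map (\<lambda>x. k \<otimes> x) xs)) (- \<theta> (hd (map (\<lambda>x. k \<otimes> x) xs))) = f (quot G xs) (- \<theta> (hd xs))"
      using a quot_translate[OF grp a(2) Ker_carrier[OF a(1)]] xs by simp
  qed
qed

lemma corresponds_zero:
  assumes "corresponds m \<phi> f" "set xs \<subseteq> carrier G" "length xs = Suc m" "\<And>g q. g \<in> tuples G m \<Longrightarrow> f g q = 0"
  shows "\<phi> xs = 0"
proof -
  have "hd xs \<in> carrier G" using assms(2,3) by (cases xs) auto
  moreover have "quot G xs \<in> tuples G m" using assms(2,3) by (intro quot_tuples grp)
  ultimately have "\<phi> (walk G (hd xs) m (quot G xs)) = 0" using assms(1,4) by (simp add: corresponds_def)
  then show ?thesis by (simp add: walk_quot[OF grp assms(2,3)])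
qed

text \<open>Every invariant homogeneous cochain comes from a cochain for the induced module.\<close>

lemma descend:
  assumes "hcts T (Suc m) \<phi>" "kinv (Suc m) \<phi>"
  obtains f where "cts T m f" "corresponds m \<phi> f"
proof
  let ?f = "\<lambda>g q. \<phi> (walk G (sec (- q)) m g)"
  show "cts T m ?f"
    using dc_family[of "product_topology (\<lambda>_. T) {..<m}" "\<lambda>q g. ?f g q" "\<lambda>x. x"] cts_walk[OF assms(1) sec(1)] by simp
  show "corresponds m \<phi> ?f"
    unfolding corresponds_def
  proof (intro ballI)
    fix s g assume s: "s \<in> carrier G" and g: "g \<in> tuples G m"
    let ?t = "sec (- (- \<theta> s))"
    have "walk G s m g = walk G (ret s \<otimes> ?t) m g"
      using s by (simp add: ret_def m_assoc sec)
    also have "\<dots> = map (\<lambda>x. ret s \<otimes> x) (walk G ?t m g)"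
      using Ker_carrier[OF ret_Ker[OF s]] tuplesD[OF g] by (intro walk_translate grp sec)
    also have "\<phi> \<dots> = \<phi> (walk G ?t m g)"
      using tuplesD[OF g] by (intro kinvD[OF assms(2) ret_Ker[OF s]] walk_carrier grp sec) auto
    finally show "\<phi> (walk G s m g) = \<phi> (walk G ?t m g)" .
  qed
qed

lemma corresponds_unique:
  assumes "corresponds m \<phi> f" "corresponds m \<phi>' f'" "g \<in> tuples G m"
    and "\<And>xs. set xs \<subseteq> carrier G \<Longrightarrow> length xs = Suc m \<Longrightarrow> F (\<phi> xs) = \<phi>' xs"
  shows "F (f g q) = f' g q"
proof -
  have "set (walk G (sec (- q)) m g) \<subseteq> carrier G" using assms(3) by (intro walk_carrier grp sec) (auto dest: tuplesD)
  then have "F (\<phi> (walk G (sec (- q)) m g)) = \<phi>' (walk G (sec (- q)) m g)" by (intro assms(4)) simp_all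
  then show ?thesis using assms(1-3) sec(1)[of "- q"] sec(2)[of "- q"] unfolding corresponds_def by simp
qed

text \<open>A cochain of the kernel extends to an invariant homogeneous cochain of the whole group by means of
  the retraction.\<close>

lemma hom_K_cochain:
  assumes "cts TK m \<Psi>"
  shows "hcts T (Suc m) (\<lambda>xs. \<Psi> (quot GK (map ret xs)))"
    "kinv (Suc m) (\<lambda>xs. \<Psi> (quot GK (map ret xs)))"
    "set xs \<subseteq> Ker \<Longrightarrow> length xs = Suc (Suc m) \<Longrightarrow> dh (\<lambda>xs. \<Psi> (quot GK xs)) xs = dlt G m \<Psi> (quot GK xs)"
proof -
  show "hcts T (Suc m) (\<lambda>xs. \<Psi> (quot GK (map ret xs)))"
    by (rule hcts_map[OF K.hcts_quot[OF assms] ret_cont_Ker])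
  show "kinv (Suc m) (\<lambda>xs. \<Psi> (quot GK (map ret xs)))"
    unfolding kinv_def
  proof (intro ballI allI impI)
    fix k xs assume a: "k \<in> Ker" "set xs \<subseteq> carrier G" "length xs = Suc m"
    have "map ret (map (\<lambda>x. k \<otimes> x) xs) = map (\<lambda>x. k \<otimes>\<^bsub>GK\<^esub> x) (map ret xs)"
      using a ret_translate by auto
    moreover have "quot GK (map (\<lambda>x. k \<otimes>\<^bsub>GK\<^esub> x) (map ret xs)) = quot GK (map ret xs)"
      by (rule quot_translate[OF K.grp]) (use a ret_Ker in auto)
    ultimately show "\<Psi> (quot GK (map ret (map (\<lambda>x. k \<otimes> x) xs))) = \<Psi> (quot GK (map ret xs))" by (simp only:)
  qed
  show "dh (\<lambda>xs. \<Psi> (quot GK xs)) xs = dlt G m \<Psi> (quot GK xs)"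
    if xs: "set xs \<subseteq> Ker" "length xs = Suc (Suc m)"
  proof -
    have "walk GK (hd xs) (Suc m) (quot GK xs) = xs" using xs by (intro walk_quot K.grp) simp_all
    moreover have "hd xs \<in> Ker" using xs by (cases xs) auto
    moreover have "quot GK xs \<in> tuples GK (Suc m)" using xs by (intro quot_tuples K.grp) simp_all
    ultimately show ?thesis
      using dh_trivial[OF K.grp, of "hd xs" "quot GK xs" m "\<lambda>xs. \<Psi> (quot GK xs)" \<Psi>] quot_walk[OF K.grp, of _ _ m]
      by simp
  qed
qed

lemma cts_Ker: assumes "cts T m f" shows "cts TK m f"
proof -
  have "dc (product_topology (\<lambda>_. TK) {..<m}) (\<lambda>g. f (\<lambda>k\<in>{..<m}. g k))"
    using K.cont_proj by (intro cts_tuple[OF assms]) (auto simp: continuous_map_in_subtopology)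
  moreover have "restrict g {..<m} = g" if "g \<in> tuples GK m" for g
    using that by (auto simp: tuples_def PiE_def extensional_restrict)
  ultimately show ?thesis using K.cts_cong[of m f "\<lambda>g. f (\<lambda>k\<in>{..<m}. g k)"] by simp
qed

text \<open>A cocycle of \<open>G\<close> that becomes a coboundary on the kernel of \<open>\<theta>\<close> becomes a coboundary
  in the induced module.\<close>

lemma induced_coboundary:
  assumes a: "coc G T (Suc m) a" and \<beta>: "cts TK m \<beta>" "\<And>g. g \<in> tuples GK (Suc m) \<Longrightarrow> a g = dlt G m \<beta> g"
  obtains \<xi> where "cts T m \<xi>" "\<And>g q. g \<in> tuples G (Suc m) \<Longrightarrow> dltQ G \<theta> m \<xi> g q = a g"
proof -
  let ?f = "\<lambda>g (q :: 'q). a g" and ?\<phi> = "\<lambda>xs. a (quot G xs)"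
  let ?B = "\<lambda>xs. \<beta> (quot GK (map ret xs))"
  have f: "cts T (Suc m) ?f" using coc_cts[OF a] by (rule dc_comp)
  note \<phi> = corresponds_exists[OF f]
  have d\<phi>: "dh ?\<phi> xs = 0" if "set xs \<subseteq> carrier G" "length xs = Suc (Suc (Suc m))" for xs
    by (rule corresponds_zero[OF corresponds_dh[OF \<phi>(1)] that]) (simp add: dltQ_def cocD[OF a])
  \<comment> \<open>The composite of the cochain \<open>\<beta>\<close> with the retraction has coboundary \<open>\<phi> \<circ> ret\<close>, and since \<open>\<phi>\<close> is a
  cocycle, the prism operator corrects this to \<open>\<phi>\<close>.\<close>
  define \<Xi> where "\<Xi> = (\<lambda>xs. ?B xs - prism ret ?\<phi> xs)"
  have "hcts T (Suc m) \<Xi>" unfolding \<Xi>_def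
    using hcts_comp2[OF hom_K_cochain(1)[OF \<beta>(1)] hcts_prism[OF \<phi>(2) ret_cont], of "(-)"] .
  moreover have "kinv (Suc m) \<Xi>" unfolding \<Xi>_def
    by (rule kinv_diff[OF hom_K_cochain(2)[OF \<beta>(1)] kinv_prism[OF \<phi>(3)]])
  ultimately obtain \<xi> where \<xi>: "cts T m \<xi>" "corresponds m \<Xi> \<xi>" by (rule descend)
  have "dh \<Xi> xs = ?\<phi> xs" if xs: "set xs \<subseteq> carrier G" "length xs = Suc (Suc m)" for xs
  proof -
    have rx: "set (map ret xs) \<subseteq> Ker" using xs(1) ret_Ker by auto
    have "dh ?B xs = dh (\<lambda>xs. \<beta> (quot GK xs)) (map ret xs)" by (rule dh_map)
    also have "\<dots> = dlt G m \<beta> (quot GK (map ret xs))"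
      by (rule hom_K_cochain(3)[OF \<beta>(1) rx]) (simp add: xs)
    also have "\<dots> = a (quot GK (map ret xs))"
      by (rule \<beta>(2)[symmetric], rule quot_tuples[OF K.grp]) (use rx xs in simp_all)
    also have "quot GK (map ret xs) = quot G (map ret xs)"
    proof -
      have "ret (xs ! l) \<in> Ker" if "l < length xs" for l using rx that by auto
      then show ?thesis unfolding quot_def by (intro restrict_ext) (simp add: m_inv_consistent[OF Ker_subgroup])
    qed
    finally have "dh ?B xs = ?\<phi> (map ret xs)" .
    moreover have "prism ret (dh ?\<phi>) xs = prism ret (\<lambda>_. 0) xs"
      using ret_Ker Ker_carrier xs(2) by (intro prism_cong[OF xs(1)] d\<phi>) auto
    ultimately show ?thesis
      using prism_homotopy[of ret ?\<phi> xs] by (simp add: \<Xi>_def dh_diff prism_zero)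
  qed
  then have "dltQ G \<theta> m \<xi> g q = a g" if "g \<in> tuples G (Suc m)" for g q
    using corresponds_unique[OF corresponds_dh[OF \<xi>(2)] \<phi>(1) that, of "\<lambda>x. x" q] by simp
  with \<xi>(1) show thesis by (rule that)
qed

end

text \<open>Lifting of cocycles with induced coefficients from \<open>\<int>/3\<close> to \<open>\<int>/9\<close>. The corresponding cocycle of the
  kernel is lifted by assumption and extended by the retraction; its reduction differs from the given cocycle
  by a coboundary, which can be lifted.\<close>

lemma shapiro_lift:
  assumes "liftable G T" "quotient_char G T \<theta>"
    and f: "cts T m f" "\<And>g q. g \<in> tuples G (Suc m) \<Longrightarrow> dltQ G \<theta> m f g q = 0"
  obtains F where "cts T m F" "\<And>g q. g \<in> tuples G (Suc m) \<Longrightarrow> dltQ G \<theta> m F g q = 0"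
    "\<And>g q. g \<in> tuples G m \<Longrightarrow> red (F g q) = f g q"
proof -
  interpret liftable G T by fact
  interpret quotient_char G T \<theta> by fact
  let ?\<phi> = "\<lambda>xs. f (quot G xs) (- \<theta> (hd xs))"
  note \<phi> = corresponds_exists[OF f(1)]
  have d\<phi>: "dh ?\<phi> xs = 0" if "set xs \<subseteq> carrier G" "length xs = Suc (Suc m)" for xs
    by (rule corresponds_zero[OF corresponds_dh[OF \<phi>(1)] that]) (simp add: f(2))
  \<comment> \<open>The component at \<open>0\<close>, restricted to the kernel, is a cocycle with trivial coefficients.\<close>
  let ?\<psi> = "\<lambda>g. ?\<phi> (walk G \<one>\<^bsub>G\<^esub> m g)"
  have "coc GK TK m ?\<psi>"
    unfolding coc_def
  proof (intro conjI ballI)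
    show "cts TK m ?\<psi>" by (rule cts_Ker[OF cts_walk[OF \<phi>(2)]]) simp
    fix g assume g: "g \<in> tuples GK (Suc m)"
    then have g': "g \<in> tuples G (Suc m)" and g0: "g 0 \<in> Ker" by (auto intro: Ker_tuples dest: tuplesD)
    have "walk G (\<one>\<^bsub>G\<^esub> \<otimes>\<^bsub>G\<^esub> g 0) m (shift m g) = walk G (g 0 \<otimes>\<^bsub>G\<^esub> \<one>\<^bsub>G\<^esub>) m (shift m g)"
      using Ker_carrier[OF g0] by simp
    also have "\<dots> = map (\<lambda>x. g 0 \<otimes>\<^bsub>G\<^esub> x) (walk G \<one>\<^bsub>G\<^esub> m (shift m g))"
      using g' Ker_carrier[OF g0] by (intro walk_translate grp) (auto dest: tuplesD[OF shift_tuples])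
    also have "?\<phi> \<dots> = ?\<phi> (walk G \<one>\<^bsub>G\<^esub> m (shift m g))"
      using g' by (intro kinvD[OF \<phi>(3) g0] walk_carrier grp) (auto dest: tuplesD[OF shift_tuples])
    finally have "dh ?\<phi> (walk G \<one>\<^bsub>G\<^esub> (Suc m) g) = dlt G m ?\<psi> g"
      using g' by (subst dh_walk[OF grp]) (auto dest: tuplesD)
    moreover have "dh ?\<phi> (walk G \<one>\<^bsub>G\<^esub> (Suc m) g) = 0"
      using g' by (intro d\<phi> walk_carrier grp length_walk) (auto dest: tuplesD)
    ultimately show "dlt GK m ?\<psi> g = 0" by simp
  qed
  from lift_cocycle[OF Ker_subgroup Ker_closed this]
  obtain \<Psi> where \<Psi>: "coc GK TK m \<Psi>" "\<And>g. g \<in> tuples GK m \<Longrightarrow> red (\<Psi> g) = ?\<psi> g" by blast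
  note \<Psi>c = coc_cts[OF \<Psi>(1)]
  let ?P = "\<lambda>xs. \<Psi> (quot GK (map ret xs))"
  let ?Z = "\<lambda>xs. lft (prism ret ?\<phi> xs)"
  \<comment> \<open>\<open>?P\<close> reduces to \<open>?\<phi> \<circ> ret\<close>, which exceeds \<open>?\<phi>\<close> by the coboundary of \<open>prism ret ?\<phi>\<close>.\<close>
  define \<Phi> where "\<Phi> = (\<lambda>xs. ?P xs - dh ?Z xs)"
  have "hcts T (Suc m) \<Phi>" unfolding \<Phi>_def
    using hcts_comp2[OF hom_K_cochain(1)[OF \<Psi>c] hcts_dh[OF hcts_comp[OF hcts_prism[OF \<phi>(2) ret_cont], of lft]], of "(-)"] .
  moreover have "kinv (Suc m) \<Phi>" unfolding \<Phi>_def
    by (rule kinv_diff[OF hom_K_cochain(2)[OF \<Psi>c] kinv_dh[OF kinv_comp[OF kinv_prism[OF \<phi>(3)], of lft]]])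
  ultimately obtain F where F: "cts T m F" "corresponds m \<Phi> F" by (rule descend)
  have dF: "dltQ G \<theta> m F g q = 0" if g: "g \<in> tuples G (Suc m)" for g q
  proof -
    have "dh \<Phi> xs = 0" if xs: "set xs \<subseteq> carrier G" "length xs = Suc (Suc m)" for xs
    proof -
      have rx: "set (map ret xs) \<subseteq> Ker" using xs(1) ret_Ker by auto
      have "dh ?P xs = dh (\<lambda>xs. \<Psi> (quot GK xs)) (map ret xs)" by (rule dh_map)
      also have "\<dots> = dlt G m \<Psi> (quot GK (map ret xs))"
        by (rule hom_K_cochain(3)[OF \<Psi>c rx]) (simp add: xs)
      also have "\<dots> = 0"
        using cocD[OF \<Psi>(1) quot_tuples[OF K.grp, of "map ret xs"]] rx xs by simp
      finally show ?thesis by (simp add: \<Phi>_def dh_diff dh_dh)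
    qed
    then show ?thesis
      using corresponds_unique[OF corresponds_dh[OF F(2)] corresponds_dh[OF F(2)] g, of "\<lambda>_. 0" q] by simp
  qed
  have "red (\<Phi> xs) = ?\<phi> xs" if xs: "set xs \<subseteq> carrier G" "length xs = Suc m" for xs
  proof -
    let ?ys = "map ret xs"
    have rx: "set ?ys \<subseteq> Ker" using xs(1) ret_Ker by auto
    then have hd: "hd ?ys \<in> Ker" using xs(2) by (cases xs) auto
    have q: "quot GK ?ys \<in> tuples GK m" using rx xs by (intro quot_tuples K.grp) simp_all
    have "?ys = walk GK (hd ?ys) m (quot GK ?ys)" using rx xs(2) by (intro walk_quot[symmetric] K.grp) simp_all
    also have "\<dots> = walk G (hd ?ys \<otimes>\<^bsub>G\<^esub> \<one>\<^bsub>G\<^esub>) m (quot GK ?ys)"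
      using Ker_carrier[OF hd] by simp
    also have "\<dots> = map (\<lambda>x. hd ?ys \<otimes>\<^bsub>G\<^esub> x) (walk G \<one>\<^bsub>G\<^esub> m (quot GK ?ys))"
      using Ker_carrier[OF hd] tuplesD[OF Ker_tuples[OF q]] by (intro walk_translate grp) simp_all
    finally have "?\<phi> ?ys = ?\<phi> (map (\<lambda>x. hd ?ys \<otimes>\<^bsub>G\<^esub> x) (walk G \<one>\<^bsub>G\<^esub> m (quot GK ?ys)))" by (rule arg_cong)
    also have "\<dots> = ?\<psi> (quot GK ?ys)"
      using tuplesD[OF Ker_tuples[OF q]] by (intro kinvD[OF \<phi>(3) hd] walk_carrier grp length_walk) auto
    also have "\<dots> = red (?P xs)" using \<Psi>(2)[OF q] by simp
    finally have 1: "red (?P xs) = ?\<phi> ?ys" ..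
    have 2: "red (dh ?Z xs) = dh (prism ret ?\<phi>) xs"
      by (subst group_hom_dh[of red]) (simp_all add: red_add)
    have "prism ret (dh ?\<phi>) xs = prism ret (\<lambda>_. 0) xs"
      using ret_Ker Ker_carrier xs(2) by (intro prism_cong[OF xs(1)] d\<phi>) auto
    then show ?thesis
      using prism_homotopy[of ret ?\<phi> xs] by (simp add: \<Phi>_def red_diff 1 2 prism_zero algebra_simps)
  qed
  then have "red (F g q) = f g q" if "g \<in> tuples G m" for g q
    using corresponds_unique[OF F(2) \<phi>(1) that, of red q] by simp
  with F(1) dF show thesis by (rule that)
qed

section \<open>Products with characters\<close>

lemma all_3: "(\<forall>x::3. P x) \<longleftrightarrow> P 0 \<and> P 1 \<and> P 2"
  by (metis z3_cases)

lemma nine_9: "(9::9) = 0" by simp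

lemma sub_3: "(0::3) - 1 = 2" "(0::3) - 2 = 1" "(1::3) - 2 = 2" "(- 1::3) = 2" "(- 2::3) = 1"
  by simp_all

lemma lambda2_simps [simp]: "lambda2 0 = 0" "lambda2 1 = 0" "lambda2 2 = 1" "lambda2 (- 1) = 1"
  by (simp_all add: lambda2_def)

lemma lambda2_add: "lambda2 (a + b) = lambda2 a + lambda2 b + a * b"
  using z3_cases[of a] z3_cases[of b] by (auto simp: lambda2_def)

lemma lambda2_minus: "lambda2 (- a) = lambda2 a + a"
  using z3_cases[of a] by (auto simp: lambda2_def)

lemma lft_simps: "lft 0 = 0" "lft 1 = 1" "lft 2 = 2"
proof -
  show "lft 0 = 0" "lft 1 = 1" by (simp_all add: lft_def bit1.Rep_0 bit1.Rep_1)
  have "Rep_bit1 (2 :: 3) = 2" using bit1.Rep_numeral[where 'a = num1, of "num.Bit0 num.One"] by simp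
  then show "lft 2 = 2" by (simp add: lft_def)
qed

text \<open>The carry in the addition of residues modulo 3.\<close>

lemma lft_add: "lft a + lft b = lft (a + b) + emb (lambda2 a * b + a * lambda2 b)"
  using z3_cases[of a] z3_cases[of b] by (auto simp: lft_simps lambda2_def emb_def z3_arith)

text \<open>Surjective characters with values in \<open>\<int>/3\<close>.\<close>

definition lin_char :: "('g, 'b) monoid_scheme \<Rightarrow> 'g topology \<Rightarrow> ('g \<Rightarrow> 3) \<Rightarrow> bool" where
  "lin_char G T \<theta> \<longleftrightarrow> \<theta> \<in> characters G T \<and> (\<forall>q. \<exists>s \<in> carrier G. \<theta> s = q)"

context top_grp
begin

lemma cts_cup:
  assumes "dc T x" "cts T m y"
  shows "cts T (Suc m) (\<lambda>g. x (g 0) * y (shift m g))"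
  by (rule dc_comp2[OF dc_pull[OF cont_proj assms(1)] cts_shift[OF assms(2)], of 0 "(*)"]) simp

lemma charactersD:
  assumes "\<theta> \<in> characters G T"
  shows "dc T \<theta>" "\<And>x y. x \<in> carrier G \<Longrightarrow> y \<in> carrier G \<Longrightarrow> \<theta> (x \<otimes> y) = \<theta> x + \<theta> y"
  using assms by (simp_all add: characters_def)

lemma quotient_char_lin: "lin_char G T \<theta> \<Longrightarrow> quotient_char G T \<theta>"
  by unfold_locales (auto simp: lin_char_def characters_def)

lemma dlt_cup_char:
  assumes "\<theta> \<in> characters G T" "g \<in> tuples G (Suc (Suc m))"
  shows "dlt G (Suc m) (\<lambda>h. \<theta> (h 0) * y (shift m h)) g = - (\<theta> (g 0) * dlt G m y (shift (Suc m) g))"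
  using charactersD(2)[OF assms(1), of "g 0" "g 1"] tuplesD[OF assms(2), of 0] tuplesD[OF assms(2), of 1]
  by (simp add: dlt_cup[OF grp assms(2)])

lemma coc_cup:
  assumes "\<theta> \<in> characters G T" "coc G T m y"
  shows "coc G T (Suc m) (\<lambda>g. \<theta> (g 0) * y (shift m g))"
  unfolding coc_def using assms by (auto simp: dlt_cup_char cocD[OF assms(2)] intro!: cts_cup charactersD(1) coc_cts[OF assms(2)])

end

text \<open>A cochain in \<open>\<int>/9\<close> with values divisible by 3 comes from a cochain in \<open>\<int>/3\<close>.\<close>

lemma (in top_grp) unemb_cochain:
  assumes "cts T m C" "\<And>h. h \<in> tuples G m \<Longrightarrow> red (C h) = 0"
  obtains k where "cts T m k" "\<And>h. h \<in> tuples G m \<Longrightarrow> C h = emb (k h)"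
    "\<And>g. g \<in> tuples G (Suc m) \<Longrightarrow> emb (dlt G m k g) = dlt G m C g"
proof
  let ?k = "\<lambda>h. unemb (C h)"
  show "cts T m ?k" by (rule dc_comp[OF assms(1)])
  show *: "C h = emb (?k h)" if "h \<in> tuples G m" for h using assms(2)[OF that] by (simp add: emb_unemb)
  show "emb (dlt G m ?k g) = dlt G m C g" if "g \<in> tuples G (Suc m)" for g
    by (subst dlt_hom[of emb]) (use * in \<open>auto simp: emb_add intro!: dlt_cong[OF grp that]\<close>)
qed

context liftable
begin

text \<open>Let \<open>p + A1 t + A2 t\<^sup>2\<close> be a cocycle with values in \<open>\<int>/3[\<tau>]\<close>, where \<open>t = \<tau> - 1\<close>, and let
  \<open>c0 + c1 t + c2 t\<^sup>2\<close> be a lift to \<open>\<int>/9[\<tau>]\<close>. The last conclusion is the coefficient of \<open>t\<close> in the cocycle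
  equation. Its right hand side is due to \<open>t\<^sup>3 = -3t - 3t\<^sup>2\<close>, and it depends only on the
  reduction since it is a multiple of 3.\<close>

lemma lift_cyclic:
  assumes th: "lin_char G T \<theta>" and cts: "cts T m p" "cts T m A1" "cts T m A2"
    and d: "\<And>g. g \<in> tuples G (Suc m) \<Longrightarrow> dlt G m p g = 0"
      "\<And>g. g \<in> tuples G (Suc m) \<Longrightarrow> dlt G m A1 g = - (\<theta> (g 0) * p (shift m g))"
      "\<And>g. g \<in> tuples G (Suc m) \<Longrightarrow> dlt G m A2 g = - (\<theta> (g 0) * A1 (shift m g)) - lambda2 (\<theta> (g 0)) * p (shift m g)"
  obtains c0 c1 where "coc G T m c0" "cts T m c1"
    "\<And>h. h \<in> tuples G m \<Longrightarrow> red (c0 h) = p h" "\<And>h. h \<in> tuples G m \<Longrightarrow> red (c1 h) = A1 h"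
    "\<And>g. g \<in> tuples G (Suc m) \<Longrightarrow> dlt G m c1 g + lft (\<theta> (g 0)) * c0 (shift m g)
       = emb (\<theta> (g 0) * A2 (shift m g) + lambda2 (\<theta> (g 0)) * A1 (shift m g))"
proof -
  have qc: "quotient_char G T \<theta>" by (rule quotient_char_lin[OF th])
  \<comment> \<open>\<open>fq p a b q\<close> is the coefficient of \<open>\<tau>\<^sup>q\<close> in \<open>p + a t + b t\<^sup>2\<close>.\<close>
  define fq where "fq = (\<lambda>p a b q. if q = (0::3) then p - a + b else if q = 1 then a + b else (b::3))"
  define f where "f = (\<lambda>h q. fq (p h) (A1 h) (A2 h) q)"
  have "dc (product_topology (\<lambda>_. T) {..<m}) (\<lambda>h. (\<lambda>(a, b, c) q. fq a b c q) (p h, A1 h, A2 h))"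
    by (rule dc_comp[OF dc_comp2[OF cts(1) dc_comp2[OF cts(2) cts(3), of Pair], of Pair]])
  then have fc: "cts T m f" by (simp add: f_def)
  have fq: "\<forall>p a b t q. fq 0 (- (t * p)) (- (t * a) - lambda2 t * p) q + (fq p a b (q - t) - fq p a b q) = 0"
    unfolding fq_def all_3 lambda2_def by simp
  have fq': "\<forall>p a b. fq p a b 0 + fq p a b 1 + fq p a b 2 = p \<and> fq p a b 1 + (fq p a b 2 + fq p a b 2) = a \<and> fq p a b 2 = b"
    unfolding fq_def all_3 by simp
  have fq1: "fq p a b 0 + fq p a b 1 + fq p a b 2 = p" and fq2: "fq p a b 1 + (fq p a b 2 + fq p a b 2) = a"
    and fq3: "fq p a b 2 = b" for p a b using fq' by blast+
  have "dltQ G \<theta> m f g q = 0" if g: "g \<in> tuples G (Suc m)" for g q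
  proof -
    have "dlt G m (\<lambda>h. f h q) g = fq (dlt G m p g) (dlt G m A1 g) (dlt G m A2 g) q"
      by (simp add: f_def fq_def dlt_add dlt_diff)
    then show ?thesis unfolding dltQ_def f_def d[OF g] using fq by simp
  qed
  from shapiro_lift[OF liftable_axioms qc fc this]
  obtain F where F: "cts T m F" "\<And>g q. g \<in> tuples G (Suc m) \<Longrightarrow> dltQ G \<theta> m F g q = 0"
    "\<And>g q. g \<in> tuples G m \<Longrightarrow> red (F g q) = f g q" by blast
  \<comment> \<open>the coefficients of \<open>1\<close> and \<open>t\<close>; the one of \<open>t\<^sup>2\<close> is \<open>F h 2\<close>\<close>
  let ?c0 = "\<lambda>h. F h 0 + F h 1 + F h 2" and ?c1 = "\<lambda>h. F h 1 + (F h 2 + F h 2)"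
  have Fd: "dlt G m (\<lambda>h. F h q) g = F (shift m g) q - F (shift m g) (q - \<theta> (g 0))" if "g \<in> tuples G (Suc m)" for g q
    using F(2)[OF that, of q] by (simp add: dltQ_def algebra_simps)
  show thesis
  proof
    show "coc G T m ?c0"
      unfolding coc_def
    proof (intro conjI ballI)
      show "cts T m ?c0" by (rule dc_comp[OF F(1), of "\<lambda>F. F 0 + F 1 + F 2"])
      fix g assume g: "g \<in> tuples G (Suc m)"
      show "dlt G m ?c0 g = 0"
        using z3_cases[of "\<theta> (g 0)"] by (elim disjE) (simp_all add: dlt_add Fd[OF g] sub_3)
    qed
    show "cts T m ?c1" by (rule dc_comp[OF F(1), of "\<lambda>F. F 1 + (F 2 + F 2)"])
    show "red (?c0 h) = p h" "red (?c1 h) = A1 h" if "h \<in> tuples G m" for h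
      by (simp_all only: red_add F(3)[OF that] f_def fq1 fq2)
    fix g assume g: "g \<in> tuples G (Suc m)"
    have sg: "shift m g \<in> tuples G m" using g by simp
    have c1d: "dlt G m ?c1 g = dlt G m (\<lambda>h. F h 1) g + (dlt G m (\<lambda>h. F h 2) g + dlt G m (\<lambda>h. F h 2) g)"
      by (simp only: dlt_add)
    have "A2 (shift m g) = red (F (shift m g) 2)" "A1 (shift m g) = red (?c1 (shift m g))"
      by (simp only: F(3)[OF sg] f_def fq3) (simp only: red_add F(3)[OF sg] f_def fq2)
    then have "emb (\<theta> (g 0) * A2 (shift m g) + lambda2 (\<theta> (g 0)) * A1 (shift m g))
       = emb (red (lft (\<theta> (g 0)) * F (shift m g) 2 + lft (lambda2 (\<theta> (g 0))) * ?c1 (shift m g)))"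
      by (simp only: red_add[of "_ * _"] red_mult red_lft)
    also have "\<dots> = 3 * (lft (\<theta> (g 0)) * F (shift m g) 2 + lft (lambda2 (\<theta> (g 0))) * ?c1 (shift m g))"
      by (rule emb_red)
    also have "\<dots> = dlt G m ?c1 g + lft (\<theta> (g 0)) * ?c0 (shift m g)"
      using z3_cases[of "\<theta> (g 0)"]
      unfolding c1d Fd[OF g] by (elim disjE) (simp_all add: lft_simps sub_3 nine_9 algebra_simps)
    finally show "dlt G m ?c1 g + lft (\<theta> (g 0)) * ?c0 (shift m g)
       = emb (\<theta> (g 0) * A2 (shift m g) + lambda2 (\<theta> (g 0)) * A1 (shift m g))" ..
  qed
qed

text \<open>The case \<open>p = 0\<close>, that is, a cocycle \<open>\<kappa> t + \<mu> t\<^sup>2\<close>. The coefficient \<open>c0\<close> of the lift is divisible by 3,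
  and \<open>c1\<close> differs from a cocycle lifting \<open>\<kappa>\<close> by a multiple of 3.\<close>

lemma cyclic_decomposable:
  assumes th: "lin_char G T \<theta>" and \<kappa>: "coc G T m \<kappa>" and \<mu>: "cts T m \<mu>"
    "\<And>g. g \<in> tuples G (Suc m) \<Longrightarrow> dlt G m \<mu> g = - (\<theta> (g 0) * \<kappa> (shift m g))"
  obtains k e where "coc G T m k" "cts T m e"
    "\<And>g. g \<in> tuples G (Suc m) \<Longrightarrow> \<theta> (g 0) * \<mu> (shift m g) + lambda2 (\<theta> (g 0)) * \<kappa> (shift m g) = \<theta> (g 0) * k (shift m g) + dlt G m e g"
proof -
  obtain c0 c1 where c: "coc G T m c0" "cts T m c1"
    "\<And>h. h \<in> tuples G m \<Longrightarrow> red (c0 h) = 0" "\<And>h. h \<in> tuples G m \<Longrightarrow> red (c1 h) = \<kappa> h"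
    "\<And>g. g \<in> tuples G (Suc m) \<Longrightarrow> dlt G m c1 g + lft (\<theta> (g 0)) * c0 (shift m g)
       = emb (\<theta> (g 0) * \<mu> (shift m g) + lambda2 (\<theta> (g 0)) * \<kappa> (shift m g))"
    using lift_cyclic[OF th, of m "\<lambda>_. 0" \<kappa> \<mu>] \<kappa> \<mu> by (auto simp: coc_def)
  obtain X where X: "coc G T m X" "\<And>g. g \<in> tuples G m \<Longrightarrow> red (X g) = \<kappa> g" using lift_cocycle_G[OF \<kappa>] by blast
  obtain k where k: "cts T m k" "\<And>h. h \<in> tuples G m \<Longrightarrow> c0 h = emb (k h)"
    "\<And>g. g \<in> tuples G (Suc m) \<Longrightarrow> emb (dlt G m k g) = dlt G m c0 g"
    using unemb_cochain[OF coc_cts[OF c(1)] c(3)] by blast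
  have "cts T m (\<lambda>h. c1 h - X h)" using dc_comp2[OF c(2) coc_cts[OF X(1)]] .
  moreover have "red (c1 h - X h) = 0" if "h \<in> tuples G m" for h using that by (simp add: red_diff c(4) X(2))
  ultimately obtain e where e: "cts T m e" "\<And>g. g \<in> tuples G (Suc m) \<Longrightarrow> emb (dlt G m e g) = dlt G m (\<lambda>h. c1 h - X h) g"
    using unemb_cochain by blast
  show thesis
  proof
    show "coc G T m k" using k(1,3) cocD[OF c(1)] emb_inject[of _ 0] by (simp add: coc_def)
    show "cts T m e" by fact
    fix g assume g: "g \<in> tuples G (Suc m)"
    have "emb (\<theta> (g 0) * \<mu> (shift m g) + lambda2 (\<theta> (g 0)) * \<kappa> (shift m g)) = emb (\<theta> (g 0) * k (shift m g) + dlt G m e g)"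
      unfolding c(5)[OF g, symmetric] using g by (simp add: emb_add e(2) dlt_diff cocD[OF X(1)] k(2) mult_emb)
    then show "\<theta> (g 0) * \<mu> (shift m g) + lambda2 (\<theta> (g 0)) * \<kappa> (shift m g) = \<theta> (g 0) * k (shift m g) + dlt G m e g"
      by (simp only: emb_inject)
  qed
qed

text \<open>For all \<open>\<theta>\<close> with the same constant coefficient \<open>p\<close>, the lifts of \<open>p\<close> are compared with a common lift \<open>P\<close>.
  The cochain \<open>\<theta> A2' + \<lambda>\<^sub>\<theta> A1'\<close> is thus controlled, up to a product \<open>\<theta> k'\<close>, by the product of \<open>\<theta>\<close> and \<open>P\<close> in
  \<open>\<int>/9\<close>.\<close>

lemma cubic_class:
  assumes th: "lin_char G T \<theta>" and cts: "cts T m A1" "cts T m A2"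
    and p: "coc G T m p" "coc G T m P" "\<And>h. h \<in> tuples G m \<Longrightarrow> red (P h) = p h"
    and d: "\<And>g. g \<in> tuples G (Suc m) \<Longrightarrow> dlt G m A1 g = - (\<theta> (g 0) * p (shift m g))"
      "\<And>g. g \<in> tuples G (Suc m) \<Longrightarrow> dlt G m A2 g = - (\<theta> (g 0) * A1 (shift m g)) - lambda2 (\<theta> (g 0)) * p (shift m g)"
  obtains k c1 where "coc G T m k" "cts T m c1" "\<And>h. h \<in> tuples G m \<Longrightarrow> red (c1 h) = A1 h"
    "\<And>g. g \<in> tuples G (Suc m) \<Longrightarrow> dlt G m c1 g + lft (\<theta> (g 0)) * P (shift m g)
       = emb (\<theta> (g 0) * A2 (shift m g) + lambda2 (\<theta> (g 0)) * A1 (shift m g) - \<theta> (g 0) * k (shift m g))"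
proof -
  obtain c0 c1 where c: "coc G T m c0" "cts T m c1"
    "\<And>h. h \<in> tuples G m \<Longrightarrow> red (c0 h) = p h" "\<And>h. h \<in> tuples G m \<Longrightarrow> red (c1 h) = A1 h"
    "\<And>g. g \<in> tuples G (Suc m) \<Longrightarrow> dlt G m c1 g + lft (\<theta> (g 0)) * c0 (shift m g)
       = emb (\<theta> (g 0) * A2 (shift m g) + lambda2 (\<theta> (g 0)) * A1 (shift m g))"
    using lift_cyclic[OF th coc_cts[OF p(1)] cts cocD[OF p(1)] d] by blast
  have "cts T m (\<lambda>h. c0 h - P h)" using dc_comp2[OF coc_cts[OF c(1)] coc_cts[OF p(2)]] .
  moreover have "red (c0 h - P h) = 0" if "h \<in> tuples G m" for h using that by (simp add: red_diff c(3) p(3))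
  ultimately obtain k where k: "cts T m k" "\<And>h. h \<in> tuples G m \<Longrightarrow> c0 h - P h = emb (k h)"
    "\<And>g. g \<in> tuples G (Suc m) \<Longrightarrow> emb (dlt G m k g) = dlt G m (\<lambda>h. c0 h - P h) g"
    using unemb_cochain by blast
  show thesis
  proof
    show "coc G T m k" using k(1,3) cocD[OF c(1)] cocD[OF p(2)] emb_inject[of _ 0] by (simp add: coc_def dlt_diff)
    fix g assume g: "g \<in> tuples G (Suc m)"
    have "P (shift m g) = c0 (shift m g) - emb (k (shift m g))" using k(2)[of "shift m g"] g by (simp add: algebra_simps)
    then show "dlt G m c1 g + lft (\<theta> (g 0)) * P (shift m g)
       = emb (\<theta> (g 0) * A2 (shift m g) + lambda2 (\<theta> (g 0)) * A1 (shift m g) - \<theta> (g 0) * k (shift m g))"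
      by (simp add: emb_diff right_diff_distrib mult_emb flip: c(5)[OF g])
  qed fact+
qed

end

section \<open>Systems of cochains for two characters\<close>

locale char_pair = top_grp G T for G :: "('g, 'b) monoid_scheme" (structure) and T +
  fixes i j :: "'g \<Rightarrow> 3"
  assumes i_char: "i \<in> characters G T" and j_char: "j \<in> characters G T"
begin

text \<open>The cochain \<open>z\<close> of degree \<open>m + 1\<close>, and the conditions on the cochains \<open>w\<^sub>r\<^sub>s\<close> of degree \<open>m\<close> from which it
  is formed.\<close>

definition zz :: "nat \<Rightarrow> ((nat \<Rightarrow> 'g) \<Rightarrow> 3) \<Rightarrow> ((nat \<Rightarrow> 'g) \<Rightarrow> 3) \<Rightarrow> ((nat \<Rightarrow> 'g) \<Rightarrow> 3) \<Rightarrow> ((nat \<Rightarrow> 'g) \<Rightarrow> 3) \<Rightarrow> ((nat \<Rightarrow> 'g) \<Rightarrow> 3) \<Rightarrow> (nat \<Rightarrow> 'g) \<Rightarrow> 3" where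
  "zz m w20 w11 w02 w12 w21 g = i (g 0) * w12 (shift m g) + lambda2 (i (g 0)) * w02 (shift m g)
     + j (g 0) * w21 (shift m g) + lambda2 (j (g 0)) * w20 (shift m g) + i (g 0) * j (g 0) * w11 (shift m g)"

definition wc :: "nat \<Rightarrow> ((nat \<Rightarrow> 'g) \<Rightarrow> 3) \<Rightarrow> ((nat \<Rightarrow> 'g) \<Rightarrow> 3) \<Rightarrow> ((nat \<Rightarrow> 'g) \<Rightarrow> 3) \<Rightarrow> ((nat \<Rightarrow> 'g) \<Rightarrow> 3) \<Rightarrow> ((nat \<Rightarrow> 'g) \<Rightarrow> 3) \<Rightarrow> bool" where
  "wc m w20 w11 w02 w12 w21 \<longleftrightarrow> coc G T m w20 \<and> coc G T m w11 \<and> coc G T m w02 \<and> cts T m w12 \<and> cts T m w21 \<and>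
     (\<forall>g \<in> tuples G (Suc m). dlt G m w12 g = - (i (g 0) * w02 (shift m g)) - j (g 0) * w11 (shift m g) \<and>
        dlt G m w21 g = - (i (g 0) * w11 (shift m g)) - j (g 0) * w20 (shift m g))"

lemma coc_zz:
  assumes w: "wc m w20 w11 w02 w12 w21"
  shows "coc G T (Suc m) (zz m w20 w11 w02 w12 w21)"
proof -
  note ij = charactersD(2)[OF i_char] charactersD(2)[OF j_char]
  have dl: "dc T (\<lambda>x. F (i x) (j x))" for F :: "3 \<Rightarrow> 3 \<Rightarrow> 3"
    using dc_comp2[OF charactersD(1)[OF i_char] charactersD(1)[OF j_char]] .
  have c: "cts T m w20" "cts T m w11" "cts T m w02" "cts T m w12" "cts T m w21"
    using w by (auto simp: wc_def coc_def)
  show ?thesis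
    unfolding coc_def
  proof (intro conjI ballI)
    have "cts T (Suc m) (\<lambda>g. i (g 0) * w12 (shift m g) + lambda2 (i (g 0)) * w02 (shift m g)
     + j (g 0) * w21 (shift m g) + lambda2 (j (g 0)) * w20 (shift m g) + i (g 0) * j (g 0) * w11 (shift m g))"
      by (intro dc_comp2[of _ _ _ "(+)"] cts_cup dl[of "\<lambda>a b. a"] dl[of "\<lambda>a b. b"] dl[of "\<lambda>a b. a * b"]
          dl[of "\<lambda>a b. lambda2 a"] dl[of "\<lambda>a b. lambda2 b"] c)
    then show "cts T (Suc m) (zz m w20 w11 w02 w12 w21)" by (simp only: zz_def[abs_def])
    fix g assume g: "g \<in> tuples G (Suc (Suc m))"
    have g01: "g 0 \<in> carrier G" "g (Suc 0) \<in> carrier G" using tuplesD[OF g] by simp_all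
    have sg: "shift (Suc m) g \<in> tuples G (Suc m)" using g by simp
    have d: "dlt G m w12 (shift (Suc m) g) = - (i (g (Suc 0)) * w02 (shift m (shift (Suc m) g))) - j (g (Suc 0)) * w11 (shift m (shift (Suc m) g))"
      "dlt G m w21 (shift (Suc m) g) = - (i (g (Suc 0)) * w11 (shift m (shift (Suc m) g))) - j (g (Suc 0)) * w20 (shift m (shift (Suc m) g))"
      "dlt G m w20 (shift (Suc m) g) = 0" "dlt G m w11 (shift (Suc m) g) = 0" "dlt G m w02 (shift (Suc m) g) = 0"
      using w sg by (auto simp: wc_def cocD shift_apply)
    have cup: "dlt G (Suc m) (\<lambda>h. F (i (h 0)) (j (h 0)) * y (shift m h)) g =
       (F (i (g (Suc 0))) (j (g (Suc 0))) - F (i (g 0) + i (g (Suc 0))) (j (g 0) + j (g (Suc 0))) + F (i (g 0)) (j (g 0)))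
         * y (shift m (shift (Suc m) g)) - F (i (g 0)) (j (g 0)) * dlt G m y (shift (Suc m) g)" for F :: "3 \<Rightarrow> 3 \<Rightarrow> 3" and y
      using dlt_cup[OF grp g, of "\<lambda>x. F (i x) (j x)" y] g01 by (simp add: ij)
    show "dlt G (Suc m) (zz m w20 w11 w02 w12 w21) g = 0"
      unfolding zz_def[abs_def] dlt_add
        cup[of "\<lambda>a b. a"] cup[of "\<lambda>a b. b"] cup[of "\<lambda>a b. a * b"] cup[of "\<lambda>a b. lambda2 a"] cup[of "\<lambda>a b. lambda2 b"] d
      by (simp add: lambda2_add algebra_simps)
  qed
qed

end

text \<open>Independence of the characters is used in the form that the pair is surjective.\<close>

locale two_chars = liftable G T + char_pair G T i j for G :: "('g, 'b) monoid_scheme" (structure) and T i j +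
  assumes surj: "\<exists>s \<in> carrier G. i s = a \<and> j s = b"
begin

lemma lin_i: "lin_char G T i" and lin_j: "lin_char G T j"
  using i_char j_char surj by (auto simp: lin_char_def)

lemma lin_plus: "lin_char G T (\<lambda>x. i x + j x)"
  unfolding lin_char_def
proof (intro conjI allI)
  show "(\<lambda>x. i x + j x) \<in> characters G T"
    using i_char j_char dc_comp2[of T i j "(+)"] by (simp add: characters_def algebra_simps)
  show "\<exists>s\<in>carrier G. i s + j s = q" for q using surj[of q 0] by (elim bexE) (auto intro!: bexI)
qed

lemma lin_minus: "lin_char G T (\<lambda>x. i x - j x)"
  unfolding lin_char_def
proof (intro conjI allI)
  show "(\<lambda>x. i x - j x) \<in> characters G T"
    using i_char j_char dc_comp2[of T i j "(-)"] by (simp add: characters_def algebra_simps)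
  show "\<exists>s\<in>carrier G. i s - j s = q" for q using surj[of q 0] by (elim bexE) (auto intro!: bexI)
qed

lemma swap: "two_chars G T j i"
  by unfold_locales (use i_char j_char surj in auto)

text \<open>Cochains of degree \<open>m + 1\<close> that are cohomologous to a sum of products of \<open>i\<close> and of \<open>j\<close> with
  cocycles.\<close>

definition decomposable :: "nat \<Rightarrow> ((nat \<Rightarrow> 'g) \<Rightarrow> 3) \<Rightarrow> bool" where
  "decomposable m f \<longleftrightarrow> (\<exists>a b e. coc G T m a \<and> coc G T m b \<and> cts T m e \<and>
     (\<forall>g \<in> tuples G (Suc m). f g = i (g 0) * a (shift m g) + j (g 0) * b (shift m g) + dlt G m e g))"

lemma decomposableI:
  assumes "coc G T m a" "coc G T m b" "cts T m e"
    "\<And>g. g \<in> tuples G (Suc m) \<Longrightarrow> f g = i (g 0) * a (shift m g) + j (g 0) * b (shift m g) + dlt G m e g"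
  shows "decomposable m f"
  using assms unfolding decomposable_def by blast

lemma decomposable_add:
  assumes "decomposable m f" "decomposable m f'" shows "decomposable m (\<lambda>g. f g + f' g)"
proof -
  obtain a b e a' b' e' where *: "coc G T m a" "coc G T m b" "cts T m e" "coc G T m a'" "coc G T m b'" "cts T m e'"
     "\<forall>g \<in> tuples G (Suc m). f g = i (g 0) * a (shift m g) + j (g 0) * b (shift m g) + dlt G m e g"
     "\<forall>g \<in> tuples G (Suc m). f' g = i (g 0) * a' (shift m g) + j (g 0) * b' (shift m g) + dlt G m e' g"
    using assms unfolding decomposable_def by blast
  show ?thesis
    by (rule decomposableI[OF coc_add[OF *(1,4)] coc_add[OF *(2,5)] dc_comp2[OF *(3,6), of "(+)"]])
      (use *(7,8) in \<open>simp add: dlt_add algebra_simps\<close>)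
qed

lemma decomposable_minus:
  assumes "decomposable m f" shows "decomposable m (\<lambda>g. - f g)"
proof -
  obtain a b e where *: "coc G T m a" "coc G T m b" "cts T m e" 
     "\<forall>g \<in> tuples G (Suc m). f g = i (g 0) * a (shift m g) + j (g 0) * b (shift m g) + dlt G m e g"
    using assms unfolding decomposable_def by blast
  show ?thesis
    by (rule decomposableI[OF coc_minus[OF *(1)] coc_minus[OF *(2)] dc_comp[OF *(3), of uminus]])
      (use *(4) in \<open>simp add: dlt_minus\<close>)
qed

lemma decomposable_cong: "decomposable m f \<Longrightarrow> (\<And>g. g \<in> tuples G (Suc m) \<Longrightarrow> f' g = f g) \<Longrightarrow> decomposable m f'"
  unfolding decomposable_def by simp

lemma decomposable_dlt: "cts T m e \<Longrightarrow> decomposable m (dlt G m e)"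
  by (rule decomposableI[OF coc_0 coc_0]) auto

lemma decomposable_cup: "coc G T m a \<Longrightarrow> coc G T m b \<Longrightarrow> decomposable m (\<lambda>g. i (g 0) * a (shift m g) + j (g 0) * b (shift m g))"
  by (rule decomposableI[of _ _ _ "\<lambda>_. 0"]) auto

lemma decomposable_swap: "two_chars.decomposable G T j i m f \<longleftrightarrow> decomposable m f"
  unfolding two_chars.decomposable_def[OF swap] decomposable_def by (metis add.commute)

text \<open>If \<open>w\<^sub>1\<^sub>1 = 0\<close>, then \<open>z\<close> splits into a part for \<open>i\<close> and a part for \<open>j\<close>.\<close>

lemma zz_decomposable_w11_0:
  assumes w: "wc m w20 w11 w02 w12 w21" and 0: "\<And>h. h \<in> tuples G m \<Longrightarrow> w11 h = 0"
  shows "decomposable m (zz m w20 w11 w02 w12 w21)"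
proof -
  obtain k e where k: "coc G T m k" "cts T m e"
    "\<And>g. g \<in> tuples G (Suc m) \<Longrightarrow> i (g 0) * w12 (shift m g) + lambda2 (i (g 0)) * w02 (shift m g) = i (g 0) * k (shift m g) + dlt G m e g"
    by (rule cyclic_decomposable[OF lin_i, of m w02 w12]) (use w 0 in \<open>auto simp: wc_def\<close>)
  obtain k' e' where k': "coc G T m k'" "cts T m e'"
    "\<And>g. g \<in> tuples G (Suc m) \<Longrightarrow> j (g 0) * w21 (shift m g) + lambda2 (j (g 0)) * w20 (shift m g) = j (g 0) * k' (shift m g) + dlt G m e' g"
    by (rule cyclic_decomposable[OF lin_j, of m w20 w21]) (use w 0 in \<open>auto simp: wc_def\<close>)
  show ?thesis
    by (rule decomposableI[OF k(1) k'(1) dc_comp2[OF k(2) k'(2), of "(+)"]])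
      (use k(3) k'(3) 0 in \<open>simp add: zz_def dlt_add algebra_simps\<close>)
qed

lemma zz_diff:
  "zz m (\<lambda>h. a h - a' h) (\<lambda>h. b h - b' h) (\<lambda>h. c h - c' h) (\<lambda>h. d h - d' h) (\<lambda>h. e h - e' h) g =
    zz m a b c d e g - zz m a' b' c' d' e' g"
  by (simp add: zz_def algebra_simps)

lemma wc_diff:
  assumes "wc m a b c d e" "wc m a' b' c' d' e'"
  shows "wc m (\<lambda>h. a h - a' h) (\<lambda>h. b h - b' h) (\<lambda>h. c h - c' h) (\<lambda>h. d h - d' h) (\<lambda>h. e h - e' h)"
  using assms dc_comp2[of "product_topology (\<lambda>_. T) {..<m}" d d' "(-)"] dc_comp2[of "product_topology (\<lambda>_. T) {..<m}" e e' "(-)"]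
  unfolding wc_def by (simp add: coc_diff dlt_diff) (simp add: algebra_simps)

text \<open>The difference of two systems with the same \<open>w\<^sub>1\<^sub>1\<close> is a system with \<open>w\<^sub>1\<^sub>1 = 0\<close>, so decomposability can be
  tested on any other system with the same \<open>w\<^sub>1\<^sub>1\<close>.\<close>

lemma zz_decomposable_same_w11:
  assumes "wc m a b c d e" "wc m a' b' c' d' e'" "\<And>h. h \<in> tuples G m \<Longrightarrow> b h = b' h"
    and "decomposable m (zz m a' b' c' d' e')"
  shows "decomposable m (zz m a b c d e)"
proof -
  have "decomposable m (zz m (\<lambda>h. a h - a' h) (\<lambda>h. b h - b' h) (\<lambda>h. c h - c' h) (\<lambda>h. d h - d' h) (\<lambda>h. e h - e' h))"
    by (rule zz_decomposable_w11_0[OF wc_diff[OF assms(1,2)]]) (simp add: assms(3))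
  from decomposable_add[OF this assms(4)] show ?thesis by (rule decomposable_cong) (simp add: zz_diff)
qed

text \<open>The comparison system has \<open>w\<^sub>2\<^sub>0 = w\<^sub>0\<^sub>2 = w\<^sub>1\<^sub>1\<close> and \<open>w\<^sub>1\<^sub>2 = w\<^sub>2\<^sub>1 = \<mu>\<close>. Its \<open>z\<close> is the expression treated in
  \<open>cyclic_decomposable\<close>, for the character \<open>i + j\<close>.\<close>

lemma zz_decomposable_plus:
  assumes w: "wc m w20 w11 w02 w12 w21" and \<mu>: "cts T m \<mu>"
    "\<And>g. g \<in> tuples G (Suc m) \<Longrightarrow> dlt G m \<mu> g = - ((i (g 0) + j (g 0)) * w11 (shift m g))"
  shows "decomposable m (zz m w20 w11 w02 w12 w21)"
proof (rule zz_decomposable_same_w11[OF w, of w11 w11 w11 \<mu> \<mu>])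
  have x: "coc G T m w11" using w by (simp add: wc_def)
  show "wc m w11 w11 w11 \<mu> \<mu>" using x \<mu> by (simp add: wc_def algebra_simps)
  obtain k e where k: "coc G T m k" "cts T m e"
    "\<And>g. g \<in> tuples G (Suc m) \<Longrightarrow> (i (g 0) + j (g 0)) * \<mu> (shift m g) + lambda2 (i (g 0) + j (g 0)) * w11 (shift m g)
       = (i (g 0) + j (g 0)) * k (shift m g) + dlt G m e g"
    using cyclic_decomposable[OF lin_plus x \<mu>] by blast
  show "decomposable m (zz m w11 w11 w11 \<mu> \<mu>)"
    by (rule decomposableI[OF k(1) k(1) k(2)]) (use k(3) in \<open>simp add: zz_def lambda2_add algebra_simps\<close>)
qed simp

text \<open>The comparison system has \<open>w\<^sub>2\<^sub>0 = w\<^sub>0\<^sub>2 = -w\<^sub>1\<^sub>1\<close>, \<open>w\<^sub>1\<^sub>2 = \<mu>\<close> and \<open>w\<^sub>2\<^sub>1 = -\<mu>\<close>, and the character is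
  \<open>i - j\<close>.\<close>

lemma zz_decomposable_minus:
  assumes w: "wc m w20 w11 w02 w12 w21" and \<mu>: "cts T m \<mu>"
    "\<And>g. g \<in> tuples G (Suc m) \<Longrightarrow> dlt G m \<mu> g = (i (g 0) - j (g 0)) * w11 (shift m g)"
  shows "decomposable m (zz m w20 w11 w02 w12 w21)"
proof (rule zz_decomposable_same_w11[OF w, of "\<lambda>h. - w11 h" w11 "\<lambda>h. - w11 h" \<mu> "\<lambda>h. - \<mu> h"])
  have x: "coc G T m w11" using w by (simp add: wc_def)
  have \<mu>': "cts T m (\<lambda>h. - \<mu> h)" by (rule dc_comp[OF \<mu>(1)])
  show "wc m (\<lambda>h. - w11 h) w11 (\<lambda>h. - w11 h) \<mu> (\<lambda>h. - \<mu> h)"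
    using x \<mu> \<mu>' coc_minus[OF x] by (simp add: wc_def dlt_minus algebra_simps)
  obtain k e where k: "coc G T m k" "cts T m e"
    "\<And>g. g \<in> tuples G (Suc m) \<Longrightarrow> (i (g 0) - j (g 0)) * - \<mu> (shift m g) + lambda2 (i (g 0) - j (g 0)) * w11 (shift m g)
       = (i (g 0) - j (g 0)) * k (shift m g) + dlt G m e g"
    by (rule cyclic_decomposable[OF lin_minus x \<mu>']) (use \<mu>(2) in \<open>simp_all add: dlt_minus\<close>)
  have l: "lambda2 (a - b) = lambda2 a + lambda2 b + b - a * b" for a b
    using lambda2_add[of a "- b"] by (simp add: lambda2_minus algebra_simps)
  show "decomposable m (zz m (\<lambda>h. - w11 h) w11 (\<lambda>h. - w11 h) \<mu> (\<lambda>h. - \<mu> h))"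
  proof (rule decomposableI[OF coc_minus[OF k(1)] coc_add[OF k(1) x] dc_comp[OF k(2), of uminus]])
    fix g assume g: "g \<in> tuples G (Suc m)"
    show "zz m (\<lambda>h. - w11 h) w11 (\<lambda>h. - w11 h) \<mu> (\<lambda>h. - \<mu> h) g = i (g 0) * - k (shift m g) + j (g 0) * (k (shift m g) + w11 (shift m g)) + dlt G m (\<lambda>h. - e h) g"
      using k(3)[OF g] by (simp add: zz_def dlt_minus l algebra_simps)
  qed
qed simp

end

section \<open>Additivity of the cubic expressions\<close>

lemma char_3: "2 * x = - (x::3)" "3 * x = 0" "x + x = - x" "- x - x = x" "4 * x = x" "5 * x = - x" "6 * x = 0"
  "7 * x = x" "8 * x = - x" "9 * x = 0"
  using z3_cases[of x] by auto

context two_chars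
begin

text \<open>The cochains \<open>p, u10, \<dots>, u21\<close> are the coordinates with respect to \<open>t\<^sub>1\<^sup>a t\<^sub>2\<^sup>b\<close> of the first component of a
  cochain \<open>(u, v, 0, -\<kappa> T\<^sub>4)\<close> as in the theorem. The first five terms of the decomposable sum are, up to
  sign and a coboundary, the coordinate \<open>\<xi>\<^sub>0\<^sub>2\<close>; the next two are the terms of \<open>z\<close> that belong to \<open>i\<close>, with \<open>\<kappa>\<close>
  removed.

  The cubic expression is formed for \<open>i\<close> with coefficients \<open>p, u10 - a, -b\<close>, for \<open>j\<close> with
  \<open>p, u01, u02\<close>, and for \<open>i + j\<close> with \<open>p, u10 + u01 - \<kappa>, u20 + u11 + u02\<close>. For \<open>i\<close>
  the coordinate \<open>u20\<close> cannot serve as coefficient of \<open>t\<^sup>2\<close>, because its coboundary involves \<open>\<kappa>\<close>; by the choice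
  of \<open>a\<close> and \<open>b\<close>, the cochain \<open>-b\<close> can, after subtracting \<open>a\<close> from \<open>u10\<close>.\<close>

lemma half_decomposable:
  assumes \<kappa>: "coc G T m \<kappa>" and p: "coc G T m p"
    and cts: "cts T m u01" "cts T m u02" "cts T m u10" "cts T m u11" "cts T m u20" "cts T m u21"
    and d: "\<And>g. g \<in> tuples G (Suc m) \<Longrightarrow> dlt G m u01 g = - (j (g 0) * p (shift m g))"
      "\<And>g. g \<in> tuples G (Suc m) \<Longrightarrow> dlt G m u02 g = - (j (g 0) * u01 (shift m g)) - lambda2 (j (g 0)) * p (shift m g)"
      "\<And>g. g \<in> tuples G (Suc m) \<Longrightarrow> dlt G m u10 g = - (i (g 0) * p (shift m g))"
      "\<And>g. g \<in> tuples G (Suc m) \<Longrightarrow> dlt G m u11 g = - (i (g 0) * u01 (shift m g)) - j (g 0) * u10 (shift m g)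
          - i (g 0) * j (g 0) * p (shift m g) - (i (g 0) + j (g 0)) * \<kappa> (shift m g)"
      "\<And>g. g \<in> tuples G (Suc m) \<Longrightarrow> dlt G m u20 g = - (i (g 0) * u10 (shift m g)) - lambda2 (i (g 0)) * p (shift m g)
          - (i (g 0) + j (g 0)) * \<kappa> (shift m g)"
      "\<And>g. g \<in> tuples G (Suc m) \<Longrightarrow> dlt G m u21 g = - (i (g 0) * u11 (shift m g)) - j (g 0) * u20 (shift m g)
          - lambda2 (i (g 0)) * u01 (shift m g) - i (g 0) * j (g 0) * u10 (shift m g) - lambda2 (i (g 0)) * j (g 0) * p (shift m g)
          - lambda2 (i (g 0) + j (g 0)) * \<kappa> (shift m g) + (i (g 0) + j (g 0)) * \<kappa> (shift m g)"
  obtains a b where "coc G T m a" "cts T m b"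
    "\<And>g. g \<in> tuples G (Suc m) \<Longrightarrow> dlt G m b g = i (g 0) * u10 (shift m g) + lambda2 (i (g 0)) * p (shift m g) - i (g 0) * a (shift m g)"
    "decomposable m (\<lambda>g. i (g 0) * u02 (shift m g) + j (g 0) * u11 (shift m g) + i (g 0) * j (g 0) * u01 (shift m g)
       + lambda2 (j (g 0)) * u10 (shift m g) + i (g 0) * lambda2 (j (g 0)) * p (shift m g)
       + i (g 0) * (u20 (shift m g) + b (shift m g)) + lambda2 (i (g 0)) * a (shift m g)
       + lambda2 (i (g 0) + j (g 0)) * \<kappa> (shift m g))"
proof -
  obtain a b where a: "coc G T m a" "cts T m b"
    "\<And>g. g \<in> tuples G (Suc m) \<Longrightarrow> i (g 0) * u10 (shift m g) + lambda2 (i (g 0)) * p (shift m g) = i (g 0) * a (shift m g) + dlt G m b g"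
    using cyclic_decomposable[OF lin_i p cts(3) d(3)] by blast
  have b: "dlt G m b g = i (g 0) * u10 (shift m g) + lambda2 (i (g 0)) * p (shift m g) - i (g 0) * a (shift m g)"
    if "g \<in> tuples G (Suc m)" for g using a(3)[OF that] by (simp add: algebra_simps)
  obtain P where P: "coc G T m P" "\<And>g. g \<in> tuples G m \<Longrightarrow> red (P g) = p g" using lift_cocycle_G[OF p] by blast
  have ca: "cts T m (\<lambda>h. u10 h - a h)" by (rule dc_comp2[OF cts(3) coc_cts[OF a(1)]])
  have cb: "cts T m (\<lambda>h. - b h)" by (rule dc_comp[OF a(2)])
  have cA1: "cts T m (\<lambda>h. u10 h + u01 h - \<kappa> h)"
    by (rule dc_comp2[OF dc_comp2[OF cts(3,1), of "(+)"] coc_cts[OF \<kappa>]])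
  have cA2: "cts T m (\<lambda>h. u20 h + u11 h + u02 h)"
    by (rule dc_comp2[OF dc_comp2[OF cts(5,4), of "(+)"] cts(2)])
  have di: "dlt G m (\<lambda>h. u10 h - a h) g = - (i (g 0) * p (shift m g))"
    "dlt G m (\<lambda>h. - b h) g = - (i (g 0) * (u10 (shift m g) - a (shift m g))) - lambda2 (i (g 0)) * p (shift m g)"
    if g: "g \<in> tuples G (Suc m)" for g
    by (simp_all add: dlt_diff dlt_minus d(3)[OF g] cocD[OF a(1) g] b[OF g] algebra_simps)
  obtain ki ci where i: "coc G T m ki" "cts T m ci" "\<And>h. h \<in> tuples G m \<Longrightarrow> red (ci h) = u10 h - a h"
    "\<And>g. g \<in> tuples G (Suc m) \<Longrightarrow> dlt G m ci g + lft (i (g 0)) * P (shift m g)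
       = emb (i (g 0) * - b (shift m g) + lambda2 (i (g 0)) * (u10 (shift m g) - a (shift m g)) - i (g 0) * ki (shift m g))"
    using cubic_class[OF lin_i ca cb p P di] by blast
  obtain kj cj where j: "coc G T m kj" "cts T m cj" "\<And>h. h \<in> tuples G m \<Longrightarrow> red (cj h) = u01 h"
    "\<And>g. g \<in> tuples G (Suc m) \<Longrightarrow> dlt G m cj g + lft (j (g 0)) * P (shift m g)
       = emb (j (g 0) * u02 (shift m g) + lambda2 (j (g 0)) * u01 (shift m g) - j (g 0) * kj (shift m g))"
    using cubic_class[OF lin_j cts(1,2) p P d(1,2)] by blast
  have dA2: "dlt G m (\<lambda>h. u20 h + u11 h + u02 h) g = - ((i (g 0) + j (g 0)) * (u10 (shift m g) + u01 (shift m g) - \<kappa> (shift m g)))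
      - lambda2 (i (g 0) + j (g 0)) * p (shift m g)" if g: "g \<in> tuples G (Suc m)" for g
    by (simp add: dlt_add d[OF g] lambda2_add algebra_simps char_3)
  have dA1: "dlt G m (\<lambda>h. u10 h + u01 h - \<kappa> h) g = - ((i (g 0) + j (g 0)) * p (shift m g))" if g: "g \<in> tuples G (Suc m)" for g
    by (simp add: dlt_add dlt_diff d(1,3)[OF g] cocD[OF \<kappa> g] algebra_simps)
  obtain kt ct where t: "coc G T m kt" "cts T m ct" "\<And>h. h \<in> tuples G m \<Longrightarrow> red (ct h) = u10 h + u01 h - \<kappa> h"
    "\<And>g. g \<in> tuples G (Suc m) \<Longrightarrow> dlt G m ct g + lft (i (g 0) + j (g 0)) * P (shift m g)
       = emb ((i (g 0) + j (g 0)) * (u20 (shift m g) + u11 (shift m g) + u02 (shift m g))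
          + lambda2 (i (g 0) + j (g 0)) * (u10 (shift m g) + u01 (shift m g) - \<kappa> (shift m g)) - (i (g 0) + j (g 0)) * kt (shift m g))"
    using cubic_class[OF lin_plus cA1 cA2 p P dA1 dA2] by blast
  \<comment> \<open>The degree 1 coefficients of the lifts for \<open>i + j\<close>, \<open>i\<close>, \<open>j\<close> combine to a lift of the cocycle \<open>a - \<kappa>\<close>,
  so \<open>ct - ci - cj\<close> is a cocycle up to a multiple of 3.\<close>
  obtain Y where Y: "coc G T m Y" "\<And>g. g \<in> tuples G m \<Longrightarrow> red (Y g) = a g - \<kappa> g"
    using lift_cocycle_G[OF coc_diff[OF a(1) \<kappa>]] by blast
  have "cts T m (\<lambda>h. ct h - ci h - cj h - Y h)"
    by (rule dc_comp2[OF dc_comp2[OF dc_comp2[OF t(2) i(2), of "(-)"] j(2), of "(-)"] coc_cts[OF Y(1)]])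
  moreover have "red (ct h - ci h - cj h - Y h) = 0" if "h \<in> tuples G m" for h
    using that by (simp add: red_diff t(3) i(3) j(3) Y(2))
  ultimately obtain e where e: "cts T m e"
    "\<And>g. g \<in> tuples G (Suc m) \<Longrightarrow> emb (dlt G m e g) = dlt G m (\<lambda>h. ct h - ci h - cj h - Y h) g"
    using unemb_cochain by blast
  \<comment> \<open>The difference of the three cubic relations, divided by 3. The last term is the carry in \<open>i + j\<close>,
  multiplied by the lift \<open>P\<close> of \<open>p\<close>.\<close>
  have de: "dlt G m e g = ((i (g 0) + j (g 0)) * (u20 (shift m g) + u11 (shift m g) + u02 (shift m g))
          + lambda2 (i (g 0) + j (g 0)) * (u10 (shift m g) + u01 (shift m g) - \<kappa> (shift m g)) - (i (g 0) + j (g 0)) * kt (shift m g))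
       - (i (g 0) * - b (shift m g) + lambda2 (i (g 0)) * (u10 (shift m g) - a (shift m g)) - i (g 0) * ki (shift m g))
       - (j (g 0) * u02 (shift m g) + lambda2 (j (g 0)) * u01 (shift m g) - j (g 0) * kj (shift m g))
       + (lambda2 (i (g 0)) * j (g 0) + i (g 0) * lambda2 (j (g 0))) * p (shift m g)" (is "_ = ?t - ?i - ?j + ?c * _")
    if g: "g \<in> tuples G (Suc m)" for g
  proof -
    have "emb (dlt G m e g) = dlt G m ct g - dlt G m ci g - dlt G m cj g"
      unfolding e(2)[OF g] dlt_diff cocD[OF Y(1) g] by simp
    also have "\<dots> = emb ?t - emb ?i - emb ?j + (lft (i (g 0)) + lft (j (g 0)) - lft (i (g 0) + j (g 0))) * P (shift m g)"
      by (simp only: t(4)[OF g, symmetric] i(4)[OF g, symmetric] j(4)[OF g, symmetric]) (simp add: algebra_simps)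
    also have "(lft (i (g 0)) + lft (j (g 0)) - lft (i (g 0) + j (g 0))) * P (shift m g) = P (shift m g) * emb ?c"
      by (simp add: lft_add)
    also have "\<dots> = emb (?c * p (shift m g))" using g by (simp add: mult_emb P(2) mult.commute)
    finally have "emb (dlt G m e g) = emb (?t - ?i - ?j + ?c * p (shift m g))" by (simp only: emb_add emb_diff)
    then show ?thesis by (simp only: emb_inject)
  qed
  show thesis
  proof (rule that[OF a(1,2) b])
    show "decomposable m (\<lambda>g. i (g 0) * u02 (shift m g) + j (g 0) * u11 (shift m g) + i (g 0) * j (g 0) * u01 (shift m g)
       + lambda2 (j (g 0)) * u10 (shift m g) + i (g 0) * lambda2 (j (g 0)) * p (shift m g)
       + i (g 0) * (u20 (shift m g) + b (shift m g)) + lambda2 (i (g 0)) * a (shift m g)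
       + lambda2 (i (g 0) + j (g 0)) * \<kappa> (shift m g))"
    proof (rule decomposableI[OF coc_diff[OF coc_diff[OF t(1) i(1)] \<kappa>] coc_diff[OF coc_diff[OF t(1) j(1)] \<kappa>] dc_comp2[OF e(1) cts(6), of "(+)"]])
      fix g assume g: "g \<in> tuples G (Suc m)"
      show "i (g 0) * u02 (shift m g) + j (g 0) * u11 (shift m g) + i (g 0) * j (g 0) * u01 (shift m g)
       + lambda2 (j (g 0)) * u10 (shift m g) + i (g 0) * lambda2 (j (g 0)) * p (shift m g)
       + i (g 0) * (u20 (shift m g) + b (shift m g)) + lambda2 (i (g 0)) * a (shift m g)
       + lambda2 (i (g 0) + j (g 0)) * \<kappa> (shift m g) = i (g 0) * (kt (shift m g) - ki (shift m g) - \<kappa> (shift m g))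
       + j (g 0) * (kt (shift m g) - kj (shift m g) - \<kappa> (shift m g)) + dlt G m (\<lambda>h. e h + u21 h) g"
        unfolding dlt_add de[OF g] d(6)[OF g] lambda2_add by (simp add: algebra_simps char_3)
    qed
  qed
qed

end

section \<open>Coordinates in the modular group ring\<close>

text \<open>The binomial coefficient \<open>t\<close> over \<open>a\<close> modulo 3, for \<open>a \<le> 2\<close>.\<close>

definition binom3 :: "nat \<Rightarrow> 3 \<Rightarrow> 3" where
  "binom3 a t = (if a = 0 then 1 else if a = 1 then t else lambda2 t)"

text \<open>The coordinate of an element of \<open>\<int>/3[G]\<close> with respect to the basis element \<open>t\<^sub>1\<^sup>a t\<^sub>2\<^sup>b\<close>, for \<open>a, b \<le> 2\<close>.\<close>

definition coord :: "nat \<Rightarrow> nat \<Rightarrow> 3 group_ring \<Rightarrow> 3" where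
  "coord a b x = (\<Sum>q\<in>UNIV. binom3 a (fst q) * binom3 b (snd q) * Poly_Mapping.lookup x q)"

lemma coord_add: "coord a b (x + y) = coord a b x + coord a b y"
  by (simp add: coord_def lookup_add distrib_left sum.distrib)
lemma coord_minus: "coord a b (- x) = - coord a b x"
  by (simp add: coord_def sum_negf)
lemma coord_diff: "coord a b (x - y) = coord a b x - coord a b y"
  using coord_add[of a b x "- y"] by (simp add: coord_minus)
lemma coord_0 [simp]: "coord a b 0 = 0" by (simp add: coord_def)

lemma lookup_single_mult: "Poly_Mapping.lookup (Poly_Mapping.single p r * x) q = r * Poly_Mapping.lookup x (q - p)"
  for x :: "'r::comm_ring_1 group_ring"
proof -
  have "Poly_Mapping.single p r * x = (\<Sum>a\<in>UNIV. Poly_Mapping.single (p + a) (r * Poly_Mapping.lookup x a))"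
    by (subst single_decomp[of x]) (simp add: sum_distrib_left mult_single)
  then have "Poly_Mapping.lookup (Poly_Mapping.single p r * x) q = (\<Sum>a\<in>UNIV. if a = q - p then r * Poly_Mapping.lookup x a else 0)"
    by (auto simp: lookup_sum lookup_single when_def algebra_simps intro!: sum.cong)
  then show ?thesis by simp
qed

lemma coord_single_mult:
  "coord a b (Poly_Mapping.single (k, l) r * x) = (\<Sum>q\<in>UNIV. binom3 a (k + fst q) * binom3 b (l + snd q) * (r * Poly_Mapping.lookup x q))"
  unfolding coord_def lookup_single_mult
  by (rule sum.reindex_bij_witness[of _ "\<lambda>q. q + (k, l)" "\<lambda>q. q - (k, l)"]) (auto simp: plus_prod_def algebra_simps)

lemma coord_single: "coord a b (Poly_Mapping.single (k, l) r) = binom3 a k * binom3 b l * r"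
proof -
  have "coord a b (Poly_Mapping.single (k, l) r) = (\<Sum>q\<in>UNIV. if q = (k, l) then binom3 a k * binom3 b l * r else 0)"
    unfolding coord_def by (intro sum.cong) (auto simp: lookup_single when_def)
  then show ?thesis by simp
qed

lemma coord_smult: "coord a b (Poly_Mapping.single 0 r * x) = r * coord a b x"
  using coord_single_mult[of a b 0 0 r x] by (simp add: coord_def sum_distrib_left algebra_simps flip: zero_prod_def)

text \<open>Multiplication by \<open>\<tau>\<^sub>1\<^sup>k \<tau>\<^sub>2\<^sup>l = (1 + t\<^sub>1)\<^sup>k (1 + t\<^sub>2)\<^sup>l\<close>; note \<open>t\<^sub>1\<^sup>3 = t\<^sub>2\<^sup>3 = 0\<close>.\<close>

lemma coord_act:
  fixes k l :: 3 and x :: "3 group_ring"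
  defines "gx \<equiv> Poly_Mapping.single (k, l) 1 * x"
  shows "coord 0 0 gx = coord 0 0 x"
    "coord 1 0 gx = coord 1 0 x + k * coord 0 0 x"
    "coord 0 1 gx = coord 0 1 x + l * coord 0 0 x"
    "coord 2 0 gx = coord 2 0 x + k * coord 1 0 x + lambda2 k * coord 0 0 x"
    "coord 0 2 gx = coord 0 2 x + l * coord 0 1 x + lambda2 l * coord 0 0 x"
    "coord 1 1 gx = coord 1 1 x + k * coord 0 1 x + l * coord 1 0 x + k * l * coord 0 0 x"
    "coord 2 1 gx = coord 2 1 x + k * coord 1 1 x + lambda2 k * coord 0 1 x + l * coord 2 0 x + k * l * coord 1 0 x + lambda2 k * l * coord 0 0 x"
    "coord 1 2 gx = coord 1 2 x + l * coord 1 1 x + lambda2 l * coord 1 0 x + k * coord 0 2 x + k * l * coord 0 1 x + k * lambda2 l * coord 0 0 x"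
    "coord 2 2 gx = coord 2 2 x + k * coord 1 2 x + lambda2 k * coord 0 2 x + l * (coord 2 1 x + k * coord 1 1 x + lambda2 k * coord 0 1 x)
       + lambda2 l * (coord 2 0 x + k * coord 1 0 x + lambda2 k * coord 0 0 x)"
  unfolding gx_def coord_single_mult unfolding coord_def sum_distrib_left sum.distrib[symmetric]
  by (intro sum.cong refl; simp add: binom3_def lambda2_add algebra_simps)+

lemma coord_tau1:
  shows "coord 0 b (x * (tau1 - 1)) = 0" "coord 1 0 (x * (tau1 - 1)) = coord 0 0 x" "coord 1 1 (x * (tau1 - 1)) = coord 0 1 x"
    "coord 2 0 (x * (tau1 - 1)) = coord 1 0 x" "coord 1 2 (x * (tau1 - 1)) = coord 0 2 x" "coord 2 1 (x * (tau1 - 1)) = coord 1 1 x"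
    "coord 2 2 (x * (tau1 - 1)) = coord 1 2 x"
proof -
  have e: "x * (tau1 - 1) = Poly_Mapping.single (1, 0) 1 * x - x" by (simp add: tau1_def algebra_simps)
  have "binom3 0 (1 + t) = binom3 0 t" for t by (simp add: binom3_def)
  then show "coord 0 b (x * (tau1 - 1)) = 0" unfolding e coord_diff coord_single_mult by (simp add: coord_def binom3_def)
  show "coord 1 0 (x * (tau1 - 1)) = coord 0 0 x" "coord 1 1 (x * (tau1 - 1)) = coord 0 1 x"
    "coord 2 0 (x * (tau1 - 1)) = coord 1 0 x" "coord 1 2 (x * (tau1 - 1)) = coord 0 2 x" "coord 2 1 (x * (tau1 - 1)) = coord 1 1 x"
    "coord 2 2 (x * (tau1 - 1)) = coord 1 2 x"
    unfolding e coord_diff coord_act by simp_all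
qed

lemma coord_tau2:
  shows "coord b 0 (x * (tau2 - 1)) = 0" "coord 0 1 (x * (tau2 - 1)) = coord 0 0 x" "coord 1 1 (x * (tau2 - 1)) = coord 1 0 x"
    "coord 0 2 (x * (tau2 - 1)) = coord 0 1 x" "coord 2 1 (x * (tau2 - 1)) = coord 2 0 x" "coord 1 2 (x * (tau2 - 1)) = coord 1 1 x"
    "coord 2 2 (x * (tau2 - 1)) = coord 2 1 x"
proof -
  have e: "x * (tau2 - 1) = Poly_Mapping.single (0, 1) 1 * x - x" by (simp add: tau2_def algebra_simps)
  have "binom3 0 (1 + t) = binom3 0 t" for t by (simp add: binom3_def)
  then show "coord b 0 (x * (tau2 - 1)) = 0" unfolding e coord_diff coord_single_mult by (simp add: coord_def binom3_def)
  show "coord 0 1 (x * (tau2 - 1)) = coord 0 0 x" "coord 1 1 (x * (tau2 - 1)) = coord 1 0 x"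
    "coord 0 2 (x * (tau2 - 1)) = coord 0 1 x" "coord 2 1 (x * (tau2 - 1)) = coord 2 0 x" "coord 1 2 (x * (tau2 - 1)) = coord 1 1 x"
    "coord 2 2 (x * (tau2 - 1)) = coord 2 1 x"
    unfolding e coord_diff coord_act by simp_all
qed

lemma mult_T:
  "x * T3 = x + Poly_Mapping.single (1, 1) 1 * x + Poly_Mapping.single (2, 2) 1 * x"
  "x * T4 = x + Poly_Mapping.single (1, 2) 1 * x + Poly_Mapping.single (2, 1) 1 * x"
  for x :: "'r::comm_ring_1 group_ring"
  by (simp_all add: T_expand algebra_simps single_one flip: zero_prod_def)

lemma coord_T4: "coord 0 0 T4 = 0" "coord 1 0 T4 = 0" "coord 0 1 T4 = 0" "coord 2 0 T4 = 1" "coord 1 1 T4 = 1" "coord 0 2 T4 = 1"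
  "coord 2 1 T4 = 1" "coord 1 2 T4 = 1" "coord 2 2 T4 = 0"
  unfolding T_expand coord_add coord_single by (simp_all add: binom3_def)

lemma lookup_TG: "Poly_Mapping.lookup (TG :: 'r::comm_ring_1 group_ring) q = 1"
  by (simp add: TG_def lookup_sum lookup_single when_def)

lemma lookup_mult_TG: "Poly_Mapping.lookup (x * TG) q = (\<Sum>a\<in>UNIV. Poly_Mapping.lookup x a)"
  for x :: "'r::comm_ring_1 group_ring"
proof -
  have "x * TG = (\<Sum>a\<in>UNIV. Poly_Mapping.single a (Poly_Mapping.lookup x a) * TG)"
    by (subst single_decomp[of x]) (simp only: sum_distrib_right)
  then show ?thesis by (simp add: lookup_sum lookup_single_mult lookup_TG)
qed

lemma sum_3x3: "(\<Sum>q\<in>UNIV. f (q :: 3 \<times> 3)) = (\<Sum>a\<in>UNIV. \<Sum>b\<in>UNIV. f (a, b))"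
  by (simp only: UNIV_Times_UNIV[symmetric] sum.cartesian_product) simp

lemma coord_TG:
  assumes "\<And>q. Poly_Mapping.lookup y q = r"
  shows "coord 0 0 y = 0" "coord 2 0 y = 0" "coord 0 2 y = 0" "coord 1 1 y = 0" "coord 2 1 y = 0" "coord 1 2 y = 0" "coord 2 2 y = r"
  unfolding coord_def assms sum_3x3 sum_UNIV_3 by (simp_all add: binom3_def char_3)

text \<open>The consequences of the last two components of \<open>\<delta> c = d\<^sub>2 \<omega>\<close>.\<close>

lemma omega_coordinates:
  fixes \<xi> y :: "3 group_ring" and a b r d :: 3
  assumes y: "y = w * TG" and e3: "\<xi> * T3 + y = 0"
    and e4: "\<xi> * T4 + y = - (Poly_Mapping.single 0 d * T4 + (Poly_Mapping.single (a, b) 1 * (Poly_Mapping.single 0 r * T4) - Poly_Mapping.single 0 r * T4))"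
  shows "coord 0 0 \<xi> = 0" "d = 0" "coord 1 0 \<xi> = (a + b) * r" "coord 0 1 \<xi> = (a + b) * r"
    "coord 1 1 \<xi> = lambda2 (a + b) * r - (a + b) * r"
    "TG_coeff (h1 (\<xi>, y)) = coord 2 0 \<xi> + coord 0 2 \<xi> - lambda2 (a + b) * r - (a + b) * r"
proof -
  define n where "n = (\<Sum>a\<in>UNIV. Poly_Mapping.lookup w a)"
  have ny: "Poly_Mapping.lookup y q = n" for q by (simp add: y n_def lookup_mult_TG)
  note cy = coord_TG[of y n, OF ny]
  have c3: "coord s t (\<xi> * T3 + y) = 0" for s t by (simp add: e3)
  note q3 = c3[unfolded mult_T coord_add]
  note q4 = arg_cong[OF e4, of "coord _ _", unfolded coord_minus coord_add coord_diff mult_T(2)[of \<xi>]]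
  \<comment> \<open>The coordinates at \<open>t\<^sub>1\<^sup>2\<close>, \<open>t\<^sub>1\<^sup>2 t\<^sub>2\<close> and \<open>t\<^sub>1\<^sup>2 t\<^sub>2\<^sup>2\<close> of the two equations suffice.\<close>
  show 00: "coord 0 0 \<xi> = 0" using q3[of 2 0] unfolding cy coord_act by (simp add: char_3 algebra_simps)
  show d: "d = 0" using q4[of 2 0] unfolding cy coord_act coord_smult coord_T4 by (simp add: char_3 algebra_simps 00)
  have 1: "coord 1 0 \<xi> = coord 0 1 \<xi>" using q3[of 2 1] unfolding cy coord_act by (simp add: char_3 algebra_simps 00)
  have 2: "coord 1 0 \<xi> + coord 0 1 \<xi> = - ((a + b) * r)"
    using q4[of 2 1] unfolding cy coord_act coord_smult coord_T4 by (simp add: char_3 algebra_simps 00 d)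
  show 10: "coord 1 0 \<xi> = (a + b) * r" using 1 2 by (simp add: char_3)
  show 01: "coord 0 1 \<xi> = (a + b) * r" using 1 10 by simp
  have 3: "n = coord 1 1 \<xi> - coord 2 0 \<xi> - coord 0 2 \<xi> + coord 1 0 \<xi> + coord 0 1 \<xi>"
    using q3[of 2 2] unfolding cy coord_act by (simp add: char_3 algebra_simps 00)
  have 4: "n = - coord 1 1 \<xi> - coord 2 0 \<xi> - coord 0 2 \<xi> - coord 1 0 \<xi> - coord 0 1 \<xi> - (lambda2 (a + b) + a + b) * r"
    using q4[of 2 2] unfolding cy coord_act coord_smult coord_T4 by (simp add: char_3 algebra_simps 00 d lambda2_add eq_neg_iff_add_eq_0)
  show 11: "coord 1 1 \<xi> = lambda2 (a + b) * r - (a + b) * r"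
  proof -
    have "coord 1 1 \<xi> - coord 2 0 \<xi> - coord 0 2 \<xi> + coord 1 0 \<xi> + coord 0 1 \<xi> =
      - coord 1 1 \<xi> - coord 2 0 \<xi> - coord 0 2 \<xi> - coord 1 0 \<xi> - coord 0 1 \<xi> - (lambda2 (a + b) + a + b) * r"
      unfolding 3[symmetric] by (rule 4)
    moreover have "(lambda2 (a + b) + a + b) * r = lambda2 (a + b) * r + (a + b) * r" by (simp add: algebra_simps)
    ultimately have "coord 1 1 \<xi> + coord 1 1 \<xi> + lambda2 (a + b) * r + ((a + b) * r + (a + b) * r + (a + b) * r + (a + b) * r + (a + b) * r) = 0"
      unfolding 10 01 by (simp add: algebra_simps)
    moreover have "\<forall>c l s :: 3. c + c + l + (s + s + s + s + s) = 0 \<longrightarrow> c = l - s"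
      unfolding all_3 by simp
    ultimately show ?thesis by blast
  qed
  have "Poly_Mapping.lookup (2 * y) 0 = n + n" unfolding mult_2[of y] lookup_add ny ..
  then have "TG_coeff (h1 (\<xi>, y)) = coord 0 0 \<xi> + (n + n)"
    by (simp only: TG_coeff_def h1.simps lookup_add lookup_mult_TG coord_def binom3_def simp_thms if_True mult_1)
  then show "TG_coeff (h1 (\<xi>, y)) = coord 2 0 \<xi> + coord 0 2 \<xi> - lambda2 (a + b) * r - (a + b) * r"
    unfolding 00 3 10 01 11 by (simp only: add_0_left char_3(3)) (simp add: algebra_simps char_3(3))
qed

section \<open>Cocycles in normal form\<close>

context two_chars
begin

text \<open>The action on the group ring, for any coefficients.\<close>

abbreviation rho :: "'g \<Rightarrow> 'r::comm_ring_1 group_ring \<Rightarrow> 'r group_ring" where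
  "rho \<equiv> \<lambda>\<gamma> x. group_elt i j \<gamma> * x"

lemma coord_tdlt:
  "coord a b (tdlt G rho m f g) = dlt G m (\<lambda>h. coord a b (f h)) g
     + (coord a b (Poly_Mapping.single (i (g 0), j (g 0)) 1 * f (shift m g)) - coord a b (f (shift m g)))"
  unfolding tdlt_def coord_add coord_diff group_elt_def by (simp add: dlt_hom[of "coord a b"] coord_add)

lemma solve_for: "- z = d + (p - q) \<Longrightarrow> d = - (p - q) - (z::3)"
  by (metis add_diff_cancel_right' diff_minus_eq_add minus_diff_commute uminus_add_conv_diff)

text \<open>The hypotheses \<open>e\<close> are the four components of \<open>\<delta>(u, v, 0, -\<kappa> T\<^sub>4) = d\<^sub>2(\<xi>, y)\<close>.\<close>

lemma eta_core:
  fixes u v :: "(nat \<Rightarrow> 'g) \<Rightarrow> 3 group_ring" and \<kappa> :: "(nat \<Rightarrow> 'g) \<Rightarrow> 3"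
  assumes cts: "cts T m u" "cts T m v" "cts T m \<kappa>"
    and y: "\<And>g. g \<in> tuples G (Suc m) \<Longrightarrow> \<exists>w. y g = w * TG"
    and e: "\<And>g. g \<in> tuples G (Suc m) \<Longrightarrow> tdlt G rho m u g = - \<xi> g * (tau1 - 1)"
      "\<And>g. g \<in> tuples G (Suc m) \<Longrightarrow> tdlt G rho m v g = - \<xi> g * (tau2 - 1)"
      "\<And>g. g \<in> tuples G (Suc m) \<Longrightarrow> \<xi> g * T3 + y g = 0"
      "\<And>g. g \<in> tuples G (Suc m) \<Longrightarrow> tdlt G rho m (\<lambda>h. - (Poly_Mapping.single 0 (\<kappa> h) * T4)) g = \<xi> g * T4 + y g"
  shows "coc G T m \<kappa>"
    "\<exists>w20 w02 w12 w21. wc m w20 \<kappa> w02 w12 w21 \<and> decomposable m (\<lambda>g. TG_coeff (h1 (\<xi> g, y g)) - zz m w20 \<kappa> w02 w12 w21 g)"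
proof -
  have x: "coord 0 0 (\<xi> g) = 0" "dlt G m \<kappa> g = 0" "coord 1 0 (\<xi> g) = (i (g 0) + j (g 0)) * \<kappa> (shift m g)"
      "coord 0 1 (\<xi> g) = (i (g 0) + j (g 0)) * \<kappa> (shift m g)"
    "coord 1 1 (\<xi> g) = lambda2 (i (g 0) + j (g 0)) * \<kappa> (shift m g) - (i (g 0) + j (g 0)) * \<kappa> (shift m g)"
    "TG_coeff (h1 (\<xi> g, y g)) = coord 2 0 (\<xi> g) + coord 0 2 (\<xi> g) - lambda2 (i (g 0) + j (g 0)) * \<kappa> (shift m g) - (i (g 0) + j (g 0)) * \<kappa> (shift m g)"
    if g: "g \<in> tuples G (Suc m)" for g
  proof -
    obtain w where w: "y g = w * TG" using y[OF g] by blast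
    have "dlt G m (\<lambda>h. Poly_Mapping.single 0 (\<kappa> h) * T4) g = Poly_Mapping.single 0 (dlt G m \<kappa> g) * T4"
      by (rule dlt_hom[of "\<lambda>r. Poly_Mapping.single 0 r * T4", symmetric]) (simp add: single_add distrib_right)
    then have "\<xi> g * T4 + y g = - (Poly_Mapping.single 0 (dlt G m \<kappa> g) * T4
       + (Poly_Mapping.single (i (g 0), j (g 0)) 1 * (Poly_Mapping.single 0 (\<kappa> (shift m g)) * T4) - Poly_Mapping.single 0 (\<kappa> (shift m g)) * T4))"
      unfolding e(4)[OF g, symmetric] by (simp add: tdlt_def dlt_minus group_elt_def)
    note * = omega_coordinates[OF w e(3)[OF g] this]
    show "coord 0 0 (\<xi> g) = 0" "dlt G m \<kappa> g = 0" "coord 1 0 (\<xi> g) = (i (g 0) + j (g 0)) * \<kappa> (shift m g)"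
      "coord 0 1 (\<xi> g) = (i (g 0) + j (g 0)) * \<kappa> (shift m g)"
      "coord 1 1 (\<xi> g) = lambda2 (i (g 0) + j (g 0)) * \<kappa> (shift m g) - (i (g 0) + j (g 0)) * \<kappa> (shift m g)"
      "TG_coeff (h1 (\<xi> g, y g)) = coord 2 0 (\<xi> g) + coord 0 2 (\<xi> g) - lambda2 (i (g 0) + j (g 0)) * \<kappa> (shift m g) - (i (g 0) + j (g 0)) * \<kappa> (shift m g)"
      by (fact *)+
  qed
  show \<kappa>: "coc G T m \<kappa>" using cts(3) x(2) by (simp add: coc_def)
  have cu: "cts T m (\<lambda>h. coord a b (u h))" "cts T m (\<lambda>h. coord a b (v h))" for a b by (rule dc_comp[OF cts(1)], rule dc_comp[OF cts(2)])
  let ?U = "\<lambda>a b h. coord a b (u h)" and ?V = "\<lambda>a b h. coord a b (v h)"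
  have dU: "dlt G m (?U a b) g = - (coord a b (Poly_Mapping.single (i (g 0), j (g 0)) 1 * u (shift m g)) - ?U a b (shift m g)) - coord a b (\<xi> g * (tau1 - 1))"
    if "g \<in> tuples G (Suc m)" for a b g
    by (rule solve_for[OF coord_tdlt[of a b m u g, unfolded e(1)[OF that] mult_minus_left coord_minus]])
  have dV: "dlt G m (?V a b) g = - (coord a b (Poly_Mapping.single (i (g 0), j (g 0)) 1 * v (shift m g)) - ?V a b (shift m g)) - coord a b (\<xi> g * (tau2 - 1))"
    if "g \<in> tuples G (Suc m)" for a b g
    by (rule solve_for[OF coord_tdlt[of a b m v g, unfolded e(2)[OF that] mult_minus_left coord_minus]])
  have pU: "coc G T m (?U 0 0)" and pV: "coc G T m (?V 0 0)"
    using cu by (auto simp: coc_def dU dV coord_tau1 coord_tau2 coord_act)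
  obtain a b where ab: "coc G T m a" "cts T m b"
    "\<And>g. g \<in> tuples G (Suc m) \<Longrightarrow> dlt G m b g = i (g 0) * ?U 1 0 (shift m g) + lambda2 (i (g 0)) * ?U 0 0 (shift m g) - i (g 0) * a (shift m g)"
    "decomposable m (\<lambda>g. i (g 0) * ?U 0 2 (shift m g) + j (g 0) * ?U 1 1 (shift m g) + i (g 0) * j (g 0) * ?U 0 1 (shift m g)
       + lambda2 (j (g 0)) * ?U 1 0 (shift m g) + i (g 0) * lambda2 (j (g 0)) * ?U 0 0 (shift m g)
       + i (g 0) * (?U 2 0 (shift m g) + b (shift m g)) + lambda2 (i (g 0)) * a (shift m g)
       + lambda2 (i (g 0) + j (g 0)) * \<kappa> (shift m g))" (is "decomposable m ?S")
    by (rule half_decomposable[OF \<kappa> pU cu(1) cu(1) cu(1) cu(1) cu(1) cu(1), of 0 1 0 2 1 0 1 1 2 0 2 1])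
      (simp_all only: dU coord_tau1 coord_act x, simp_all add: algebra_simps)
  interpret sw: two_chars G T j i by (rule swap)
  obtain a' b' where ab': "coc G T m a'" "cts T m b'"
    "\<And>g. g \<in> tuples G (Suc m) \<Longrightarrow> dlt G m b' g = j (g 0) * ?V 0 1 (shift m g) + lambda2 (j (g 0)) * ?V 0 0 (shift m g) - j (g 0) * a' (shift m g)"
    "sw.decomposable m (\<lambda>g. j (g 0) * ?V 2 0 (shift m g) + i (g 0) * ?V 1 1 (shift m g) + j (g 0) * i (g 0) * ?V 1 0 (shift m g)
       + lambda2 (i (g 0)) * ?V 0 1 (shift m g) + j (g 0) * lambda2 (i (g 0)) * ?V 0 0 (shift m g)
       + j (g 0) * (?V 0 2 (shift m g) + b' (shift m g)) + lambda2 (j (g 0)) * a' (shift m g)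
       + lambda2 (j (g 0) + i (g 0)) * \<kappa> (shift m g))" (is "sw.decomposable m ?S'")
    by (rule sw.half_decomposable[OF \<kappa> pV cu(2) cu(2) cu(2) cu(2) cu(2) cu(2), of 1 0 2 0 0 1 1 1 0 2 1 2])
      (simp_all only: dV coord_tau2 coord_act x, simp_all add: algebra_simps)
  \<comment> \<open>The equation for \<open>u\<^sub>2\<^sub>0\<close> involves \<open>u\<^sub>1\<^sub>0\<close> and \<open>u\<^sub>0\<^sub>0\<close>, which the cochain \<open>b\<close> trades for the cocycle \<open>a\<close>; the
  contribution \<open>(i + j) \<kappa>'\<close> of \<open>\<xi>\<^sub>1\<^sub>0\<close> accounts for the summand \<open>\<kappa>\<close>.\<close>
  let ?w20 = "\<lambda>h. a' h + \<kappa> h" and ?w02 = "\<lambda>h. a h + \<kappa> h" and ?w12 = "\<lambda>h. ?U 2 0 h + b h" and ?w21 = "\<lambda>h. ?V 0 2 h + b' h"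
  have "wc m ?w20 \<kappa> ?w02 ?w12 ?w21"
    unfolding wc_def
  proof (intro conjI ballI)
    show "coc G T m ?w20" "coc G T m \<kappa>" "coc G T m ?w02" by (intro coc_add \<kappa> ab(1) ab'(1))+
    show "cts T m ?w12" "cts T m ?w21"
      by (rule dc_comp2[OF cu(1) ab(2)], rule dc_comp2[OF cu(2) ab'(2)])
    fix g assume g: "g \<in> tuples G (Suc m)"
    show "dlt G m ?w12 g = - (i (g 0) * ?w02 (shift m g)) - j (g 0) * \<kappa> (shift m g)"
      unfolding dlt_add ab(3)[OF g] dU[OF g] coord_tau1 coord_act x[OF g] by (simp add: algebra_simps)
    show "dlt G m ?w21 g = - (i (g 0) * \<kappa> (shift m g)) - j (g 0) * ?w20 (shift m g)"
      unfolding dlt_add ab'(3)[OF g] dV[OF g] coord_tau2 coord_act x[OF g] by (simp add: algebra_simps)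
  qed
  moreover have "decomposable m (\<lambda>g. TG_coeff (h1 (\<xi> g, y g)) - zz m ?w20 \<kappa> ?w02 ?w12 ?w21 g)"
  proof (rule decomposable_cong)
    \<comment> \<open>\<open>\<xi>\<^sub>0\<^sub>2\<close> and \<open>\<xi>\<^sub>2\<^sub>0\<close> are eliminated by means of the equations for \<open>u\<^sub>1\<^sub>2\<close> and \<open>v\<^sub>2\<^sub>1\<close>.\<close>
    have dS: "decomposable m ?S'" using ab'(4) by (simp only: decomposable_swap)
    have dD: "decomposable m (dlt G m (\<lambda>h. ?U 1 2 h + ?V 2 1 h))" by (rule decomposable_dlt[OF dc_comp2[OF cu(1) cu(2)]])
    show "decomposable m (\<lambda>g. - (?S g + ?S' g + (i (g 0) * \<kappa> (shift m g) + j (g 0) * \<kappa> (shift m g)) + dlt G m (\<lambda>h. ?U 1 2 h + ?V 2 1 h) g))"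
      by (rule decomposable_minus[OF decomposable_add[OF decomposable_add[OF decomposable_add[OF ab(4) dS] decomposable_cup[OF \<kappa> \<kappa>]] dD]])
    fix g assume g: "g \<in> tuples G (Suc m)"
    show "TG_coeff (h1 (\<xi> g, y g)) - zz m ?w20 \<kappa> ?w02 ?w12 ?w21 g =
      - (?S g + ?S' g + (i (g 0) * \<kappa> (shift m g) + j (g 0) * \<kappa> (shift m g)) + dlt G m (\<lambda>h. ?U 1 2 h + ?V 2 1 h) g)"
      unfolding dlt_add dU[OF g] dV[OF g] coord_tau1 coord_tau2 coord_act x(6)[OF g] zz_def lambda2_add by (simp add: algebra_simps)
  qed
  ultimately show "\<exists>w20 w02 w12 w21. wc m w20 \<kappa> w02 w12 w21 \<and> decomposable m (\<lambda>g. TG_coeff (h1 (\<xi> g, y g)) - zz m w20 \<kappa> w02 w12 w21 g)" by blast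
qed

end

section \<open>The modules\<close>

lemma ideal_closed:
  fixes t :: "'r::comm_ring_1 group_ring"
  shows "\<exists>x. 0 = x * t" "\<exists>x. x * t = 0" "x = a * t \<Longrightarrow> y = b * t \<Longrightarrow> \<exists>c. x + y = c * t" "x = a * t \<Longrightarrow> \<exists>c. - x = c * t"
    "x = a * t \<Longrightarrow> \<exists>c. z * x = c * t" "\<exists>c. a * t + b * t = c * t" "\<exists>c. - (a * t) = c * t"
    "\<exists>c. z * (a * t) = c * t"
  by (metis mult_zero_left, metis mult_zero_left, metis distrib_right, metis mult_minus_left, metis mult.assoc,
      metis distrib_right, metis mult_minus_left, metis mult.assoc)

lemma carrier1_closed:
  "0 \<in> carrier1" "x \<in> carrier1 \<Longrightarrow> y \<in> carrier1 \<Longrightarrow> x + y \<in> carrier1" "x \<in> carrier1 \<Longrightarrow> - x \<in> carrier1"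
  "x \<in> carrier1 \<Longrightarrow> z * x \<in> carrier1"
  unfolding carrier1_def by (auto intro: ideal_closed)

lemma carrier2_closed:
  "0 \<in> carrier2" "x \<in> carrier2 \<Longrightarrow> y \<in> carrier2 \<Longrightarrow> x + y \<in> carrier2" "x \<in> carrier2 \<Longrightarrow> - x \<in> carrier2"
  "(a, b) \<in> carrier2 \<Longrightarrow> (z * a, z * b) \<in> carrier2"
  unfolding carrier2_def zero_prod_def by (auto intro: ideal_closed)

lemma carrier3_closed:
  "0 \<in> carrier3" "x \<in> carrier3 \<Longrightarrow> y \<in> carrier3 \<Longrightarrow> x + y \<in> carrier3" "x \<in> carrier3 \<Longrightarrow> - x \<in> carrier3"
  "(a, b, c, d) \<in> carrier3 \<Longrightarrow> (z * a, z * b, z * c, z * d) \<in> carrier3"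
  unfolding carrier3_def zero_prod_def by (auto intro: ideal_closed)

lemma d2_add: "d2 (x + y) = d2 x + d2 y"
  by (cases x; cases y) (simp add: algebra_simps)
lemma d2_0: "d2 0 = 0" by (simp add: zero_prod_def)
lemma d2_minus: "d2 (- x) = - d2 x"
  by (cases x) (simp add: algebra_simps)
lemma d2_diff: "d2 (x - y) = d2 x - d2 y"
  using d2_add[of x "- y"] by (simp add: d2_minus)

lemma to_module4_mem: "z \<in> to_module4 x \<longleftrightarrow> (\<exists>a \<in> carrier2. z = x + d2 a)"
  unfolding to_module4_def image_image image_iff ..

lemma carrier2_diff: "x \<in> carrier2 \<Longrightarrow> y \<in> carrier2 \<Longrightarrow> x - y \<in> carrier2"
  using carrier2_closed(2)[of x "- y"] carrier2_closed(3)[of y] by simp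

lemma to_module4_eq_iff: "to_module4 x = to_module4 y \<longleftrightarrow> (\<exists>a \<in> carrier2. x = y + d2 a)"
proof
  assume "to_module4 x = to_module4 y"
  moreover have "x \<in> to_module4 x" unfolding to_module4_mem by (rule bexI[of _ 0]) (simp_all add: d2_0 carrier2_closed)
  ultimately show "\<exists>a \<in> carrier2. x = y + d2 a" by (simp only: to_module4_mem)
next
  assume "\<exists>a \<in> carrier2. x = y + d2 a"
  then obtain a where a: "a \<in> carrier2" "x = y + d2 a" ..
  show "to_module4 x = to_module4 y"
  proof (intro equalityI subsetI)
    fix z assume "z \<in> to_module4 x"
    then obtain b where "b \<in> carrier2" "z = x + d2 b" unfolding to_module4_mem by blast
    then show "z \<in> to_module4 y" unfolding to_module4_mem using a
      by (intro bexI[of _ "a + b"]) (simp_all add: d2_add carrier2_closed add.assoc)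
  next
    fix z assume "z \<in> to_module4 y"
    then obtain b where "b \<in> carrier2" "z = y + d2 b" unfolding to_module4_mem by blast
    then show "z \<in> to_module4 x" unfolding to_module4_mem using a
      by (intro bexI[of _ "b - a"]) (simp_all add: d2_diff carrier2_diff)
  qed
qed

lemma comm_group_image:
  fixes S :: "'a::ab_group_add set"
  assumes "\<phi> ` S = carrier N" "0 \<in> S" "\<And>x y. x \<in> S \<Longrightarrow> y \<in> S \<Longrightarrow> x + y \<in> S" "\<And>x. x \<in> S \<Longrightarrow> - x \<in> S"
    and "\<And>x y. x \<in> S \<Longrightarrow> y \<in> S \<Longrightarrow> \<phi> (x + y) = \<phi> x \<otimes>\<^bsub>N\<^esub> \<phi> y" "\<phi> 0 = \<one>\<^bsub>N\<^esub>"
  shows "comm_group N"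
proof (rule comm_groupI)
  show "\<one>\<^bsub>N\<^esub> \<in> carrier N" using assms(1,2,6) by (metis imageI)
  show "\<And>x y. x \<in> carrier N \<Longrightarrow> y \<in> carrier N \<Longrightarrow> x \<otimes>\<^bsub>N\<^esub> y \<in> carrier N"
    unfolding assms(1)[symmetric] using assms(3) by (auto simp flip: assms(5))
  show "\<And>x y z. x \<in> carrier N \<Longrightarrow> y \<in> carrier N \<Longrightarrow> z \<in> carrier N \<Longrightarrow> x \<otimes>\<^bsub>N\<^esub> y \<otimes>\<^bsub>N\<^esub> z = x \<otimes>\<^bsub>N\<^esub> (y \<otimes>\<^bsub>N\<^esub> z)"
    unfolding assms(1)[symmetric] using assms(3) by (auto simp: add.assoc simp flip: assms(5))
  show "\<And>x y. x \<in> carrier N \<Longrightarrow> y \<in> carrier N \<Longrightarrow> x \<otimes>\<^bsub>N\<^esub> y = y \<otimes>\<^bsub>N\<^esub> x"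
    unfolding assms(1)[symmetric] by (auto simp: add.commute simp flip: assms(5))
  show "\<And>x. x \<in> carrier N \<Longrightarrow> \<one>\<^bsub>N\<^esub> \<otimes>\<^bsub>N\<^esub> x = x"
    unfolding assms(1)[symmetric] assms(6)[symmetric] using assms(2) by (auto simp flip: assms(5))
  show "\<exists>y\<in>carrier N. y \<otimes>\<^bsub>N\<^esub> x = \<one>\<^bsub>N\<^esub>" if x: "x \<in> carrier N" for x
  proof -
    obtain x' where "x' \<in> S" "x = \<phi> x'" using x unfolding assms(1)[symmetric] by blast
    then show ?thesis unfolding assms(1)[symmetric] assms(6)[symmetric]
      using assms(4)[of x'] by (intro bexI[of _ "\<phi> (- x')"]) (simp_all flip: assms(5))
  qed
qed

context two_chars
begin

lemma rho_dc: "dc T (\<lambda>\<gamma>. F (i \<gamma>) (j \<gamma>))"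
  using dc_comp2[OF charactersD(1)[OF i_char] charactersD(1)[OF j_char]] .

text \<open>The diagonal actions on \<open>\<M>\<^sub>2\<close> and \<open>\<M>\<^sub>3\<close>.\<close>

abbreviation rho2 :: "'g \<Rightarrow> 3 group_ring \<times> 3 group_ring \<Rightarrow> 3 group_ring \<times> 3 group_ring" where
  "rho2 \<equiv> \<lambda>\<gamma> (x, y). (group_elt i j \<gamma> * x, group_elt i j \<gamma> * y)"

abbreviation rho3 :: "'g \<Rightarrow> 3 group_ring \<times> 3 group_ring \<times> 3 group_ring \<times> 3 group_ring \<Rightarrow> 3 group_ring \<times> 3 group_ring \<times> 3 group_ring \<times> 3 group_ring" where
  "rho3 \<equiv> \<lambda>\<gamma> (a, b, x, y). (group_elt i j \<gamma> * a, group_elt i j \<gamma> * b, group_elt i j \<gamma> * x, group_elt i j \<gamma> * y)"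

lemma pmod1: "pmod G T (module1 i j) carrier1 rho (\<lambda>x. x)"
  unfolding module1_def
proof (rule pmod_additive)
  show "dc T rho" using rho_dc[of "\<lambda>a b x. Poly_Mapping.single (a, b) 1 * x"] by (simp add: group_elt_def)
qed (simp_all add: carrier1_closed distrib_left)

lemma pmod2: "pmod G T (module2 i j) carrier2 rho2 (\<lambda>x. x)"
  unfolding module2_def
proof (rule pmod_additive)
  show "dc T rho2" using rho_dc[of "\<lambda>a b (x, y). (Poly_Mapping.single (a, b) 1 * x, Poly_Mapping.single (a, b) 1 * y)"]
    by (simp add: group_elt_def)
qed (auto simp: carrier2_closed distrib_left)

lemma pmod3: "pmod G T (module3 i j) carrier3 rho3 (\<lambda>x. x)"
  unfolding module3_def
proof (rule pmod_additive)
  show "dc T rho3" using rho_dc[of "\<lambda>a b (x, y, z, w). (Poly_Mapping.single (a, b) 1 * x, Poly_Mapping.single (a, b) 1 * y,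
      Poly_Mapping.single (a, b) 1 * z, Poly_Mapping.single (a, b) 1 * w)"]
    by (simp add: group_elt_def)
qed (auto simp: carrier3_closed distrib_left)

lemma rho3_d2: "rho3 \<gamma> (d2 x) = d2 (rho2 \<gamma> x)"
  by (cases x) (simp add: algebra_simps)

lemma rho3_image:
  "rho3 \<gamma> ` to_module4 x = to_module4 (rho3 \<gamma> x)"
proof -
  have add: "rho3 \<gamma> (x + y) = rho3 \<gamma> x + rho3 \<gamma> y" for x y :: "3 group_ring \<times> 3 group_ring \<times> 3 group_ring \<times> 3 group_ring"
    by (cases x; cases y) (simp add: distrib_left)
  show ?thesis
  proof (intro equalityI subsetI)
    fix z assume "z \<in> rho3 \<gamma> ` to_module4 x"
    then obtain a where a: "a \<in> carrier2" "z = rho3 \<gamma> (x + d2 a)" by (elim imageE) (simp only: to_module4_mem, blast)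
    then have "rho2 \<gamma> a \<in> carrier2" by (cases a) (simp add: carrier2_closed)
    then show "z \<in> to_module4 (rho3 \<gamma> x)" unfolding to_module4_mem
      using a(2)[unfolded add rho3_d2] by blast
  next
    fix z assume "z \<in> to_module4 (rho3 \<gamma> x)"
    then obtain a1 a2 where a: "(a1, a2) \<in> carrier2" "z = rho3 \<gamma> x + d2 (a1, a2)" unfolding to_module4_mem by (metis surj_pair)
    let ?h = "Poly_Mapping.single (- i \<gamma>, - j \<gamma>) 1"
    have h: "group_elt i j \<gamma> * (?h * y) = y" for y :: "3 group_ring"
      by (simp add: group_elt_def mult_single single_one flip: mult.assoc zero_prod_def)
    have "z = rho3 \<gamma> (x + d2 (?h * a1, ?h * a2))" unfolding add rho3_d2 a(2) by (simp add: h)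
    then show "z \<in> rho3 \<gamma> ` to_module4 x" unfolding to_module4_def image_image
      using carrier2_closed(4)[OF a(1)] by (intro image_eqI[of _ _ "(?h * a1, ?h * a2)"])
  qed
qed

lemma pmod4: "pmod G T (module4 i j) carrier3 rho3 to_module4"
proof -
  let ?M = "module3 i j :: ('g, 3 group_ring \<times> 3 group_ring \<times> 3 group_ring \<times> 3 group_ring) gmodule" and ?N = "d2 ` carrier2 :: (3 group_ring \<times> 3 group_ring \<times> 3 group_ring \<times> 3 group_ring) set"
  have coset: "?N #>\<^bsub>?M\<^esub> x = to_module4 x" for x
    by (auto simp: r_coset_def to_module4_def image_image module3_def additive_module_def add.commute simp del: d2.simps)
  have onto: "to_module4 ` carrier3 = carrier (module4 i j :: ('g, (3 group_ring \<times> 3 group_ring \<times> 3 group_ring \<times> 3 group_ring) set) gmodule)"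
    unfolding module4_def quotient_module_def FactGroup_def RCOSETS_def coset
    by (auto simp: module3_def additive_module_def)
  have mult: "to_module4 (x + y) = to_module4 x \<otimes>\<^bsub>module4 i j\<^esub> to_module4 y" for x y :: "3 group_ring \<times> 3 group_ring \<times> 3 group_ring \<times> 3 group_ring"
  proof -
    have "to_module4 x \<otimes>\<^bsub>module4 i j\<^esub> to_module4 y = {a + b | a b. a \<in> to_module4 x \<and> b \<in> to_module4 y}"
      by (simp add: module4_def quotient_module_def FactGroup_def set_mult_def module3_def additive_module_def
          del: split_paired_Ex split_paired_All) blast
    also have "\<dots> = to_module4 (x + y)"
    proof (intro equalityI subsetI)
      fix z assume "z \<in> {a + b | a b. a \<in> to_module4 x \<and> b \<in> to_module4 y}"
      then obtain a b where "a \<in> carrier2" "b \<in> carrier2" "z = x + d2 a + (y + d2 b)" unfolding to_module4_mem by blast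
      then show "z \<in> to_module4 (x + y)" unfolding to_module4_mem
        by (intro bexI[of _ "a + b"]) (simp_all add: d2_add carrier2_closed algebra_simps)
    next
      fix z assume "z \<in> to_module4 (x + y)"
      then obtain a where a: "a \<in> carrier2" "z = x + y + d2 a" unfolding to_module4_mem by blast
      have "x + d2 a \<in> to_module4 x" "y + d2 0 \<in> to_module4 y" using a(1) carrier2_closed(1) unfolding to_module4_mem by blast+
      then show "z \<in> {a + b | a b. a \<in> to_module4 x \<and> b \<in> to_module4 y}"
        unfolding a(2) by (intro CollectI exI[of _ "x + d2 a"] exI[of _ "y + d2 0"]) (simp add: d2_0 algebra_simps)
    qed
    finally show ?thesis ..
  qed
  have one: "to_module4 0 = \<one>\<^bsub>module4 i j :: ('g, (3 group_ring \<times> 3 group_ring \<times> 3 group_ring \<times> 3 group_ring) set) gmodule\<^esub>"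
    by (simp add: module4_def quotient_module_def FactGroup_def to_module4_def)
  interpret M3: pmod G T ?M carrier3 rho3 "\<lambda>x. x" by (rule pmod3)
  show ?thesis
  proof (intro pmod.intro top_grp_axioms pmod_axioms.intro)
    show "comm_group (module4 i j :: ('g, (3 group_ring \<times> 3 group_ring \<times> 3 group_ring \<times> 3 group_ring) set) gmodule)"
      by (rule comm_group_image[OF onto carrier3_closed(1,2,3) mult one])
  qed (use M3.S_0 M3.S_add M3.S_minus M3.rho_in M3.rho_add M3.rho_dc onto mult in
      \<open>auto simp: module4_def quotient_module_def module3_def additive_module_def rho3_image\<close>)
qed

end

section \<open>The Positselski map on cochains\<close>

lemma (in quotient_char) dltQ_dltQ:
  assumes "cts T m f" "g \<in> tuples G (Suc (Suc m))"
  shows "dltQ G \<theta> (Suc m) (dltQ G \<theta> m f) g q = 0"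
proof -
  note r = corresponds_dh[OF corresponds_dh[OF corresponds_exists(1)[OF assms(1)]]]
  show ?thesis
    using corresponds_unique[OF r r assms(2), of "\<lambda>_. 0" q] by (simp add: dh_dh)
qed

text \<open>\<open>h1_coeff\<close> is the composition of \<open>h\<^sub>1\<close> with the identification of \<open>\<int>/3\<int>[G]T\<^sub>G\<close> with \<open>\<int>/3\<int>\<close>.\<close>

definition h1_coeff :: "3 group_ring \<times> 3 group_ring \<Rightarrow> 3" where "h1_coeff x = TG_coeff (h1 x)"

lemma h1_coeff_add: "h1_coeff (x + y) = h1_coeff x + h1_coeff y"
  by (cases x; cases y) (simp add: h1_coeff_def TG_coeff_def lookup_add algebra_simps)
lemma h1_coeff_0: "h1_coeff 0 = 0" using h1_coeff_add[of 0 0] by simp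
lemma h1_coeff_minus: "h1_coeff (- x) = - h1_coeff x" using h1_coeff_add[of x "- x"] by (simp add: h1_coeff_0 eq_neg_iff_add_eq_0 add.commute)
lemma h1_coeff_diff: "h1_coeff (x - y) = h1_coeff x - h1_coeff y" using h1_coeff_add[of x "- y"] by (simp add: h1_coeff_minus)

lemma h1_coeff_eq: "h1_coeff (x, y) = coord 0 0 x + (Poly_Mapping.lookup y 0 + Poly_Mapping.lookup y 0)"
  by (simp only: h1_coeff_def TG_coeff_def h1.simps mult_2[of y] lookup_add lookup_mult_TG coord_def binom3_def simp_thms if_True mult_1)

text \<open>This makes the Positselski map independent of the choice of \<open>\<omega>\<close>.\<close>

lemma h1_coeff_kernel:
  assumes "x \<in> carrier2" "d2 x = 0"
  shows "h1_coeff x = 0"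
proof -
  obtain a w where x: "x = (a, w * TG)" using assms(1) by (auto simp: carrier2_def)
  define n where "n = (\<Sum>q\<in>UNIV. Poly_Mapping.lookup w q)"
  have e: "a * (tau1 - 1) = 0" "a * (tau2 - 1) = 0" "a * T3 + w * TG = 0"
    using assms(2) unfolding x by (simp_all add: zero_prod_def)
  have z: "coord s t (a * (tau1 - 1)) = 0" "coord s t (a * (tau2 - 1)) = 0" "coord s t (a * T3 + w * TG) = 0" for s t
    by (simp_all only: e coord_0)
  note cy = coord_TG[of "w * TG" n, OF lookup_mult_TG[of w, folded n_def]]
  have c: "coord 0 0 a = 0" "coord 1 0 a = 0" "coord 0 1 a = 0" "coord 1 1 a = 0" "coord 2 0 a = 0" "coord 0 2 a = 0"
    using z(1)[of 1 0] z(1)[of 2 0] z(1)[of 1 1] z(1)[of 2 1] z(2)[of 2 1] z(1)[of 1 2] unfolding coord_tau1 coord_tau2 by blast+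
  have d: "coord 2 1 a = 0" "coord 1 2 a = 0" using z(2)[of 2 2] z(1)[of 2 2] unfolding coord_tau1 coord_tau2 by blast+
  have "n = 0" using z(3)[of 2 2, unfolded coord_add mult_T coord_act cy c d] by (simp add: char_3)
  then show ?thesis unfolding x h1_coeff_eq by (simp add: c lookup_mult_TG n_def[symmetric])
qed

lemma h1_coeff_cong: "x \<in> carrier2 \<Longrightarrow> y \<in> carrier2 \<Longrightarrow> d2 x = d2 y \<Longrightarrow> h1_coeff x = h1_coeff y"
  using h1_coeff_kernel[of "x - y"] by (simp add: carrier2_diff d2_diff h1_coeff_diff)

text \<open>Modulo \<open>\<tau>\<^sub>4\<close>, the element \<open>\<tau>\<^sub>1\<^sup>k \<tau>\<^sub>2\<^sup>l\<close> is the power of \<open>\<tau>\<^sub>3\<close> with exponent \<open>2(k + l)\<close>.\<close>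

lemma T4_single: "Poly_Mapping.single (k, l) r * T4 = Poly_Mapping.single (2 * (k + l), 2 * (k + l)) r * T4"
  using z3_cases[of k] z3_cases[of l]
  by (elim disjE; simp add: T_expand distrib_left mult_single z3_arith add_ac)

lemma T3_single: "Poly_Mapping.single (s, s) r * T3 = Poly_Mapping.single 0 r * T3"
  using z3_cases[of s]
  by (elim disjE; simp add: T_expand distrib_left mult_single z3_arith add_ac zero_prod_def)

text \<open>Since \<open>\<tau>\<^sub>3 T\<^sub>3 = T\<^sub>3\<close>, replacing powers of \<open>\<tau>\<^sub>3\<close> by \<open>1\<close> changes \<open>x T\<^sub>4\<close> by some \<open>z T\<^sub>4\<close> with \<open>z T\<^sub>3 = 0\<close>.\<close>

lemma T4_normal:
  fixes x :: "3 group_ring"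
  shows "\<exists>z r. z * T3 = 0 \<and> x * T4 = z * T4 + Poly_Mapping.single 0 r * T4"
proof -
  let ?z = "\<Sum>q\<in>UNIV. Poly_Mapping.single (2 * (fst q + snd q), 2 * (fst q + snd q)) (Poly_Mapping.lookup x q)
     - Poly_Mapping.single 0 (Poly_Mapping.lookup x q)"
  let ?r = "\<Sum>q\<in>UNIV. Poly_Mapping.lookup x q"
  have r: "Poly_Mapping.single 0 ?r = (\<Sum>q\<in>UNIV. Poly_Mapping.single (0 :: 3 \<times> 3) (Poly_Mapping.lookup x q))"
    by (rule poly_mapping_eqI) (simp add: lookup_single lookup_sum when_def)
  have z3: "?z * T3 = 0"
    by (simp only: sum_distrib_right left_diff_distrib T3_single diff_self sum.neutral_const)
  have x: "x * T4 = (\<Sum>q\<in>UNIV. Poly_Mapping.single q (Poly_Mapping.lookup x q) * T4)"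
    by (subst single_decomp[of x]) (simp only: sum_distrib_right)
  have q: "Poly_Mapping.single q s * T4 = Poly_Mapping.single (2 * (fst q + snd q), 2 * (fst q + snd q)) s * T4" for q and s :: 3
    using T4_single[of "fst q" "snd q" s] by simp
  have "x * T4 = (\<Sum>q\<in>UNIV. Poly_Mapping.single (2 * (fst q + snd q), 2 * (fst q + snd q)) (Poly_Mapping.lookup x q) * T4)"
    unfolding x by (intro sum.cong refl q)
  then have "x * T4 = ?z * T4 + Poly_Mapping.single 0 ?r * T4"
    unfolding r sum_distrib_right sum.distrib[symmetric] by (simp add: left_diff_distrib)
  with z3 show ?thesis by blast
qed

text \<open>Representatives \<open>(u, v, 0, -r T\<^sub>4)\<close> of the elements of \<open>\<M>\<^sub>4 \<otimes> \<int>/3\<close>; \<open>n\<close> is the triple \<open>(u, v, r)\<close>.\<close>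

lemma module4_normal_form:
  fixes x :: "3 group_ring \<times> 3 group_ring \<times> 3 group_ring \<times> 3 group_ring"
  assumes "x \<in> carrier3"
  shows "\<exists>n. \<exists>b \<in> carrier2. x = (fst n, fst (snd n), 0, - (Poly_Mapping.single 0 (snd (snd n)) * T4)) + d2 b"
proof -
  obtain x1 x2 x3 x4 where x: "x = (x1, x2, x3 * T3, x4 * T4)" using assms by (auto simp: carrier3_def)
  obtain z r where z: "z * T3 = 0" "(x4 - x3) * T4 = z * T4 + Poly_Mapping.single 0 r * T4" using T4_normal[of "x4 - x3"] by blast
  let ?b = "(x3 + z, 0)"
  have b: "?b \<in> carrier2" using ideal_closed(1)[of TG] by (auto simp: carrier2_def)
  have "x4 * T4 = x3 * T4 + (x4 - x3) * T4" by (simp add: left_diff_distrib)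
  then have 4: "x4 * T4 = - (Poly_Mapping.single 0 (- r) * T4) + ((x3 + z) * T4 + 0)"
    unfolding z(2) by (simp add: algebra_simps single_uminus)
  have "x = (x1 + (x3 + z) * (tau1 - 1), x2 + (x3 + z) * (tau2 - 1), 0, - (Poly_Mapping.single 0 (- r) * T4)) + d2 ?b"
    unfolding x by (simp only: d2.simps plus_prod_def fst_conv snd_conv 4[symmetric]) (simp add: distrib_right left_diff_distrib z(1))
  then show ?thesis using b
    by (intro exI[of _ "(x1 + (x3 + z) * (tau1 - 1), x2 + (x3 + z) * (tau2 - 1), - r)"] bexI[of _ ?b]) (simp_all only: fst_conv snd_conv)
qed

context two_chars
begin

lemma pair_char: "quotient_char G T (\<lambda>x. (i x, j x))"
proof
  show "dc T (\<lambda>x. (i x, j x))" by (rule rho_dc)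
  show "\<exists>s\<in>carrier G. (i s, j s) = q" for q using surj[of "fst q" "snd q"] by (cases q) auto
qed (use charactersD(2)[OF i_char] charactersD(2)[OF j_char] in auto)

text \<open>The module \<open>\<int>/3[G]\<close> as an induced module.\<close>

lemma lookup_tdlt:
  "Poly_Mapping.lookup (tdlt G rho m f g) q = dltQ G (\<lambda>x. (i x, j x)) m (\<lambda>h. Poly_Mapping.lookup (f h)) g q"
proof -
  have "Poly_Mapping.lookup (dlt G m f g) q = dlt G m (\<lambda>h. Poly_Mapping.lookup (f h) q) g"
    by (rule dlt_hom[of "\<lambda>x. Poly_Mapping.lookup x q"]) (simp add: lookup_add)
  then show ?thesis
    by (simp add: tdlt_def dltQ_def lookup_add lookup_minus group_elt_def lookup_single_mult)
qed

lemma tdlt_tdlt: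
  fixes f :: "(nat \<Rightarrow> 'g) \<Rightarrow> 3 group_ring"
  assumes "cts T m f" "g \<in> tuples G (Suc (Suc m))"
  shows "tdlt G rho (Suc m) (tdlt G rho m f) g = 0"
proof (rule poly_mapping_eqI)
  fix q
  have "cts T m (\<lambda>h. Poly_Mapping.lookup (f h))" by (rule dc_comp[OF assms(1)])
  moreover have "(\<lambda>h. Poly_Mapping.lookup (tdlt G rho m f h)) = dltQ G (\<lambda>x. (i x, j x)) m (\<lambda>h. Poly_Mapping.lookup (f h))"
    by (simp add: fun_eq_iff lookup_tdlt)
  ultimately show "Poly_Mapping.lookup (tdlt G rho (Suc m) (tdlt G rho m f) g) q = Poly_Mapping.lookup 0 q"
    using quotient_char.dltQ_dltQ[OF pair_char _ assms(2)] by (simp add: lookup_tdlt)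
qed

lemma dlt_fst: "fst (dlt G m c g) = dlt G m (\<lambda>h. fst (c h)) g" and dlt_snd: "snd (dlt G m c g) = dlt G m (\<lambda>h. snd (c h)) g"
  by (rule dlt_hom; simp)+

lemma tdlt3_components:
  "tdlt G rho3 m c g = (tdlt G rho m (\<lambda>h. fst (c h)) g, tdlt G rho m (\<lambda>h. fst (snd (c h))) g,
     tdlt G rho m (\<lambda>h. fst (snd (snd (c h)))) g, tdlt G rho m (\<lambda>h. snd (snd (snd (c h)))) g)"
  by (intro prod_eqI) (simp_all add: tdlt_def dlt_fst dlt_snd case_prod_beta)

lemma tdlt3_tdlt3:
  assumes "cts T m c" "g \<in> tuples G (Suc (Suc m))"
  shows "tdlt G rho3 (Suc m) (tdlt G rho3 m c) g = 0"
proof -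
  have "cts T m (\<lambda>h. fst (c h))" "cts T m (\<lambda>h. fst (snd (c h)))" "cts T m (\<lambda>h. fst (snd (snd (c h))))"
    "cts T m (\<lambda>h. snd (snd (snd (c h))))"
    by (rule dc_comp[OF assms(1)])+
  then show ?thesis
    unfolding tdlt3_components[of "Suc m"] unfolding tdlt3_components[of m] fst_conv snd_conv
    using assms(2) by (simp add: tdlt_tdlt zero_prod_def)
qed

lemma tdlt_cong:
  assumes "g \<in> tuples G (Suc m)" "\<And>h. h \<in> tuples G m \<Longrightarrow> f h = f' h"
  shows "tdlt G r m f g = tdlt G r m f' g"
  unfolding tdlt_def using assms dlt_cong[OF grp assms] by simp

lemma tdlt_d2: "tdlt G rho3 m (\<lambda>h. d2 (f h)) g = d2 (tdlt G rho2 m f g)"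
  unfolding tdlt_def d2_add d2_diff rho3_d2 by (simp only: dlt_hom[of d2, OF d2_add])

lemma h1_coeff_rho2: "x \<in> carrier2 \<Longrightarrow> h1_coeff (rho2 \<gamma> x) = h1_coeff x"
  by (auto simp: carrier2_def h1_coeff_eq group_elt_def coord_act lookup_mult_TG lookup_single_mult)

lemma h1_coeff_tdlt:
  assumes "f \<in> pmod.pc G T carrier2 m" "g \<in> tuples G (Suc m)"
  shows "h1_coeff (tdlt G rho2 m f g) = dlt G m (\<lambda>h. h1_coeff (f h)) g"
proof -
  have "f (shift m g) \<in> carrier2" using assms by (simp add: pmod.pc_def[OF pmod2])
  from h1_coeff_rho2[OF this] show ?thesis unfolding tdlt_def h1_coeff_add h1_coeff_diff by (simp add: dlt_hom[of h1_coeff, OF h1_coeff_add])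
qed

text \<open>The class \<open>[c]\<close> of a cochain \<open>c\<close> with values in \<open>\<M>\<^sub>3 \<otimes> \<int>/3\<close>, and the Positselski map on classes of\n  degree \<open>m\<close>.\<close>

abbreviation cl4 where "cl4 m c \<equiv> cohomology_class G T (module4 i j) m (cochain_map G m to_module4 c)"

abbreviation eta where "eta m X \<equiv> positselski_map G T i j (Suc m) X"

text \<open>The value of \<open>\<eta>\<close> may be computed from any \<open>c\<close> and \<open>\<omega>\<close>. Two cochains \<open>c\<close> that represent the same class differ
  by a coboundary and by \<open>d\<^sub>2 f\<close> for a cochain \<open>f\<close>, and \<open>\<omega>\<close> changes by \<open>\<delta>f\<close> and by an element of the
  kernel of \<open>d\<^sub>2\<close>.\<close>

lemma eta_eq:
  assumes c: "c \<in> pmod.pc G T carrier3 m" and \<omega>: "\<omega> \<in> pmod.pc G T carrier2 (Suc m)"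
    and e: "\<And>g. g \<in> tuples G (Suc m) \<Longrightarrow> tdlt G rho3 m c g = d2 (\<omega> g)"
  shows "eta m (cl4 m c) = cls (Suc m) (\<lambda>g. h1_coeff (\<omega> g))"
proof -
  interpret M2: pmod G T "module2 i j" carrier2 rho2 "\<lambda>x. x" by (rule pmod2)
  interpret M3: pmod G T "module3 i j" carrier3 rho3 "\<lambda>x. x" by (rule pmod3)
  interpret M4: pmod G T "module4 i j" carrier3 rho3 to_module4 by (rule pmod4)
  have cbeq: "coboundary G (module3 i j) m (cochain_map G m (\<lambda>x. x) c1) = cochain_map G (Suc m) d2 (cochain_map G (Suc m) (\<lambda>x. x) \<omega>1)
      \<longleftrightarrow> (\<forall>g \<in> tuples G (Suc m). tdlt G rho3 m c1 g = d2 (\<omega>1 g))" if "c1 \<in> M3.pc m" for c1 \<omega>1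
    unfolding M3.coboundary_eq[OF that] by (auto simp: cochain_map_def fun_eq_iff)
  have t4: "cochain_map G m to_module4 (cochain_map G m (\<lambda>x. x) c1) = cochain_map G m to_module4 c1" for c1 :: "(nat \<Rightarrow> 'g) \<Rightarrow> 3 group_ring \<times> 3 group_ring \<times> 3 group_ring \<times> 3 group_ring"
    by (auto simp: cochain_map_def fun_eq_iff)
  have th: "cochain_map G (Suc m) (TG_coeff \<circ> h1) (cochain_map G (Suc m) (\<lambda>x. x) \<omega>1) = restrict (\<lambda>g. h1_coeff (\<omega>1 g)) (tuples G (Suc m))" for \<omega>1
    by (auto simp: cochain_map_def fun_eq_iff h1_coeff_def)
  show ?thesis
    unfolding positselski_map_def diff_Suc_1
  proof (rule the_equality)
    show "\<exists>c'\<in>cochains G T (module3 i j) m. \<exists>\<omega>'\<in>cochains G T (module2 i j) (Suc m).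
       cochain_map G m to_module4 c' \<in> cl4 m c \<and>
       coboundary G (module3 i j) m c' = cochain_map G (Suc m) d2 \<omega>' \<and>
       cls (Suc m) (\<lambda>g. h1_coeff (\<omega> g)) = cohomology_class G T Z3_module (Suc m) (cochain_map G (Suc m) (TG_coeff \<circ> h1) \<omega>')"
      using M4.class_self[OF c] e
      by (intro bexI[OF _ M3.cm_cochain[OF c]] bexI[OF _ M2.cm_cochain[OF \<omega>]] conjI) (simp_all add: t4 cbeq[OF c] th e del: d2.simps)
  next
    fix Y assume "\<exists>c'\<in>cochains G T (module3 i j) m. \<exists>\<omega>'\<in>cochains G T (module2 i j) (Suc m).
       cochain_map G m to_module4 c' \<in> cl4 m c \<and>
       coboundary G (module3 i j) m c' = cochain_map G (Suc m) d2 \<omega>' \<and>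
       Y = cohomology_class G T Z3_module (Suc m) (cochain_map G (Suc m) (TG_coeff \<circ> h1) \<omega>')"
    then obtain c1 \<omega>1 where c1: "c1 \<in> M3.pc m" and \<omega>1: "\<omega>1 \<in> M2.pc (Suc m)" and cl: "cochain_map G m to_module4 c1 \<in> cl4 m c"
      and e1: "\<forall>g \<in> tuples G (Suc m). tdlt G rho3 m c1 g = d2 (\<omega>1 g)" and Y: "Y = cls (Suc m) (\<lambda>g. h1_coeff (\<omega>1 g))"
      unfolding M3.cochains_eq M2.cochains_eq by (auto simp only: cbeq t4 th)
    obtain b where b: "b \<in> M4.bd m" "cochain_map G m to_module4 c1 = cochain_map G m to_module4 (\<lambda>g. b g + c g)"
      using cl unfolding M4.class_eq[OF c] by auto
    have bpc: "b \<in> M3.pc m" using M4.bd_pc[OF b(1)] by (simp add: M4.pc_def M3.pc_def)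
    \<comment> \<open>The choice depends on the value of \<open>c1 h - (b h + c h)\<close> only, which makes \<open>f\<close> continuous.\<close>
    define f where "f = (\<lambda>h. SOME a. a \<in> carrier2 \<and> c1 h - (b h + c h) = d2 a)"
    have f: "f h \<in> carrier2" "c1 h = b h + c h + d2 (f h)" if "h \<in> tuples G m" for h
    proof -
      have "to_module4 (c1 h) = to_module4 (b h + c h)" using fun_cong[OF b(2), of h] that by (simp add: cochain_map_def)
      then obtain a where "a \<in> carrier2" "c1 h = b h + c h + d2 a" unfolding to_module4_eq_iff by blast
      then have "a \<in> carrier2 \<and> c1 h - (b h + c h) = d2 a" by (simp del: d2.simps)
      then have "\<exists>a. a \<in> carrier2 \<and> c1 h - (b h + c h) = d2 a" by (rule exI)
      from someI_ex[OF this] show "f h \<in> carrier2" "c1 h = b h + c h + d2 (f h)"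
        unfolding f_def by (simp_all add: algebra_simps del: d2.simps)
    qed
    have "cts T m (\<lambda>h. c1 h - (b h + c h))"
      using c1 c bpc by (intro dc_comp2[of _ _ _ "(-)"] dc_comp2[of _ _ _ "(+)"]) (simp_all add: M3.pc_def)
    then have "cts T m f" unfolding f_def by (rule dc_comp)
    then have fpc: "f \<in> M2.pc m" using f(1) by (simp add: M2.pc_def)
    have bz: "tdlt G rho3 m b g = 0" if g: "g \<in> tuples G (Suc m)" for g
    proof (cases m)
      case 0
      then have "b = (\<lambda>_. 0)" using b(1) by (simp add: M4.bd_def)
      then show ?thesis using M3.tdlt_0[OF g] by simp
    next
      case (Suc k)
      then obtain e where e: "e \<in> M4.pc k" "\<forall>g \<in> tuples G m. b g = tdlt G rho3 k e g"
        using b(1) unfolding M4.bd_def by auto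
      have "tdlt G rho3 m b g = tdlt G rho3 (Suc k) (tdlt G rho3 k e) g"
        unfolding Suc by (rule tdlt_cong) (use g e(2) Suc in auto)
      then show ?thesis using tdlt3_tdlt3[of k e g] e(1) g Suc by (simp add: M4.pc_def)
    qed
    have d2f: "(\<lambda>h. d2 (f h)) \<in> M3.pc m"
    proof -
      have "cts T m f" "\<And>h. h \<in> tuples G m \<Longrightarrow> f h \<in> carrier2" using fpc by (simp_all add: M2.pc_def)
      then show ?thesis unfolding M3.pc_def using d2_carrier dc_comp[of _ f d2] by blast
    qed
    have "h1_coeff (\<omega>1 g) = h1_coeff (\<omega> g) + dlt G m (\<lambda>h. h1_coeff (f h)) g" if g: "g \<in> tuples G (Suc m)" for g
    proof -
      have "d2 (\<omega>1 g) = tdlt G rho3 m (\<lambda>h. (b h + c h) + d2 (f h)) g"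
        using tdlt_cong[OF g f(2), where r = rho3] e1[rule_format, OF g] by (simp only:)
      also have "\<dots> = d2 (\<omega> g) + d2 (tdlt G rho2 m f g)"
        by (simp only: M3.tdlt_add[OF M3.pc_add[OF bpc c] d2f g] M3.tdlt_add[OF bpc c g] bz[OF g] e[OF g] tdlt_d2 add_0_left)
      also have "\<dots> = d2 (\<omega> g + tdlt G rho2 m f g)" by (simp only: d2_add)
      finally have "h1_coeff (\<omega>1 g) = h1_coeff (\<omega> g + tdlt G rho2 m f g)"
        using \<omega> \<omega>1 g M2.tdlt_in[OF fpc g] by (intro h1_coeff_cong carrier2_closed) (simp_all add: M2.pc_def)
      then show ?thesis by (simp add: h1_coeff_add h1_coeff_tdlt[OF fpc g])
    qed
    moreover have "cts T (Suc m) (\<lambda>g. h1_coeff (\<omega>1 g))" using \<omega>1 by (simp add: M2.pc_def dc_comp[of _ _ h1_coeff])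
    moreover have "cts T m (\<lambda>h. h1_coeff (f h))" using fpc by (simp add: M2.pc_def dc_comp[of _ _ h1_coeff])
    ultimately show "Y = cls (Suc m) (\<lambda>g. h1_coeff (\<omega> g))" unfolding Y by (intro cls_eqI)
  qed
qed

lemma cl4_omega:
  assumes c: "c \<in> pmod.pc G T carrier3 m" and z: "cochain_map G m to_module4 c \<in> cocycles G T (module4 i j) m"
  obtains \<omega> where "\<omega> \<in> pmod.pc G T carrier2 (Suc m)" "\<And>g. g \<in> tuples G (Suc m) \<Longrightarrow> tdlt G rho3 m c g = d2 (\<omega> g)"
proof -
  interpret M2: pmod G T "module2 i j" carrier2 rho2 "\<lambda>x. x" by (rule pmod2)
  interpret M4: pmod G T "module4 i j" carrier3 rho3 to_module4 by (rule pmod4)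
  define \<omega> where "\<omega> = (\<lambda>g. SOME a. a \<in> carrier2 \<and> tdlt G rho3 m c g = d2 a)"
  have "to_module4 (tdlt G rho3 m c g) = to_module4 0" if "g \<in> tuples G (Suc m)" for g
    using z that unfolding M4.cocycle_iff[OF c] M4.phi_0 by blast
  then have ex: "\<exists>a. a \<in> carrier2 \<and> tdlt G rho3 m c g = d2 a" if "g \<in> tuples G (Suc m)" for g
    using that unfolding to_module4_eq_iff by (simp only: add_0_left Bex_def)
  have 1: "\<omega> g \<in> carrier2" "tdlt G rho3 m c g = d2 (\<omega> g)" if "g \<in> tuples G (Suc m)" for g
    using someI_ex[OF ex[OF that]] unfolding \<omega>_def by blast+
  have "cts T m c" using c by (simp add: M4.pc_def)
  then have "cts T (Suc m) \<omega>" unfolding \<omega>_def by (rule dc_comp[OF M4.cts_tdlt])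
  with 1 show thesis by (intro that[of \<omega>]) (simp_all add: M2.pc_def)
qed

lemma eta_normal:
  assumes u: "cts T m u" "cts T m v" "cts T m \<kappa>"
    and z: "cochain_map G m to_module4 (\<lambda>h. (u h, v h, 0, - (Poly_Mapping.single 0 (\<kappa> h) * T4))) \<in> cocycles G T (module4 i j) m" (is "cochain_map _ _ _ ?c \<in> _")
  obtains e w20 w02 w12 w21 where "eta m (cl4 m ?c) = cls (Suc m) e" "cts T (Suc m) e"
    "wc m w20 \<kappa> w02 w12 w21" "decomposable m (\<lambda>g. e g - zz m w20 \<kappa> w02 w12 w21 g)"
proof -
  have ct: "cts T m ?c"
    by (rule dc_comp2[OF u(1) dc_comp2[OF u(2,3), of Pair], of "\<lambda>a (b, r). (a, b, 0, - (Poly_Mapping.single 0 r * T4))", simplified])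
  moreover have "?c h \<in> carrier3" for h
    unfolding carrier3_def using ideal_closed(1)[of T3] ideal_closed(7)[of _ T4] by auto
  ultimately have c: "?c \<in> pmod.pc G T carrier3 m" by (simp add: pmod.pc_def[OF pmod3])
  obtain \<omega> where \<omega>: "\<omega> \<in> pmod.pc G T carrier2 (Suc m)" "\<And>g. g \<in> tuples G (Suc m) \<Longrightarrow> tdlt G rho3 m ?c g = d2 (\<omega> g)"
    using cl4_omega[OF c z] by blast
  have d: "tdlt G rho m u g = - fst (\<omega> g) * (tau1 - 1)" "tdlt G rho m v g = - fst (\<omega> g) * (tau2 - 1)"
    "fst (\<omega> g) * T3 + snd (\<omega> g) = 0" "tdlt G rho m (\<lambda>h. - (Poly_Mapping.single 0 (\<kappa> h) * T4)) g = fst (\<omega> g) * T4 + snd (\<omega> g)"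
    if g: "g \<in> tuples G (Suc m)" for g
  proof -
    have 0: "tdlt G rho m (\<lambda>h. 0) g = 0" by (simp add: tdlt_def)
    obtain a b where ab: "\<omega> g = (a, b)" by (metis surj_pair)
    have "(tdlt G rho m u g, tdlt G rho m v g, 0, tdlt G rho m (\<lambda>h. - (Poly_Mapping.single 0 (\<kappa> h) * T4)) g)
      = (- a * (tau1 - 1), - a * (tau2 - 1), a * T3 + b, a * T4 + b)"
      using \<omega>(2)[OF g] unfolding tdlt3_components fst_conv snd_conv ab d2.simps 0 .
    then show "tdlt G rho m u g = - fst (\<omega> g) * (tau1 - 1)" "tdlt G rho m v g = - fst (\<omega> g) * (tau2 - 1)"
    "fst (\<omega> g) * T3 + snd (\<omega> g) = 0" "tdlt G rho m (\<lambda>h. - (Poly_Mapping.single 0 (\<kappa> h) * T4)) g = fst (\<omega> g) * T4 + snd (\<omega> g)"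
      unfolding ab fst_conv snd_conv prod.inject by (simp_all only:)
  qed
  have y: "\<exists>w. snd (\<omega> g) = w * TG" if "g \<in> tuples G (Suc m)" for g
  proof -
    have "\<omega> g \<in> carrier2" using \<omega>(1) that by (simp add: pmod.pc_def[OF pmod2])
    then show ?thesis by (auto simp: carrier2_def)
  qed
  obtain w20 w02 w12 w21 where w: "wc m w20 \<kappa> w02 w12 w21"
    "decomposable m (\<lambda>g. TG_coeff (h1 (fst (\<omega> g), snd (\<omega> g))) - zz m w20 \<kappa> w02 w12 w21 g)"
    using eta_core(2)[OF u y d] by blast
  have "cts T (Suc m) (\<lambda>g. h1_coeff (\<omega> g))" using \<omega>(1) by (simp add: pmod.pc_def[OF pmod2] dc_comp[of _ _ h1_coeff])
  with w show thesis
    by (intro that[OF eta_eq[OF c \<omega>]]) (simp_all add: h1_coeff_def)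
qed

end

section \<open>Classes that vanish on the common kernel\<close>

lemma dltQ_diff: "dltQ G \<theta> m (\<lambda>h q. f h q - f' h q) g q = dltQ G \<theta> m f g q - dltQ G \<theta> m f' g q"
  by (simp add: dltQ_def dlt_diff)

lemma dltQ_translate: "dltQ G \<theta> m (\<lambda>h q. f h (q - e)) g q = dltQ G \<theta> m f g (q - e)"
proof -
  have *: "q - e - \<theta> (g 0) = q - \<theta> (g 0) - e" by (simp add: algebra_simps)
  show ?thesis unfolding dltQ_def by (simp only: *)
qed

lemma dltQ_hom:
  assumes "\<And>x y. F (x + y) = F x + F y"
  shows "F (dltQ G \<theta> m f g q) = dltQ G \<theta> m (\<lambda>h q. F (f h q)) g q"
proof -
  have "F (x - y) = F x - F y" for x y using assms[of "x - y" y] by (simp add: algebra_simps)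
  then show ?thesis by (simp add: dltQ_def assms dlt_hom[of F, OF assms])
qed

lemma dltQ_cong:
  assumes "group G" "g \<in> tuples G (Suc m)" "\<And>h q. h \<in> tuples G m \<Longrightarrow> f h q = f' h q"
  shows "dltQ G \<theta> m f g q = dltQ G \<theta> m f' g q"
  unfolding dltQ_def using dlt_cong[OF assms(1,2), of "\<lambda>h. f h q" "\<lambda>h. f' h q"] assms by simp

lemma dltQ_sum_all:
  fixes \<theta> :: "'g \<Rightarrow> 'q::{finite, ab_group_add}"
  shows "(\<Sum>q\<in>UNIV. dltQ G \<theta> m f g q) = dlt G m (\<lambda>h. \<Sum>q\<in>UNIV. f h q) g"
proof -
  have "(\<Sum>q\<in>UNIV. f (shift m g) (q - \<theta> (g 0))) = (\<Sum>q\<in>UNIV. f (shift m g) q)"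
    by (rule sum.reindex_bij_witness[of _ "\<lambda>q. q + \<theta> (g 0)" "\<lambda>q. q - \<theta> (g 0)"]) auto
  then show ?thesis by (simp add: dltQ_def sum.distrib sum_subtractf dlt_sum)
qed

text \<open>Summation over the cosets of \<open>\<langle>\<tau>\<^sub>3\<rangle>\<close>, the diagonal, and of \<open>\<langle>\<tau>\<^sub>4\<rangle>\<close>, the antidiagonal. The quotients are identified
  with \<open>\<int>/3\<close> by \<open>i - j\<close> and \<open>i + j\<close>.\<close>

lemma dltQ_sum_diag:
  fixes i j :: "'g \<Rightarrow> 3"
  shows "dltQ G (\<lambda>x. i x - j x) m (\<lambda>h s. \<Sum>c\<in>UNIV. f h (s + c, c)) g s = (\<Sum>c\<in>UNIV. dltQ G (\<lambda>x. (i x, j x)) m f g (s + c, c))"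
proof -
  have "(\<Sum>c\<in>UNIV. f (shift m g) (s - (i (g 0) - j (g 0)) + c, c)) = (\<Sum>c\<in>UNIV. f (shift m g) ((s + c, c) - (i (g 0), j (g 0))))"
    by (rule sum.reindex_bij_witness[of _ "\<lambda>c. c - j (g 0)" "\<lambda>c. c + j (g 0)"]) (auto simp: algebra_simps)
  then show ?thesis by (simp add: dltQ_def sum.distrib sum_subtractf dlt_sum)
qed

lemma dltQ_sum_antidiag:
  fixes i j :: "'g \<Rightarrow> 3"
  shows "dltQ G (\<lambda>x. i x + j x) m (\<lambda>h s. \<Sum>c\<in>UNIV. f h (s + c, - c)) g s = (\<Sum>c\<in>UNIV. dltQ G (\<lambda>x. (i x, j x)) m f g (s + c, - c))"
proof -
  have "(\<Sum>c\<in>UNIV. f (shift m g) (s - (i (g 0) + j (g 0)) + c, - c)) = (\<Sum>c\<in>UNIV. f (shift m g) ((s + c, - c) - (i (g 0), j (g 0))))"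
    by (rule sum.reindex_bij_witness[of _ "\<lambda>c. c + j (g 0)" "\<lambda>c. c - j (g 0)"]) (auto simp: algebra_simps)
  then show ?thesis by (simp add: dltQ_def sum.distrib sum_subtractf dlt_sum)
qed

text \<open>The element of the group ring with given coefficients.\<close>

definition of_coeffs :: "(3 \<times> 3 \<Rightarrow> 3) \<Rightarrow> 3 group_ring" where
  "of_coeffs F = (\<Sum>q\<in>UNIV. Poly_Mapping.single q (F q))"

lemma lookup_of_coeffs [simp]: "Poly_Mapping.lookup (of_coeffs F) = F"
  by (rule ext) (simp add: of_coeffs_def lookup_sum lookup_single when_def)

lemma sum_3_from: "(\<Sum>c\<in>UNIV. f (c::3)) = f t + f (t - 1) + f (t - 2)"
  using z3_cases[of t] by (elim disjE) (simp_all add: sum_UNIV_3 sub_3 algebra_simps)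

lemma lookup_mult_T3: "Poly_Mapping.lookup (x * T3) q = (\<Sum>c\<in>UNIV. Poly_Mapping.lookup x (fst q - snd q + c, c))" for x :: "3 group_ring"
  unfolding sum_3_from[of _ "snd q"] by (cases q) (simp add: mult_T lookup_add lookup_single_mult)

lemma lookup_mult_T4: "Poly_Mapping.lookup (x * T4) q = (\<Sum>c\<in>UNIV. Poly_Mapping.lookup x (fst q + snd q + c, - c))" for x :: "3 group_ring"
proof -
  have bb: "b - (2 :: 3) = 1 + b" "b - (1 :: 3) = 2 + b" for b using z3_cases[of b] by auto
  show ?thesis
    unfolding sum_3_from[of _ "- snd q"] by (cases q) (simp add: mult_T lookup_add lookup_single_mult, simp only: bb)
qed

text \<open>Coefficients constant on the cosets of \<open>\<langle>\<tau>\<^sub>3\<rangle>\<close> give a multiple of \<open>T\<^sub>3\<close>, and similarly for \<open>T\<^sub>4\<close>.\<close>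

lemma of_coeffs_T3: "\<exists>x. of_coeffs (\<lambda>q. F (fst q - snd q)) = x * T3"
proof
  have "Poly_Mapping.lookup (of_coeffs (\<lambda>q. if snd q = 0 then F (fst q) else 0) * T3) q = F (fst q - snd q)" for q
    by (simp add: lookup_mult_T3 sum_3_from[of _ 0])
  then show "of_coeffs (\<lambda>q. F (fst q - snd q)) = of_coeffs (\<lambda>q. if snd q = 0 then F (fst q) else 0) * T3"
    by (intro poly_mapping_eqI) simp
qed

lemma of_coeffs_T4: "\<exists>x. of_coeffs (\<lambda>q. F (fst q + snd q)) = x * T4"
proof
  have "Poly_Mapping.lookup (of_coeffs (\<lambda>q. if snd q = 0 then F (fst q) else 0) * T4) q = F (fst q + snd q)" for q
    by (simp add: lookup_mult_T4 sum_3_from[of _ 0])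
  then show "of_coeffs (\<lambda>q. F (fst q + snd q)) = of_coeffs (\<lambda>q. if snd q = 0 then F (fst q) else 0) * T4"
    by (intro poly_mapping_eqI) simp
qed

lemma (in quotient_char) cts_dltQ:
  assumes "cts T m f"
  shows "cts T (Suc m) (dltQ G \<theta> m f)"
proof -
  have "cts T (Suc m) (dlt G m (\<lambda>h. f h q))" for q by (rule cts_dlt[OF dc_comp[OF assms]])
  then have 1: "cts T (Suc m) (\<lambda>g q. dlt G m (\<lambda>h. f h q) g)"
    by (rule dc_family[of "product_topology (\<lambda>_. T) {..<Suc m}" "\<lambda>q g. dlt G m (\<lambda>h. f h q) g" "\<lambda>x. x"])
  have 2: "cts T (Suc m) (\<lambda>g. \<theta> (g 0))" by (rule dc_pull[OF cont_proj theta_dc]) simp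
  show ?thesis
    using dc_comp2[OF 1 dc_comp2[OF cts_shift[OF assms] 2, of Pair], of "\<lambda>D (S, t) q. D q + (S (q - t) - S q)"]
    by (simp add: dltQ_def[abs_def])
qed

context two_chars
begin

text \<open>The choice of preimages under the embedding of \<open>\<int>/3\<int>\<close> into \<open>\<int>/9\<int>\<close>, for functions.\<close>

lemma unemb_family:
  fixes C :: "(nat \<Rightarrow> 'g) \<Rightarrow> 'q \<Rightarrow> 9"
  assumes "cts T m C" "\<And>h q. h \<in> tuples G m \<Longrightarrow> red (C h q) = 0"
  obtains k where "cts T m k" "\<And>h q. h \<in> tuples G m \<Longrightarrow> emb (k h q) = C h q"
proof
  show "cts T m (\<lambda>h q. unemb (C h q))" by (rule dc_comp[OF assms(1)])
  show "emb (unemb (C h q)) = C h q" if "h \<in> tuples G m" for h q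
    using assms(2)[OF that] by (rule emb_unemb)
qed

lemma emb_dltQ:
  assumes "g \<in> tuples G (Suc m)" "\<And>h q. h \<in> tuples G m \<Longrightarrow> emb (k h q) = C h q"
  shows "emb (dltQ G \<theta> m k g q) = dltQ G \<theta> m C g q"
  unfolding dltQ_hom[of emb, OF emb_add] using assms by (intro dltQ_cong grp) auto

text \<open>Let the cocycle \<open>a\<close> be the coboundary of the cochain \<open>\<xi>\<close> with values in \<open>\<int>/3[G]\<close>, let \<open>X\<close> lift \<open>\<xi>\<close>, and let the
  cocycle \<open>A\<close> lift \<open>a\<close>. With \<open>3B = A - \<delta>X\<close> one puts \<open>\<omega> = (B, -a T\<^sub>G)\<close>. The components of \<open>c\<close> are \<open>(F - D X)/3\<close> or \<open>(F - N X)/3\<close>, where \<open>D\<close> is minus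
  multiplication by \<open>t\<^sub>1\<close> or \<open>t\<^sub>2\<close>, \<open>N\<close> is summation over \<open>\<langle>\<tau>\<^sub>3\<rangle>\<close> or \<open>\<langle>\<tau>\<^sub>4\<rangle>\<close>, and \<open>F\<close> is a cocycle that lifts \<open>D \<xi>\<close>
  or \<open>N \<xi>\<close>. These are cocycles because \<open>D\<close> annihilates constants and \<open>N\<close> multiplies them by 3.\<close>

lemma eta_exact:
  assumes a: "coc G T (Suc m) a"
    and \<xi>: "cts T m \<xi>" "\<And>g q. g \<in> tuples G (Suc m) \<Longrightarrow> dltQ G (\<lambda>x. (i x, j x)) m \<xi> g q = a g"
  obtains c where "c \<in> pmod.pc G T carrier3 m" "cochain_map G m to_module4 c \<in> cocycles G T (module4 i j) m"
    "eta m (cl4 m c) = cls (Suc m) a"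
proof -
  let ?Q = "\<lambda>x. (i x, j x)"
  note P = pair_char
  have cf: "cts T m (\<lambda>h. F (\<xi> h))" for F by (rule dc_comp[OF \<xi>(1)])
  define X where "X = (\<lambda>h q. lft (\<xi> h q))"
  have cX: "cts T m (\<lambda>h. F (X h))" for F unfolding X_def by (rule dc_comp[OF \<xi>(1)])
  have rX: "red (X h q) = \<xi> h q" for h q by (simp add: X_def)
  have c0: "a g + a g + a g = 0" for g using z3_cases[of "a g"] by auto
  obtain A where A: "coc G T (Suc m) A" "\<And>g. g \<in> tuples G (Suc m) \<Longrightarrow> red (A g) = a g"
    using lift_cocycle_G[OF a] by blast
  let ?e1 = "(1, 0) :: 3 \<times> 3" and ?e2 = "(0, 1) :: 3 \<times> 3"
  \<comment> \<open>the operators \<open>D\<close>, where \<open>e\<close> is the translation by \<open>\<tau>\<^sub>1\<close> or \<open>\<tau>\<^sub>2\<close>\<close>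
  have ex: "\<exists>C. cts T m C \<and> (\<forall>g \<in> tuples G (Suc m). \<forall>q. emb (dltQ G ?Q m C g q) = dltQ G ?Q m X g (q - e) - dltQ G ?Q m X g q)" for e
  proof -
    have z: "dltQ G ?Q m (\<lambda>h q. \<xi> h q - \<xi> h (q - e)) g q = 0" if "g \<in> tuples G (Suc m)" for g q
      using \<xi>(2)[OF that] by (simp only: dltQ_diff dltQ_translate) simp
    obtain F where F: "cts T m F" "\<And>g q. g \<in> tuples G (Suc m) \<Longrightarrow> dltQ G ?Q m F g q = 0"
      "\<And>g q. g \<in> tuples G m \<Longrightarrow> red (F g q) = \<xi> g q - \<xi> g (q - e)"
      using shapiro_lift[OF liftable_axioms P cf[of "\<lambda>x q. x q - x (q - e)"] z] by blast
    have "cts T m (\<lambda>h q. F h q - (X h q - X h (q - e)))"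
      by (rule dc_comp2[OF F(1) cX[of "\<lambda>x. x"], of "\<lambda>f x q. f q - (x q - x (q - e))"])
    moreover have "red (F h q - (X h q - X h (q - e))) = 0" if "h \<in> tuples G m" for h q
      by (simp add: red_diff rX F(3)[OF that])
    ultimately obtain C where C: "cts T m C" "\<And>h q. h \<in> tuples G m \<Longrightarrow> emb (C h q) = F h q - (X h q - X h (q - e))"
      using unemb_family[of m "\<lambda>h q. F h q - (X h q - X h (q - e))"] by blast
    have "emb (dltQ G ?Q m C g q) = dltQ G ?Q m X g (q - e) - dltQ G ?Q m X g q" if g: "g \<in> tuples G (Suc m)" for g q
    proof -
      have "emb (dltQ G ?Q m C g q) = dltQ G ?Q m (\<lambda>h q. F h q - (X h q - X h (q - e))) g q"
        by (rule emb_dltQ[OF g C(2)])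
      then show ?thesis by (simp only: dltQ_diff dltQ_translate F(2)[OF g]) simp
    qed
    with C(1) show ?thesis by blast
  qed
  obtain C1 where C1: "cts T m C1" "\<And>g q. g \<in> tuples G (Suc m) \<Longrightarrow> emb (dltQ G ?Q m C1 g q) = dltQ G ?Q m X g (q - ?e1) - dltQ G ?Q m X g q"
    using ex[of ?e1] by blast
  obtain C2 where C2: "cts T m C2" "\<And>g q. g \<in> tuples G (Suc m) \<Longrightarrow> emb (dltQ G ?Q m C2 g q) = dltQ G ?Q m X g (q - ?e2) - dltQ G ?Q m X g q"
    using ex[of ?e2] by blast
  \<comment> \<open>the operators \<open>N\<close>, where \<open>(s + c, n c)\<close> runs through a coset of \<open>\<langle>\<tau>\<^sub>3\<rangle>\<close> or \<open>\<langle>\<tau>\<^sub>4\<rangle>\<close>\<close>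
  have ex': "\<exists>C. cts T m C \<and> (\<forall>g \<in> tuples G (Suc m). \<forall>s. emb (dltQ G \<theta> m C g s) = - (\<Sum>c\<in>UNIV. dltQ G ?Q m X g (s + c, n c)))"
    if \<theta>: "quotient_char G T \<theta>"
      and s3: "\<And>f g s. dltQ G \<theta> m (\<lambda>h s. \<Sum>c\<in>UNIV. f h (s + c, n c)) g s = (\<Sum>c\<in>UNIV. dltQ G ?Q m f g (s + c, n c) :: 3)"
      and s9: "\<And>f g s. dltQ G \<theta> m (\<lambda>h s. \<Sum>c\<in>UNIV. f h (s + c, n c)) g s = (\<Sum>c\<in>UNIV. dltQ G ?Q m f g (s + c, n c) :: 9)"
    for \<theta> and n :: "3 \<Rightarrow> 3"
  proof -
    have z: "dltQ G \<theta> m (\<lambda>h s. \<Sum>c\<in>UNIV. \<xi> h (s + c, n c)) g q = 0" if "g \<in> tuples G (Suc m)" for g q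
    proof -
      have "dltQ G \<theta> m (\<lambda>h s. \<Sum>c\<in>UNIV. \<xi> h (s + c, n c)) g q = (\<Sum>c\<in>(UNIV :: 3 set). a g)"
        by (simp only: s3 \<xi>(2)[OF that])
      also have "\<dots> = 0" unfolding sum_UNIV_3 using c0[of g] by (simp only: add.assoc)
      finally show ?thesis .
    qed
    obtain F where F: "cts T m F" "\<And>g q. g \<in> tuples G (Suc m) \<Longrightarrow> dltQ G \<theta> m F g q = 0"
      "\<And>g q. g \<in> tuples G m \<Longrightarrow> red (F g q) = (\<Sum>c\<in>UNIV. \<xi> g (q + c, n c))"
      using shapiro_lift[OF liftable_axioms \<theta> cf[of "\<lambda>x s. \<Sum>c\<in>UNIV. x (s + c, n c)"] z] by blast
    have "cts T m (\<lambda>h q. F h q - (\<Sum>c\<in>UNIV. X h (q + c, n c)))"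
      by (rule dc_comp2[OF F(1) cX[of "\<lambda>x. x"], of "\<lambda>f x q. f q - (\<Sum>c\<in>UNIV. x (q + c, n c))"])
    moreover have "red (F h q - (\<Sum>c\<in>UNIV. X h (q + c, n c))) = 0" if "h \<in> tuples G m" for h q
      by (simp add: red_diff red_sum rX F(3)[OF that])
    ultimately obtain C where C: "cts T m C" "\<And>h q. h \<in> tuples G m \<Longrightarrow> emb (C h q) = F h q - (\<Sum>c\<in>UNIV. X h (q + c, n c))"
      using unemb_family[of m "\<lambda>h q. F h q - (\<Sum>c\<in>UNIV. X h (q + c, n c))"] by blast
    have "emb (dltQ G \<theta> m C g q) = - (\<Sum>c\<in>UNIV. dltQ G ?Q m X g (q + c, n c))" if g: "g \<in> tuples G (Suc m)" for g q
    proof -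
      have "emb (dltQ G \<theta> m C g q) = dltQ G \<theta> m (\<lambda>h q. F h q - (\<Sum>c\<in>UNIV. X h (q + c, n c))) g q"
        by (rule emb_dltQ[OF g C(2)])
      then show ?thesis by (simp only: dltQ_diff s9 F(2)[OF g]) simp
    qed
    with C(1) show ?thesis by blast
  qed
  obtain C3 where C3: "cts T m C3" "\<And>g s. g \<in> tuples G (Suc m) \<Longrightarrow> emb (dltQ G (\<lambda>x. i x - j x) m C3 g s) = - (\<Sum>c\<in>UNIV. dltQ G ?Q m X g (s + c, c))"
    using ex'[of "\<lambda>x. i x - j x" "\<lambda>c. c", OF quotient_char_lin[OF lin_minus] dltQ_sum_diag dltQ_sum_diag] by (elim exE conjE) (rule that; blast)
  obtain C4 where C4: "cts T m C4" "\<And>g s. g \<in> tuples G (Suc m) \<Longrightarrow> emb (dltQ G (\<lambda>x. i x + j x) m C4 g s) = - (\<Sum>c\<in>UNIV. dltQ G ?Q m X g (s + c, - c))"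
    using ex'[of "\<lambda>x. i x + j x" "\<lambda>c. - c", OF quotient_char_lin[OF lin_plus] dltQ_sum_antidiag dltQ_sum_antidiag] by (elim exE conjE) (rule that; blast)
  have "cts T (Suc m) (\<lambda>g q. A g - dltQ G ?Q m X g q)"
    by (rule dc_comp2[OF coc_cts[OF A(1)] quotient_char.cts_dltQ[OF P cX[of "\<lambda>x. x"]], of "\<lambda>a d q. a - d q"])
  moreover have "red (A g - dltQ G ?Q m X g q) = 0" if g: "g \<in> tuples G (Suc m)" for g q
    by (simp add: red_diff dltQ_hom[of red, OF red_add] rX \<xi>(2)[OF g] A(2)[OF g])
  ultimately obtain B where B: "cts T (Suc m) B" "\<And>g q. g \<in> tuples G (Suc m) \<Longrightarrow> emb (B g q) = A g - dltQ G ?Q m X g q"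
    using unemb_family[of "Suc m" "\<lambda>g q. A g - dltQ G ?Q m X g q"] by blast
  have dX: "dltQ G ?Q m X g q = A g - emb (B g q)" if "g \<in> tuples G (Suc m)" for g q
    using B(2)[OF that] by simp
  \<comment> \<open>Over a coset, the constant \<open>A\<close> sums to \<open>3A\<close>, which depends on \<open>a\<close> only; this is the source of \<open>-a T\<^sub>G\<close>.\<close>
  have A3: "A g + A g + A g = emb (a g)" if g: "g \<in> tuples G (Suc m)" for g
    using emb_red[of "A g"] by (simp add: A(2)[OF g])
  have d1: "dltQ G ?Q m C1 g q = B g q - B g (q - ?e1)" and d2: "dltQ G ?Q m C2 g q = B g q - B g (q - ?e2)" if g: "g \<in> tuples G (Suc m)" for g q
    using C1(2)[OF g, of q] C2(2)[OF g, of q] unfolding dX[OF g] by (simp_all add: emb_diff[symmetric] emb_inject)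
  have sB: "- (\<Sum>c\<in>UNIV. dltQ G ?Q m X g (s + c, n c)) = emb ((\<Sum>c\<in>UNIV. B g (s + c, n c)) - a g)" if g: "g \<in> tuples G (Suc m)" for g s and n :: "3 \<Rightarrow> 3"
    unfolding dX[OF g] sum_subtractf emb_diff emb_sum A3[OF g, symmetric] by (simp add: sum_UNIV_3 add.assoc)
  have d3: "dltQ G (\<lambda>x. i x - j x) m C3 g s = (\<Sum>c\<in>UNIV. B g (s + c, c)) - a g"
    and d4: "dltQ G (\<lambda>x. i x + j x) m C4 g s = (\<Sum>c\<in>UNIV. B g (s + c, - c)) - a g" if g: "g \<in> tuples G (Suc m)" for g s
    using C3(2)[OF g, of s, unfolded sB[OF g, of s "\<lambda>c. c"]] C4(2)[OF g, of s, unfolded sB[OF g, of s "\<lambda>c. - c"]] by (simp_all only: emb_inject)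
  define c where "c = (\<lambda>h. (of_coeffs (C1 h), of_coeffs (C2 h), of_coeffs (\<lambda>q. C3 h (fst q - snd q)), of_coeffs (\<lambda>q. C4 h (fst q + snd q))))"
  define \<omega> where "\<omega> = (\<lambda>g. (of_coeffs (B g), - (Poly_Mapping.single 0 (a g) * TG)))"
  have "cts T m c" unfolding c_def
    by (rule dc_comp2[OF dc_comp2[OF C1(1) C2(1), of Pair] dc_comp2[OF C3(1) C4(1), of Pair],
      of "\<lambda>(a, b) (c, d). (of_coeffs a, of_coeffs b, of_coeffs (\<lambda>q. c (fst q - snd q)), of_coeffs (\<lambda>q. d (fst q + snd q)))", simplified])
  moreover have "c h \<in> carrier3" for h unfolding c_def carrier3_def using of_coeffs_T3[of "C3 h"] of_coeffs_T4[of "C4 h"] by simp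
  ultimately have cpc: "c \<in> pmod.pc G T carrier3 m" by (simp add: pmod.pc_def[OF pmod3])
  have "cts T (Suc m) \<omega>" unfolding \<omega>_def
    by (rule dc_comp2[OF B(1) coc_cts[OF a], of "\<lambda>b a. (of_coeffs b, - (Poly_Mapping.single 0 a * TG))"])
  moreover have "\<omega> g \<in> carrier2" for g unfolding \<omega>_def carrier2_def using ideal_closed(7)[of _ TG] by simp
  ultimately have \<omega>pc: "\<omega> \<in> pmod.pc G T carrier2 (Suc m)" by (simp add: pmod.pc_def[OF pmod2])
  have e: "tdlt G rho3 m c g = d2 (\<omega> g)" if g: "g \<in> tuples G (Suc m)" for g
  proof -
    have y: "Poly_Mapping.lookup (- (Poly_Mapping.single 0 (a g) * TG)) q = - a g" for q
      by (simp add: lookup_single_mult lookup_TG)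
    have t: "- x * (tau1 - 1) = x - Poly_Mapping.single ?e1 1 * x" "- x * (tau2 - 1) = x - Poly_Mapping.single ?e2 1 * x" for x :: "3 group_ring"
      by (simp_all add: tau1_def tau2_def algebra_simps)
    have 3: "dltQ G ?Q m (\<lambda>h q. C3 h (fst q - snd q)) g q = dltQ G (\<lambda>x. i x - j x) m C3 g (fst q - snd q)" for q
      by (simp add: dltQ_def algebra_simps)
    have 4: "dltQ G ?Q m (\<lambda>h q. C4 h (fst q + snd q)) g q = dltQ G (\<lambda>x. i x + j x) m C4 g (fst q + snd q)" for q
      by (simp add: dltQ_def algebra_simps)
    have "tdlt G rho m (\<lambda>h. of_coeffs (C1 h)) g = - of_coeffs (B g) * (tau1 - 1)"
      unfolding t by (rule poly_mapping_eqI) (simp add: lookup_tdlt lookup_minus lookup_single_mult d1[OF g])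
    moreover have "tdlt G rho m (\<lambda>h. of_coeffs (C2 h)) g = - of_coeffs (B g) * (tau2 - 1)"
      unfolding t by (rule poly_mapping_eqI) (simp add: lookup_tdlt lookup_minus lookup_single_mult d2[OF g])
    moreover have "tdlt G rho m (\<lambda>h. of_coeffs (\<lambda>q. C3 h (fst q - snd q))) g = of_coeffs (B g) * T3 + - (Poly_Mapping.single 0 (a g) * TG)"
      by (rule poly_mapping_eqI) (simp only: lookup_tdlt lookup_of_coeffs lookup_add lookup_minus lookup_single_mult lookup_TG mult_1_right lookup_mult_T3 3 d3[OF g] add_uminus_conv_diff)
    moreover have "tdlt G rho m (\<lambda>h. of_coeffs (\<lambda>q. C4 h (fst q + snd q))) g = of_coeffs (B g) * T4 + - (Poly_Mapping.single 0 (a g) * TG)"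
      by (rule poly_mapping_eqI) (simp only: lookup_tdlt lookup_of_coeffs lookup_add lookup_minus lookup_single_mult lookup_TG mult_1_right lookup_mult_T4 4 d4[OF g] add_uminus_conv_diff)
    ultimately show ?thesis
      unfolding tdlt3_components c_def \<omega>_def fst_conv snd_conv d2.simps by (simp only:)
  qed
  \<comment> \<open>The sum over all of \<open>G\<close> shows that the sum of the coefficients of \<open>B\<close> is a coboundary. Hence
  \<open>h\<^sub>1(\<omega>)\<close> is cohomologous to \<open>-2a = a\<close>.\<close>
  have "coc G T m (\<lambda>h. \<Sum>q\<in>UNIV. \<xi> h q)"
    unfolding coc_def
  proof (intro conjI ballI)
    show "cts T m (\<lambda>h. \<Sum>q\<in>UNIV. \<xi> h q)" by (rule cf)
    fix g assume g: "g \<in> tuples G (Suc m)"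
    show "dlt G m (\<lambda>h. \<Sum>q\<in>UNIV. \<xi> h q) g = 0"
    proof -
      have "dlt G m (\<lambda>h. \<Sum>q\<in>UNIV. \<xi> h q) g = (\<Sum>q\<in>(UNIV :: (3 \<times> 3) set). a g)"
        by (simp only: dltQ_sum_all[of G ?Q, symmetric] \<xi>(2)[OF g])
      also have "\<dots> = 0" unfolding sum_3x3 sum_UNIV_3 using c0[of g] by (simp only: add.assoc add_0_right)
      finally show ?thesis .
    qed
  qed
  then obtain E where E: "coc G T m E" "\<And>h. h \<in> tuples G m \<Longrightarrow> red (E h) = (\<Sum>q\<in>UNIV. \<xi> h q)"
    using lift_cocycle_G by blast
  have "cts T m (\<lambda>h. (\<Sum>q\<in>UNIV. X h q) - E h)" by (rule dc_comp2[OF cX[of "\<lambda>x. \<Sum>q\<in>UNIV. x q"] coc_cts[OF E(1)]])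
  moreover have "red ((\<Sum>q\<in>UNIV. X h q) - E h) = 0" if "h \<in> tuples G m" for h
    by (simp add: red_diff red_sum rX E(2)[OF that])
  ultimately obtain f where f: "cts T m f" "\<And>g. g \<in> tuples G (Suc m) \<Longrightarrow> emb (dlt G m f g) = dlt G m (\<lambda>h. (\<Sum>q\<in>UNIV. X h q) - E h) g"
    using unemb_cochain[of m "\<lambda>h. (\<Sum>q\<in>UNIV. X h q) - E h"] by blast
  have H: "h1_coeff (\<omega> g) = a g + dlt G m (\<lambda>h. - f h) g" if g: "g \<in> tuples G (Suc m)" for g
  proof -
    have "emb (dlt G m f g) = (\<Sum>q\<in>UNIV. dltQ G ?Q m X g q)"
      unfolding f(2)[OF g] dlt_diff cocD[OF E(1) g] dltQ_sum_all by simp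
    also have "\<dots> = emb (- (\<Sum>q\<in>UNIV. B g q))"
      unfolding dX[OF g] sum_subtractf emb_minus emb_sum by (simp add: nine_9)
    finally have "dlt G m f g = - (\<Sum>q\<in>UNIV. B g q)" by (simp only: emb_inject)
    moreover have "h1_coeff (\<omega> g) = (\<Sum>q\<in>UNIV. B g q) + (- a g + - a g)"
      unfolding \<omega>_def h1_coeff_eq by (simp add: coord_def binom3_def lookup_single_mult lookup_TG)
    moreover have "- a g + - a g = a g" using z3_cases[of "a g"] by auto
    ultimately show ?thesis by (simp add: dlt_minus)
  qed
  show thesis
  proof
    show "c \<in> pmod.pc G T carrier3 m" by fact
    show "cochain_map G m to_module4 c \<in> cocycles G T (module4 i j) m"
      unfolding pmod.cocycle_iff[OF pmod4 cpc]
    proof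
      fix g assume g: "g \<in> tuples G (Suc m)"
      have "\<omega> g \<in> carrier2" using \<omega>pc g by (simp add: pmod.pc_def[OF pmod2])
      then have "to_module4 (tdlt G rho3 m c g) = to_module4 0" unfolding to_module4_eq_iff e[OF g] by auto
      then show "to_module4 (tdlt G rho3 m c g) = \<one>\<^bsub>module4 i j\<^esub>" by (simp only: pmod.phi_0[OF pmod4])
    qed
    have "eta m (cl4 m c) = cls (Suc m) (\<lambda>g. h1_coeff (\<omega> g))" by (rule eta_eq[OF cpc \<omega>pc e])
    also have "\<dots> = cls (Suc m) a"
    proof (rule cls_eqI[OF _ _ H])
      show "cts T (Suc m) (\<lambda>g. h1_coeff (\<omega> g))" using \<omega>pc by (simp add: pmod.pc_def[OF pmod2] dc_comp[of _ _ h1_coeff])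
      show "cts T m (\<lambda>h. - f h)" by (rule dc_comp[OF f(1)])
    qed
    finally show "eta m (cl4 m c) = cls (Suc m) a" .
  qed
qed

end

section \<open>The cohomology groups\<close>

context top_grp
begin

lemma cls_eq_set:
  "cts T n a \<Longrightarrow> cls n a = {restrict (\<lambda>g. b g + a g) (tuples G n) | b. b \<in> pmod.bd G T UNIV (\<lambda>\<gamma> x. x) n}"
  using pmod.class_eq[OF pmod_trivial, of a n] by (simp add: cochain_map_id)

lemma carrier_cls: "carrier (cohomology G T trivial_module n) = {cls n f | f. coc G T n f}"
  unfolding pmod.carrier_cohomology[OF pmod_trivial]
proof (intro equalityI subsetI)
  fix X assume "X \<in> {cohomology_class G T trivial_module n z |z. z \<in> cocycles G T trivial_module n}"
  then obtain z where "z \<in> cocycles G T trivial_module n" "X = cohomology_class G T trivial_module n z" by blast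
  then have "coc G T n z" "X = cls n z" by (simp_all add: cocycles_trivial extensional_restrict)
  then show "X \<in> {cls n f |f. coc G T n f}" by blast
qed (use cocycles_trivialI in blast)

lemma one_cohomology: "\<one>\<^bsub>cohomology G T trivial_module n\<^esub> = cls n (\<lambda>_. 0)"
  by (simp add: cls_eq_set cohomology_def FactGroup_def pmod.coboundaries_eq[OF pmod_trivial] cochain_map_id image_def) blast

lemma mult_cohomology:
  fixes a b :: "(nat \<Rightarrow> 'g) \<Rightarrow> 'r::ab_group_add"
  assumes "cts T n a" "cts T n b"
  shows "cls n a \<otimes>\<^bsub>cohomology G T trivial_module n\<^esub> cls n b = cls n (\<lambda>g. a g + b g)"
proof -
  interpret M: pmod G T "trivial_module :: ('g, 'r) gmodule" UNIV "\<lambda>\<gamma> x. x" "\<lambda>x. x" by (rule pmod_trivial)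
  have ab: "cts T n (\<lambda>g. a g + b g)" using assms by (rule dc_comp2)
  have m: "restrict (\<lambda>g. x g + a g) (tuples G n) \<otimes>\<^bsub>cochain_group G T trivial_module n\<^esub> restrict (\<lambda>g. y g + b g) (tuples G n)
     = restrict (\<lambda>g. (x g + y g) + (a g + b g)) (tuples G n)" for x y
    by (auto simp: cochain_group_def trivial_module_def additive_module_def fun_eq_iff algebra_simps)
  have "cls n a \<otimes>\<^bsub>cohomology G T trivial_module n\<^esub> cls n b =
     {restrict (\<lambda>g. (x g + y g) + (a g + b g)) (tuples G n) | x y. x \<in> M.bd n \<and> y \<in> M.bd n}"
    unfolding cls_eq_set[OF assms(1)] cls_eq_set[OF assms(2)]
    by (simp add: cohomology_def FactGroup_def set_mult_def m[symmetric]) blast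
  also have "\<dots> = cls n (\<lambda>g. a g + b g)"
    unfolding cls_eq_set[OF ab]
  proof (intro equalityI subsetI)
    fix z assume "z \<in> {restrict (\<lambda>g. (x g + y g) + (a g + b g)) (tuples G n) | x y. x \<in> M.bd n \<and> y \<in> M.bd n}"
    then obtain x y where "x \<in> M.bd n" "y \<in> M.bd n" "z = restrict (\<lambda>g. (x g + y g) + (a g + b g)) (tuples G n)" by blast
    then show "z \<in> {restrict (\<lambda>g. x g + (a g + b g)) (tuples G n) | x. x \<in> M.bd n}"
      using M.bd_add[of x n y] by (intro CollectI exI[of _ "\<lambda>g. x g + y g"] conjI)
  next
    fix z assume "z \<in> {restrict (\<lambda>g. x g + (a g + b g)) (tuples G n) | x. x \<in> M.bd n}"
    then obtain x where x: "x \<in> M.bd n" "z = restrict (\<lambda>g. x g + (a g + b g)) (tuples G n)" by blast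
    show "z \<in> {restrict (\<lambda>g. (x g + y g) + (a g + b g)) (tuples G n) | x y. x \<in> M.bd n \<and> y \<in> M.bd n}"
      using x M.bd_0[of n] by (intro CollectI exI[of _ x] exI[of _ "\<lambda>_. 0"]) simp
  qed
  finally show ?thesis .
qed

lemma inv_cohomology:
  assumes "coc G T (Suc m) a"
  shows "inv\<^bsub>cohomology G T trivial_module (Suc m)\<^esub> cls (Suc m) a = cls (Suc m) (\<lambda>g. - a g)"
  unfolding m_inv_def
proof (rule the_equality)
  have c: "cts T (Suc m) a" "cts T (Suc m) (\<lambda>g. - a g)" using coc_cts[OF assms] coc_cts[OF coc_minus[OF assms]] by simp_all
  show "cls (Suc m) (\<lambda>g. - a g) \<in> carrier (cohomology G T trivial_module (Suc m)) \<and>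
    cls (Suc m) a \<otimes>\<^bsub>cohomology G T trivial_module (Suc m)\<^esub> cls (Suc m) (\<lambda>g. - a g) = \<one>\<^bsub>cohomology G T trivial_module (Suc m)\<^esub> \<and>
    cls (Suc m) (\<lambda>g. - a g) \<otimes>\<^bsub>cohomology G T trivial_module (Suc m)\<^esub> cls (Suc m) a = \<one>\<^bsub>cohomology G T trivial_module (Suc m)\<^esub>"
    using coc_minus[OF assms] by (auto simp: carrier_cls mult_cohomology[OF c] mult_cohomology[OF c(2,1)] one_cohomology)
  fix Y assume "Y \<in> carrier (cohomology G T trivial_module (Suc m)) \<and>
    cls (Suc m) a \<otimes>\<^bsub>cohomology G T trivial_module (Suc m)\<^esub> Y = \<one>\<^bsub>cohomology G T trivial_module (Suc m)\<^esub> \<and>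
    Y \<otimes>\<^bsub>cohomology G T trivial_module (Suc m)\<^esub> cls (Suc m) a = \<one>\<^bsub>cohomology G T trivial_module (Suc m)\<^esub>"
  then obtain y where y: "coc G T (Suc m) y" "Y = cls (Suc m) y" and
    "cls (Suc m) a \<otimes>\<^bsub>cohomology G T trivial_module (Suc m)\<^esub> Y = \<one>\<^bsub>cohomology G T trivial_module (Suc m)\<^esub>"
    unfolding carrier_cls by blast
  then have eq: "cls (Suc m) (\<lambda>g. a g + y g) = cls (Suc m) (\<lambda>_. 0)"
    by (simp add: mult_cohomology[OF c(1) coc_cts[OF y(1)]] one_cohomology)
  have "cts T (Suc m) (\<lambda>g. a g + y g)" by (rule dc_comp2[OF c(1) coc_cts[OF y(1)]])
  then obtain e where e: "cts T m e" "\<And>g. g \<in> tuples G (Suc m) \<Longrightarrow> a g + y g = 0 + dlt G m e g"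
    using cls_eqD[OF _ dc_const eq] by blast
  show "Y = cls (Suc m) (\<lambda>g. - a g)" unfolding y(2)
  proof (rule cls_eqI[OF coc_cts[OF y(1)] e(1)])
    show "y g = - a g + dlt G m e g" if "g \<in> tuples G (Suc m)" for g using e(2)[OF that] by (simp add: algebra_simps)
  qed
qed

lemma cup1_eq: "cup1 G (Suc m) x y = restrict (\<lambda>g. x (g 0) * y (shift m g)) (tuples G (Suc m))"
  by (simp add: cup1_def shift_def)

end

lemma (in quotient_char) restriction_cls:
  assumes "cts T (Suc m) a"
  shows "restriction_map G T trivial_module (Suc m) Ker (cls (Suc m) a) = K.cls (Suc m) a"
proof -
  have r: "restrict (restrict f (tuples G (Suc m))) (tuples GK (Suc m)) = restrict f (tuples GK (Suc m))" for f :: "(nat \<Rightarrow> 'g) \<Rightarrow> 'c"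
    using Ker_tuples by (auto simp: fun_eq_iff)
  have *: "K.cls (Suc m) (\<lambda>g. b g + a g) = K.cls (Suc m) a" if b: "b \<in> pmod.bd G T UNIV (\<lambda>\<gamma> x. x) (Suc m)" for b
  proof -
    obtain e where e: "cts T m e" "cts T (Suc m) b" "\<forall>g \<in> tuples G (Suc m). b g = dlt G m e g"
      using b by (auto simp: pmod.bd_def[OF pmod_trivial])
    show ?thesis
      by (rule K.cls_eqI[OF cts_Ker[OF dc_comp2[OF e(2) assms]] cts_Ker[OF e(1)]]) (use e(3) Ker_tuples in simp)
  qed
  show ?thesis
    unfolding restriction_map_def
  proof (rule the_equality)
    have "restrict a (tuples G (Suc m)) \<in> cls (Suc m) a"
      using pmod.class_self[OF pmod_trivial, of a "Suc m"] assms by (simp add: cochain_map_id)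
    then show "\<exists>z\<in>cls (Suc m) a. K.cls (Suc m) a = cohomology_class GK TK trivial_module (Suc m) (restrict z (tuples GK (Suc m)))"
      using r[of a] by (intro bexI[of _ "restrict a (tuples G (Suc m))"]) simp_all
    fix Y assume "\<exists>z\<in>cls (Suc m) a. Y = cohomology_class GK TK trivial_module (Suc m) (restrict z (tuples GK (Suc m)))"
    then obtain b where "b \<in> pmod.bd G T UNIV (\<lambda>\<gamma> x. x) (Suc m)"
      "Y = cohomology_class GK TK trivial_module (Suc m) (restrict (restrict (\<lambda>g. b g + a g) (tuples G (Suc m))) (tuples GK (Suc m)))"
      unfolding cls_eq_set[OF assms] by blast
    then show "Y = K.cls (Suc m) a" unfolding r using * by simp
  qed
qed

context char_pair
begin

lemma z_cochain_eq: "z_cochain G i j (Suc m) w20 w11 w02 w12 w21 = restrict (zz m w20 w11 w02 w12 w21) (tuples G (Suc m))"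
  by (auto simp: z_cochain_def cup1_eq zz_def fun_eq_iff)

lemma w_conditions_iff:
  "w_conditions G T i j (Suc m) w20 w11 w02 w12 w21 \<longleftrightarrow>
     w20 \<in> extensional (tuples G m) \<and> w11 \<in> extensional (tuples G m) \<and> w02 \<in> extensional (tuples G m) \<and>
     w12 \<in> extensional (tuples G m) \<and> w21 \<in> extensional (tuples G m) \<and> wc m w20 w11 w02 w12 w21"
proof -
  have "coboundary G Z3_module m w = (\<lambda>g \<in> tuples G (Suc m). - cup1 G (Suc m) x y g - cup1 G (Suc m) x' y' g)
     \<longleftrightarrow> (\<forall>g \<in> tuples G (Suc m). dlt G m w g = - (x (g 0) * y (shift m g)) - x' (g 0) * y' (shift m g))"
    if "w \<in> extensional (tuples G m)" "cts T m w" for w x y x' y'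
    using coboundary_trivial[OF that(2)] that(1) by (auto simp: extensional_restrict cup1_eq fun_eq_iff)
  then show ?thesis
    unfolding w_conditions_def wc_def diff_Suc_1 cocycles_trivial cochains_trivial by (auto simp: ball_conj_distrib)
qed

lemma wc_restrict:
  assumes "wc m w20 w11 w02 w12 w21"
  shows "w_conditions G T i j (Suc m) (restrict w20 (tuples G m)) (restrict w11 (tuples G m)) (restrict w02 (tuples G m))
     (restrict w12 (tuples G m)) (restrict w21 (tuples G m))"
proof -
  have c: "cts T m (restrict w (tuples G m)) \<longleftrightarrow> cts T m w" for w :: "(nat \<Rightarrow> 'g) \<Rightarrow> 3" by (rule cts_cong) simp
  have d: "dlt G m (restrict w (tuples G m)) g = dlt G m w g" if "g \<in> tuples G (Suc m)" for g and w :: "(nat \<Rightarrow> 'g) \<Rightarrow> 3"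
    by (rule dlt_cong[OF grp that]) simp
  show ?thesis unfolding w_conditions_iff using assms by (simp add: wc_def coc_restrict c d)
qed

lemma zz_restrict:
  "restrict (zz m (restrict w20 (tuples G m)) (restrict w11 (tuples G m)) (restrict w02 (tuples G m))
     (restrict w12 (tuples G m)) (restrict w21 (tuples G m))) (tuples G (Suc m)) = restrict (zz m w20 w11 w02 w12 w21) (tuples G (Suc m))"
  by (auto simp: zz_def fun_eq_iff)

end

text \<open>As \<open>1 + \<tau>\<^sub>1 + \<tau>\<^sub>1\<^sup>2\<close> maps both \<open>T\<^sub>3\<close> and \<open>T\<^sub>4\<close> to \<open>T\<^sub>G\<close>, multiplication by it describes \<open>\<pi>\<^sub>4\<close> without
  reference to \<open>\<eta>\<^sub>3\<close> and \<open>\<eta>\<^sub>4\<close>.\<close>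

lemma mult_TG_factor:
  "a * T3 * (1 + tau1 + tau1\<^sup>2) = a * TG" "a * T4 * (1 + tau1 + tau1\<^sup>2) = a * TG" for a :: "'r::comm_ring_1 group_ring"
proof -
  have "TG = T3 * (1 + tau1 + tau1\<^sup>2 :: 'r group_ring)" "TG = T4 * (1 + tau1 + tau1\<^sup>2 :: 'r group_ring)"
    using TG_factor by (simp_all only: mult.commute)
  then show "a * T3 * (1 + tau1 + tau1\<^sup>2) = a * TG" "a * T4 * (1 + tau1 + tau1\<^sup>2) = a * TG"
    by (simp_all only: mult.assoc)
qed

lemma pi4_to_module4:
  assumes "(x1, x2, x3, x4) \<in> carrier3"
  shows "pi4 (to_module4 (x1, x2, x3, x4)) = (x3 - x4) * (1 + tau1 + tau1\<^sup>2)"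
  unfolding pi4_def
proof (rule the_equality)
  obtain a b where ab: "x3 = a * T3" "x4 = b * T4" using assms by (auto simp: carrier3_def)
  have "(x1, x2, a * T3, b * T4) \<in> to_module4 (x1, x2, x3, x4)"
    unfolding to_module4_mem using carrier2_closed(1) by (intro bexI[of _ 0]) (simp_all add: ab d2_0)
  moreover have "(a - b) * TG = (x3 - x4) * (1 + tau1 + tau1\<^sup>2)"
    by (simp only: left_diff_distrib ab mult_TG_factor)
  ultimately show "\<exists>\<eta>1 \<eta>2 \<eta>3 \<eta>4. (\<eta>1, \<eta>2, \<eta>3 * T3, \<eta>4 * T4) \<in> to_module4 (x1, x2, x3, x4) \<and> (x3 - x4) * (1 + tau1 + tau1\<^sup>2) = (\<eta>3 - \<eta>4) * TG"
    by (intro exI[of _ x1] exI[of _ x2] exI[of _ a] exI[of _ b]) simp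
  fix y assume "\<exists>\<eta>1 \<eta>2 \<eta>3 \<eta>4. (\<eta>1, \<eta>2, \<eta>3 * T3, \<eta>4 * T4) \<in> to_module4 (x1, x2, x3, x4) \<and> y = (\<eta>3 - \<eta>4) * TG"
  then obtain e1 e2 a b p where e: "(e1, e2, a * T3, b * T4) = (x1, x2, x3, x4) + d2 p" "y = (a - b) * TG"
    unfolding to_module4_mem by blast
  obtain \<xi> w where p: "p = (\<xi>, w)" by (cases p)
  have 34: "a * T3 = x3 + (\<xi> * T3 + w)" "b * T4 = x4 + (\<xi> * T4 + w)" using e(1) by (simp_all add: p)
  have "a * TG = (x3 + (\<xi> * T3 + w)) * (1 + tau1 + tau1\<^sup>2)" by (simp only: 34[symmetric] mult_TG_factor)
  moreover have "b * TG = (x4 + (\<xi> * T4 + w)) * (1 + tau1 + tau1\<^sup>2)" by (simp only: 34[symmetric] mult_TG_factor)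
  moreover have "\<xi> * T3 * (1 + tau1 + tau1\<^sup>2) = \<xi> * T4 * (1 + tau1 + tau1\<^sup>2)"
    by (simp only: mult_TG_factor)
  ultimately show "y = (x3 - x4) * (1 + tau1 + tau1\<^sup>2)"
    unfolding e(2) left_diff_distrib by (simp only: distrib_right) (simp add: algebra_simps)
qed

section \<open>The image of the Positselski map\<close>

context two_chars
begin

lemma pi4_star_normal:
  assumes "cts T m u" "cts T m v" "cts T m \<kappa>"
  shows "pi4_star G T i j m (cl4 m (\<lambda>h. (u h, v h, 0, - (Poly_Mapping.single 0 (\<kappa> h) * T4)))) = cls m \<kappa>" (is "pi4_star _ _ _ _ _ (cl4 m ?c) = _")
proof -
  let ?n = "1 + tau1 + tau1\<^sup>2 :: 3 group_ring"
  let ?p = "\<lambda>(x1, x2, x3, x4). (x3 - x4) * ?n :: 3 group_ring"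
  have ct: "cts T m ?c"
    by (rule dc_comp2[OF assms(1) dc_comp2[OF assms(2,3), of Pair], of "\<lambda>a (b, r). (a, b, 0, - (Poly_Mapping.single 0 r * T4))", simplified])
  moreover have "?c h \<in> carrier3" for h
    unfolding carrier3_def using ideal_closed(1)[of T3] ideal_closed(7)[of _ T4] by auto
  ultimately have c: "?c \<in> pmod.pc G T carrier3 m" by (simp add: pmod.pc_def[OF pmod3])
  have "cohomology_map G T (module1 i j) m pi4 (cl4 m ?c) = cohomology_class G T (module1 i j) m (cochain_map G m (\<lambda>x. x) (\<lambda>h. ?p (?c h)))"
  proof (rule cohomology_map_class[OF pmod4 pmod1 _ _ _ _ c])
    fix x :: "3 group_ring \<times> 3 group_ring \<times> 3 group_ring \<times> 3 group_ring" assume x: "x \<in> carrier3"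
    obtain x1 x2 x3 x4 where e: "x = (x1, x2, x3, x4)" by (cases x)
    show "pi4 (to_module4 x) = ?p x" using x unfolding e by (simp add: pi4_to_module4)
    obtain a b where "x3 = a * T3" "x4 = b * T4" using x unfolding e by (auto simp: carrier3_def)
    then have "?p x = (a - b) * TG" unfolding e by (simp add: left_diff_distrib mult_TG_factor)
    then show "?p x \<in> carrier1" by (auto simp: carrier1_def)
  next
    fix x y :: "3 group_ring \<times> 3 group_ring \<times> 3 group_ring \<times> 3 group_ring"
    show "?p (x + y) = ?p x + ?p y" by (cases x; cases y) (simp add: algebra_simps)
  next
    fix \<gamma> and x :: "3 group_ring \<times> 3 group_ring \<times> 3 group_ring \<times> 3 group_ring"
    show "?p (rho3 \<gamma> x) = rho \<gamma> (?p x)" by (cases x) (simp add: algebra_simps)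
  qed
  moreover have "cohomology_map G T Z3_module m TG_coeff (cohomology_class G T (module1 i j) m (cochain_map G m (\<lambda>x. x) (\<lambda>h. ?p (?c h))))
      = cohomology_class G T Z3_module m (cochain_map G m (\<lambda>x. x) (\<lambda>h. TG_coeff (?p (?c h))))"
  proof (rule cohomology_map_class[OF pmod1 pmod_trivial])
    fix x y :: "3 group_ring" assume "x \<in> carrier1" "y \<in> carrier1"
    show "TG_coeff (x + y) = TG_coeff x + TG_coeff y" by (simp add: TG_coeff_def lookup_add)
  next
    fix \<gamma> and x :: "3 group_ring" assume "x \<in> carrier1"
    then show "TG_coeff (rho \<gamma> x) = TG_coeff x"
      by (auto simp: carrier1_def TG_coeff_def group_elt_def lookup_single_mult lookup_mult_TG)
  next
    have "?p (?c h) = Poly_Mapping.single 0 (\<kappa> h) * TG" for h by (simp add: mult_TG_factor)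
    moreover have "cts T m (\<lambda>h. Poly_Mapping.single 0 (\<kappa> h) * TG :: 3 group_ring)" by (rule dc_comp[OF assms(3)])
    moreover have "Poly_Mapping.single 0 (\<kappa> h) * TG \<in> carrier1" for h by (auto simp: carrier1_def)
    ultimately show "(\<lambda>h. ?p (?c h)) \<in> pmod.pc G T carrier1 m" by (simp only: pmod.pc_def[OF pmod1] mem_Collect_eq simp_thms ball_triv)
  qed auto
  moreover have "TG_coeff (?p (?c h)) = \<kappa> h" for h
  proof -
    have "?p (?c h) = Poly_Mapping.single 0 (\<kappa> h) * TG" by (simp add: mult_TG_factor)
    then show ?thesis by (simp add: TG_coeff_def lookup_single_mult lookup_TG)
  qed
  ultimately show ?thesis unfolding pi4_star_def by (simp only: cochain_map_id)
qed

lemma decomposable_in_Dec: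
  assumes "decomposable m f" "cts T (Suc m) f"
  shows "cls (Suc m) f \<in> Dec G T i j (Suc m)"
proof -
  obtain a b e where *: "coc G T m a" "coc G T m b" "cts T m e"
    "\<forall>g \<in> tuples G (Suc m). f g = i (g 0) * a (shift m g) + j (g 0) * b (shift m g) + dlt G m e g"
    using assms(1) unfolding decomposable_def by blast
  let ?a = "restrict a (tuples G m)" and ?b = "restrict b (tuples G m)"
  have r: "restrict (\<lambda>g. x (g 0) * restrict a (tuples G m) (shift m g)) (tuples G (Suc m)) = restrict (\<lambda>g. x (g 0) * a (shift m g)) (tuples G (Suc m))"
    for x and a :: "(nat \<Rightarrow> 'g) \<Rightarrow> 3" by (auto simp: fun_eq_iff)
  have "cls (Suc m) f = cls (Suc m) (\<lambda>g. i (g 0) * a (shift m g) + j (g 0) * b (shift m g))"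
    by (rule cls_eqI[OF assms(2) *(3)]) (use *(4) in simp)
  also have "\<dots> = cls (Suc m) (\<lambda>g. i (g 0) * a (shift m g)) \<otimes>\<^bsub>cohomology G T Z3_module (Suc m)\<^esub> cls (Suc m) (\<lambda>g. j (g 0) * b (shift m g))"
    by (rule mult_cohomology[symmetric]) (rule coc_cts[OF coc_cup[OF i_char *(1)]], rule coc_cts[OF coc_cup[OF j_char *(2)]])
  also have "\<dots> = cohomology_class G T Z3_module (Suc m) (cup1 G (Suc m) i ?a) \<otimes>\<^bsub>cohomology G T Z3_module (Suc m)\<^esub>
      cohomology_class G T Z3_module (Suc m) (cup1 G (Suc m) j ?b)"
    by (simp only: cup1_eq r)
  finally show ?thesis unfolding Dec_def diff_Suc_1 using cocycles_trivialI[OF *(1)] cocycles_trivialI[OF *(2)] by blast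
qed

lemma eta_subset:
  assumes "X \<in> carrier (cohomology G T (module4 i j) m)"
  shows "\<exists>w20 w11 w02 w12 w21. wc m w20 w11 w02 w12 w21 \<and> eta m X = cls (Suc m) (zz m w20 w11 w02 w12 w21)"
proof -
  interpret M4: pmod G T "module4 i j" carrier3 rho3 to_module4 by (rule pmod4)
  obtain z where z: "z \<in> cocycles G T (module4 i j) m" "X = cohomology_class G T (module4 i j) m z"
    using assms unfolding M4.carrier_cohomology by blast
  then obtain c where c: "c \<in> M4.pc m" "z = cochain_map G m to_module4 c"
    using M4.cochains_eq[of m] by (auto simp: cocycles_def)
  define nf where "nf = (\<lambda>x :: 3 group_ring \<times> 3 group_ring \<times> 3 group_ring \<times> 3 group_ring. SOME n. \<exists>b \<in> carrier2. x = (fst n, fst (snd n), 0, - (Poly_Mapping.single 0 (snd (snd n)) * T4)) + d2 b)"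
  let ?u = "\<lambda>h. fst (nf (c h))" and ?v = "\<lambda>h. fst (snd (nf (c h)))" and ?k = "\<lambda>h. snd (snd (nf (c h)))"
  let ?c = "\<lambda>h. (?u h, ?v h, 0, - (Poly_Mapping.single 0 (?k h) * T4))"
  have cc: "cts T m (\<lambda>h. F (c h))" for F using c(1) dc_comp[of _ c F] by (simp add: M4.pc_def)
  have nf: "to_module4 (c h) = to_module4 (?c h)" if "h \<in> tuples G m" for h
  proof -
    have "c h \<in> carrier3" using c(1) that by (simp add: M4.pc_def)
    from someI_ex[OF module4_normal_form[OF this]] show ?thesis unfolding nf_def to_module4_eq_iff .
  qed
  then have zc: "z = cochain_map G m to_module4 ?c" unfolding c(2) by (rule M4.cm_cong)
  obtain e w20 w02 w12 w21 where e: "eta m (cl4 m ?c) = cls (Suc m) e" "cts T (Suc m) e"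
    "wc m w20 ?k w02 w12 w21" "decomposable m (\<lambda>g. e g - zz m w20 ?k w02 w12 w21 g)"
    using eta_normal[OF cc[of "\<lambda>x. fst (nf x)"] cc[of "\<lambda>x. fst (snd (nf x))"] cc[of "\<lambda>x. snd (snd (nf x))"]] z(1)[unfolded zc] by blast
  obtain a b f where d: "coc G T m a" "coc G T m b" "cts T m f"
    "\<forall>g \<in> tuples G (Suc m). e g - zz m w20 ?k w02 w12 w21 g = i (g 0) * a (shift m g) + j (g 0) * b (shift m g) + dlt G m f g"
    using e(4) unfolding decomposable_def by blast
  \<comment> \<open>The cocycles \<open>a\<close> and \<open>b\<close> of the decomposable difference can be added to \<open>w\<^sub>1\<^sub>2\<close> and \<open>w\<^sub>2\<^sub>1\<close>.\<close>
  have "wc m w20 ?k w02 (\<lambda>h. w12 h + a h) (\<lambda>h. w21 h + b h)"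
    using e(3) d(1,2) dc_comp2[OF _ coc_cts[OF d(1)], of w12 "(+)"] dc_comp2[OF _ coc_cts[OF d(2)], of w21 "(+)"]
    unfolding wc_def by (simp add: dlt_add cocD[OF d(1)] cocD[OF d(2)])
  moreover have "cls (Suc m) e = cls (Suc m) (zz m w20 ?k w02 (\<lambda>h. w12 h + a h) (\<lambda>h. w21 h + b h))"
  proof (rule cls_eqI[OF e(2) d(3)])
    fix g assume "g \<in> tuples G (Suc m)"
    then have "e g - zz m w20 ?k w02 w12 w21 g = i (g 0) * a (shift m g) + j (g 0) * b (shift m g) + dlt G m f g" using d(4) by blast
    then have "e g = zz m w20 ?k w02 w12 w21 g + (i (g 0) * a (shift m g) + j (g 0) * b (shift m g) + dlt G m f g)" by (simp add: algebra_simps)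
    then show "e g = zz m w20 ?k w02 (\<lambda>h. w12 h + a h) (\<lambda>h. w21 h + b h) g + dlt G m f g" by (simp add: zz_def algebra_simps)
  qed
  moreover have "eta m X = cls (Suc m) e" unfolding z(2) zc by (rule e(1))
  ultimately show ?thesis by (intro exI conjI) (assumption, simp only:)
qed

text \<open>Every term of \<open>z\<close> contains a factor that vanishes if the first argument is in the common kernel.\<close>

lemma zz_in_kernel:
  assumes "wc m w20 w11 w02 w12 w21"
  shows "cls (Suc m) (zz m w20 w11 w02 w12 w21) \<in> kernel (cohomology G T Z3_module (Suc m))
    (cohomology (G\<lparr>carrier := common_kernel G i j\<rparr>) (subtopology T (common_kernel G i j)) Z3_module (Suc m))
    (restriction_map G T Z3_module (Suc m) (common_kernel G i j))"
proof -
  interpret Q: quotient_char G T "\<lambda>x. (i x, j x)" by (rule pair_char)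
  have K: "common_kernel G i j = Q.Ker" by (auto simp: common_kernel_def Q.Ker_def zero_prod_def)
  have z: "coc G T (Suc m) (zz m w20 w11 w02 w12 w21)" by (rule coc_zz[OF assms])
  have "zz m w20 w11 w02 w12 w21 g = 0" if "g \<in> tuples Q.GK (Suc m)" for g
  proof -
    have "g 0 \<in> Q.Ker" using tuplesD[OF that] by simp
    then show ?thesis by (simp add: Q.Ker_def zz_def zero_prod_def)
  qed
  then have "Q.K.cls (Suc m) (zz m w20 w11 w02 w12 w21) = Q.K.cls (Suc m) (\<lambda>_. 0)"
    by (intro Q.K.cls_eqI[where e = "\<lambda>_. 0", OF Q.cts_Ker[OF coc_cts[OF z]] dc_const]) auto
  then show ?thesis
    unfolding kernel_def K mem_Collect_eq Q.restriction_cls[OF coc_cts[OF z]] Q.K.one_cohomology carrier_cls using z by blast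
qed

lemma kernel_in_eta:
  assumes "X \<in> kernel (cohomology G T Z3_module (Suc m))
    (cohomology (G\<lparr>carrier := common_kernel G i j\<rparr>) (subtopology T (common_kernel G i j)) Z3_module (Suc m))
    (restriction_map G T Z3_module (Suc m) (common_kernel G i j))"
  shows "X \<in> eta m ` carrier (cohomology G T (module4 i j) m)"
proof -
  interpret Q: quotient_char G T "\<lambda>x. (i x, j x)" by (rule pair_char)
  have K: "common_kernel G i j = Q.Ker" by (auto simp: common_kernel_def Q.Ker_def zero_prod_def)
  from assms obtain a where a: "coc G T (Suc m) a" "X = cls (Suc m) a" and
    r: "restriction_map G T Z3_module (Suc m) Q.Ker X = Q.K.cls (Suc m) (\<lambda>_. 0)"
    unfolding kernel_def K mem_Collect_eq Q.K.one_cohomology carrier_cls by blast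
  have eq: "Q.K.cls (Suc m) a = Q.K.cls (Suc m) (\<lambda>_. 0)"
    using r unfolding a(2) Q.restriction_cls[OF coc_cts[OF a(1)]] .
  obtain \<beta> where \<beta>: "cts Q.TK m \<beta>" "\<And>g. g \<in> tuples Q.GK (Suc m) \<Longrightarrow> a g = 0 + dlt Q.GK m \<beta> g"
    using Q.K.cls_eqD[OF Q.cts_Ker[OF coc_cts[OF a(1)]] dc_const eq] by blast
  have \<beta>': "a g = dlt G m \<beta> g" if "g \<in> tuples Q.GK (Suc m)" for g using \<beta>(2)[OF that] by simp
  obtain \<xi> where \<xi>: "cts T m \<xi>" "\<And>g q. g \<in> tuples G (Suc m) \<Longrightarrow> dltQ G (\<lambda>x. (i x, j x)) m \<xi> g q = a g"
    using Q.induced_coboundary[OF a(1) \<beta>(1) \<beta>'] by blast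
  obtain c where c: "cochain_map G m to_module4 c \<in> cocycles G T (module4 i j) m" "eta m (cl4 m c) = cls (Suc m) a"
    using eta_exact[OF a(1) \<xi>] by blast
  then show "X \<in> eta m ` carrier (cohomology G T (module4 i j) m)"
    unfolding a(2) pmod.carrier_cohomology[OF pmod4] by (intro image_eqI[of _ _ "cl4 m c"]) auto
qed

lemma zz_decomposable_vanishing_cup:
  assumes w: "wc m w20 w11 w02 w12 w21"
    and v: "cls (Suc m) (\<lambda>g. - (i (g 0) + j (g 0)) * w11 (shift m g)) = cls (Suc m) (\<lambda>_. 0) \<or>
      cls (Suc m) (\<lambda>g. (i (g 0) - j (g 0)) * w11 (shift m g)) = cls (Suc m) (\<lambda>_. 0) \<or> cls m w11 = cls m (\<lambda>_. 0)"
  shows "decomposable m (zz m w20 w11 w02 w12 w21)"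
proof -
  have x: "coc G T m w11" using w by (simp add: wc_def)
  note p = coc_cup[OF _ x, of "\<lambda>x. i x + j x"] and n = coc_cup[OF _ x, of "\<lambda>x. i x - j x"]
  have ch: "(\<lambda>x. i x + j x) \<in> characters G T" "(\<lambda>x. i x - j x) \<in> characters G T"
    using lin_plus lin_minus by (simp_all add: lin_char_def)
  from v consider "cls (Suc m) (\<lambda>g. - (i (g 0) + j (g 0)) * w11 (shift m g)) = cls (Suc m) (\<lambda>_. 0)"
    | "cls (Suc m) (\<lambda>g. (i (g 0) - j (g 0)) * w11 (shift m g)) = cls (Suc m) (\<lambda>_. 0)" | "cls m w11 = cls m (\<lambda>_. 0)" by blast
  then show ?thesis
  proof cases
    case 1
    have "cts T (Suc m) (\<lambda>g. - (i (g 0) + j (g 0)) * w11 (shift m g))"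
      using dc_comp[OF coc_cts[OF p[OF ch(1)]], of uminus] by (simp only: mult_minus_left)
    from cls_eqD[OF this dc_const 1] obtain \<mu> where \<mu>: "cts T m \<mu>"
      "\<And>g. g \<in> tuples G (Suc m) \<Longrightarrow> - (i (g 0) + j (g 0)) * w11 (shift m g) = 0 + dlt G m \<mu> g" by blast
    show ?thesis
    proof (rule zz_decomposable_plus[OF w \<mu>(1)])
      show "dlt G m \<mu> g = - ((i (g 0) + j (g 0)) * w11 (shift m g))" if "g \<in> tuples G (Suc m)" for g
        using \<mu>(2)[OF that] by (simp only: mult_minus_left add_0_left)
    qed
  next
    case 2
    from cls_eqD[OF coc_cts[OF n[OF ch(2)]] dc_const 2] obtain \<mu> where \<mu>: "cts T m \<mu>"
      "\<And>g. g \<in> tuples G (Suc m) \<Longrightarrow> (i (g 0) - j (g 0)) * w11 (shift m g) = 0 + dlt G m \<mu> g" by blast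
    show ?thesis by (rule zz_decomposable_minus[OF w \<mu>(1)]) (use \<mu>(2) in simp)
  next
    case 3
    show ?thesis
    proof (cases m)
      case 0
      have "w11 h = 0" if h: "h \<in> tuples G m" for h
      proof -
        have "restrict w11 (tuples G m) \<in> cls m w11"
          using pmod.class_self[OF pmod_trivial, of w11 m] x by (simp add: cochain_map_id coc_def)
        then have "restrict w11 (tuples G m) = restrict (\<lambda>_. 0) (tuples G m)"
          unfolding 3 cls_eq_set[OF dc_const] by (simp add: pmod.bd_def[OF pmod_trivial] 0)
        from fun_cong[OF this, of h] show ?thesis using h by simp
      qed
      then show ?thesis by (rule zz_decomposable_w11_0[OF w])
    next
      case (Suc k)
      obtain e where e: "cts T k e" "\<And>h. h \<in> tuples G (Suc k) \<Longrightarrow> w11 h = 0 + dlt G k e h"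
        using cls_eqD[of k w11 "\<lambda>_. 0"] coc_cts[OF x] 3 unfolding Suc by blast
      show ?thesis
      proof (rule zz_decomposable_plus[OF w])
        show "cts T m (\<lambda>h. (i (h 0) + j (h 0)) * e (shift k h))"
          unfolding Suc by (rule cts_cup[OF charactersD(1)[OF ch(1)] e(1)])
        fix g assume g: "g \<in> tuples G (Suc m)"
        then show "dlt G m (\<lambda>h. (i (h 0) + j (h 0)) * e (shift k h)) g = - ((i (g 0) + j (g 0)) * w11 (shift m g))"
          using dlt_cup_char[OF ch(1), of g k e] e(2)[of "shift m g"] unfolding Suc by simp
      qed
    qed
  qed
qed

end

text \<open>The image of the pair of characters is a linear subspace of \<open>(\<int>/3)\<^sup>2\<close> on which no nonzero linear form
  vanishes.\<close>

lemma independent_surj: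
  assumes "top_grp G T" "\<chi>\<^sub>1 \<in> characters G T" "\<chi>\<^sub>2 \<in> characters G T" "independent_characters G \<chi>\<^sub>1 \<chi>\<^sub>2"
  shows "\<exists>s \<in> carrier G. \<chi>\<^sub>1 s = a \<and> \<chi>\<^sub>2 s = b"
proof -
  interpret top_grp G T by fact
  let ?H = "{(\<chi>\<^sub>1 s, \<chi>\<^sub>2 s) | s. s \<in> carrier G}"
  have add: "x + y \<in> ?H" if xy: "x \<in> ?H" "y \<in> ?H" for x y
  proof -
    obtain s t where st: "s \<in> carrier G" "t \<in> carrier G" "x = (\<chi>\<^sub>1 s, \<chi>\<^sub>2 s)" "y = (\<chi>\<^sub>1 t, \<chi>\<^sub>2 t)" using xy by blast
    then have "x + y = (\<chi>\<^sub>1 (s \<otimes>\<^bsub>G\<^esub> t), \<chi>\<^sub>2 (s \<otimes>\<^bsub>G\<^esub> t))"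
      using charactersD(2)[OF assms(2)] charactersD(2)[OF assms(3)] by simp
    then show ?thesis using st(1,2) by blast
  qed
  have scale: "(k * x, k * y) \<in> ?H" if "(x, y) \<in> ?H" for k x y
  proof -
    have 0: "(0, 0) \<in> ?H" using charactersD(2)[OF assms(2), of "\<one>\<^bsub>G\<^esub>" "\<one>\<^bsub>G\<^esub>"] charactersD(2)[OF assms(3), of "\<one>\<^bsub>G\<^esub>" "\<one>\<^bsub>G\<^esub>"]
      by (intro CollectI exI[of _ "\<one>\<^bsub>G\<^esub>"]) simp
    have "(x + x, y + y) \<in> ?H" using add[OF that that] by simp
    then have 2: "(2 * x, 2 * y) \<in> ?H" by (simp only: mult_2)
    from z3_cases[of k] show ?thesis
    proof (elim disjE)
      assume "k = 0" then show ?thesis using 0 by (simp only: mult_zero_left)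
    next
      assume "k = 1" then show ?thesis using that by (simp only: mult_1)
    next
      assume "k = 2" then show ?thesis using 2 by (simp only:)
    qed
  qed
  have ind: "\<exists>\<gamma> \<in> carrier G. c * \<chi>\<^sub>1 \<gamma> + d * \<chi>\<^sub>2 \<gamma> \<noteq> 0" if "c \<noteq> 0 \<or> d \<noteq> 0" for c d
    using assms(4) that unfolding independent_characters_def by blast
  have unit: "\<exists>k. k * x = 1" if "x \<noteq> (0::3)" for x
    using that z3_cases[of x] by (auto intro: exI[of _ 1] exI[of _ 2])
  obtain g where g: "g \<in> carrier G" "\<chi>\<^sub>1 g \<noteq> 0" using ind[of 1 0] by auto
  obtain k where k: "k * \<chi>\<^sub>1 g = 1" using unit[OF g(2)] by blast
  define c where "c = k * \<chi>\<^sub>2 g"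
  have "(\<chi>\<^sub>1 g, \<chi>\<^sub>2 g) \<in> ?H" using g by blast
  from scale[OF this, of k] have 1: "(1, c) \<in> ?H" by (simp add: k c_def)
  obtain h where h: "h \<in> carrier G" "- c * \<chi>\<^sub>1 h + 1 * \<chi>\<^sub>2 h \<noteq> 0" using ind[of "- c" 1] by auto
  obtain l where l: "l * (- c * \<chi>\<^sub>1 h + 1 * \<chi>\<^sub>2 h) = 1" using unit[OF h(2)] by blast
  have "(\<chi>\<^sub>1 h, \<chi>\<^sub>2 h) \<in> ?H" using h by blast
  from add[OF this scale[OF 1, of "- \<chi>\<^sub>1 h"]] have "(0, - c * \<chi>\<^sub>1 h + 1 * \<chi>\<^sub>2 h) \<in> ?H" by (simp add: algebra_simps)
  from scale[OF this, of l] have 2: "(0, 1) \<in> ?H" by (simp only: l mult_zero_right)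
  from add[OF scale[OF 1, of a] scale[OF 2, of "b - a * c"]] have "(a, b) \<in> ?H" by simp
  then show ?thesis by auto
qed

theorem theorem3p14:
  fixes G :: "('g, 'b) monoid_scheme" and T :: "'g topology"
    and \<chi>\<^sub>1 \<chi>\<^sub>2 :: "'g \<Rightarrow> 3" and n :: nat
  assumes "pro_p_group 3 G T"
    and "\<chi>\<^sub>1 \<in> characters G T" and "\<chi>\<^sub>2 \<in> characters G T"
    and "n \<ge> 1"
  shows
    "(\<forall>w20 w11 w02 w12 w21.
        w_conditions G T \<chi>\<^sub>1 \<chi>\<^sub>2 n w20 w11 w02 w12 w21 \<longrightarrow>
        z_cochain G \<chi>\<^sub>1 \<chi>\<^sub>2 n w20 w11 w02 w12 w21 \<in> cocycles G T Z3_module n)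
     \<and>
     (voevodsky_pro_3_group G T \<and> independent_characters G \<chi>\<^sub>1 \<chi>\<^sub>2 \<longrightarrow>
        positselski_map G T \<chi>\<^sub>1 \<chi>\<^sub>2 n ` carrier (cohomology G T (module4 \<chi>\<^sub>1 \<chi>\<^sub>2) (n - 1))
          = (let K = common_kernel G \<chi>\<^sub>1 \<chi>\<^sub>2 in
             kernel (cohomology G T Z3_module n)
                    (cohomology (G\<lparr>carrier := K\<rparr>) (subtopology T K) Z3_module n)
                    (restriction_map G T Z3_module n K))
        \<and>
        (\<forall>u \<in> cochains G T (regular_module \<chi>\<^sub>1 \<chi>\<^sub>2) (n - 1).
         \<forall>v \<in> cochains G T (regular_module \<chi>\<^sub>1 \<chi>\<^sub>2) (n - 1).
         \<forall>x \<in> cocycles G T Z3_module (n - 1).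
           let c = (\<lambda>g \<in> tuples G (n - 1). (u g, v g, 0, - (Poly_Mapping.single 0 (x g) * T4)));
               c4 = cochain_map G (n - 1) to_module4 c;
               C = cohomology_class G T (module4 \<chi>\<^sub>1 \<chi>\<^sub>2) (n - 1) c4
           in c4 \<in> cocycles G T (module4 \<chi>\<^sub>1 \<chi>\<^sub>2) (n - 1) \<longrightarrow>
                pi4_star G T \<chi>\<^sub>1 \<chi>\<^sub>2 (n - 1) C = cohomology_class G T Z3_module (n - 1) x \<and>
                (\<exists>w20 w11 w02 w12 w21.
                   w_conditions G T \<chi>\<^sub>1 \<chi>\<^sub>2 n w20 w11 w02 w12 w21 \<and> w11 = x \<and>
                   positselski_map G T \<chi>\<^sub>1 \<chi>\<^sub>2 n C
                     \<otimes>\<^bsub>cohomology G T Z3_module n\<^esub>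
                   inv\<^bsub>cohomology G T Z3_module n\<^esub>
                     (cohomology_class G T Z3_module n (z_cochain G \<chi>\<^sub>1 \<chi>\<^sub>2 n w20 w11 w02 w12 w21))
                     \<in> Dec G T \<chi>\<^sub>1 \<chi>\<^sub>2 n))
        \<and>
        positselski_map G T \<chi>\<^sub>1 \<chi>\<^sub>2 n ` carrier (cohomology G T (module4 \<chi>\<^sub>1 \<chi>\<^sub>2) (n - 1))
          = {cohomology_class G T Z3_module n (z_cochain G \<chi>\<^sub>1 \<chi>\<^sub>2 n w20 w11 w02 w12 w21)
               | w20 w11 w02 w12 w21. w_conditions G T \<chi>\<^sub>1 \<chi>\<^sub>2 n w20 w11 w02 w12 w21}
        \<and>
        (\<forall>x w20 w11 w02 w12 w21.
           w_conditions G T \<chi>\<^sub>1 \<chi>\<^sub>2 n w20 w11 w02 w12 w21 \<and> w11 = x \<longrightarrow>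
           (cohomology_class G T Z3_module n (cup1 G n (\<lambda>\<gamma>. - (\<chi>\<^sub>1 \<gamma> + \<chi>\<^sub>2 \<gamma>)) x)
                = \<one>\<^bsub>cohomology G T Z3_module n\<^esub> \<or>
            cohomology_class G T Z3_module n (cup1 G n (\<lambda>\<gamma>. \<chi>\<^sub>1 \<gamma> - \<chi>\<^sub>2 \<gamma>) x)
                = \<one>\<^bsub>cohomology G T Z3_module n\<^esub> \<or>
            cohomology_class G T Z3_module (n - 1) x
                = \<one>\<^bsub>cohomology G T Z3_module (n - 1)\<^esub> \<longrightarrow>
            cohomology_class G T Z3_module n (z_cochain G \<chi>\<^sub>1 \<chi>\<^sub>2 n w20 w11 w02 w12 w21)
              \<in> Dec G T \<chi>\<^sub>1 \<chi>\<^sub>2 n)))"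
proof -
  have tg: "top_grp G T" using assms(1) by (simp add: pro_p_group_def top_grp_def)
  interpret top_grp G T by (rule tg)
  interpret char_pair G T \<chi>\<^sub>1 \<chi>\<^sub>2
    by (intro char_pair.intro char_pair_axioms.intro tg assms(2,3))
  obtain m where n: "n = Suc m" using assms(4) by (cases n) auto
  have part1: "z_cochain G \<chi>\<^sub>1 \<chi>\<^sub>2 n w20 w11 w02 w12 w21 \<in> cocycles G T Z3_module n"
    if "w_conditions G T \<chi>\<^sub>1 \<chi>\<^sub>2 n w20 w11 w02 w12 w21" for w20 w11 w02 w12 w21
    using that coc_zz[of m w20 w11 w02 w12 w21] unfolding n w_conditions_iff z_cochain_eq
    by (intro cocycles_trivialI) blast
  let "_ \<and> (_ \<longrightarrow> ?Q)" = ?thesis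
  have main: ?Q if V: "voevodsky_pro_3_group G T \<and> independent_characters G \<chi>\<^sub>1 \<chi>\<^sub>2"
  proof -
    interpret two_chars G T \<chi>\<^sub>1 \<chi>\<^sub>2
      by (intro two_chars.intro two_chars_axioms.intro liftable_voevodsky char_pair_axioms
        independent_surj[OF tg assms(2,3)]) (use V in blast)+
    let ?H = "carrier (cohomology G T (module4 \<chi>\<^sub>1 \<chi>\<^sub>2) m)"
    let ?K = "common_kernel G \<chi>\<^sub>1 \<chi>\<^sub>2"
    let ?ker = "kernel (cohomology G T Z3_module n) (cohomology (G\<lparr>carrier := ?K\<rparr>) (subtopology T ?K) Z3_module n)
                    (restriction_map G T Z3_module n ?K)"
    let ?Z = "{cohomology_class G T Z3_module n (z_cochain G \<chi>\<^sub>1 \<chi>\<^sub>2 n w20 w11 w02 w12 w21)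
               | w20 w11 w02 w12 w21. w_conditions G T \<chi>\<^sub>1 \<chi>\<^sub>2 n w20 w11 w02 w12 w21}"
    \<comment> \<open>A cycle of inclusions between the image, the classes of the cochains \<open>z\<close> and the kernel.\<close>
    have 1: "positselski_map G T \<chi>\<^sub>1 \<chi>\<^sub>2 n ` ?H \<subseteq> ?Z"
    proof
      fix Y assume "Y \<in> positselski_map G T \<chi>\<^sub>1 \<chi>\<^sub>2 n ` ?H"
      then obtain X where X: "X \<in> ?H" "Y = eta m X" unfolding n by blast
      obtain w20 w11 w02 w12 w21 where w: "wc m w20 w11 w02 w12 w21" "Y = cls (Suc m) (zz m w20 w11 w02 w12 w21)"
        using eta_subset[OF X(1)] X(2) by blast
      show "Y \<in> ?Z" unfolding n z_cochain_eq w(2) using wc_restrict[OF w(1)] zz_restrict[of m w20 w11 w02 w12 w21]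
        by (intro CollectI exI conjI[rotated]) (assumption, simp only:)
    qed
    have 2: "?Z \<subseteq> ?ker"
    proof
      fix Y assume "Y \<in> ?Z"
      then obtain w20 w11 w02 w12 w21 where "wc m w20 w11 w02 w12 w21" "Y = cls (Suc m) (zz m w20 w11 w02 w12 w21)"
        unfolding n z_cochain_eq w_conditions_iff by blast
      then show "Y \<in> ?ker" unfolding n using zz_in_kernel by blast
    qed
    have 3: "?ker \<subseteq> positselski_map G T \<chi>\<^sub>1 \<chi>\<^sub>2 n ` ?H"
      unfolding n using kernel_in_eta by blast
    have part2: "pi4_star G T \<chi>\<^sub>1 \<chi>\<^sub>2 m C = cohomology_class G T Z3_module m x \<and>
                (\<exists>w20 w11 w02 w12 w21.
                   w_conditions G T \<chi>\<^sub>1 \<chi>\<^sub>2 n w20 w11 w02 w12 w21 \<and> w11 = x \<and>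
                   positselski_map G T \<chi>\<^sub>1 \<chi>\<^sub>2 n C
                     \<otimes>\<^bsub>cohomology G T Z3_module n\<^esub>
                   inv\<^bsub>cohomology G T Z3_module n\<^esub>
                     (cohomology_class G T Z3_module n (z_cochain G \<chi>\<^sub>1 \<chi>\<^sub>2 n w20 w11 w02 w12 w21))
                     \<in> Dec G T \<chi>\<^sub>1 \<chi>\<^sub>2 n)"
      if u: "u \<in> cochains G T (regular_module \<chi>\<^sub>1 \<chi>\<^sub>2) m" and v: "v \<in> cochains G T (regular_module \<chi>\<^sub>1 \<chi>\<^sub>2) m"
        and x: "x \<in> cocycles G T Z3_module m"
        and c4: "c4 = cochain_map G m to_module4 (\<lambda>g \<in> tuples G m. (u g, v g, 0, - (Poly_Mapping.single 0 (x g) * T4)))"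
        and C: "C = cohomology_class G T (module4 \<chi>\<^sub>1 \<chi>\<^sub>2) m c4" and z: "c4 \<in> cocycles G T (module4 \<chi>\<^sub>1 \<chi>\<^sub>2) m"
      for u v x c4 C
    proof -
      let ?c = "\<lambda>h. (u h, v h, 0, - (Poly_Mapping.single 0 (x h) * T4))"
      have uv: "cts T m u" "cts T m v"
        using u v by (simp_all add: cochains_def regular_module_def additive_module_def)
      have x': "coc G T m x" "restrict x (tuples G m) = x" using x by (simp_all add: cocycles_trivial extensional_restrict)
      have c4': "c4 = cochain_map G m to_module4 ?c" unfolding c4 by (auto simp: cochain_map_def fun_eq_iff)
      obtain e w20 w02 w12 w21 where e: "positselski_map G T \<chi>\<^sub>1 \<chi>\<^sub>2 (Suc m) C = cls (Suc m) e" "cts T (Suc m) e"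
        "wc m w20 x w02 w12 w21" "decomposable m (\<lambda>g. e g - zz m w20 x w02 w12 w21 g)"
        using eta_normal[OF uv coc_cts[OF x'(1)]] z unfolding C c4' by blast
      let ?r = "\<lambda>w. restrict w (tuples G m)"
      have zc: "coc G T (Suc m) (zz m w20 x w02 w12 w21)" by (rule coc_zz[OF e(3)])
      have d: "cts T (Suc m) (\<lambda>g. e g + - zz m w20 x w02 w12 w21 g)" by (rule dc_comp2[OF e(2) coc_cts[OF zc]])
      have "cls (Suc m) (\<lambda>g. e g + - zz m w20 x w02 w12 w21 g) \<in> Dec G T \<chi>\<^sub>1 \<chi>\<^sub>2 (Suc m)"
        by (rule decomposable_in_Dec[OF _ d]) (use e(4) in simp)
      then have D: "cls (Suc m) e \<otimes>\<^bsub>cohomology G T Z3_module (Suc m)\<^esub> inv\<^bsub>cohomology G T Z3_module (Suc m)\<^esub> cls (Suc m) (zz m w20 x w02 w12 w21)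
         \<in> Dec G T \<chi>\<^sub>1 \<chi>\<^sub>2 (Suc m)"
        by (simp only: inv_cohomology[OF zc] mult_cohomology[OF e(2) coc_cts[OF coc_minus[OF zc]]])
      have "pi4_star G T \<chi>\<^sub>1 \<chi>\<^sub>2 m C = cohomology_class G T Z3_module m x"
        unfolding C c4' using pi4_star_normal[OF uv coc_cts[OF x'(1)]] by (simp only: x'(2))
      moreover have "w_conditions G T \<chi>\<^sub>1 \<chi>\<^sub>2 n (?r w20) x (?r w02) (?r w12) (?r w21)"
        using wc_restrict[OF e(3)] by (simp only: n x'(2))
      moreover have "positselski_map G T \<chi>\<^sub>1 \<chi>\<^sub>2 n C \<otimes>\<^bsub>cohomology G T Z3_module n\<^esub>
                   inv\<^bsub>cohomology G T Z3_module n\<^esub>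
                     (cohomology_class G T Z3_module n (z_cochain G \<chi>\<^sub>1 \<chi>\<^sub>2 n (?r w20) x (?r w02) (?r w12) (?r w21)))
                     \<in> Dec G T \<chi>\<^sub>1 \<chi>\<^sub>2 n"
        using D zz_restrict[of m w20 x w02 w12 w21] by (simp only: n z_cochain_eq e(1) x'(2))
      ultimately show ?thesis by blast
    qed
    have part4: "cohomology_class G T Z3_module n (z_cochain G \<chi>\<^sub>1 \<chi>\<^sub>2 n w20 w11 w02 w12 w21) \<in> Dec G T \<chi>\<^sub>1 \<chi>\<^sub>2 n"
      if w: "w_conditions G T \<chi>\<^sub>1 \<chi>\<^sub>2 n w20 w11 w02 w12 w21"
        and v: "cohomology_class G T Z3_module n (cup1 G n (\<lambda>\<gamma>. - (\<chi>\<^sub>1 \<gamma> + \<chi>\<^sub>2 \<gamma>)) w11)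
                = \<one>\<^bsub>cohomology G T Z3_module n\<^esub> \<or>
            cohomology_class G T Z3_module n (cup1 G n (\<lambda>\<gamma>. \<chi>\<^sub>1 \<gamma> - \<chi>\<^sub>2 \<gamma>) w11)
                = \<one>\<^bsub>cohomology G T Z3_module n\<^esub> \<or>
            cohomology_class G T Z3_module m w11
                = \<one>\<^bsub>cohomology G T Z3_module m\<^esub>" for w20 w11 w02 w12 w21
    proof -
      have wc: "wc m w20 w11 w02 w12 w21" and r: "restrict w11 (tuples G m) = w11"
        using w unfolding n w_conditions_iff by (simp_all add: extensional_restrict)
      have "decomposable m (zz m w20 w11 w02 w12 w21)"
        using v r by (intro zz_decomposable_vanishing_cup[OF wc]) (simp only: n cup1_eq one_cohomology)
      then show ?thesis unfolding n z_cochain_eq by (intro decomposable_in_Dec coc_cts[OF coc_zz[OF wc]])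
    qed
    have n1: "n - 1 = m" by (simp add: n)
    show ?Q
      unfolding Let_def n1
    proof (intro conjI)
      show "positselski_map G T \<chi>\<^sub>1 \<chi>\<^sub>2 n ` ?H = ?ker" by (rule subset_antisym[OF subset_trans[OF 1 2] 3])
      show "positselski_map G T \<chi>\<^sub>1 \<chi>\<^sub>2 n ` ?H = ?Z" by (rule subset_antisym[OF 1 subset_trans[OF 2 3]])
    qed ((intro ballI impI, rule part2[OF _ _ _ refl refl], assumption+),
      (intro allI impI, elim conjE, hypsubst, rule part4, assumption+))
  qed
  then show ?thesis using part1 by blast
qed

end
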